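(* Consider the planar Newtonian three-body problem with masses $m_1=m_2=1$, $m_3=m>0$, let $0<\theta<\pi/2$, and make the Collision Assumption stated in the context. If $(m,\theta)\in D$, then there are positive constants $l$, $r_0$ and $c$ such that the action of the path $$x_1(t)=le^{i\theta t}+(r_0+ct)e^{i(\theta-\frac{\pi}{2})t},\quad x_2(t)=le^{i\theta t}-(r_0+ct)e^{i(\theta-\frac{\pi}{2})t},\quad x_3(t)=-\tfrac{2l}{m}e^{i\theta t}\qquad(0\le t\le 1)$$ is less than the action of the Euler orbit. Therefore non-homographic dihedral orbits exist for every $(m,\theta)\in D$.
   Context: Identify the plane with $\mathbb{C}$; $\mathcal{X}=\{x\in\mathbb{C}^3: x_1+x_2+mx_3=0\}$. The Lagrangian is $L=\sum_i\frac12 m_i|\dot x_i|^2+\sum_{i<j}\frac{m_im_j}{|x_i-x_j|}$, and the action of a path or loop is the integral of $L$ along it. Symmetry: $h_1$ acts on the plane as the reflection $R_1$ along the line $\mathbb{R}$ and trivially on the indices; $h_2$ acts as the reflection $R_2$ along the line $\mathbb{R}e^{i\theta}$ and exchanges the indices 1 and 2. So on $\mathcal{X}$, $h_1(x_1,x_2,x_3)=(R_1x_1,R_1x_2,R_1x_3)$ and $h_2(x_1,x_2,x_3)=(R_2x_2,R_2x_1,R_2x_3)$. $P$ is the space of $H^1$ paths $x\colon[0,1]\to\mathcal{X}$ with $x(0)$ fixed by $h_1$ and $x(1)$ fixed by $h_2$; the paths in the claim belong to $P$. A dihedral orbit (for given $m,\theta$) is a solution of the three-body problem whose restriction to a time interval,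 rescaled to $[0,1]$, lies in $P$, and which is obtained from that path by extending it through the symmetries $h_1,h_2$ (acting on time as the reflections about the two endpoints). When $\theta=\pi/q$ with $q$ an integer the symmetry group $G$ is a finite dihedral group and the orbit is periodic; in general it is periodic in a rotating frame. An orbit is homographic if its configuration stays similar to itself. Collision Assumption: let $G$ be a finite group acting orthogonally on the time circle $T^1$ and on the plane, and acting on the indices of the bodies by permutations preserving the masses; let $\Lambda=H^1(T^1,\mathcal{X})$ be the loop space, with $G$ acting by $x(t)\mapsto g\,x(g^{-1}t)$, let $\Lambda^G$ be the set of $G$-equivariant loops, and let $\mathcal{A}^G$ be the action restricted to $\Lambda^G$. Then all local minima of $\mathcal{A}^G$ in $\Lambda^G$ are collision-free. Definition of $D$: the action of the Euler orbit (the collinear solution with $x_3$ at the center of mass) is given by $\mathcal{A}_E=\frac32\big[(\tfrac12+2m)^2(\tfrac{\pi}{2}-\theta)\big]^{1/3}$. $\mathcal{A}_D$ denotes the Lagrangian action of the path in the claim, with its potential terms for the pairs $\{1,3\}$ and $\{2,3\}$ replaced by upper estimates, so that $$\mathcal{A}_D-\mathcal{A}_E=l^2\theta^2\Big(1+\frac2m\Big)+c^2+\frac1{12}(3r_0^2+c^2+3cr_0)(\pi-2\theta)^2+\frac{m^2}{m(l-r_0)+2l}+\frac{m}{\sqrt{(r_0+c)^2+l^2(1+2/m)^2}}+\frac1{2c}\log\Big(1+\frac{c}{r_0}\Big)-\frac32\Big[\big(\tfrac12+2m\big)^2\big(\tfrac{\pi}{2}-\theta\big)\Big]^{1/3}.$$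 $D\subset\mathbb{R}^2$ is the set of all pairs $(m,\theta)$ such that $\inf\{\mathcal{A}_D-\mathcal{A}_E: l>r_0>0,\ l>c>0\}<0$, with $\mathcal{A}_D-\mathcal{A}_E$ given by this expression. *)

theory Defs
  imports "HOL-Analysis.Analysis" "HOL-Algebra.Group_Action"
begin

section \<open>Configurations, Newton's equations, action\<close>

text \<open>A configuration of three bodies in the plane is an element of \<open>complex ^ 3\<close>.
  The index type \<open>3\<close> has the elements \<open>1\<close>, \<open>2\<close>, \<open>3\<close>.\<close>

type_synonym config = "complex ^ 3"

definition mass :: "real \<Rightarrow> 3 \<Rightarrow> real" where
  "mass m i = (if i = 3 then m else 1)"

definition config_space :: "real \<Rightarrow> config set" where
  "config_space m = {x. x $ 1 + x $ 2 + complex_of_real m * x $ 3 = 0}"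

definition collision_free :: "(real \<Rightarrow> config) \<Rightarrow> bool" where
  "collision_free x \<longleftrightarrow> (\<forall>t i j. i \<noteq> j \<longrightarrow> x t $ i \<noteq> x t $ j)"

definition newton_solution :: "real \<Rightarrow> (real \<Rightarrow> config) \<Rightarrow> bool" where
  "newton_solution m x \<longleftrightarrow> collision_free x \<and>
     (\<exists>v. \<forall>t i.
        ((\<lambda>s. x s $ i) has_vector_derivative v t $ i) (at t) \<and>
        ((\<lambda>s. v s $ i) has_vector_derivative
           (\<Sum>j\<in>UNIV - {i}. (mass m j / norm (x t $ j - x t $ i) ^ 3) *\<^sub>R (x t $ j - x t $ i))) (at t))"

text \<open>\<open>x\<close> is of class \<open>H\<^sup>1\<close> on \<open>[a, b]\<close> iff it is the integral of a square-integrable function \<open>v\<close>;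
  this \<open>v\<close> is unique up to a null set.\<close>

definition has_L2_derivative ::
    "real \<Rightarrow> real \<Rightarrow> (real \<Rightarrow> config) \<Rightarrow> (real \<Rightarrow> config) \<Rightarrow> bool" where
  "has_L2_derivative a b x v \<longleftrightarrow>
     set_borel_measurable lborel {a..b} v \<and>
     set_integrable lborel {a..b} (\<lambda>t. (norm (v t))\<^sup>2) \<and>
     (\<forall>t\<in>{a..b}. x t = x a + (LBINT s:{a..t}. v s))"

definition H1_on :: "real \<Rightarrow> real \<Rightarrow> (real \<Rightarrow> config) \<Rightarrow> bool" where
  "H1_on a b x \<longleftrightarrow> (\<exists>v. has_L2_derivative a b x v)"

definition weak_deriv :: "real \<Rightarrow> real \<Rightarrow> (real \<Rightarrow> config) \<Rightarrow> real \<Rightarrow> config" where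
  "weak_deriv a b x = (SOME v. has_L2_derivative a b x v)"

definition H1_norm :: "real \<Rightarrow> real \<Rightarrow> (real \<Rightarrow> config) \<Rightarrow> real" where
  "H1_norm a b x =
     sqrt (LBINT t:{a..b}. (norm (x t))\<^sup>2 + (norm (weak_deriv a b x t))\<^sup>2)"

definition kinetic :: "real \<Rightarrow> config \<Rightarrow> real" where
  "kinetic m v = (\<Sum>i\<in>UNIV. mass m i * (norm (v $ i))\<^sup>2 / 2)"

text \<open>The division is that of \<^typ>\<open>ennreal\<close>, for which \<open>a / 0 = \<infinity>\<close> when \<open>a > 0\<close>: the potential is
  infinite at collisions (the division of \<^typ>\<open>real\<close> would give the value \<open>0\<close> there).\<close>

definition potential :: "real \<Rightarrow> config \<Rightarrow> ennreal" where
  "potential m x =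
     ennreal (mass m 1 * mass m 2) / ennreal (norm (x $ 1 - x $ 2)) +
     ennreal (mass m 1 * mass m 3) / ennreal (norm (x $ 1 - x $ 3)) +
     ennreal (mass m 2 * mass m 3) / ennreal (norm (x $ 2 - x $ 3))"

definition action :: "real \<Rightarrow> real \<Rightarrow> real \<Rightarrow> (real \<Rightarrow> config) \<Rightarrow> ennreal" where
  "action m a b x =
     (\<integral>\<^sup>+t. (ennreal (kinetic m (weak_deriv a b x t)) + potential m (x t)) * indicator {a..b} t \<partial>lborel)"

section \<open>Dihedral orbits\<close>

definition h1 :: "config \<Rightarrow> config" where
  "h1 x = vector [cnj (x $ 1), cnj (x $ 2), cnj (x $ 3)]"

definition refl :: "real \<Rightarrow> complex \<Rightarrow> complex" where
  \<comment> \<open>reflection along the line through \<open>0\<close> and \<open>cis \<theta>\<close>\<close>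
  "refl \<theta> z = cis (2 * \<theta>) * cnj z"

definition h2 :: "real \<Rightarrow> config \<Rightarrow> config" where
  "h2 \<theta> x = vector [refl \<theta> (x $ 2), refl \<theta> (x $ 1), refl \<theta> (x $ 3)]"

definition path_space :: "real \<Rightarrow> real \<Rightarrow> (real \<Rightarrow> config) set" where
  "path_space m \<theta> = {x. H1_on 0 1 x \<and> (\<forall>t\<in>{0..1}. x t \<in> config_space m) \<and>
                        h1 (x 0) = x 0 \<and> h2 \<theta> (x 1) = x 1}"

definition dihedral_orbit :: "real \<Rightarrow> real \<Rightarrow> (real \<Rightarrow> config) \<Rightarrow> bool" where
  "dihedral_orbit m \<theta> y \<longleftrightarrow> newton_solution m y \<and>
     (\<exists>a b. a < b \<and>
        (\<lambda>s. y (a + s * (b - a))) \<in> path_space m \<theta> \<and>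
        (\<forall>t. y (2 * a - t) = h1 (y t)) \<and>
        (\<forall>t. y (2 * b - t) = h2 \<theta> (y t)))"

definition homographic :: "(real \<Rightarrow> config) \<Rightarrow> bool" where
  "homographic y \<longleftrightarrow> (\<forall>s t. \<exists>c d. c \<noteq> 0 \<and> (\<forall>i. y t $ i = c * y s $ i + d))"

section \<open>The collision assumption\<close>

text \<open>The time circle of length \<open>T\<close> is the unit circle of the plane, the time \<open>t\<close> corresponding to
  the point \<open>cis (2\<pi>t/T)\<close>; loops are \<open>T\<close>-periodic functions on the real line. The group acts
  by \<open>\<tau>\<close> on the plane containing the time circle, by \<open>\<rho>\<close> on the plane of the bodies
  and by \<open>\<sigma>\<close> on the indices.\<close>

definition circle_point :: "real \<Rightarrow> real \<Rightarrow> complex" where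
  "circle_point T t = cis (2 * pi * t / T)"

definition circle_time :: "real \<Rightarrow> complex \<Rightarrow> real" where
  "circle_time T z = T * Arg z / (2 * pi)"

definition symmetry_group ::
    "real \<Rightarrow> 'g monoid \<Rightarrow> ('g \<Rightarrow> complex \<Rightarrow> complex) \<Rightarrow> ('g \<Rightarrow> complex \<Rightarrow> complex) \<Rightarrow> ('g \<Rightarrow> 3 \<Rightarrow> 3) \<Rightarrow> bool"
  where
  "symmetry_group m G \<tau> \<rho> \<sigma> \<longleftrightarrow>
     group G \<and> finite (carrier G) \<and>
     group_action G UNIV \<tau> \<and> (\<forall>g\<in>carrier G. orthogonal_transformation (\<tau> g)) \<and>
     group_action G UNIV \<rho> \<and> (\<forall>g\<in>carrier G. orthogonal_transformation (\<rho> g)) \<and>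
     group_action G UNIV \<sigma> \<and> (\<forall>g\<in>carrier G. \<forall>i. mass m (\<sigma> g i) = mass m i)"

definition loop_space :: "real \<Rightarrow> real \<Rightarrow> (real \<Rightarrow> config) set" where
  "loop_space m T = {x. (\<forall>t. x (t + T) = x t) \<and> H1_on 0 T x \<and> (\<forall>t. x t \<in> config_space m)}"

definition loop_act ::
    "real \<Rightarrow> 'g monoid \<Rightarrow> ('g \<Rightarrow> complex \<Rightarrow> complex) \<Rightarrow> ('g \<Rightarrow> complex \<Rightarrow> complex) \<Rightarrow> ('g \<Rightarrow> 3 \<Rightarrow> 3) \<Rightarrow>
     'g \<Rightarrow> (real \<Rightarrow> config) \<Rightarrow> (real \<Rightarrow> config)" where
  \<comment> \<open>the loop \<open>t \<mapsto> g x(g\<^sup>-\<^sup>1 t)\<close>\<close>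
  "loop_act T G \<tau> \<rho> \<sigma> g x =
     (\<lambda>t. \<chi> i. \<rho> g (x (circle_time T (\<tau> (inv\<^bsub>G\<^esub> g) (circle_point T t))) $ \<sigma> (inv\<^bsub>G\<^esub> g) i))"

definition equivariant_loops ::
    "real \<Rightarrow> real \<Rightarrow> 'g monoid \<Rightarrow> ('g \<Rightarrow> complex \<Rightarrow> complex) \<Rightarrow> ('g \<Rightarrow> complex \<Rightarrow> complex) \<Rightarrow> ('g \<Rightarrow> 3 \<Rightarrow> 3) \<Rightarrow>
     (real \<Rightarrow> config) set" where
  "equivariant_loops m T G \<tau> \<rho> \<sigma> =
     {x \<in> loop_space m T. \<forall>g\<in>carrier G. loop_act T G \<tau> \<rho> \<sigma> g x = x}"

definition local_minimum :: "real \<Rightarrow> real \<Rightarrow> (real \<Rightarrow> config) set \<Rightarrow> (real \<Rightarrow> config) \<Rightarrow> bool" where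
  \<comment> \<open>finite action is required: where the action is constantly infinite there is no minimum\<close>
  "local_minimum m T \<Lambda> x \<longleftrightarrow> x \<in> \<Lambda> \<and> action m 0 T x < \<infinity> \<and>
     (\<exists>\<epsilon>>0. \<forall>y\<in>\<Lambda>. H1_norm 0 T (\<lambda>t. y t - x t) < \<epsilon> \<longrightarrow> action m 0 T x \<le> action m 0 T y)"

text \<open>Every finite group is isomorphic to one with a carrier in \<^typ>\<open>nat\<close>. Groups bound to collisions,
  i.e. those for which every equivariant loop has a collision, are left out; for these the
  conclusion is void or false. (For example, a generator with \<open>x\<^sub>1(-t) = x\<^sub>2(t)\<close>, \<open>x\<^sub>3(-t) = x\<^sub>3(t)\<close> and one with
  \<open>x(t + T/2) = -x(t)\<close>: the action attains its minimum, and all equivariant loops satisfy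
  \<open>x\<^sub>1(0) = x\<^sub>2(0)\<close>.) Without this proviso the assumption would be contradictory.\<close>

definition collision_assumption :: "real \<Rightarrow> bool" where
  "collision_assumption m \<longleftrightarrow>
     (\<forall>T > 0. \<forall>(G :: nat monoid) \<tau> \<rho> \<sigma>.
        symmetry_group m G \<tau> \<rho> \<sigma> \<longrightarrow>
        (\<exists>x \<in> equivariant_loops m T G \<tau> \<rho> \<sigma>. collision_free x) \<longrightarrow>
        (\<forall>x. local_minimum m T (equivariant_loops m T G \<tau> \<rho> \<sigma>) x \<longrightarrow> collision_free x))"

section \<open>The Euler orbit, the test path and the region of parameters\<close>

text \<open>Bodies \<open>1\<close> and \<open>2\<close> rotate about body \<open>3\<close> from the real line at time \<open>0\<close> to the line
  orthogonal to \<open>cis \<theta>\<close> at time \<open>1\<close>. The radius \<open>R\<close> is determined by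
  \<open>(\<pi>/2 - \<theta>)\<^sup>2 R = (1/4 + m) / R\<^sup>2\<close>, which is Newton's equation (see \<open>euler_path_newton\<close> below).\<close>

definition euler_radius :: "real \<Rightarrow> real \<Rightarrow> real" where
  "euler_radius m \<theta> = root 3 ((1/4 + m) / (pi/2 - \<theta>)\<^sup>2)"

definition euler_path :: "real \<Rightarrow> real \<Rightarrow> real \<Rightarrow> config" where
  "euler_path m \<theta> t =
     vector [of_real (euler_radius m \<theta>) * cis ((\<theta> - pi/2) * t),
             - of_real (euler_radius m \<theta>) * cis ((\<theta> - pi/2) * t),
             0]"

definition A_E :: "real \<Rightarrow> real \<Rightarrow> real" where
  \<comment> \<open>The closed form entering the definition of \<open>D\<close>. It is not the action of \<open>euler_path\<close>, which is
    \<open>3/2 * root 3 (2 * (1/2 + 2 * m)\<^sup>2 * (pi/2 - \<theta>)\<^sup>2)\<close>; for \<open>\<theta> < \<pi>/2\<close> the latter is at least \<open>A_E\<close>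
    iff \<open>\<pi>/2 - \<theta> \<ge> 1/2\<close>.\<close>
  "A_E m \<theta> = 3/2 * root 3 ((1/2 + 2 * m)\<^sup>2 * (pi/2 - \<theta>))"

definition test_path :: "real \<Rightarrow> real \<Rightarrow> real \<Rightarrow> real \<Rightarrow> real \<Rightarrow> real \<Rightarrow> config" where
  "test_path m \<theta> l r0 c t =
     vector [of_real l * cis (\<theta> * t) + of_real (r0 + c * t) * cis ((\<theta> - pi/2) * t),
             of_real l * cis (\<theta> * t) - of_real (r0 + c * t) * cis ((\<theta> - pi/2) * t),
             - of_real (2 * l / m) * cis (\<theta> * t)]"

definition A_D :: "real \<Rightarrow> real \<Rightarrow> real \<Rightarrow> real \<Rightarrow> real \<Rightarrow> real" where
  "A_D m \<theta> l r0 c =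
     l\<^sup>2 * \<theta>\<^sup>2 * (1 + 2 / m) + c\<^sup>2
     + 1/12 * (3 * r0\<^sup>2 + c\<^sup>2 + 3 * c * r0) * (pi - 2 * \<theta>)\<^sup>2
     + m\<^sup>2 / (m * (l - r0) + 2 * l)
     + m / sqrt ((r0 + c)\<^sup>2 + l\<^sup>2 * (1 + 2 / m)\<^sup>2)
     + 1 / (2 * c) * ln (1 + c / r0)"

definition D :: "(real \<times> real) set" where
  "D = {(m, \<theta>). Inf {A_D m \<theta> l r0 c - A_E m \<theta> | l r0 c. l > r0 \<and> r0 > 0 \<and> l > c \<and> c > 0} < 0}"

section \<open>Consistency checks\<close>

lemma test_path_boundary:
  "h1 (test_path m \<theta> l r0 c 0) = test_path m \<theta> l r0 c 0"
  "h2 \<theta> (test_path m \<theta> l r0 c 1) = test_path m \<theta> l r0 c 1"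
  "m \<noteq> 0 \<Longrightarrow> test_path m \<theta> l r0 c t \<in> config_space m"
proof -
  show "h1 (test_path m \<theta> l r0 c 0) = test_path m \<theta> l r0 c 0"
    by (simp add: h1_def test_path_def vec_eq_iff forall_3)
  have 1: "cis (2 * \<theta>) * cnj (cis \<theta>) = cis \<theta>"
    by (simp add: cis_cnj cis_mult)
  have 2: "cis (2 * \<theta>) * cnj (cis (\<theta> - pi/2)) = - cis (\<theta> - pi/2)"
  proof -
    have "2 * \<theta> + - (\<theta> - pi/2) = \<theta> - pi/2 + pi"
      by (simp add: field_simps)
    then have "cis (2 * \<theta>) * cnj (cis (\<theta> - pi/2)) = cis (\<theta> - pi/2) * cis pi"
      by (simp only: cis_cnj cis_mult)
    then show ?thesis by simp
  qed
  have r: "refl \<theta> (of_real a * cis \<theta> + of_real b * cis (\<theta> - pi/2)) =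
           of_real a * cis \<theta> - of_real b * cis (\<theta> - pi/2)" for a b
  proof -
    have "refl \<theta> (of_real a * cis \<theta> + of_real b * cis (\<theta> - pi/2)) =
       of_real a * (cis (2 * \<theta>) * cnj (cis \<theta>)) + of_real b * (cis (2 * \<theta>) * cnj (cis (\<theta> - pi/2)))"
      unfolding refl_def by (simp add: algebra_simps)
    then show ?thesis unfolding 1 2 by simp
  qed
  have e1: "test_path m \<theta> l r0 c 1 $ 1 = of_real l * cis \<theta> + of_real (r0 + c) * cis (\<theta> - pi/2)"
    and e2: "test_path m \<theta> l r0 c 1 $ 2 = of_real l * cis \<theta> + of_real (- (r0 + c)) * cis (\<theta> - pi/2)"
    and e3: "test_path m \<theta> l r0 c 1 $ 3 = of_real (- (2 * l / m)) * cis \<theta> + of_real 0 * cis (\<theta> - pi/2)"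
    by (simp_all add: test_path_def ring_distribs)
  show "h2 \<theta> (test_path m \<theta> l r0 c 1) = test_path m \<theta> l r0 c 1"
    unfolding h2_def vec_eq_iff forall_3 vector_3 e1 e2 e3 r by (simp add: ring_distribs)
  show "test_path m \<theta> l r0 c t \<in> config_space m" if "m \<noteq> 0"
    using that by (simp add: test_path_def config_space_def)
qed

lemma euler_path_newton:
  assumes "m > 0" "\<theta> < pi/2"
  shows "newton_solution m (euler_path m \<theta>)"
proof -
  define R where "R = euler_radius m \<theta>"
  define a where "a = \<theta> - pi/2"
  have a: "a \<noteq> 0" using assms by (simp add: a_def)
  have Ra: "R = root 3 ((1/4 + m) / a\<^sup>2)"
    by (simp only: R_def euler_radius_def a_def power2_commute[of \<theta>])
  have pos: "(1/4 + m) / a\<^sup>2 > 0" using a assms by simp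
  then have R: "R > 0" unfolding Ra by (simp only: real_root_gt_zero zero_less_numeral)
  have "R ^ 3 = (1/4 + m) / a\<^sup>2"
    unfolding Ra using pos by (intro real_root_pow_pos) auto
  then have R3: "R ^ 3 * a\<^sup>2 = 1/4 + m" using a by simp
  define u where "u t = cis (a * t)" for t
  have nu [simp]: "norm (u t) = 1" "u t \<noteq> 0" for t by (auto simp: u_def)
  have du: "((\<lambda>t. k * u t) has_vector_derivative k * (\<i> * of_real a) * u t) (at t)" for t k
  proof -
    have "((\<lambda>z. k * exp (\<i> * of_real a * z)) has_field_derivative
           k * (\<i> * of_real a) * exp (\<i> * of_real a * of_real t)) (at (of_real t))"
      by (auto intro!: derivative_eq_intros)
    from has_vector_derivative_real_field[OF this] show ?thesis
      by (simp add: u_def cis_conv_exp mult.assoc)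
  qed
  define w :: "3 \<Rightarrow> real" where "w i = (if i = 1 then 1 else if i = 2 then -1 else 0)" for i
  have w: "w 1 = 1" "w 2 = -1" "w 3 = 0" by (auto simp: w_def)
  have E: "euler_path m \<theta> t $ i = of_real (R * w i) * u t" for t i
    using exhaust_3[of i] by (auto simp: euler_path_def R_def a_def u_def w)
  have U: "UNIV - {1::3} = {2, 3}" "UNIV - {2::3} = {1, 3}" "UNIV - {3::3} = {1, 2}"
    using exhaust_3 by fastforce+
  have k: "1 / (2 * R)^3 * (2 * R) + m / R^3 * R = R * a\<^sup>2"
  proof -
    have "1 / (2 * R)^3 * (2 * R) + m / R^3 * R = (1/4 + m) / R^2"
      using R by (simp add: divide_simps power2_eq_square power3_eq_cube)
    also have "\<dots> = R * a\<^sup>2"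
      unfolding R3[symmetric] using R by (simp add: power2_eq_square power3_eq_cube)
    finally show ?thesis .
  qed
  have acc: "(\<Sum>j\<in>UNIV - {i}. (mass m j / norm (euler_path m \<theta> t $ j - euler_path m \<theta> t $ i) ^ 3)
               *\<^sub>R (euler_path m \<theta> t $ j - euler_path m \<theta> t $ i)) =
             of_real (R * w i) * (\<i> * of_real a) * (\<i> * of_real a) * u t" for t i
  proof -
    have d: "euler_path m \<theta> t $ j - euler_path m \<theta> t $ i = of_real (R * (w j - w i)) * u t" for i j
      by (simp add: E algebra_simps)
    have n: "norm (euler_path m \<theta> t $ j - euler_path m \<theta> t $ i) = R * \<bar>w j - w i\<bar>" for i j
      unfolding d norm_mult norm_of_real abs_mult using R by simp
    have s: "(\<Sum>j\<in>UNIV - {i}. (mass m j / (R * \<bar>w j - w i\<bar>) ^ 3) * (R * (w j - w i))) = - (R * w i * a\<^sup>2)"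
    proof -
      consider "i = 1" | "i = 2" | "i = 3" using exhaust_3[of i] by blast
      then show ?thesis
      proof cases
        case 1
        show ?thesis unfolding 1 U using k by (simp add: w mass_def)
      next
        case 2
        show ?thesis unfolding 2 U using k by (simp add: w mass_def)
      next
        case 3
        show ?thesis unfolding 3 U by (simp add: w mass_def)
      qed
    qed
    have "(\<Sum>j\<in>UNIV - {i}. (mass m j / norm (euler_path m \<theta> t $ j - euler_path m \<theta> t $ i) ^ 3)
               *\<^sub>R (euler_path m \<theta> t $ j - euler_path m \<theta> t $ i)) =
       of_real (\<Sum>j\<in>UNIV - {i}. (mass m j / (R * \<bar>w j - w i\<bar>) ^ 3) * (R * (w j - w i))) * u t"
      unfolding n unfolding d by (simp add: scaleR_conv_of_real sum_distrib_right mult.assoc)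
    also have "\<dots> = of_real (R * w i) * (\<i> * of_real a) * (\<i> * of_real a) * u t"
      unfolding s by (simp add: power2_eq_square algebra_simps)
    finally show ?thesis .
  qed
  have "w i = w j \<Longrightarrow> i = j" for i j
    using exhaust_3[of i] exhaust_3[of j] by (auto simp: w)
  then have "collision_free (euler_path m \<theta>)"
    using R by (auto simp: collision_free_def E)
  then show ?thesis
    unfolding newton_solution_def
  proof (intro conjI exI[of _ "\<lambda>t. \<chi> i. of_real (R * w i) * (\<i> * of_real a) * u t"] allI)
    fix t i
    show "((\<lambda>s. euler_path m \<theta> s $ i) has_vector_derivative
            (\<chi> i. of_real (R * w i) * (\<i> * of_real a) * u t) $ i) (at t)"
      unfolding E vec_lambda_beta by (rule du)
    show "((\<lambda>s. (\<chi> i. of_real (R * w i) * (\<i> * of_real a) * u s) $ i) has_vector_derivative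
            (\<Sum>j\<in>UNIV - {i}. (mass m j / norm (euler_path m \<theta> t $ j - euler_path m \<theta> t $ i) ^ 3)
               *\<^sub>R (euler_path m \<theta> t $ j - euler_path m \<theta> t $ i))) (at t)"
      unfolding acc vec_lambda_beta by (rule du)
  qed
qed

end

theory Submission
  imports Defs "HOL-Complex_Analysis.Great_Picard"
begin

text \<open>In the inequality defining \<open>D\<close>, the crude bounds of the potential of the pairs \<open>{1, 3}\<close> and \<open>{2, 3}\<close>
  force \<open>\<theta> \<le> \<pi>/4\<close>. In that range the exact potential of these pairs, estimated by a convexity argument,
  leaves enough room to push \<open>c\<close> to \<open>0\<close>, and yields a test path whose action lies below the stated
  closed form and hence below the action of the Euler orbit.

  For arbitrary \<open>\<theta>\<close> no finite symmetry group is available, so that collisions of a minimizer are excluded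
  directly. The kinetic part is the supremum of \<open>\<Sum> |\<Delta>x|\<^sup>2 / \<Delta>t\<close> over partitions, which is lower semicontinuous
  under pointwise convergence and makes the existence of a minimizer a compactness argument. A triple
  collision costs more action than the Euler orbit. Near a binary collision a comparison argument bounds the
  action of the pair on short intervals, and separating the two bodies in a direction that makes no obtuse angle
  with either branch then lowers the action. A collision-free minimizer satisfies Newton's equations and reflects at its
  endpoints, so that it extends by symmetry. If it were homographic, it would be a collinear motion with \<open>x\<^sub>3 = 0\<close>,
  whose action is at least that of the Euler orbit by an inequality of Wirtinger type.\<close>

section \<open>Energy of a path\<close>

text \<open>The closed form \<open>A_E\<close> is not the action of \<open>euler_path\<close>; it
  lies below that action only while \<open>pi / 2 - \<theta> \<ge> 1/2\<close>. So membership in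
  \<open>D\<close> must bound \<open>\<theta>\<close> before it says anything about the Euler orbit.
  The parameters \<open>l\<close>, \<open>r0\<close>, \<open>c\<close> behind \<open>D\<close> are
  not those of the test path found: bodies 2 and 3 start at distance
  \<open>l * (1 + 2 / m) - r0\<close> and, as the radius grows, at first approach each other, so
  \<open>A_D\<close> does not evidently bound the action. They are traded for the optimal distance
  \<open>As\<close> of body 3 from the midpoint of the others, a radius \<open>\<rho>\<close> below
  both the mean radius and the optimal one, and a tiny \<open>c\<close>. Partition sums spare
  competitors any derivative: an increment inequality is enough. Near a collision the scale is a
  length \<open>\<nu>^3\<close>, on which the pair has energy of order \<open>\<nu>\<close> and
  distance of order \<open>\<nu>^2\<close>. A separation by \<open>\<eta> * \<nu>^2\<close> changes
  both parts of the action by order \<open>\<eta>^2 * \<nu>\<close>, with a gain twice the cost,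
  while the third body enters only with order \<open>\<nu>^3\<close>.\<close>

fun psum :: "(real \<Rightarrow> 'a::real_normed_vector) \<Rightarrow> real list \<Rightarrow> real" where
  "psum f (s # t # ts) = (norm (f t - f s))\<^sup>2 / (t - s) + psum f (t # ts)"
| "psum f _ = 0"

text \<open>The integral of \<open>|f'|^2\<close> for the polygon that interpolates \<open>f\<close>
  at the points of \<open>P\<close>.\<close>

definition penergy :: "(real \<Rightarrow> 'a::real_normed_vector) \<Rightarrow> real set \<Rightarrow> real" where
  "penergy f P = psum f (sorted_list_of_set P)"

text \<open>Riesz's criterion for \<open>H^1\<close>: for functions into a Euclidean space these
  sums are bounded exactly if \<open>f\<close> has a square-integrable weak derivative. Boundedness
  is a predicate of its own because the real-valued \<open>SUP\<close> in \<open>energy\<close>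
  carries no information on unbounded sets.\<close>

definition fin_energy :: "real \<Rightarrow> real \<Rightarrow> (real \<Rightarrow> 'a::real_normed_vector) \<Rightarrow> bool" where
  "fin_energy a b f \<longleftrightarrow> bdd_above (penergy f ` {P. finite P \<and> P \<subseteq> {a..b}})"

definition energy :: "real \<Rightarrow> real \<Rightarrow> (real \<Rightarrow> 'a::real_normed_vector) \<Rightarrow> real" where
  "energy a b f = (SUP P\<in>{P. finite P \<and> P \<subseteq> {a..b}}. penergy f P)"

text \<open>Cauchy-Schwarz in the form \<open>(u + v)^2 / (p + q) \<le> u^2 / p + v^2 / q\<close>: a
  further partition point never lowers the sum. If \<open>x\<close> is one of the ends, the
  convention \<open>a / 0 = 0\<close> removes one piece and the other equals the left-hand
  side.\<close>

lemma norm_sq_div_split: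
  fixes f :: "real \<Rightarrow> 'a::real_normed_vector"
  assumes "s \<le> x" "x \<le> t"
  shows "(norm (f t - f s))\<^sup>2 / (t - s) \<le> (norm (f x - f s))\<^sup>2 / (x - s) + (norm (f t - f x))\<^sup>2 / (t - x)"
proof (cases "s = x \<or> x = t")
  case False
  then have lt: "s < x" "x < t" using assms by auto
  define u v p q where "u = norm (f x - f s)" and "v = norm (f t - f x)" and "p = x - s" and "q = t - x"
  have pq: "p > 0" "q > 0" "t - s = p + q" using lt by (auto simp: p_def q_def)
  have "norm (f t - f s) \<le> u + v"
    unfolding u_def v_def by (metis add.commute diff_add_cancel add_diff_eq norm_triangle_ineq)
  then have "(norm (f t - f s))\<^sup>2 / (t - s) \<le> (u + v)\<^sup>2 / (p + q)"
    unfolding pq(3) using pq by (intro divide_right_mono power_mono) auto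
  also have "\<dots> \<le> u\<^sup>2 / p + v\<^sup>2 / q"
  proof -
    have "u\<^sup>2 / p + v\<^sup>2 / q - (u + v)\<^sup>2 / (p + q) = (u * q - v * p)\<^sup>2 / (p * q * (p + q))"
      using pq by (simp add: divide_simps power2_eq_square) (simp add: algebra_simps)
    also have "\<dots> \<ge> 0" using pq by simp
    finally show ?thesis by linarith
  qed
  finally show ?thesis unfolding u_def v_def p_def q_def .
qed auto

lemma psum_insort: "sorted ts \<Longrightarrow> psum f ts \<le> psum f (insort x ts)"
proof (induction f ts rule: psum.induct)
  case (1 f s t ts)
  have st: "s \<le> t" using 1 by auto
  consider "x \<le> s" | "s < x" "x \<le> t" | "t < x" by linarith
  then show ?case
  proof cases
    case 1
    then show ?thesis using st by simp
  next
    case 2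
    then show ?thesis using norm_sq_div_split[of s x t f] by simp
  next
    case 3
    have "insort x (s # t # ts) = s # t # insort x ts" using 3 st by simp
    moreover have "insort x (t # ts) = t # insort x ts" using 3 by simp
    ultimately show ?thesis using 1 by simp
  qed
qed auto

lemma penergy_mono:
  assumes "finite Q" "P \<subseteq> Q"
  shows "penergy f P \<le> penergy f Q"
proof -
  have "finite R \<Longrightarrow> finite P \<Longrightarrow> penergy f P \<le> penergy f (R \<union> P)" for R P
  proof (induction R rule: finite_induct)
    case (insert x R)
    have "penergy f (R \<union> P) \<le> penergy f (insert x (R \<union> P))"
    proof (cases "x \<in> R \<union> P")
      case False
      then show ?thesis using insert by (simp add: penergy_def psum_insort)
    qed (simp add: insert_absorb)
    then show ?case using insert by auto
  qed simp
  from this[of Q P] show ?thesis using assms finite_subset by (metis Un_absorb2)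
qed

lemma penergy_nonneg: "penergy f P \<ge> 0"
  using penergy_mono[of P "{}" f] by (cases "finite P") (auto simp: penergy_def)

lemma penergy_pair: "s < t \<Longrightarrow> penergy f {s, t} = (norm (f t - f s))\<^sup>2 / (t - s)"
  by (simp add: penergy_def)

lemma penergy_le_energy:
  "fin_energy a b f \<Longrightarrow> finite P \<Longrightarrow> P \<subseteq> {a..b} \<Longrightarrow> penergy f P \<le> energy a b f"
  unfolding energy_def fin_energy_def by (rule cSUP_upper) auto

lemma energy_nonneg: "fin_energy a b f \<Longrightarrow> energy a b f \<ge> 0"
  using penergy_le_energy[of a b f "{}"] penergy_nonneg[of f "{}"] by auto

lemma energy_leI:
  assumes "\<And>P. finite P \<Longrightarrow> P \<subseteq> {a..b} \<Longrightarrow> penergy f P \<le> C"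
  shows "fin_energy a b f" "energy a b f \<le> C"
proof -
  show "fin_energy a b f" unfolding fin_energy_def using assms by (intro bdd_aboveI[of _ C]) auto
  show "energy a b f \<le> C" unfolding energy_def using assms by (intro cSUP_least) auto
qed

text \<open>Partition sums increase under refinement, so the supremum is a limit along the directed
  set of finite partitions. Limits, unlike suprema, are compatible with sums of several energies;
  \<open>energy_combination\<close> rests on this.\<close>

lemma tendsto_penergy:
  assumes "fin_energy a b f"
  shows "((penergy f) \<longlongrightarrow> energy a b f) (finite_subsets_at_top {a..b})"
proof (rule order_tendstoI)
  fix e assume "energy a b f < e"
  then show "eventually (\<lambda>P. penergy f P < e) (finite_subsets_at_top {a..b})"
    unfolding eventually_finite_subsets_at_top
    by (intro exI[of _ "{}"]) (auto intro: le_less_trans[OF penergy_le_energy[OF assms]])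
next
  fix e assume "e < energy a b f"
  then obtain P where P: "finite P" "P \<subseteq> {a..b}" "e < penergy f P"
    unfolding energy_def using assms[unfolded fin_energy_def]
    by (subst (asm) less_cSUP_iff) auto
  then show "eventually (\<lambda>P. e < penergy f P) (finite_subsets_at_top {a..b})"
    unfolding eventually_finite_subsets_at_top
    by (intro exI[of _ P]) (auto intro: less_le_trans[OF _ penergy_mono])
qed

lemma energy_ge:
  assumes "fin_energy a b f" "a \<le> s" "s \<le> t" "t \<le> b"
  shows "(norm (f t - f s))\<^sup>2 \<le> (t - s) * energy a b f"
proof (cases "s = t")
  case False
  then have "s < t" using assms by simp
  then show ?thesis
    using penergy_le_energy[OF assms(1), of "{s, t}"] assms penergy_pair[of s t f]
    by (simp add: divide_simps mult.commute)
qed simp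

lemma psum_dom:
  assumes "\<And>s t. a \<le> s \<Longrightarrow> s \<le> t \<Longrightarrow> t \<le> b \<Longrightarrow> (norm (f t - f s))\<^sup>2 \<le> (t - s) * (G t - G s)"
  shows "sorted (x # ts) \<Longrightarrow> distinct (x # ts) \<Longrightarrow> set (x # ts) \<subseteq> {a..b} \<Longrightarrow> psum f (x # ts) \<le> G b - G x"
proof (induction ts arbitrary: x)
  case Nil
  have "0 \<le> (b - x) * (G b - G x)" using assms[of x b] Nil by (auto intro: order_trans[OF zero_le_power2])
  then show ?case using Nil by (cases "x = b") (auto simp: zero_le_mult_iff)
next
  case (Cons t ts)
  have "x < t" using Cons by auto
  moreover have "(norm (f t - f x))\<^sup>2 \<le> (t - x) * (G t - G x)" using assms[of x t] Cons by auto
  ultimately have "(norm (f t - f x))\<^sup>2 / (t - x) \<le> G t - G x" by (simp add: divide_simps mult.commute)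
  moreover have "psum f (t # ts) \<le> G b - G t" using Cons by (intro Cons.IH) auto
  ultimately show ?case by simp
qed

text \<open>On every partition the increments of \<open>G\<close> telescope. \<open>G\<close> stands
  for a primitive of \<open>|f'|^2\<close>; the upper bounds for modified paths below consist in
  exhibiting such a \<open>G\<close>, usually built from the energy of the given path by means of
  the converse \<open>energy_incr\<close>.\<close>

lemma energy_dom:
  assumes "a \<le> b" "\<And>s t. a \<le> s \<Longrightarrow> s \<le> t \<Longrightarrow> t \<le> b \<Longrightarrow> (norm (f t - f s))\<^sup>2 \<le> (t - s) * (G t - G s)"
  shows "fin_energy a b f" "energy a b f \<le> G b - G a"
proof -
  have mono: "G s \<le> G t" if "a \<le> s" "s \<le> t" "t \<le> b" for s t
  proof -
    have "0 \<le> (t - s) * (G t - G s)" using assms(2)[OF that] by (auto intro: order_trans[OF zero_le_power2])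
    then show ?thesis using that by (cases "s = t") (auto simp: zero_le_mult_iff)
  qed
  have "penergy f P \<le> G b - G a" if "finite P" "P \<subseteq> {a..b}" for P
  proof (cases "sorted_list_of_set P")
    case Nil
    then show ?thesis using mono[of a b] assms by (simp add: penergy_def)
  next
    case (Cons x ts)
    have s: "set (x # ts) \<subseteq> {a..b}" using that Cons by (metis set_sorted_list_of_set)
    have "sorted (x # ts)" "distinct (x # ts)"
      by (simp_all only: Cons[symmetric] sorted_sorted_list_of_set distinct_sorted_list_of_set)
    with s assms(2) have "psum f (x # ts) \<le> G b - G x"
      by (intro psum_dom[of a b f G])
    then show ?thesis using Cons mono[of a x] s by (simp add: penergy_def)
  qed
  then show "fin_energy a b f" "energy a b f \<le> G b - G a" using energy_leI[of a b f "G b - G a"] by auto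
qed

lemma psum_append: "psum f (xs @ b # ys) = psum f (xs @ [b]) + psum f (b # ys)"
  by (induction xs rule: induct_list012) auto

lemma penergy_Un:
  assumes "finite P" "finite Q" "P \<subseteq> {a..b}" "Q \<subseteq> {b..c}" "b \<in> P" "b \<in> Q"
  shows "penergy f (P \<union> Q) = penergy f P + penergy f Q"
proof -
  define xs where "xs = sorted_list_of_set (P - {b})"
  define ys where "ys = sorted_list_of_set (Q - {b})"
  have eq: "sorted_list_of_set A = zs" if "sorted zs" "distinct zs" "set zs = A" for A :: "real set" and zs
    using that sorted_list_of_set.idem_if_sorted_distinct[of zs] by auto
  have xs: "set xs = P - {b}" "sorted xs" "distinct xs" and ys: "set ys = Q - {b}" "sorted ys" "distinct ys"
    using assms by (auto simp: xs_def ys_def)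
  have "sorted_list_of_set P = xs @ [b]"
    by (rule eq) (use assms xs in \<open>auto simp: sorted_append\<close>)
  moreover have "sorted_list_of_set Q = b # ys"
    by (rule eq) (use assms ys in auto)
  moreover have "sorted_list_of_set (P \<union> Q) = xs @ b # ys"
  proof (rule eq)
    have x: "x < b" if "x \<in> set xs" for x
    proof -
      have "x \<in> P" "x \<noteq> b" using that xs by auto
      moreover from this have "x \<le> b" using assms(3) by auto
      ultimately show ?thesis by simp
    qed
    have y: "b < y" if "y \<in> set ys" for y
    proof -
      have "y \<in> Q" "y \<noteq> b" using that ys by auto
      moreover from this have "b \<le> y" using assms(4) by auto
      ultimately show ?thesis by simp
    qed
    have xy: "u < v" if "u \<in> set xs" "v \<in> set ys" for u v
      using x[OF that(1)] y[OF that(2)] by simp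
    show "sorted (xs @ b # ys)"
      using xs(2) ys(2) x y xy by (simp add: sorted_append less_imp_le)
    have "u \<notin> set ys" if "u \<in> set xs" for u using xy[OF that, of u] by auto
    moreover have "b \<notin> set xs" "b \<notin> set ys" using xs(1) ys(1) by auto
    ultimately show "distinct (xs @ b # ys)"
      using xs(3) ys(3) by auto
    show "set (xs @ b # ys) = P \<union> Q" using xs ys assms by auto
  qed
  ultimately show ?thesis unfolding penergy_def using psum_append[of f xs b ys] by simp
qed

lemma energy_add:
  assumes "a \<le> b" "b \<le> c" "fin_energy a b f" "fin_energy b c f"
  shows "fin_energy a c f" "energy a c f = energy a b f + energy b c f"
proof -
  have le: "penergy f R \<le> energy a b f + energy b c f" if "finite R" "R \<subseteq> {a..c}" for R
  proof -
    \<comment> \<open>Inserting \<open>b\<close> can only raise the sum, which afterwards splits at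
      \<open>b\<close>.\<close>
    define P Q where "P = insert b (R \<inter> {a..b})" and "Q = insert b (R \<inter> {b..c})"
    have "R \<subseteq> P \<union> Q" using that assms by (auto simp: P_def Q_def)
    then have "penergy f R \<le> penergy f (P \<union> Q)" using that by (intro penergy_mono) (auto simp: P_def Q_def)
    also have "\<dots> = penergy f P + penergy f Q"
      using that assms by (intro penergy_Un[of _ _ a b c]) (auto simp: P_def Q_def)
    also have "\<dots> \<le> energy a b f + energy b c f"
      using that assms by (intro add_mono penergy_le_energy) (auto simp: P_def Q_def)
    finally show ?thesis .
  qed
  show fin: "fin_energy a c f" using le by (rule energy_leI(1))
  have "energy a c f \<le> energy a b f + energy b c f" using le by (rule energy_leI(2))
  moreover have "energy a b f \<le> energy a c f - energy b c f"
  proof (rule energy_leI(2))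
    fix P assume P: "finite P" "P \<subseteq> {a..b}"
    have "energy b c f \<le> energy a c f - penergy f P"
    proof (rule energy_leI(2))
      fix Q assume Q: "finite Q" "Q \<subseteq> {b..c}"
      have "penergy f P + penergy f Q \<le> penergy f (insert b P) + penergy f (insert b Q)"
        using P Q by (intro add_mono penergy_mono) auto
      also have "\<dots> = penergy f (insert b P \<union> insert b Q)"
        using P Q assms by (intro penergy_Un[symmetric, of _ _ a b c]) auto
      also have "\<dots> \<le> energy a c f"
        using P Q assms by (intro penergy_le_energy fin) auto
      finally show "penergy f Q \<le> energy a c f - penergy f P" by simp
    qed
    then show "penergy f P \<le> energy a c f - energy b c f" by simp
  qed
  ultimately show "energy a c f = energy a b f + energy b c f" by simp
qed

lemma fin_energy_subset: "fin_energy a b f \<Longrightarrow> a \<le> c \<Longrightarrow> d \<le> b \<Longrightarrow> fin_energy c d f"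
  unfolding fin_energy_def by (erule bdd_above_mono) (auto intro!: image_mono)

lemma energy_split:
  assumes "fin_energy a c f" "a \<le> b" "b \<le> c"
  shows "energy a c f = energy a b f + energy b c f"
  using assms by (intro energy_add(2) fin_energy_subset[OF assms(1)]) auto

lemma energy_incr:
  assumes "fin_energy a b f" "a \<le> s" "s \<le> t" "t \<le> b"
  shows "(norm (f t - f s))\<^sup>2 \<le> (t - s) * (energy a t f - energy a s f)"
proof -
  have "energy a t f = energy a s f + energy s t f"
    using assms by (intro energy_split fin_energy_subset[OF assms(1)]) auto
  moreover have "(norm (f t - f s))\<^sup>2 \<le> (t - s) * energy s t f"
    using assms by (intro energy_ge[of s t] fin_energy_subset[OF assms(1)]) auto
  ultimately show ?thesis by simp
qed

lemma energy_cong: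
  assumes "\<And>t. a \<le> t \<Longrightarrow> t \<le> b \<Longrightarrow> f t = g t"
  shows "energy a b f = energy a b g" "fin_energy a b f = fin_energy a b g"
proof -
  have p: "set ts \<subseteq> {a..b} \<Longrightarrow> psum f ts = psum g ts" for ts
    by (induction ts rule: induct_list012) (use assms in auto)
  have "penergy f P = penergy g P" if "finite P" "P \<subseteq> {a..b}" for P
    unfolding penergy_def using that by (intro p) auto
  then have "penergy f ` {P. finite P \<and> P \<subseteq> {a..b}} = penergy g ` {P. finite P \<and> P \<subseteq> {a..b}}"
    by (intro image_cong) auto
  then show "energy a b f = energy a b g" "fin_energy a b f = fin_energy a b g"
    unfolding energy_def fin_energy_def by auto
qed

lemma energy_degenerate: "energy a a f = 0"
proof -
  have *: "s = t" if "a \<le> s" "s \<le> t" "t \<le> a" for s t using that by simp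
  have "fin_energy a a f" "energy a a f \<le> 0 - 0"
    using energy_dom[of a a f "\<lambda>_. 0"] by (auto dest!: *)
  then show ?thesis using energy_nonneg[of a a f] by simp
qed

lemma energy_affine_le:
  assumes "p > 0" "a \<le> b" "fin_energy (p * a + q) (p * b + q) f"
  shows "fin_energy a b (\<lambda>t. f (p * t + q))" "energy a b (\<lambda>t. f (p * t + q)) \<le> p * energy (p * a + q) (p * b + q) f"
proof -
  define G where "G t = p * energy (p * a + q) (p * t + q) f" for t
  have "(norm (f (p * t + q) - f (p * s + q)))\<^sup>2 \<le> (t - s) * (G t - G s)" if "a \<le> s" "s \<le> t" "t \<le> b" for s t
    using energy_incr[OF assms(3), of "p * s + q" "p * t + q"] that assms(1) by (simp add: G_def algebra_simps)
  from energy_dom[OF assms(2) this] show "fin_energy a b (\<lambda>t. f (p * t + q))"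
    "energy a b (\<lambda>t. f (p * t + q)) \<le> p * energy (p * a + q) (p * b + q) f"
    by (auto simp: G_def energy_degenerate)
qed

lemma energy_reflect:
  assumes "a \<le> b" "fin_energy (c - b) (c - a) f"
  shows "fin_energy a b (\<lambda>t. f (c - t))" "energy a b (\<lambda>t. f (c - t)) = energy (c - b) (c - a) f"
proof -
  have *: "fin_energy a b (\<lambda>t. f (c - t)) \<and> energy a b (\<lambda>t. f (c - t)) \<le> energy (c - b) (c - a) f"
    if "a \<le> b" "fin_energy (c - b) (c - a) f" for a b and f :: "real \<Rightarrow> 'a"
  proof -
    define G where "G t = - energy (c - b) (c - t) f" for t
    have "(norm (f (c - t) - f (c - s)))\<^sup>2 \<le> (t - s) * (G t - G s)" if "a \<le> s" "s \<le> t" "t \<le> b" for s t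
      using energy_incr[OF \<open>fin_energy (c - b) (c - a) f\<close>, of "c - t" "c - s"] that
      by (simp add: G_def norm_minus_commute)
    from energy_dom[OF that(1) this] show ?thesis by (auto simp: G_def energy_degenerate)
  qed
  show "fin_energy a b (\<lambda>t. f (c - t))" using *[OF assms] by simp
  \<comment> \<open>Reflection is an involution: the inequality just shown, applied to the reflected
    function, is the reverse one.\<close>
  have "energy (c - b) (c - a) (\<lambda>t. f (c - (c - t))) \<le> energy (c - (c - a)) (c - (c - b)) (\<lambda>t. f (c - t))"
    using *[of "c - b" "c - a" "\<lambda>t. f (c - t)"] *[OF assms] assms by simp
  then show "energy a b (\<lambda>t. f (c - t)) = energy (c - b) (c - a) f" using *[OF assms] by simp
qed

text \<open>A quadratic identity between increments holds for each term of each partition sum and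
  survives in the limit. It takes the place of a pointwise identity between the integrands
  \<open>|f'|^2\<close>.\<close>

lemma energy_combination:
  fixes f :: "'i \<Rightarrow> real \<Rightarrow> 'a::real_normed_vector" and g :: "'j \<Rightarrow> real \<Rightarrow> 'b::real_normed_vector"
  assumes fin: "\<And>i. i \<in> I \<Longrightarrow> fin_energy a b (f i)" "\<And>j. j \<in> J \<Longrightarrow> fin_energy a b (g j)"
    and eq: "\<And>s t. s \<in> {a..b} \<Longrightarrow> t \<in> {a..b} \<Longrightarrow>
       (\<Sum>i\<in>I. \<alpha> i * (norm (f i t - f i s))\<^sup>2) = (\<Sum>j\<in>J. \<beta> j * (norm (g j t - g j s))\<^sup>2)"
  shows "(\<Sum>i\<in>I. \<alpha> i * energy a b (f i)) = (\<Sum>j\<in>J. \<beta> j * energy a b (g j))"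
proof -
  have psum: "(\<Sum>i\<in>I. \<alpha> i * psum (f i) ts) = (\<Sum>j\<in>J. \<beta> j * psum (g j) ts)" if "set ts \<subseteq> {a..b}" for ts
    using that
  proof (induction ts rule: induct_list012)
    case (3 s t ts)
    have "(\<Sum>i\<in>I. \<alpha> i * psum (f i) (s # t # ts)) =
      (\<Sum>i\<in>I. \<alpha> i * (norm (f i t - f i s))\<^sup>2) / (t - s) + (\<Sum>i\<in>I. \<alpha> i * psum (f i) (t # ts))"
      by (simp add: ring_distribs sum.distrib sum_divide_distrib)
    also have "\<dots> = (\<Sum>j\<in>J. \<beta> j * (norm (g j t - g j s))\<^sup>2) / (t - s) + (\<Sum>j\<in>J. \<beta> j * psum (g j) (t # ts))"
      using 3 eq[of s t] by simp
    also have "\<dots> = (\<Sum>j\<in>J. \<beta> j * psum (g j) (s # t # ts))"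
      by (simp add: ring_distribs sum.distrib sum_divide_distrib)
    finally show ?case .
  qed auto
  have F: "\<forall>\<^sub>F P in finite_subsets_at_top {a..b}. finite P \<and> P \<subseteq> {a..b}"
    by (rule eventually_finite_subsets_at_top_weakI) simp
  have l: "((\<lambda>P. \<Sum>i\<in>I. \<alpha> i * penergy (f i) P) \<longlongrightarrow> (\<Sum>i\<in>I. \<alpha> i * energy a b (f i))) (finite_subsets_at_top {a..b})"
    by (intro tendsto_intros tendsto_penergy fin)
  have r: "((\<lambda>P. \<Sum>j\<in>J. \<beta> j * penergy (g j) P) \<longlongrightarrow> (\<Sum>j\<in>J. \<beta> j * energy a b (g j))) (finite_subsets_at_top {a..b})"
    by (intro tendsto_intros tendsto_penergy fin)
  have "\<forall>\<^sub>F P in finite_subsets_at_top {a..b}. (\<Sum>i\<in>I. \<alpha> i * penergy (f i) P) = (\<Sum>j\<in>J. \<beta> j * penergy (g j) P)"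
    using F by eventually_elim (auto simp: penergy_def intro!: psum)
  then have "((\<lambda>P. \<Sum>j\<in>J. \<beta> j * penergy (g j) P) \<longlongrightarrow> (\<Sum>i\<in>I. \<alpha> i * energy a b (f i))) (finite_subsets_at_top {a..b})"
    using l by (rule Lim_transform_eventually[rotated])
  from tendsto_unique[OF finite_subsets_at_top_neq_bot this r] show ?thesis .
qed

lemma fin_energy_isCont:
  assumes "fin_energy a b f"
  shows "continuous_on {a..b} f"
proof (cases "a \<le> b")
  case True
  define C where "C = energy a b f"
  have C: "C \<ge> 0" unfolding C_def using assms by (rule energy_nonneg)
  have H: "dist (f s) (f t) \<le> sqrt (\<bar>s - t\<bar> * C)" if "s \<in> {a..b}" "t \<in> {a..b}" for s t
  proof -
    have "(dist (f s) (f t))\<^sup>2 \<le> \<bar>s - t\<bar> * C"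
      using energy_ge[OF assms, of s t] energy_ge[OF assms, of t s] that unfolding C_def
      by (cases "s \<le> t") (auto simp: dist_norm norm_minus_commute)
    then show ?thesis by (rule real_le_rsqrt)
  qed
  show ?thesis unfolding continuous_on_def
  proof
    fix t assume t: "t \<in> {a..b}"
    have "((\<lambda>s. sqrt (\<bar>s - t\<bar> * C)) \<longlongrightarrow> sqrt (\<bar>t - t\<bar> * C)) (at t within {a..b})"
      by (intro tendsto_intros)
    then have "((\<lambda>s. sqrt (\<bar>s - t\<bar> * C)) \<longlongrightarrow> 0) (at t within {a..b})" by simp
    then have "((\<lambda>s. dist (f s) (f t)) \<longlongrightarrow> 0) (at t within {a..b})"
      by (rule Lim_null_comparison[rotated]) (use t in \<open>auto simp: eventually_at_filter intro!: always_eventually H\<close>)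
    then show "(f \<longlongrightarrow> f t) (at t within {a..b})" by (subst tendsto_dist_iff)
  qed
qed auto

section \<open>Action and minimizers\<close>

lemma energy_add_functions:
  assumes "a \<le> b" "fin_energy a b f" "fin_energy a b g"
  shows "fin_energy a b (\<lambda>t. f t + g t)"
proof -
  define G where "G t = 2 * (energy a t f + energy a t g)" for t
  have "(norm ((f t + g t) - (f s + g s)))\<^sup>2 \<le> (t - s) * (G t - G s)" if st: "a \<le> s" "s \<le> t" "t \<le> b" for s t
  proof -
    define u v where "u = norm (f t - f s)" and "v = norm (g t - g s)"
    have "norm ((f t + g t) - (f s + g s)) \<le> u + v"
      unfolding u_def v_def by (metis add_diff_add norm_triangle_ineq)
    then have "(norm ((f t + g t) - (f s + g s)))\<^sup>2 \<le> (u + v)\<^sup>2" by (intro power_mono) auto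
    also have "\<dots> \<le> 2 * u\<^sup>2 + 2 * v\<^sup>2" using zero_le_power2[of "u - v"] by (simp add: power2_eq_square algebra_simps)
    also have "\<dots> \<le> (t - s) * (G t - G s)"
      using energy_incr[OF assms(2) st] energy_incr[OF assms(3) st]
      by (simp add: G_def u_def v_def algebra_simps)
    finally show ?thesis .
  qed
  from energy_dom(1)[OF assms(1) this] show ?thesis .
qed

lemma fin_energy_linear:
  fixes f :: "real \<Rightarrow> complex"
  assumes "a \<le> b" "fin_energy a b f"
  shows "fin_energy a b (\<lambda>t. c * f t)"
proof -
  define G where "G t = (norm c)\<^sup>2 * energy a t f" for t
  have "(norm (c * f t - c * f s))\<^sup>2 \<le> (t - s) * (G t - G s)" if st: "a \<le> s" "s \<le> t" "t \<le> b" for s t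
  proof -
    have "(norm (c * f t - c * f s))\<^sup>2 = (norm c)\<^sup>2 * (norm (f t - f s))\<^sup>2"
      by (simp add: norm_mult power_mult_distrib flip: right_diff_distrib)
    also have "\<dots> \<le> (norm c)\<^sup>2 * ((t - s) * (energy a t f - energy a s f))"
      by (intro mult_left_mono energy_incr[OF assms(2) st]) auto
    finally show ?thesis by (simp add: G_def algebra_simps)
  qed
  from energy_dom(1)[OF assms(1) this] show ?thesis .
qed

lemma fin_energy_diff:
  fixes f g :: "real \<Rightarrow> complex"
  assumes "a \<le> b" "fin_energy a b f" "fin_energy a b g"
  shows "fin_energy a b (\<lambda>t. f t - g t)"
  using energy_add_functions[OF assms(1,2) fin_energy_linear[OF assms(1,3), of "-1"]] by simp

lemma UNIV_3_distinct: "distinct [i, j, k] \<Longrightarrow> (UNIV :: 3 set) = {i, j, k}"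
proof -
  assume d: "distinct [i, j, k]"
  have "card {i, j, k} = 3" using d by simp
  then show ?thesis by (intro card_seteq[symmetric]) auto
qed

lemma sum_3_distinct: "distinct [i, j, k :: 3] \<Longrightarrow> sum f UNIV = f i + f j + f k"
  by (subst UNIV_3_distinct, assumption) (auto simp: add.assoc)

section \<open>The two parts of the action under cutting, rescaling and reversing time\<close>

definition pair_potential :: "real \<Rightarrow> 3 \<Rightarrow> 3 \<Rightarrow> complex \<Rightarrow> ennreal" where
  "pair_potential m i j d = ennreal (mass m i * mass m j) / ennreal (norm d)"

lemma pair_potential_commute: "pair_potential m i j (x - y) = pair_potential m j i (y - x)"
  by (simp add: pair_potential_def mult.commute norm_minus_commute)

lemma potential_distinct:
  assumes "distinct [i, j, k]"
  shows "potential m x = pair_potential m i j (x $ i - x $ j) + pair_potential m i k (x $ i - x $ k)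
           + pair_potential m j k (x $ j - x $ k)"
proof -
  have p: "pair_potential m 2 1 (x $ 2 - x $ 1) = pair_potential m 1 2 (x $ 1 - x $ 2)"
    "pair_potential m 3 1 (x $ 3 - x $ 1) = pair_potential m 1 3 (x $ 1 - x $ 3)"
    "pair_potential m 3 2 (x $ 3 - x $ 2) = pair_potential m 2 3 (x $ 2 - x $ 3)"
    by (rule pair_potential_commute)+
  have "potential m x = pair_potential m 1 2 (x $ 1 - x $ 2) + pair_potential m 1 3 (x $ 1 - x $ 3)
           + pair_potential m 2 3 (x $ 2 - x $ 3)"
    by (simp add: potential_def pair_potential_def)
  then show ?thesis
    using assms exhaust_3[of i] exhaust_3[of j] exhaust_3[of k] p by (elim disjE) (simp_all add: ac_simps)
qed

definition kin :: "real \<Rightarrow> real \<Rightarrow> real \<Rightarrow> (real \<Rightarrow> config) \<Rightarrow> real" where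
  "kin m a b x = (\<Sum>i\<in>UNIV. mass m i / 2 * energy a b (\<lambda>t. x t $ i))"

definition fin_kin :: "real \<Rightarrow> real \<Rightarrow> (real \<Rightarrow> config) \<Rightarrow> bool" where
  "fin_kin a b x \<longleftrightarrow> (\<forall>i. fin_energy a b (\<lambda>t. x t $ i))"

definition pot :: "real \<Rightarrow> real \<Rightarrow> real \<Rightarrow> (real \<Rightarrow> config) \<Rightarrow> ennreal" where
  "pot m a b x = (\<integral>\<^sup>+t\<in>{a..b}. potential m (x t) \<partial>lborel)"

lemma mass_pos: "m > 0 \<Longrightarrow> mass m i > 0"
  by (simp add: mass_def)

lemma fin_kinD: "fin_kin a b x \<Longrightarrow> fin_energy a b (\<lambda>t. x t $ i)"
  by (simp add: fin_kin_def)

lemma fin_kin_subset: "fin_kin a b x \<Longrightarrow> a \<le> c \<Longrightarrow> d \<le> b \<Longrightarrow> fin_kin c d x"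
  unfolding fin_kin_def using fin_energy_subset by blast

lemma kin_nonneg: "m > 0 \<Longrightarrow> fin_kin a b x \<Longrightarrow> kin m a b x \<ge> 0"
  unfolding kin_def by (intro sum_nonneg mult_nonneg_nonneg energy_nonneg fin_kinD)
    (auto intro: less_imp_le[OF mass_pos])

lemma kin_split:
  assumes "fin_kin a c x" "a \<le> b" "b \<le> c"
  shows "kin m a c x = kin m a b x + kin m b c x"
  unfolding kin_def sum.distrib[symmetric]
  by (intro sum.cong refl) (simp add: energy_split[OF fin_kinD[OF assms(1)] assms(2,3)] distrib_left)

lemma fin_kin_add:
  assumes "fin_kin a b x" "fin_kin b c x" "a \<le> b" "b \<le> c"
  shows "fin_kin a c x"
  unfolding fin_kin_def using energy_add(1)[OF assms(3,4)] assms(1,2)[THEN fin_kinD] by blast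

lemma kin_cong:
  assumes "\<And>t. a \<le> t \<Longrightarrow> t \<le> b \<Longrightarrow> x t = y t"
  shows "kin m a b x = kin m a b y" "fin_kin a b x = fin_kin a b y"
proof -
  have "energy a b (\<lambda>t. x t $ i) = energy a b (\<lambda>t. y t $ i)" for i
    by (intro energy_cong(1)) (simp add: assms)
  then show "kin m a b x = kin m a b y" by (simp add: kin_def)
  have "fin_energy a b (\<lambda>t. x t $ i) = fin_energy a b (\<lambda>t. y t $ i)" for i
    by (intro energy_cong(2)) (simp add: assms)
  then show "fin_kin a b x = fin_kin a b y" by (simp add: fin_kin_def)
qed

lemma kin_affine_le:
  assumes "m > 0" "p > 0" "a \<le> b" "fin_kin (p * a + q) (p * b + q) x"
  shows "fin_kin a b (\<lambda>t. x (p * t + q))" "kin m a b (\<lambda>t. x (p * t + q)) \<le> p * kin m (p * a + q) (p * b + q) x"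
proof -
  show "fin_kin a b (\<lambda>t. x (p * t + q))"
    unfolding fin_kin_def using energy_affine_le(1)[OF assms(2,3) fin_kinD[OF assms(4)]] by blast
  have "mass m i / 2 * energy a b (\<lambda>t. x (p * t + q) $ i)
      \<le> p * (mass m i / 2 * energy (p * a + q) (p * b + q) (\<lambda>t. x t $ i))" for i
  proof -
    have "mass m i / 2 * energy a b (\<lambda>t. x (p * t + q) $ i)
        \<le> mass m i / 2 * (p * energy (p * a + q) (p * b + q) (\<lambda>t. x t $ i))"
      using energy_affine_le(2)[OF assms(2,3) fin_kinD[OF assms(4)]] mass_pos[OF assms(1), of i]
      by (intro mult_left_mono) auto
    then show ?thesis by (simp add: mult_ac)
  qed
  then show "kin m a b (\<lambda>t. x (p * t + q)) \<le> p * kin m (p * a + q) (p * b + q) x"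
    unfolding kin_def sum_distrib_left by (intro sum_mono)
qed

lemma kin_reflect:
  assumes "a \<le> b" "fin_kin (c - b) (c - a) x"
  shows "fin_kin a b (\<lambda>t. x (c - t))" "kin m a b (\<lambda>t. x (c - t)) = kin m (c - b) (c - a) x"
  unfolding fin_kin_def kin_def
  using energy_reflect[OF assms(1) fin_kinD[OF assms(2)]] by auto

lemma fin_kin_continuous: "fin_kin a b x \<Longrightarrow> continuous_on {a..b} (\<lambda>t. x t $ i)"
  by (intro fin_energy_isCont fin_kinD)

lemma kin_le_energy_bound:
  assumes "m > 0" "fin_kin a b x"
  shows "mass m i / 2 * energy a b (\<lambda>t. x t $ i) \<le> kin m a b x"
  unfolding kin_def
  by (rule member_le_sum)
     (auto intro!: mult_nonneg_nonneg energy_nonneg fin_kinD[OF assms(2)] less_imp_le[OF mass_pos[OF assms(1)]])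

lemma measurable_pair_potential:
  fixes f :: "real \<Rightarrow> complex"
  assumes "continuous_on {a..b} f"
  shows "(\<lambda>t. pair_potential m i j (f t) * indicator {a..b} t) \<in> borel_measurable lborel"
proof (cases "a \<le> b")
  case True
  \<comment> \<open>Clamping the argument to \<open>[a, b]\<close> gives a continuous, hence
    measurable, function on the whole line.\<close>
  define g where "g t = f (max a (min b t))" for t
  have "continuous_on UNIV g" unfolding g_def
    by (rule continuous_on_compose2[OF assms]) (use True in \<open>auto intro!: continuous_on_max continuous_on_min continuous_intros\<close>)
  then have [measurable]: "g \<in> borel_measurable borel" by (rule borel_measurable_continuous_onI)
  have "(\<lambda>t. pair_potential m i j (g t) * indicator {a..b} t) \<in> borel_measurable lborel"
    unfolding pair_potential_def by measurable
  also have "(\<lambda>t. pair_potential m i j (g t) * indicator {a..b} t) = (\<lambda>t. pair_potential m i j (f t) * indicator {a..b} t)"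
    by (auto simp: fun_eq_iff g_def indicator_def)
  finally show ?thesis .
qed auto

lemma measurable_potential:
  assumes "fin_kin a b x"
  shows "(\<lambda>t. potential m (x t) * indicator {a..b} t) \<in> borel_measurable lborel"
proof -
  have c: "continuous_on {a..b} (\<lambda>t. x t $ i - x t $ j)" for i j
    by (intro continuous_intros fin_kin_continuous[OF assms])
  have "(\<lambda>t. pair_potential m 1 2 (x t $ 1 - x t $ 2) * indicator {a..b} t
        + pair_potential m 1 3 (x t $ 1 - x t $ 3) * indicator {a..b} t
        + pair_potential m 2 3 (x t $ 2 - x t $ 3) * indicator {a..b} t) \<in> borel_measurable lborel"
    by (intro borel_measurable_add measurable_pair_potential c)
  then show ?thesis
    by (simp add: potential_distinct[of 1 2 3] distrib_right)
qed

lemma nn_integral_interval_split: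
  fixes f :: "real \<Rightarrow> ennreal"
  assumes "a \<le> b" "b \<le> c"
    "(\<lambda>t. f t * indicator {a..b} t) \<in> borel_measurable lborel" "(\<lambda>t. f t * indicator {b..c} t) \<in> borel_measurable lborel"
  shows "(\<integral>\<^sup>+t\<in>{a..c}. f t \<partial>lborel) = (\<integral>\<^sup>+t\<in>{a..b}. f t \<partial>lborel) + (\<integral>\<^sup>+t\<in>{b..c}. f t \<partial>lborel)"
proof -
  have "(\<integral>\<^sup>+t\<in>{a..c}. f t \<partial>lborel) = (\<integral>\<^sup>+t. f t * indicator {a..b} t + f t * indicator {b..c} t \<partial>lborel)"
  proof (rule nn_integral_cong_AE)
    have "AE t in lborel. t \<noteq> b" by (rule AE_lborel_singleton)
    then show "AE t in lborel. f t * indicator {a..c} t = f t * indicator {a..b} t + f t * indicator {b..c} t"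
      by eventually_elim (use assms(1,2) in \<open>auto simp: indicator_def\<close>)
  qed
  also have "\<dots> = (\<integral>\<^sup>+t\<in>{a..b}. f t \<partial>lborel) + (\<integral>\<^sup>+t\<in>{b..c}. f t \<partial>lborel)"
    using assms by (intro nn_integral_add) auto
  finally show ?thesis .
qed

lemma pot_split:
  assumes "fin_kin a b x" "fin_kin b c x" "a \<le> b" "b \<le> c"
  shows "pot m a c x = pot m a b x + pot m b c x"
  unfolding pot_def using assms by (intro nn_integral_interval_split measurable_potential)

lemma pot_cong: "(\<And>t. a \<le> t \<Longrightarrow> t \<le> b \<Longrightarrow> x t = y t) \<Longrightarrow> pot m a b x = pot m a b y"
  unfolding pot_def by (intro nn_integral_cong) (auto simp: indicator_def)

lemma pot_affine:
  assumes "p \<noteq> 0" "fin_kin a b x"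
  shows "pot m a b x = ennreal \<bar>p\<bar> * (\<integral>\<^sup>+t\<in>{t. q + p * t \<in> {a..b}}. potential m (x (q + p * t)) \<partial>lborel)"
proof -
  have "pot m a b x = ennreal \<bar>p\<bar> * (\<integral>\<^sup>+t. potential m (x (q + p * t)) * indicator {a..b} (q + p * t) \<partial>lborel)"
    unfolding pot_def
    by (subst nn_integral_real_affine[OF _ assms(1), of _ q]) (use measurable_potential[OF assms(2), of m] in simp_all)
  also have "(\<lambda>t. potential m (x (q + p * t)) * indicator {a..b} (q + p * t)) =
       (\<lambda>t. potential m (x (q + p * t)) * indicator {t. q + p * t \<in> {a..b}} t)"
    by (auto simp: fun_eq_iff indicator_def)
  finally show ?thesis .
qed

lemma pot_scale:
  assumes "p > 0" "fin_kin (p * a + q) (p * b + q) x"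
  shows "pot m (p * a + q) (p * b + q) x = ennreal p * pot m a b (\<lambda>t. x (p * t + q))"
proof -
  have "{t. q + p * t \<in> {p * a + q..p * b + q}} = {a..b}" using assms(1) by (auto simp: mult_le_cancel_left)
  then show ?thesis using pot_affine[OF _ assms(2), of p m q] assms(1) by (simp add: pot_def add.commute)
qed

lemma pot_reflect:
  assumes "fin_kin (c - b) (c - a) x"
  shows "pot m a b (\<lambda>t. x (c - t)) = pot m (c - b) (c - a) x"
proof -
  have "{t. c + (-1) * t \<in> {c - b..c - a}} = {a..b}" by auto
  then show ?thesis using pot_affine[OF _ assms, of "-1" m c] by (simp add: pot_def)
qed

section \<open>Changing the relative position of one pair\<close>

definition dirv :: "real \<Rightarrow> 3 \<Rightarrow> 3 \<Rightarrow> complex \<Rightarrow> config" where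
  "dirv m i j z = (\<chi> l. if l = i then of_real (mass m j / (mass m i + mass m j)) * z
                        else if l = j then - of_real (mass m i / (mass m i + mass m j)) * z else 0)"

text \<open>The pair moves about its own centre of mass, so that this centre and the third body keep
  their motion. The kinetic part then changes only through the relative motion, weighted with the
  reduced mass.\<close>

definition with_pair :: "real \<Rightarrow> 3 \<Rightarrow> 3 \<Rightarrow> (real \<Rightarrow> config) \<Rightarrow> (real \<Rightarrow> complex) \<Rightarrow> real \<Rightarrow> config" where
  "with_pair m i j x dn t = x t + dirv m i j (dn t - (x t $ i - x t $ j))"

lemma dirv_diff: "i \<noteq> j \<Longrightarrow> m > 0 \<Longrightarrow> dirv m i j z $ i - dirv m i j z $ j = z"
proof -
  assume a: "i \<noteq> j" "m > 0"
  have "mass m i + mass m j > 0" using mass_pos[OF a(2)] by (simp add: add_pos_pos)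
  then have "mass m j / (mass m i + mass m j) + mass m i / (mass m i + mass m j) = 1"
    by (simp add: add.commute flip: add_divide_distrib)
  then have "of_real (mass m j / (mass m i + mass m j)) * z + of_real (mass m i / (mass m i + mass m j)) * z = z"
    by (metis distrib_right mult_1 of_real_1 of_real_add)
  then show ?thesis using a by (simp add: dirv_def del: of_real_divide)
qed

lemma dirv_norm: "m > 0 \<Longrightarrow> norm (dirv m i j z $ l) \<le> norm z"
proof -
  assume a: "m > 0"
  have p: "mass m i > 0" "mass m j > 0" using mass_pos[OF a] by auto
  have le1: "norm (of_real c * z) \<le> norm z" if "0 \<le> c" "c \<le> 1" for c
    using that by (simp add: norm_mult mult_left_le_one_le)
  have "mass m j / (mass m i + mass m j) \<le> 1" "mass m i / (mass m i + mass m j) \<le> 1" using p by (simp_all add: divide_simps)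
  then show ?thesis using le1[of "mass m j / (mass m i + mass m j)"] le1[of "mass m i / (mass m i + mass m j)"] p
    by (auto simp: dirv_def)
qed

lemma dirv_other: "l \<noteq> i \<Longrightarrow> l \<noteq> j \<Longrightarrow> dirv m i j z $ l = 0"
  by (simp add: dirv_def)

lemma dirv_0: "dirv m i j 0 = 0"
  by (simp add: dirv_def vec_eq_iff)

lemma with_pair_diff: "i \<noteq> j \<Longrightarrow> m > 0 \<Longrightarrow> with_pair m i j x dn t $ i - with_pair m i j x dn t $ j = dn t"
  using dirv_diff[of i j m "dn t - (x t $ i - x t $ j)"] by (simp add: with_pair_def algebra_simps)

lemma with_pair_same: "dn t = x t $ i - x t $ j \<Longrightarrow> with_pair m i j x dn t = x t"
  by (simp add: with_pair_def dirv_0)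

text \<open>Koenig's theorem for two masses: \<open>p |u|^2 + q |v|^2\<close> is the share of the
  centre of mass, which is common to both sides, plus the reduced mass times
  \<open>|u - v|^2\<close>. The relative terms stand on opposite sides, so that all coefficients are
  positive.\<close>

lemma mass_identity:
  fixes p q :: real and u v d :: complex
  assumes "p > 0" "q > 0"
  shows "p * (norm (u + of_real (q / (p + q)) * (d - (u - v))))\<^sup>2 + q * (norm (v - of_real (p / (p + q)) * (d - (u - v))))\<^sup>2
      + p * q / (p + q) * (norm (u - v))\<^sup>2 = p * (norm u)\<^sup>2 + q * (norm v)\<^sup>2 + p * q / (p + q) * (norm d)\<^sup>2"
proof -
  have id: "p * (x + q / (p + q) * (z - (x - y)))\<^sup>2 + q * (y - p / (p + q) * (z - (x - y)))\<^sup>2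
      + p * q / (p + q) * (x - y)\<^sup>2 = p * x\<^sup>2 + q * y\<^sup>2 + p * q / (p + q) * z\<^sup>2" for x y z :: real
  proof -
    define c where "c = (p * x + q * y) / (p + q)"
    have pq: "p + q \<noteq> 0" using assms by simp
    have 1: "x + q / (p + q) * (z - (x - y)) = c + q / (p + q) * z"
      using pq by (simp add: c_def divide_simps) (simp add: algebra_simps)
    have 2: "y - p / (p + q) * (z - (x - y)) = c - p / (p + q) * z"
      using pq by (simp add: c_def divide_simps) (simp add: algebra_simps)
    have 3: "x = c + q / (p + q) * (x - y)" "y = c - p / (p + q) * (x - y)"
      using pq by (simp_all add: c_def divide_simps) (simp_all add: algebra_simps)
    have 4: "p * (c + q / (p + q) * w)\<^sup>2 + q * (c - p / (p + q) * w)\<^sup>2 = (p + q) * c\<^sup>2 + p * q / (p + q) * w\<^sup>2" for w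
    proof -
      have "p * (c + q / (p + q) * w)\<^sup>2 + q * (c - p / (p + q) * w)\<^sup>2
          = (p + q) * c\<^sup>2 + (p * q\<^sup>2 + q * p\<^sup>2) / (p + q)\<^sup>2 * w\<^sup>2"
        by (simp add: power2_eq_square algebra_simps add_divide_distrib)
      also have "(p * q\<^sup>2 + q * p\<^sup>2) / (p + q)\<^sup>2 = p * q / (p + q)"
        using pq by (simp add: divide_simps power2_eq_square) (simp add: algebra_simps)
      finally show ?thesis .
    qed
    have "p * x\<^sup>2 + q * y\<^sup>2 = (p + q) * c\<^sup>2 + p * q / (p + q) * (x - y)\<^sup>2"
      using 4[of "x - y"] 3 by metis
    then show ?thesis unfolding 1 2 4 by simp
  qed
  have R: "Re (of_real c * z) = c * Re z" "Im (of_real c * z) = c * Im z" for c z by simp_all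
  show ?thesis
    using id[of "Re u" "Re d" "Re v"] id[of "Im u" "Im d" "Im v"]
    unfolding cmod_power2 plus_complex.sel minus_complex.sel R distrib_left by linarith
qed

lemma kin_with_pair:
  assumes m: "m > 0" and d: "distinct [i, j, k]" and ab: "a \<le> b" and x: "fin_kin a b x" and dn: "fin_energy a b dn"
  shows "fin_kin a b (with_pair m i j x dn)"
    "kin m a b (with_pair m i j x dn) = kin m a b x
       + mass m i * mass m j / (mass m i + mass m j) / 2 * (energy a b dn - energy a b (\<lambda>t. x t $ i - x t $ j))"
proof -
  let ?y = "with_pair m i j x dn" and ?d = "\<lambda>t. x t $ i - x t $ j"
  define M where "M = mass m i * mass m j / (mass m i + mass m j)"
  have fd: "fin_energy a b ?d" by (intro fin_energy_diff ab fin_kinD[OF x])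
  define \<alpha> \<beta> :: complex where "\<alpha> = of_real (mass m j / (mass m i + mass m j))"
    and "\<beta> = of_real (mass m i / (mass m i + mass m j))"
  have comp: "?y t $ l = x t $ l + (if l = i then \<alpha> else if l = j then - \<beta> else 0) * (dn t - ?d t)" for t l
    by (simp add: with_pair_def dirv_def \<alpha>_def \<beta>_def)
  show fy: "fin_kin a b ?y"
    unfolding fin_kin_def comp
    by (intro allI energy_add_functions ab fin_kinD[OF x] fin_energy_linear fin_energy_diff dn)
  \<comment> \<open>The indices \<open>Some l\<close> are the three bodies; \<open>None\<close>
    carries the relative motion, with the reduced mass \<open>M\<close> as its weight.\<close>
  define f where "f l = (case l of None \<Rightarrow> ?d | Some l \<Rightarrow> (\<lambda>t. ?y t $ l))" for l :: "3 option"
  define g where "g l = (case l of None \<Rightarrow> dn | Some l \<Rightarrow> (\<lambda>t. x t $ l))" for l :: "3 option"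
  define w where "w l = (case l of None \<Rightarrow> M | Some l \<Rightarrow> mass m l)" for l :: "3 option"
  have S: "sum F UNIV = F None + (F (Some i) + F (Some j) + F (Some k))" for F :: "3 option \<Rightarrow> real"
  proof -
    have "sum F UNIV = F None + sum (\<lambda>l. F (Some l)) UNIV"
      by (simp add: UNIV_option_conv sum.reindex)
    then show ?thesis using sum_3_distinct[OF d, of "\<lambda>l. F (Some l)"] by simp
  qed
  have id: "(\<Sum>l\<in>UNIV. w l * (norm (f l t - f l s))\<^sup>2) = (\<Sum>l\<in>UNIV. w l * (norm (g l t - g l s))\<^sup>2)" for s t
  proof -
    define u v e where "u = x t $ i - x s $ i" and "v = x t $ j - x s $ j" and "e = dn t - dn s"
    have c: "?y t $ i - ?y s $ i = u + \<alpha> * (e - (u - v))"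
      "?y t $ j - ?y s $ j = v - \<beta> * (e - (u - v))"
      "?y t $ k - ?y s $ k = x t $ k - x s $ k" "?d t - ?d s = u - v"
      using d
      by (fastforce simp: comp u_def v_def e_def algebra_simps)+
    show ?thesis
      unfolding S w_def f_def g_def option.case c \<alpha>_def \<beta>_def
      using mass_identity[of "mass m i" "mass m j" u e v] mass_pos[OF m]
      by (simp add: M_def u_def v_def e_def)
  qed
  have "(\<Sum>l\<in>UNIV. w l * energy a b (f l)) = (\<Sum>l\<in>UNIV. w l * energy a b (g l))"
  proof (rule energy_combination)
    show "fin_energy a b (f l)" for l using fd fin_kinD[OF fy] by (cases l) (auto simp: f_def)
    show "fin_energy a b (g l)" for l using dn fin_kinD[OF x] by (cases l) (auto simp: g_def)
  qed (rule id)
  then have "M * energy a b ?d + 2 * kin m a b ?y = M * energy a b dn + 2 * kin m a b x"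
    unfolding S w_def f_def g_def option.case kin_def sum_3_distinct[OF d] by (simp add: algebra_simps)
  then show "kin m a b ?y = kin m a b x
       + mass m i * mass m j / (mass m i + mass m j) / 2 * (energy a b dn - energy a b ?d)"
    unfolding M_def[symmetric] by (simp add: algebra_simps)
qed

text \<open>Competitors need not have their centre of mass at 0, so single bodies and pairs may be
  varied freely. The boundary maps are parameters, which makes the notion stable under time
  reversal: facts about the time 1 follow from facts about the time 0.\<close>

definition minimizer :: "real \<Rightarrow> (config \<Rightarrow> config) \<Rightarrow> (config \<Rightarrow> config) \<Rightarrow> (real \<Rightarrow> config) \<Rightarrow> bool" where
  "minimizer m ha hb x \<longleftrightarrow> fin_kin 0 1 x \<and> ha (x 0) = x 0 \<and> hb (x 1) = x 1 \<and> pot m 0 1 x < \<infinity> \<and>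
     (\<forall>y. fin_kin 0 1 y \<longrightarrow> ha (y 0) = y 0 \<longrightarrow> hb (y 1) = y 1 \<longrightarrow>
        ennreal (kin m 0 1 x) + pot m 0 1 x \<le> ennreal (kin m 0 1 y) + pot m 0 1 y)"

lemma minimizer_reverse:
  assumes "minimizer m ha hb x"
  shows "minimizer m hb ha (\<lambda>t. x (1 - t))"
  unfolding minimizer_def
proof (intro conjI allI impI)
  have x: "fin_kin (1 - 1) (1 - 0) x" using assms by (simp add: minimizer_def)
  have fx: "fin_kin 0 1 (\<lambda>t. x (1 - t))" and kx: "kin m 0 1 (\<lambda>t. x (1 - t)) = kin m 0 1 x"
    using kin_reflect[OF _ x] by auto
  have px: "pot m 0 1 (\<lambda>t. x (1 - t)) = pot m 0 1 x" using pot_reflect[OF x] by simp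
  show "fin_kin 0 1 (\<lambda>t. x (1 - t))" by fact
  show "hb (x (1 - 0)) = x (1 - 0)" "ha (x (1 - 1)) = x (1 - 1)" "pot m 0 1 (\<lambda>t. x (1 - t)) < \<infinity>"
    using assms px by (auto simp: minimizer_def)
  fix y assume y: "fin_kin 0 1 y" "hb (y 0) = y 0" "ha (y 1) = y 1"
  then have y': "fin_kin (1 - 1) (1 - 0) y" by simp
  have "fin_kin 0 1 (\<lambda>t. y (1 - t))" "kin m 0 1 (\<lambda>t. y (1 - t)) = kin m 0 1 y"
    "pot m 0 1 (\<lambda>t. y (1 - t)) = pot m 0 1 y"
    using kin_reflect[OF _ y'] pot_reflect[OF y'] by auto
  moreover have "ennreal (kin m 0 1 x) + pot m 0 1 x \<le> ennreal (kin m 0 1 (\<lambda>t. y (1 - t))) + pot m 0 1 (\<lambda>t. y (1 - t))"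
    using assms y calculation(1) by (auto simp: minimizer_def)
  ultimately show "ennreal (kin m 0 1 (\<lambda>t. x (1 - t))) + pot m 0 1 (\<lambda>t. x (1 - t)) \<le> ennreal (kin m 0 1 y) + pot m 0 1 y"
    using kx px by simp
qed

text \<open>The actions outside \<open>[a, b]\<close> cancel. The guards \<open>0 < a\<close> and
  \<open>b < 1\<close> allow an interval that touches an end of \<open>[0, 1]\<close>; there the
  competitor may move the end point as long as it respects the boundary map.\<close>

lemma minimizer_local:
  assumes m: "m > 0" and x: "minimizer m ha hb x" and ab: "0 \<le> a" "a \<le> b" "b \<le> 1"
    and y: "fin_kin a b y" "\<And>t. 0 \<le> t \<Longrightarrow> t \<le> a \<Longrightarrow> 0 < a \<Longrightarrow> y t = x t" "\<And>t. b \<le> t \<Longrightarrow> t \<le> 1 \<Longrightarrow> b < 1 \<Longrightarrow> y t = x t"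
      "ha (y 0) = y 0" "hb (y 1) = y 1"
    and B: "pot m a b y \<le> ennreal B" "B \<ge> 0"
  shows "kin m a b x + enn2real (pot m a b x) \<le> kin m a b y + B"
proof -
  have fx: "fin_kin 0 1 x" and px: "pot m 0 1 x < \<infinity>" using x by (auto simp: minimizer_def)
  have fxs: "fin_kin 0 a x" "fin_kin a b x" "fin_kin b 1 x" "fin_kin 0 b x" using ab by (auto intro: fin_kin_subset[OF fx])
  \<comment> \<open>The outer intervals degenerate to a point for \<open>a = 0\<close> or
    \<open>b = 1\<close> and then contribute nothing.\<close>
  have deg: "fin_kin t t z \<and> kin m t t z = 0 \<and> pot m t t z = 0" for t z
  proof (intro conjI)
    have "fin_energy t t f" for f :: "real \<Rightarrow> complex"
      by (rule energy_dom(1)[of t t f "\<lambda>_. 0"]) (auto dest: antisym)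
    then show "fin_kin t t z" by (simp add: fin_kin_def)
    show "kin m t t z = 0" by (simp add: kin_def energy_degenerate)
    show "pot m t t z = 0" unfolding pot_def
    proof (subst nn_integral_0_iff_AE)
      show "(\<lambda>s. potential m (z s) * indicator {t..t} s) \<in> borel_measurable lborel"
        using \<open>fin_kin t t z\<close> by (rule measurable_potential)
      show "AE s in lborel. potential m (z s) * indicator {t..t} s = 0"
        using AE_lborel_singleton[of t] by eventually_elim (auto simp: indicator_def)
    qed
  qed
  have l: "fin_kin 0 a y \<and> kin m 0 a y = kin m 0 a x \<and> pot m 0 a y = pot m 0 a x"
  proof (cases "a = 0")
    case False
    then have e: "y t = x t" if "0 \<le> t" "t \<le> a" for t using y(2) that ab by auto
    then show ?thesis using kin_cong[OF e] pot_cong[OF e, where m=m] fxs by auto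
  qed (use deg in auto)
  have r: "fin_kin b 1 y \<and> kin m b 1 y = kin m b 1 x \<and> pot m b 1 y = pot m b 1 x"
  proof (cases "b = 1")
    case False
    then have e: "y t = x t" if "b \<le> t" "t \<le> 1" for t using y(3) that ab by auto
    then show ?thesis using kin_cong[OF e] pot_cong[OF e, where m=m] fxs by auto
  qed (use deg in auto)
  have fy0: "fin_kin 0 b y" using fin_kin_add[of 0 a y b] l y(1) ab by auto
  have fy: "fin_kin 0 1 y" using fin_kin_add[of 0 b y 1] fy0 r ab by auto
  have K: "kin m 0 1 z = kin m 0 a z + kin m a b z + kin m b 1 z"
    "pot m 0 1 z = pot m 0 a z + pot m a b z + pot m b 1 z" if z: "fin_kin 0 1 z" for z
  proof -
    have zs: "fin_kin 0 a z" "fin_kin a b z" "fin_kin b 1 z" "fin_kin 0 b z" using ab by (auto intro: fin_kin_subset[OF z])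
    show "kin m 0 1 z = kin m 0 a z + kin m a b z + kin m b 1 z"
      using kin_split[OF z, of b m] kin_split[OF zs(4), of a m] ab by simp
    show "pot m 0 1 z = pot m 0 a z + pot m a b z + pot m b 1 z"
      using pot_split[OF zs(4,3), of m] pot_split[OF zs(1,2), of m] ab by simp
  qed
  have fin: "pot m 0 a x < \<infinity>" "pot m a b x < \<infinity>" "pot m b 1 x < \<infinity>"
    using px unfolding K(2)[OF fx] by auto
  then obtain p q r' where pqr: "pot m 0 a x = ennreal p" "pot m a b x = ennreal q" "pot m b 1 x = ennreal r'"
    "p \<ge> 0" "q \<ge> 0" "r' \<ge> 0"
    by (metis ennreal_cases infinity_ennreal_def less_irrefl)
  have "ennreal (kin m 0 1 x) + pot m 0 1 x \<le> ennreal (kin m 0 1 y) + pot m 0 1 y"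
    using x fy y(4,5) by (auto simp: minimizer_def)
  also have "\<dots> \<le> ennreal (kin m 0 1 y) + (ennreal p + ennreal B + ennreal r')"
    unfolding K(2)[OF fy] using l r pqr B by (intro add_mono) auto
  finally have "ennreal (kin m 0 1 x + (p + q + r')) \<le> ennreal (kin m 0 1 y + (p + B + r'))"
    unfolding K(2)[OF fx] pqr(1-3) using pqr(4-6) B kin_nonneg[OF m fx] kin_nonneg[OF m fy]
    by (simp add: ennreal_plus)
  then have "kin m 0 1 x + (p + q + r') \<le> kin m 0 1 y + (p + B + r')"
    using pqr(4-6) B kin_nonneg[OF m fy] by (subst (asm) ennreal_le_iff) auto
  then show ?thesis unfolding K(1)[OF fx] K(1)[OF fy] using l r pqr by simp
qed

section \<open>Isolated binary collisions\<close>

lemma nn_integral_powr: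
  assumes "p > -1" "h \<ge> 0"
  shows "(\<integral>\<^sup>+t\<in>{a..a + h}. ennreal ((t - a) powr p) \<partial>lborel) = ennreal (h powr (p + 1) / (p + 1))"
    "(\<integral>\<^sup>+t\<in>{a - h..a}. ennreal ((a - t) powr p) \<partial>lborel) = ennreal (h powr (p + 1) / (p + 1))"
proof -
  have 0: "(\<integral>\<^sup>+t\<in>{0..h}. ennreal (t powr p) \<partial>lborel) = ennreal (h powr (p + 1) / (p + 1))"
  proof -
    have *: "(\<lambda>t. indicator {0..h} t * (t powr p)) = (\<lambda>t. if t \<in> {0..h} then t powr p else 0)"
      by (auto simp: fun_eq_iff indicator_def)
    have "(\<integral>\<^sup>+t. ennreal (indicator {0..h} t * (t powr p)) \<partial>lborel) = ennreal (h powr (p + 1) / (p + 1))"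
      by (rule nn_integral_has_integral_lborel)
         (use has_integral_powr_from_0[OF assms] * in \<open>auto simp: has_integral_restrict_UNIV[of "{0..h}", symmetric]\<close>)
    moreover have "(\<lambda>t. ennreal (t powr p) * indicator {0..h} t) = (\<lambda>t. ennreal (indicator {0..h} t * (t powr p)))"
      by (auto simp: fun_eq_iff indicator_def)
    ultimately show ?thesis by simp
  qed
  have "(\<integral>\<^sup>+t\<in>{a..a + h}. ennreal ((t - a) powr p) \<partial>lborel)
     = ennreal \<bar>1\<bar> * (\<integral>\<^sup>+t. ennreal ((a + 1 * t - a) powr p) * indicator {a..a + h} (a + 1 * t) \<partial>lborel)"
    by (rule nn_integral_real_affine) auto
  also have "(\<lambda>t. ennreal ((a + 1 * t - a) powr p) * indicator {a..a + h} (a + 1 * t)) =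
     (\<lambda>t. ennreal (t powr p) * indicator {0..h} t)" by (auto simp: indicator_def fun_eq_iff)
  finally show "(\<integral>\<^sup>+t\<in>{a..a + h}. ennreal ((t - a) powr p) \<partial>lborel) = ennreal (h powr (p + 1) / (p + 1))"
    using 0 by simp
  have "(\<integral>\<^sup>+t\<in>{a - h..a}. ennreal ((a - t) powr p) \<partial>lborel)
     = ennreal \<bar>-1\<bar> * (\<integral>\<^sup>+t. ennreal ((a - (a + (-1) * t)) powr p) * indicator {a - h..a} (a + (-1) * t) \<partial>lborel)"
    by (rule nn_integral_real_affine) auto
  also have "(\<lambda>t. ennreal ((a - (a + (-1) * t)) powr p) * indicator {a - h..a} (a + (-1) * t)) =
     (\<lambda>t. ennreal (t powr p) * indicator {0..h} t)" by (auto simp: indicator_def fun_eq_iff)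
  finally show "(\<integral>\<^sup>+t\<in>{a - h..a}. ennreal ((a - t) powr p) \<partial>lborel) = ennreal (h powr (p + 1) / (p + 1))"
    using 0 by simp
qed

text \<open>The function \<open>w powr (2/3)\<close> is the profile of a parabolic collision orbit;
  the square of its derivative has the primitive \<open>4/3 * w powr (1/3)\<close>. In terms of the
  cube roots \<open>U\<close>, \<open>V\<close> the difference of the two sides is
  \<open>(U - V)^4 / 3\<close>.\<close>

lemma powr_two_thirds_incr:
  fixes u v :: real
  assumes "0 \<le> v" "v \<le> u"
  shows "(u powr (2/3) - v powr (2/3))\<^sup>2 \<le> (u - v) * (4/3 * u powr (1/3) - 4/3 * v powr (1/3))"
proof -
  define U V where "U = u powr (1/3)" and "V = v powr (1/3)"
  have p: "w powr (2/3) = (w powr (1/3))\<^sup>2" "w = (w powr (1/3)) ^ 3" if "w \<ge> 0" for w :: real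
    using that by (simp_all add: power2_eq_square power3_eq_cube flip: powr_add)
  have U: "u powr (2/3) = U\<^sup>2" "v powr (2/3) = V\<^sup>2" "u = U ^ 3" "v = V ^ 3"
    using assms p[of u] p[of v] by (simp_all add: U_def V_def)
  have "(U\<^sup>2 - V\<^sup>2)\<^sup>2 \<le> (U ^ 3 - V ^ 3) * (4/3 * U - 4/3 * V)"
  proof -
    have "(U ^ 3 - V ^ 3) * (4/3 * U - 4/3 * V) - (U\<^sup>2 - V\<^sup>2)\<^sup>2 = (1/3) * ((U - V)\<^sup>2)\<^sup>2"
      by (simp add: power2_eq_square power3_eq_cube algebra_simps)
    also have "\<dots> \<ge> 0" by simp
    finally show ?thesis by linarith
  qed
  then show ?thesis unfolding U(1,2) using U(3,4) by (metis U_def V_def)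
qed

text \<open>The exponent 2/3 balances the two parts of the action: the energy and the integral of
  \<open>1 / bump\<close> are both of order \<open>(b - a) powr (1/3)\<close>, although
  \<open>bump\<close> vanishes at both ends.\<close>

definition bump :: "real \<Rightarrow> real \<Rightarrow> real \<Rightarrow> real" where
  "bump a b t = (min (t - a) (b - t)) powr (2/3)"

lemma energy_bump:
  assumes "a < b"
  shows "fin_energy a b (bump a b)" "energy a b (bump a b) \<le> 8/3 * (b - a) powr (1/3)"
proof -
  define c where "c = (a + b) / 2"
  have c: "a \<le> c" "c \<le> b" "c - a = (b - a) / 2" "b - c = (b - a) / 2" using assms by (auto simp: c_def field_simps)
  have l: "fin_energy a c (\<lambda>t. (t - a) powr (2/3))" "energy a c (\<lambda>t. (t - a) powr (2/3)) \<le> 4/3 * (c - a) powr (1/3)"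
  proof -
    have "(norm ((t - a) powr (2/3) - (s - a) powr (2/3)))\<^sup>2
        \<le> (t - s) * (4/3 * (t - a) powr (1/3) - 4/3 * (s - a) powr (1/3))" if "a \<le> s" "s \<le> t" "t \<le> c" for s t
      using powr_two_thirds_incr[of "s - a" "t - a"] that by simp
    from energy_dom[OF c(1) this] show "fin_energy a c (\<lambda>t. (t - a) powr (2/3))"
      "energy a c (\<lambda>t. (t - a) powr (2/3)) \<le> 4/3 * (c - a) powr (1/3)" by auto
  qed
  have r: "fin_energy c b (\<lambda>t. (b - t) powr (2/3))" "energy c b (\<lambda>t. (b - t) powr (2/3)) \<le> 4/3 * (b - c) powr (1/3)"
  proof -
    have "(norm ((b - t) powr (2/3) - (b - s) powr (2/3)))\<^sup>2
        \<le> (t - s) * (- (4/3 * (b - t) powr (1/3)) - (- (4/3 * (b - s) powr (1/3))))" if "c \<le> s" "s \<le> t" "t \<le> b" for s t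
      using powr_two_thirds_incr[of "b - t" "b - s"] that by (simp add: power2_commute)
    from energy_dom[OF c(2) this] show "fin_energy c b (\<lambda>t. (b - t) powr (2/3))"
      "energy c b (\<lambda>t. (b - t) powr (2/3)) \<le> 4/3 * (b - c) powr (1/3)" by auto
  qed
  have el: "(t - a) powr (2/3) = bump a b t" if "a \<le> t" "t \<le> c" for t
    using that c by (simp add: bump_def min_def c_def)
  have er: "(b - t) powr (2/3) = bump a b t" if "c \<le> t" "t \<le> b" for t
  proof -
    have "b - t \<le> t - a" using that by (simp add: c_def field_simps)
    then show ?thesis by (simp add: bump_def min_absorb2)
  qed
  have l': "fin_energy a c (bump a b)" "energy a c (bump a b) \<le> 4/3 * (c - a) powr (1/3)"
    using l energy_cong[of a c "\<lambda>t. (t - a) powr (2/3)" "bump a b"] el by auto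
  have r': "fin_energy c b (bump a b)" "energy c b (bump a b) \<le> 4/3 * (b - c) powr (1/3)"
    using r energy_cong[of c b "\<lambda>t. (b - t) powr (2/3)" "bump a b"] er by auto
  have q1: "(c - a) powr (1/3) \<le> (b - a) powr (1/3)" by (rule powr_mono2) (use c assms in linarith)+
  have q2: "(b - c) powr (1/3) \<le> (b - a) powr (1/3)" by (rule powr_mono2) (use c assms in linarith)+
  show "fin_energy a b (bump a b)" by (rule energy_add(1)[OF c(1,2) l'(1) r'(1)])
  have "energy a b (bump a b) = energy a c (bump a b) + energy c b (bump a b)"
    by (rule energy_add(2)[OF c(1,2) l'(1) r'(1)])
  then show "energy a b (bump a b) \<le> 8/3 * (b - a) powr (1/3)" using l'(2) r'(2) q1 q2 by linarith
qed

lemma pair_potential_real: "r > 0 \<Longrightarrow> k \<ge> 0 \<Longrightarrow> ennreal k / ennreal r = ennreal (k / r)"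
  by (rule divide_ennreal) auto

lemma nn_integral_bump:
  assumes "a < b" "k \<ge> 0"
  shows "(\<integral>\<^sup>+t\<in>{a..b}. ennreal k / ennreal (bump a b t) \<partial>lborel) \<le> ennreal (6 * k * (b - a) powr (1/3))"
proof -
  define c h where "c = (a + b) / 2" and "h = (b - a) / 2"
  have c: "a \<le> c" "c \<le> b" "a + h = c" "b - h = c" "h > 0" using assms by (auto simp: c_def h_def field_simps)
  let ?f = "\<lambda>t. ennreal k * (ennreal ((t - a) powr (-2/3)) * indicator {a..a + h} t) + ennreal k * (ennreal ((b - t) powr (-2/3)) * indicator {b - h..b} t)"
  have "(\<integral>\<^sup>+t\<in>{a..b}. ennreal k / ennreal (bump a b t) \<partial>lborel) \<le> (\<integral>\<^sup>+t. ?f t \<partial>lborel)"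
  proof (rule nn_integral_mono_AE)
    have "AE t in lborel. t \<noteq> a" "AE t in lborel. t \<noteq> b" by (rule AE_lborel_singleton)+
    then show "AE t in lborel. ennreal k / ennreal (bump a b t) * indicator {a..b} t \<le> ?f t"
    proof eventually_elim
      case (elim t)
      show ?case
      proof (cases "t \<in> {a..b}")
        case True
        have *: "ennreal k / ennreal (w powr (2/3)) = ennreal k * ennreal (w powr (-2/3))" if "w > 0" for w
        proof -
          have "k / w powr (2/3) = k * w powr (-2/3)" using that by (simp add: powr_minus divide_simps)
          then show ?thesis using that assms by (simp add: pair_potential_real ennreal_mult'')
        qed
        show ?thesis
        proof (cases "t \<le> c")
          case tc: True
          then have "t - a \<le> b - t" by (simp add: c_def)
          then have bm: "bump a b t = (t - a) powr (2/3)" by (simp add: bump_def min_absorb1)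
          then have "ennreal k / ennreal (bump a b t) * indicator {a..b} t = ennreal k * (ennreal ((t - a) powr (-2/3)) * indicator {a..a + h} t)"
          proof -
            have i: "t \<in> {a..a + h}" using True tc c(3) by simp
            show ?thesis unfolding bm indicator_simps(1)[OF True] indicator_simps(1)[OF i]
              using *[of "t - a"] elim True by simp
          qed
          then show ?thesis by simp
        next
          case tc: False
          then have "b - t \<le> t - a" by (simp add: c_def)
          then have bm: "bump a b t = (b - t) powr (2/3)" by (simp add: bump_def min_absorb2)
          then have "ennreal k / ennreal (bump a b t) * indicator {a..b} t = ennreal k * (ennreal ((b - t) powr (-2/3)) * indicator {b - h..b} t)"
          proof -
            have i: "t \<in> {b - h..b}" using True tc c(4) by simp
            show ?thesis unfolding bm indicator_simps(1)[OF True] indicator_simps(1)[OF i]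
              using *[of "b - t"] elim True by simp
          qed
          then show ?thesis by simp
        qed
      qed simp
    qed
  qed
  also have "\<dots> = ennreal k * ennreal (3 * h powr (1/3)) + ennreal k * ennreal (3 * h powr (1/3))"
    using nn_integral_powr[of "-2/3" h a] nn_integral_powr[of "-2/3" h b] c(5)
    by (simp add: nn_integral_add nn_integral_cmult mult.commute)
  also have "\<dots> = ennreal (6 * k * h powr (1/3))"
    using assms by (simp flip: ennreal_mult'' ennreal_plus)
  also have "\<dots> \<le> ennreal (6 * k * (b - a) powr (1/3))"
    using assms by (intro ennreal_leI mult_left_mono powr_mono2) (auto simp: h_def)
  finally show ?thesis .
qed

text \<open>A virial-type estimate obtained by changing the time. The competitor runs through the
  piece of length \<open>l\<close> at half speed and through the rest a little faster. This halves
  the kinetic and doubles the potential part of the piece; on the rest the potential part does not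
  grow and the kinetic part grows at most by the factor \<open>p\<close>.\<close>

lemma kin_le_pot:
  assumes m: "m > 0" and x: "minimizer m ha hb x" and t0: "0 \<le> t0" "t0 < 1" and l: "0 < l" "l \<le> (1 - t0) / 3"
  shows "kin m t0 (t0 + l) x \<le> 2 * enn2real (pot m t0 (t0 + l) x) + 6 * l / (1 - t0) * kin m 0 1 x"
proof -
  have fx: "fin_kin 0 1 x" and px: "pot m 0 1 x < \<infinity>" using x by (auto simp: minimizer_def)
  have lt: "t0 + 2 * l < 1" using l t0 by (simp add: field_simps)
  define L where "L = 1 - t0 - l"
  have L: "L \<ge> 2 * l" "L > 0" "L - l > 0" "L \<ge> 2/3 * (1 - t0)" using l t0 by (auto simp: L_def field_simps)
  \<comment> \<open>The affine map with slope \<open>p\<close> and fixed point 1 takes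
    \<open>[t0 + 2 * l, 1]\<close> onto \<open>[t0 + l, 1]\<close>, which makes up for the time
    lost.\<close>
  define p where "p = L / (L - l)"
  have p: "p > 0" "p \<ge> 1" "p - 1 \<le> 2 * l / L" using L l by (auto simp: p_def divide_simps algebra_simps)
  have pe: "p * (t0 + 2 * l) + (1 - p) = t0 + l"
  proof -
    have "p * (L - l) = L" using L by (simp add: p_def)
    then show ?thesis by (simp add: L_def algebra_simps)
  qed
  define h :: real where "h = 1/2"
  have h: "h > 0" by (simp add: h_def)
  define y where "y t = (if t \<le> t0 then x t else if t \<le> t0 + 2 * l then x (h * t + t0 / 2) else x (p * t + (1 - p)))" for t
  have yl: "x (h * t + t0 / 2) = y t" if "t0 \<le> t" "t \<le> t0 + 2 * l" for t
  proof (cases "t = t0")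
    case True
    then have "h * t + t0 / 2 = t0" by (simp add: h_def)
    then show ?thesis using True by (simp add: y_def)
  qed (use that in \<open>simp add: y_def\<close>)
  have yr: "x (p * t + (1 - p)) = y t" if "t0 + 2 * l \<le> t" "t \<le> 1" for t
  proof (cases "t = t0 + 2 * l")
    case True
    have "h * t + t0 / 2 = t0 + l" unfolding True h_def by (simp add: field_simps)
    then show ?thesis using True pe l yl[of t] by simp
  qed (use that l in \<open>simp add: y_def\<close>)
  have fs: "fin_kin t0 (t0 + l) x" "fin_kin (t0 + l) 1 x" "fin_kin t0 1 x"
    using t0 l by (auto intro!: fin_kin_subset[OF fx])
  have e1: "h * t0 + t0 / 2 = t0" "h * (t0 + 2 * l) + t0 / 2 = t0 + l" by (simp_all add: h_def field_simps)
  have f1: "fin_kin (h * t0 + t0 / 2) (h * (t0 + 2 * l) + t0 / 2) x" unfolding e1 by (rule fs(1))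
  have c1: "kin m t0 (t0 + 2 * l) (\<lambda>t. x (h * t + t0 / 2)) = kin m t0 (t0 + 2 * l) y"
    "fin_kin t0 (t0 + 2 * l) (\<lambda>t. x (h * t + t0 / 2)) = fin_kin t0 (t0 + 2 * l) y"
    "pot m t0 (t0 + 2 * l) (\<lambda>t. x (h * t + t0 / 2)) = pot m t0 (t0 + 2 * l) y"
    by (rule kin_cong pot_cong, erule (1) yl)+
  have tt: "t0 \<le> t0 + 2 * l" using l by simp
  have k1: "fin_kin t0 (t0 + 2 * l) y" "kin m t0 (t0 + 2 * l) y \<le> h * kin m t0 (t0 + l) x"
    using kin_affine_le[OF m h tt f1] unfolding e1 c1 by simp_all
  have p1: "pot m t0 (t0 + l) x = ennreal h * pot m t0 (t0 + 2 * l) y"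
    using pot_scale[OF h f1, of m] unfolding e1 c1 .
  have e2: "p * 1 + (1 - p) = 1" by simp
  have f2: "fin_kin (p * (t0 + 2 * l) + (1 - p)) (p * 1 + (1 - p)) x" unfolding e2 pe by (rule fs(2))
  have c2: "kin m (t0 + 2 * l) 1 (\<lambda>t. x (p * t + (1 - p))) = kin m (t0 + 2 * l) 1 y"
    "fin_kin (t0 + 2 * l) 1 (\<lambda>t. x (p * t + (1 - p))) = fin_kin (t0 + 2 * l) 1 y"
    "pot m (t0 + 2 * l) 1 (\<lambda>t. x (p * t + (1 - p))) = pot m (t0 + 2 * l) 1 y"
    by (rule kin_cong pot_cong, erule (1) yr)+
  have k2: "fin_kin (t0 + 2 * l) 1 y" "kin m (t0 + 2 * l) 1 y \<le> p * kin m (t0 + l) 1 x"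
    using kin_affine_le[OF m p(1) less_imp_le[OF lt] f2] unfolding e2 pe c2 by simp_all
  have p2: "pot m (t0 + l) 1 x = ennreal p * pot m (t0 + 2 * l) 1 y"
    using pot_scale[OF p(1) f2, of m] unfolding e2 pe c2 .
  have fy: "fin_kin t0 1 y" by (rule fin_kin_add[OF k1(1) k2(1)]) (use l lt in linarith)+
  have p01: "pot m 0 1 x = pot m 0 t0 x + pot m t0 1 x"
    by (rule pot_split[OF fin_kin_subset[OF fx] fs(3)]) (use t0 in linarith)+
  have pt: "pot m t0 1 x = pot m t0 (t0 + l) x + pot m (t0 + l) 1 x"
    by (rule pot_split[OF fs(1,2)]) (use lt l in linarith)+
  have "pot m t0 (t0 + l) x < \<infinity>" "pot m (t0 + l) 1 x < \<infinity>" using px unfolding p01 pt by (auto simp: less_top[symmetric])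
  then obtain P Q where PQ: "pot m t0 (t0 + l) x = ennreal P" "pot m (t0 + l) 1 x = ennreal Q" "P \<ge> 0" "Q \<ge> 0"
    by (metis ennreal_cases infinity_ennreal_def less_irrefl)
  have "pot m t0 (t0 + 2 * l) y = ennreal 2 * pot m t0 (t0 + l) x"
  proof -
    have "ennreal 2 * ennreal h = ennreal (2 * h)" by (rule ennreal_mult''[symmetric]) (use h in simp)
    also have "2 * h = 1" by (simp add: h_def)
    finally have "ennreal 2 * ennreal h = 1" by simp
    then show ?thesis unfolding p1 mult.assoc[symmetric] by simp
  qed
  then have y1: "pot m t0 (t0 + 2 * l) y = ennreal (2 * P)" unfolding PQ(1) ennreal_mult''[OF PQ(3)] .
  have "1 \<le> ennreal p" using p(2) by (metis ennreal_1 ennreal_leI)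
  from mult_right_mono[OF this, of "pot m (t0 + 2 * l) 1 y"]
  have y2: "pot m (t0 + 2 * l) 1 y \<le> ennreal Q" unfolding p2[symmetric] PQ by simp
  have "pot m t0 1 y \<le> ennreal (2 * P + Q)"
    using pot_split[OF k1(1) k2(1), of m] l lt y1 y2 PQ by (simp add: ennreal_plus add_left_mono)
  moreover have "y 1 = x 1" using yr[of 1] lt by simp
  moreover have "y 0 = x 0" using t0 by (simp add: y_def)
  ultimately have "kin m t0 1 x + enn2real (pot m t0 1 x) \<le> kin m t0 1 y + (2 * P + Q)"
    using x t0 PQ by (intro minimizer_local[OF m x _ _ _ fy]) (auto simp: y_def minimizer_def)
  moreover have "enn2real (pot m t0 1 x) = P + Q" unfolding pt PQ using PQ by (simp flip: ennreal_plus)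
  moreover have "kin m t0 1 x = kin m t0 (t0 + l) x + kin m (t0 + l) 1 x" by (rule kin_split[OF fs(3)]) (use l t0 lt in linarith)+
  moreover have "kin m t0 1 y \<le> 1/2 * kin m t0 (t0 + l) x + p * kin m (t0 + l) 1 x"
    using kin_split[OF fy, of "t0 + 2 * l"] l lt k1(2) k2(2) by (auto simp: h_def)
  ultimately have "1/2 * kin m t0 (t0 + l) x \<le> P + (p - 1) * kin m (t0 + l) 1 x" by (simp add: algebra_simps)
  also have "\<dots> \<le> P + 3 * l / (1 - t0) * kin m 0 1 x"
  proof -
    have "(p - 1) * kin m (t0 + l) 1 x \<le> 3 * l / (1 - t0) * kin m 0 1 x"
    proof (rule mult_mono)
      have "2 * l / L \<le> 2 * l / (2/3 * (1 - t0))" using L l t0 by (intro divide_left_mono mult_pos_pos) auto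
      also have "\<dots> = 3 * l / (1 - t0)" using t0 by (simp add: field_simps)
      finally show "p - 1 \<le> 3 * l / (1 - t0)" using p by simp
      have "kin m 0 1 x = kin m 0 (t0 + l) x + kin m (t0 + l) 1 x" by (rule kin_split[OF fx]) (use l t0 lt in linarith)+
      moreover have "kin m 0 (t0 + l) x \<ge> 0" using l t0 by (intro kin_nonneg[OF m] fin_kin_subset[OF fx]) auto
      ultimately show "kin m (t0 + l) 1 x \<le> kin m 0 1 x" by simp
      show "kin m (t0 + l) 1 x \<ge> 0" using fs by (intro kin_nonneg[OF m])
      show "3 * l / (1 - t0) \<ge> 0" using l t0 by simp
    qed
    then show ?thesis by simp
  qed
  finally show ?thesis using PQ by (simp add: algebra_simps)
qed

lemma energy_orthogonal:
  fixes Q u :: complex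
  assumes "a \<le> b" "fin_energy a b (f :: real \<Rightarrow> real)" "fin_energy a b (g :: real \<Rightarrow> real)" "inner Q u = 0" "norm u = 1"
  shows "fin_energy a b (\<lambda>t. f t *\<^sub>R Q + g t *\<^sub>R u)"
    "energy a b (\<lambda>t. f t *\<^sub>R Q + g t *\<^sub>R u) \<le> energy a b f * (norm Q)\<^sup>2 + energy a b g"
proof -
  define G where "G t = energy a t f * (norm Q)\<^sup>2 + energy a t g" for t
  have "(norm ((f t *\<^sub>R Q + g t *\<^sub>R u) - (f s *\<^sub>R Q + g s *\<^sub>R u)))\<^sup>2 \<le> (t - s) * (G t - G s)"
    if st: "a \<le> s" "s \<le> t" "t \<le> b" for s t
  proof -
    have "(f t *\<^sub>R Q + g t *\<^sub>R u) - (f s *\<^sub>R Q + g s *\<^sub>R u) = (f t - f s) *\<^sub>R Q + (g t - g s) *\<^sub>R u"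
      by (simp add: algebra_simps)
    also have "(norm \<dots>)\<^sup>2 = (f t - f s)\<^sup>2 * (norm Q)\<^sup>2 + (g t - g s)\<^sup>2"
      using norm_add_Pythagorean[of "(f t - f s) *\<^sub>R Q" "(g t - g s) *\<^sub>R u"] assms(4,5)
      by (simp add: orthogonal_def power_mult_distrib)
    also have "\<dots> \<le> (t - s) * (energy a t f - energy a s f) * (norm Q)\<^sup>2 + (t - s) * (energy a t g - energy a s g)"
      using energy_incr[OF assms(2) st] energy_incr[OF assms(3) st] by (intro add_mono mult_right_mono) auto
    finally show ?thesis by (simp add: G_def algebra_simps)
  qed
  from energy_dom[OF assms(1) this] show "fin_energy a b (\<lambda>t. f t *\<^sub>R Q + g t *\<^sub>R u)"
    "energy a b (\<lambda>t. f t *\<^sub>R Q + g t *\<^sub>R u) \<le> energy a b f * (norm Q)\<^sup>2 + energy a b g"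
    by (auto simp: G_def energy_degenerate)
qed

lemma energy_affine_fun:
  assumes "a < b"
  shows "fin_energy a b (\<lambda>t. (t - a) / (b - a))" "energy a b (\<lambda>t. (t - a) / (b - a)) \<le> 1 / (b - a)"
proof -
  define G where "G t = t / (b - a)\<^sup>2" for t
  have "(norm ((t - a) / (b - a) - (s - a) / (b - a)))\<^sup>2 \<le> (t - s) * (G t - G s)" for s t
    by (simp add: G_def power_divide power2_eq_square flip: diff_divide_distrib)
  from energy_dom[OF less_imp_le[OF assms] this] have *: "fin_energy a b (\<lambda>t. (t - a) / (b - a))"
    "energy a b (\<lambda>t. (t - a) / (b - a)) \<le> G b - G a" by auto
  have "G b - G a = 1 / (b - a)" using assms by (simp add: G_def power2_eq_square flip: diff_divide_distrib)
  with * show "fin_energy a b (\<lambda>t. (t - a) / (b - a))" "energy a b (\<lambda>t. (t - a) / (b - a)) \<le> 1 / (b - a)"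
    by (simp_all only:)
qed

lemma potential_le_pair:
  assumes m: "m > 0" and d: "distinct [i, j, k]" and r: "r > 0" "norm (z $ i - z $ k) \<ge> r" "norm (z $ j - z $ k) \<ge> r"
  shows "potential m z \<le> pair_potential m i j (z $ i - z $ j) + ennreal ((mass m i + mass m j) * mass m k / r)"
proof -
  have *: "pair_potential m l k w \<le> ennreal (mass m l * mass m k / r)" if "norm w \<ge> r" for l w
  proof -
    have k: "mass m l * mass m k \<ge> 0" using mass_pos[OF m, of l] mass_pos[OF m, of k] by simp
    have "pair_potential m l k w = ennreal (mass m l * mass m k / norm w)"
      unfolding pair_potential_def using that r k by (intro pair_potential_real) auto
    also have "\<dots> \<le> ennreal (mass m l * mass m k / r)"
      using that r k by (intro ennreal_leI divide_left_mono mult_pos_pos) auto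
    finally show ?thesis .
  qed
  have "potential m z \<le> pair_potential m i j (z $ i - z $ j) + (ennreal (mass m i * mass m k / r) + ennreal (mass m j * mass m k / r))"
    unfolding potential_distinct[OF d] add.assoc using r by (intro add_left_mono add_mono *) auto
  also have "ennreal (mass m i * mass m k / r) + ennreal (mass m j * mass m k / r) = ennreal ((mass m i + mass m j) * mass m k / r)"
    using r mass_pos[OF m, of i] mass_pos[OF m, of j] mass_pos[OF m, of k]
    by (simp add: add_divide_distrib distrib_right flip: ennreal_plus)
  finally show ?thesis .
qed

text \<open>The third body stays away: a body of the pair is displaced by at most
  \<open>3 * r / 8\<close> and \<open>x\<close> deviates from \<open>z\<close> by at most
  \<open>r / 16\<close> for each body, which leaves at least \<open>r / 2\<close> of the distance
  \<open>r\<close>. The third body therefore costs no more than a multiple of the length of the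
  interval.\<close>

lemma pot_with_pair_le:
  assumes m: "m > 0" and d: "distinct [i, j, k]" and ab: "a \<le> b" and r: "r > 0"
    and x: "fin_kin a b x" and e: "fin_energy a b e"
    and near: "\<And>t l. a \<le> t \<Longrightarrow> t \<le> b \<Longrightarrow> norm (x t $ l - z $ l) \<le> r / 16" "z $ i = z $ j" "norm (z $ i - z $ k) = r"
      "\<And>t. a \<le> t \<Longrightarrow> t \<le> b \<Longrightarrow> norm (e t) \<le> r / 4"
  shows "pot m a b (with_pair m i j x e) \<le>
    (\<integral>\<^sup>+t\<in>{a..b}. pair_potential m i j (e t) \<partial>lborel) + ennreal ((mass m i + mass m j) * mass m k / (r / 4) * (b - a))"
proof -
  define C where "C = (mass m i + mass m j) * mass m k / (r / 4)"
  have C: "C \<ge> 0" unfolding C_def using r mass_pos[OF m] by (intro divide_nonneg_nonneg mult_nonneg_nonneg add_nonneg_nonneg) (auto intro: less_imp_le)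
  have ij: "i \<noteq> j" "k \<noteq> i" "k \<noteq> j" using d by auto
  have "potential m (with_pair m i j x e t) \<le> pair_potential m i j (e t) + ennreal C" if t: "a \<le> t" "t \<le> b" for t
  proof -
    let ?y = "with_pair m i j x e t"
    have n: "norm (x t $ l - z $ l) \<le> r / 16" for l using near(1)[OF t] .
    have dd: "norm (x t $ i - x t $ j) \<le> r / 8"
      using norm_triangle_ineq4[of "x t $ i - z $ i" "x t $ j - z $ j"] n[of i] n[of j] near(2) by simp
    have c: "norm (?y $ l - x t $ l) \<le> 3 * r / 8" for l
    proof -
      have "norm (?y $ l - x t $ l) \<le> norm (e t - (x t $ i - x t $ j))"
        unfolding with_pair_def using dirv_norm[OF m, of i j "e t - (x t $ i - x t $ j)" l] by simp
      also have "\<dots> \<le> r / 4 + r / 8" using norm_triangle_ineq4[of "e t" "x t $ i - x t $ j"] near(4)[OF t] dd by simp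
      finally show ?thesis by simp
    qed
    have k: "?y $ k = x t $ k" using ij by (simp add: with_pair_def dirv_other)
    have four: "norm (A - B - C' + E) \<le> norm A + norm B + norm C' + norm E" for A B C' E :: complex
      using norm_triangle_ineq[of "A - B - C'" E] norm_triangle_ineq4[of "A - B" C'] norm_triangle_ineq4[of A B] by linarith
    have far: "norm (?y $ l - ?y $ k) \<ge> r / 4" if "z $ l = z $ i" for l
    proof -
      have "z $ i - z $ k = (?y $ l - ?y $ k) - (?y $ l - x t $ l) - (x t $ l - z $ l) + (x t $ k - z $ k)"
        using k that by simp
      then have "norm (z $ i - z $ k) \<le> norm (?y $ l - ?y $ k) + norm (?y $ l - x t $ l) + norm (x t $ l - z $ l) + norm (x t $ k - z $ k)"
        using four[of "?y $ l - ?y $ k" "?y $ l - x t $ l" "x t $ l - z $ l" "x t $ k - z $ k"] by (simp only:)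
      then show ?thesis using c[of l] n[of l] n[of k] r near(3) by linarith
    qed
    have r4: "r / 4 > 0" using r by simp
    show ?thesis
      using potential_le_pair[OF m d r4 far[OF refl] far[OF near(2)[symmetric]]]
      unfolding with_pair_diff[OF ij(1) m] C_def .
  qed
  then have "pot m a b (with_pair m i j x e) \<le> (\<integral>\<^sup>+t. (pair_potential m i j (e t) * indicator {a..b} t + ennreal C * indicator {a..b} t) \<partial>lborel)"
    unfolding pot_def by (intro nn_integral_mono) (auto simp: indicator_def)
  also have "\<dots> = (\<integral>\<^sup>+t\<in>{a..b}. pair_potential m i j (e t) \<partial>lborel) + (\<integral>\<^sup>+t. ennreal C * indicator {a..b} t \<partial>lborel)"
    by (intro nn_integral_add measurable_pair_potential fin_energy_isCont e) auto
  also have "(\<integral>\<^sup>+t. ennreal C * indicator {a..b} t \<partial>lborel) = ennreal (C * (b - a))"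
    using ab C by (simp add: nn_integral_cmult_indicator ennreal_mult'')
  finally show ?thesis unfolding C_def .
qed

lemma complex_orthogonal_unit: "\<exists>u::complex. norm u = 1 \<and> inner Q u = 0"
proof (cases "Q = 0")
  case False
  have "norm (\<i> * sgn Q) = 1" using False by (simp add: norm_mult norm_sgn)
  moreover have "inner Q (\<i> * sgn Q) = 0"
    by (simp add: inner_complex_def sgn_div_norm scaleR_conv_of_real)
  ultimately show ?thesis by blast
qed (auto intro: exI[of _ 1])

lemma complex_unit_direction: "\<exists>P'::complex. norm P' = 1 \<and> norm P *\<^sub>R P' = P"
proof (cases "P = 0")
  case False
  then show ?thesis by (intro exI[of _ "sgn P"]) (simp add: norm_sgn sgn_div_norm)
qed (auto intro: exI[of _ 1])

text \<open>The bisector of the two directions serves, except for opposite directions, where it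
  vanishes and a normal takes its place.\<close>

lemma complex_common_halfplane:
  fixes P Q :: complex
  assumes "norm P = 1" "norm Q = 1"
  shows "\<exists>u. norm u = 1 \<and> inner P u \<ge> 0 \<and> inner Q u \<ge> 0"
proof (cases "P + Q = 0")
  case True
  obtain u where u: "norm u = 1" "inner P u = 0" using complex_orthogonal_unit by blast
  have "Q = - P" using True by (simp add: add_eq_0_iff)
  then show ?thesis using u by (intro exI[of _ u]) simp
next
  case False
  have "\<bar>inner P Q\<bar> \<le> 1" using Cauchy_Schwarz_ineq2[of P Q] assms by simp
  then have "inner P (P + Q) \<ge> 0" "inner Q (P + Q) \<ge> 0"
    using assms by (auto simp: inner_add_right norm_eq_1 inner_commute)
  then show ?thesis using False
    by (intro exI[of _ "sgn (P + Q)"]) (auto simp: norm_sgn sgn_div_norm)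
qed

lemma ennreal_divide_antimono:
  assumes "0 \<le> k" "0 \<le> a" "a \<le> b"
  shows "ennreal k / ennreal b \<le> ennreal k / ennreal a"
proof (cases "a = 0")
  case False
  then have "a > 0" "b > 0" using assms by auto
  then show ?thesis
    using assms by (simp add: divide_ennreal ennreal_leI divide_left_mono)
next
  case True
  then show ?thesis using assms by (cases "k = 0") auto
qed

text \<open>Up to the time \<open>a + tau\<close>, \<open>|d|^2\<close> is at most
  \<open>tau * E0 \<le> eps^2 / 4\<close>, while the hypothesis on \<open>e\<close> adds at least
  \<open>eps^2 / 4\<close> to it. So \<open>|e|^2 \<ge> 2 * |d|^2\<close>, hence
  \<open>|e| \<ge> 4/3 * |d|\<close>, and \<open>1 / |d| - 1 / |e|\<close> is at least
  \<open>1 / (4 * |d|)\<close>, which is at least \<open>1 / (2 * eps)\<close>.\<close>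

lemma pair_potential_gain:
  assumes m: "m > 0" and ab: "a < b" and fd: "fin_energy a b d" and fe: "fin_energy a b e" and d0: "d a = 0"
    and E: "energy a b d \<le> E0" and eps: "eps > 0"
    and sq: "\<And>t. a \<le> t \<Longrightarrow> t \<le> b \<Longrightarrow> (norm (d t))\<^sup>2 + (eps * ((b - t) / (b - a)))\<^sup>2 \<le> (norm (e t))\<^sup>2"
    and tau: "0 < tau" "tau \<le> (b - a) / 2" "tau * E0 \<le> eps\<^sup>2 / 4"
  shows "(\<integral>\<^sup>+t\<in>{a..b}. pair_potential m i j (e t) \<partial>lborel) + ennreal (mass m i * mass m j * tau / (2 * eps))
      \<le> (\<integral>\<^sup>+t\<in>{a..b}. pair_potential m i j (d t) \<partial>lborel)"
proof -
  define k where "k = mass m i * mass m j"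
  have k: "k > 0" using mass_pos[OF m] by (simp add: k_def)
  have real: "pair_potential m i j z = ennreal (k / norm z)" if "z \<noteq> 0" for z
    using that k unfolding pair_potential_def k_def[symmetric] by (intro pair_potential_real) auto
  have top: "pair_potential m i j 0 = \<infinity>"
    using mass_pos[OF m, of i] mass_pos[OF m, of j] by (simp add: pair_potential_def ennreal_divide_eq_top_iff)
  have base: "pair_potential m i j (e t) \<le> pair_potential m i j (d t)" if t: "a \<le> t" "t \<le> b" for t
  proof (cases "d t = 0")
    case False
    have "(norm (d t))\<^sup>2 \<le> (norm (e t))\<^sup>2" using sq[OF t] by (smt (verit) zero_le_power2)
    then have le: "norm (d t) \<le> norm (e t)" by (rule power2_le_imp_le) simp
    then have "e t \<noteq> 0" using False by auto
    have "k / norm (e t) \<le> k / norm (d t)" using le False k \<open>e t \<noteq> 0\<close> by (intro divide_left_mono mult_pos_pos) auto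
    then show ?thesis unfolding real[OF False] real[OF \<open>e t \<noteq> 0\<close>] by (rule ennreal_leI)
  qed (simp add: top)
  have gain: "pair_potential m i j (e t) + ennreal (k / (2 * eps)) \<le> pair_potential m i j (d t)" if t: "a \<le> t" "t \<le> a + tau" for t
  proof (cases "d t = 0")
    case False
    have tb: "t \<le> b" using t tau ab by (simp add: field_simps)
    have half: "(b - t) / (b - a) \<ge> 1/2" using t tau ab by (simp add: field_simps)
    define r R where "r = norm (d t)" and "R = norm (e t)"
    have r: "r > 0" using False by (simp add: r_def)
    have "r\<^sup>2 \<le> (t - a) * energy a b d"
      using energy_ge[OF fd, of a t] t tb d0 by (simp add: r_def)
    also have "\<dots> \<le> tau * E0"
      using t E energy_nonneg[OF fd] by (intro mult_mono) auto
    finally have r2: "r\<^sup>2 \<le> eps\<^sup>2 / 4" using tau by simp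
    then have "r\<^sup>2 \<le> (eps / 2)\<^sup>2" by (simp add: power_divide)
    then have rh: "r \<le> eps / 2" by (rule power2_le_imp_le) (use eps in simp)
    have "(eps * (1/2))\<^sup>2 \<le> (eps * ((b - t) / (b - a)))\<^sup>2"
      using half eps by (intro power_mono mult_left_mono) auto
    then have "eps\<^sup>2 / 4 \<le> (eps * ((b - t) / (b - a)))\<^sup>2" by (simp add: power_mult_distrib power_divide)
    then have "2 * r\<^sup>2 \<le> R\<^sup>2" using sq[OF t(1) tb] r2 unfolding r_def R_def by linarith
    then have "(4/3 * r)\<^sup>2 \<le> R\<^sup>2" by (simp add: power_mult_distrib power_divide)  (use zero_le_power2[of r] in linarith)
    then have R: "4/3 * r \<le> R" by (rule power2_le_imp_le) (simp add: R_def)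
    then have "R > 0" using r by linarith
    have kR: "k / R \<le> k / (4/3 * r)" using R r k \<open>R > 0\<close> by (intro divide_left_mono mult_pos_pos) auto
    have "k / (4/3 * r) = k / r - k / (4 * r)" using r by (simp add: field_simps)
    moreover have "k / (2 * eps) \<le> k / (4 * r)" using rh r k eps by (intro divide_left_mono mult_pos_pos) auto
    ultimately have "k / R + k / (2 * eps) \<le> k / r" using kR by simp
    moreover have "pair_potential m i j (e t) = ennreal (k / R)" using \<open>R > 0\<close> unfolding R_def by (intro real) auto
    ultimately show ?thesis
      unfolding real[OF False] r_def[symmetric] using k eps \<open>R > 0\<close> by (simp add: ennreal_leI flip: ennreal_plus)
  qed (simp add: top)
  have "(\<integral>\<^sup>+t\<in>{a..b}. pair_potential m i j (e t) \<partial>lborel) + ennreal (k * tau / (2 * eps))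
      = (\<integral>\<^sup>+t\<in>{a..b}. pair_potential m i j (e t) \<partial>lborel) + (\<integral>\<^sup>+t. ennreal (k / (2 * eps)) * indicator {a..a + tau} t \<partial>lborel)"
    using k eps tau by (simp add: nn_integral_cmult_indicator flip: ennreal_mult'')
  also have "\<dots> = (\<integral>\<^sup>+t. pair_potential m i j (e t) * indicator {a..b} t + ennreal (k / (2 * eps)) * indicator {a..a + tau} t \<partial>lborel)"
    by (intro nn_integral_add[symmetric] measurable_pair_potential fin_energy_isCont fe) auto
  also have "\<dots> \<le> (\<integral>\<^sup>+t\<in>{a..b}. pair_potential m i j (d t) \<partial>lborel)"
  proof (rule nn_integral_mono)
    fix t
    have "a + tau \<le> b" using tau ab by (simp add: field_simps)
    then show "pair_potential m i j (e t) * indicator {a..b} t + ennreal (k / (2 * eps)) * indicator {a..a + tau} t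
        \<le> pair_potential m i j (d t) * indicator {a..b} t"
      using base[of t] gain[of t] tau by (auto simp: indicator_def)
  qed
  finally show ?thesis unfolding k_def .
qed

text \<open>\<open>Q\<close> will be the direction of \<open>d b\<close>. The path \<open>d\<close>
  is straightened to a motion on one ray at the same distance from 0, which does not raise its
  energy, and gets a displacement that falls linearly from \<open>eps\<close> at \<open>a\<close> to
  0 at \<open>b\<close>.\<close>

definition tent :: "real \<Rightarrow> real \<Rightarrow> (real \<Rightarrow> complex) \<Rightarrow> complex \<Rightarrow> real \<Rightarrow> complex \<Rightarrow> real \<Rightarrow> complex" where
  "tent a b d Q eps u t = norm (d t) *\<^sub>R Q + (eps * ((b - t) / (b - a))) *\<^sub>R u"

lemma tent:
  assumes ab: "a < b" and fd: "fin_energy a b d" and d0: "d a = 0" and Q: "norm Q = 1" and u: "norm u = 1"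
    and Qu: "inner Q u \<ge> 0" and eps: "eps \<ge> 0"
  shows "fin_energy a b (tent a b d Q eps u)" "energy a b (tent a b d Q eps u) \<le> energy a b d + eps\<^sup>2 / (b - a)"
    "a \<le> t \<Longrightarrow> t \<le> b \<Longrightarrow> (norm (d t))\<^sup>2 + (eps * ((b - t) / (b - a)))\<^sup>2 \<le> (norm (tent a b d Q eps u t))\<^sup>2"
    "a \<le> t \<Longrightarrow> t \<le> b \<Longrightarrow> norm (tent a b d Q eps u t) \<le> norm (d t) + eps"
    "tent a b d Q eps u a = eps *\<^sub>R u"
proof -
  define s where "s = inner Q u"
  define h where "h = 1 / (b - a)"
  have h: "h > 0" using ab by (simp add: h_def)
  have sq: "(norm (p *\<^sub>R Q + q *\<^sub>R u))\<^sup>2 = p\<^sup>2 + q\<^sup>2 + 2 * p * q * s" for p q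
  proof -
    have "(norm (p *\<^sub>R Q + q *\<^sub>R u))\<^sup>2 = (norm (p *\<^sub>R Q))\<^sup>2 + (norm (q *\<^sub>R u))\<^sup>2 + 2 * inner (p *\<^sub>R Q) (q *\<^sub>R u)"
      unfolding power2_norm_eq_inner inner_add_left inner_add_right by (simp add: inner_commute)
    then show ?thesis using Q u by (simp add: s_def power_mult_distrib)
  qed
  \<comment> \<open>The cross term pairs the shrinking displacement along \<open>u\<close> with the
    change of \<open>|d|\<close> along \<open>Q\<close>. Since \<open>d a = 0\<close>, it telescopes
    to a nonpositive multiple of \<open>s * |d b|\<close>, provided the angle between
    \<open>Q\<close> and \<open>u\<close> is not obtuse.\<close>
  define G where "G t = energy a t d - 2 * eps * h * s * norm (d t) + eps\<^sup>2 * h\<^sup>2 * t" for t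
  have "(norm (tent a b d Q eps u t' - tent a b d Q eps u t))\<^sup>2 \<le> (t' - t) * (G t' - G t)"
    if st: "a \<le> t" "t \<le> t'" "t' \<le> b" for t t'
  proof -
    define dn where "dn = norm (d t') - norm (d t)"
    have diff: "tent a b d Q eps u t' - tent a b d Q eps u t = dn *\<^sub>R Q + (- (eps * h * (t' - t))) *\<^sub>R u"
      by (simp add: tent_def dn_def h_def algebra_simps diff_divide_distrib)
    have "(norm (tent a b d Q eps u t' - tent a b d Q eps u t))\<^sup>2
        = dn\<^sup>2 + (eps * h * (t' - t))\<^sup>2 - 2 * dn * (eps * h * (t' - t)) * s"
      unfolding diff sq by simp
    moreover have "dn\<^sup>2 \<le> (norm (d t' - d t))\<^sup>2"
      unfolding dn_def by (metis abs_le_square_iff norm_triangle_ineq3 abs_norm_cancel)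
    moreover have "(norm (d t' - d t))\<^sup>2 \<le> (t' - t) * (energy a t' d - energy a t d)"
      by (rule energy_incr[OF fd st])
    ultimately show ?thesis
      by (simp add: G_def dn_def power2_eq_square algebra_simps)
  qed
  note * = energy_dom[OF less_imp_le[OF ab] this]
  show "fin_energy a b (tent a b d Q eps u)" by (rule *(1))
  have "G b - G a = energy a b d + eps\<^sup>2 * h\<^sup>2 * (b - a) - 2 * eps * h * s * norm (d b)"
    by (simp add: G_def energy_degenerate d0 algebra_simps)
  also have "eps\<^sup>2 * h\<^sup>2 * (b - a) = eps\<^sup>2 / (b - a)" using ab by (simp add: h_def power2_eq_square)
  finally have "G b - G a \<le> energy a b d + eps\<^sup>2 / (b - a)" using eps h Qu by (simp add: s_def)
  with *(2) show "energy a b (tent a b d Q eps u) \<le> energy a b d + eps\<^sup>2 / (b - a)" by linarith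
  show "tent a b d Q eps u a = eps *\<^sub>R u" using ab d0 by (simp add: tent_def)
  assume t: "a \<le> t" "t \<le> b"
  define q where "q = eps * ((b - t) / (b - a))"
  have q: "q \<ge> 0" "q \<le> eps" using t ab eps by (auto simp: q_def divide_simps intro!: mult_left_mono)
  have e: "tent a b d Q eps u t = norm (d t) *\<^sub>R Q + q *\<^sub>R u" by (simp add: tent_def q_def)
  show "(norm (d t))\<^sup>2 + (eps * ((b - t) / (b - a)))\<^sup>2 \<le> (norm (tent a b d Q eps u t))\<^sup>2"
    unfolding e sq q_def[symmetric] using q Qu by (simp add: s_def)
  show "norm (tent a b d Q eps u t) \<le> norm (d t) + eps"
    unfolding e using norm_triangle_ineq[of "norm (d t) *\<^sub>R Q" "q *\<^sub>R u"] Q u q by simp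
qed

text \<open>An integrated form of the collision asymptotics, distance of order
  \<open>t powr (2/3)\<close>; writing the length as \<open>\<nu> ^ 3\<close> avoids fractional
  powers. A competitor whose potential part is of order \<open>\<nu>\<close> bounds the potential
  part of the minimizer, \<open>kin_le_pot\<close> turns this into a bound of the kinetic part, and
  the relative motion is a share of the latter.\<close>

lemma minimizer_pair_energy:
  assumes m: "m > 0" and x: "minimizer m ha hb x" and t0: "0 \<le> t0" "t0 < 1" and dist: "distinct [i, j, k]"
    and col: "x t0 $ i = x t0 $ j" and free: "x t0 $ i \<noteq> x t0 $ k"
  shows "\<exists>C > 0. \<exists>\<nu>0 > 0. \<forall>\<nu>. 0 < \<nu> \<longrightarrow> \<nu> \<le> \<nu>0 \<longrightarrow>
     t0 + \<nu> ^ 3 \<le> 1 \<and> energy t0 (t0 + \<nu> ^ 3) (\<lambda>t. x t $ i - x t $ j) \<le> C * \<nu> \<and>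
     (\<forall>t l. t0 \<le> t \<longrightarrow> t \<le> t0 + \<nu> ^ 3 \<longrightarrow> norm (x t $ l - x t0 $ l) \<le> norm (x t0 $ i - x t0 $ k) / 16)"
proof -
  define d where "d t = x t $ i - x t $ j" for t
  define r where "r = norm (x t0 $ i - x t0 $ k)"
  have r: "r > 0" using free by (simp add: r_def)
  have ij: "i \<noteq> j" using dist by simp
  have fx: "fin_kin 0 1 x" using x by (simp add: minimizer_def)
  define \<mu> where "\<mu> = mass m i * mass m j / (mass m i + mass m j)"
  define k2 where "k2 = mass m i * mass m j"
  have \<mu>: "\<mu> > 0" "k2 > 0" using mass_pos[OF m] by (simp_all add: \<mu>_def k2_def add_pos_pos)
  define CR where "CR = (mass m i + mass m j) * mass m k / (r / 4)"
  have CR: "CR > 0" unfolding CR_def using r mass_pos[OF m] by (intro divide_pos_pos mult_pos_pos add_pos_pos) auto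
  have "\<exists>\<delta>>0. \<forall>t\<in>{0..1}. dist t t0 < \<delta> \<longrightarrow> (\<forall>l. norm (x t $ l - x t0 $ l) \<le> r / 16)"
  proof -
    have "\<exists>\<delta>>0. \<forall>t\<in>{0..1}. dist t t0 < \<delta> \<longrightarrow> norm (x t $ l - x t0 $ l) < r / 16" for l
      using fin_kin_continuous[OF fx, of l] t0 r unfolding continuous_on_iff
      by (metis atLeastAtMost_iff dist_norm less_imp_le zero_less_divide_iff zero_less_numeral)
    then obtain \<delta> where \<delta>: "\<And>l. \<delta> l > 0" "\<And>l t. t \<in> {0..1} \<Longrightarrow> dist t t0 < \<delta> l \<Longrightarrow> norm (x t $ l - x t0 $ l) < r / 16"
      by metis
    show ?thesis
    proof (intro exI[of _ "Min (range \<delta>)"] conjI ballI impI allI)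
      show "Min (range \<delta>) > 0" using \<delta>(1) by simp
      fix t l assume "t \<in> {0..1}" "dist t t0 < Min (range \<delta>)"
      moreover have "Min (range \<delta>) \<le> \<delta> l" by simp
      ultimately show "norm (x t $ l - x t0 $ l) \<le> r / 16" using less_imp_le[OF \<delta>(2)] by fastforce
    qed
  qed
  then obtain \<delta> where \<delta>: "\<delta> > 0" "\<And>t l. t \<in> {0..1} \<Longrightarrow> dist t t0 < \<delta> \<Longrightarrow> norm (x t $ l - x t0 $ l) \<le> r / 16"
    by metis
  define K where "K = kin m 0 1 x"
  have K: "K \<ge> 0" unfolding K_def by (rule kin_nonneg[OF m fx])
  define C0 where "C0 = 2 * (4/3 * \<mu> + 6 * k2 + CR) + 6 * K / (1 - t0)"
  have C0: "C0 > 0" unfolding C0_def using \<mu> CR K t0 by (intro add_pos_nonneg) auto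
  define \<nu>0 where "\<nu>0 = Min {1, (1 - t0) / 3, \<delta> / 2, r / 8}"
  have "\<nu>0 > 0" using t0 \<delta> r by (simp add: \<nu>0_def)
  moreover have "\<nu>0 \<le> v" if "v \<in> {1, (1 - t0) / 3, \<delta> / 2, r / 8}" for v
    unfolding \<nu>0_def using that by (intro Min_le) auto
  ultimately have \<nu>0: "\<nu>0 > 0" "\<nu>0 \<le> 1" "\<nu>0 \<le> (1 - t0) / 3" "\<nu>0 \<le> \<delta> / 2" "\<nu>0 \<le> r / 8"
    by blast+
  have main: "t0 + \<nu> ^ 3 \<le> 1 \<and> energy t0 (t0 + \<nu> ^ 3) (\<lambda>t. x t $ i - x t $ j) \<le> 2 * C0 / \<mu> * \<nu> \<and>
     (\<forall>t l. t0 \<le> t \<longrightarrow> t \<le> t0 + \<nu> ^ 3 \<longrightarrow> norm (x t $ l - x t0 $ l) \<le> norm (x t0 $ i - x t0 $ k) / 16)"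
    if \<nu>: "0 < \<nu>" "\<nu> \<le> \<nu>0" for \<nu>
  proof (intro conjI allI impI)
    define a b where "a = t0" and "b = t0 + \<nu> ^ 3"
    have \<nu>1: "\<nu> \<le> 1" using \<nu> \<nu>0 by simp
    have \<nu>3: "\<nu> ^ 3 \<le> \<nu>" "\<nu> ^ 2 \<le> \<nu>" using \<nu> \<nu>1 power_decreasing[of 1 3 \<nu>] power_decreasing[of 1 2 \<nu>] by auto
    have ab: "a < b" "b - a = \<nu> ^ 3" "b \<le> 1" "0 \<le> a"
      using \<nu> \<nu>3 \<nu>0 t0 by (auto simp: a_def b_def field_simps)
    show "t0 + \<nu> ^ 3 \<le> 1" using ab by (simp add: b_def)
    have near: "norm (x t $ l - x t0 $ l) \<le> r / 16" if "a \<le> t" "t \<le> b" for t l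
    proof (rule \<delta>(2))
      show "t \<in> {0..1}" using that ab by auto
      have "\<bar>t - t0\<bar> \<le> \<nu> ^ 3" using that by (auto simp: a_def b_def)
      then show "dist t t0 < \<delta>" using \<nu>3 \<nu> \<nu>0 \<delta> by (simp add: dist_real_def)
    qed
    then show "t0 \<le> t \<Longrightarrow> t \<le> t0 + \<nu> ^ 3 \<Longrightarrow> norm (x t $ l - x t0 $ l) \<le> norm (x t0 $ i - x t0 $ k) / 16" for t l
      by (simp add: a_def b_def r_def)
    have fab: "fin_kin a b x" using ab by (intro fin_kin_subset[OF fx]) auto
    have fd: "fin_energy a b d" unfolding d_def using ab by (intro fin_energy_diff fin_kinD[OF fab]) auto
    define Q where "Q = d b"
    \<comment> \<open>The relative motion is replaced by the linear path to \<open>Q\<close> with a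
      detour of profile \<open>bump\<close> normal to it. Orthogonality makes the energies add and
      keeps the distance at least \<open>bump\<close>; the linear part costs at most the energy of
      \<open>d\<close>.\<close>
    obtain u where u: "norm u = 1" "inner Q u = 0" using complex_orthogonal_unit by blast
    define c where "c t = ((t - a) / (b - a)) *\<^sub>R Q + bump a b t *\<^sub>R u" for t
    have fc: "fin_energy a b c"
      and Ec: "energy a b c \<le> energy a b (\<lambda>t. (t - a) / (b - a)) * (norm Q)\<^sup>2 + energy a b (bump a b)"
      unfolding c_def
      using energy_orthogonal[OF less_imp_le[OF ab(1)] energy_affine_fun(1)[OF ab(1)] energy_bump(1)[OF ab(1)] u(2,1)] by auto
    have p13: "(\<nu> ^ 3) powr (1/3) = \<nu>" "(\<nu> ^ 3) powr (2/3) = \<nu> ^ 2"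
      using \<nu> powr_powr[of \<nu> 3 "1/3"] powr_powr[of \<nu> 3 "2/3"] by simp_all
    have da: "d a = 0" using col by (simp add: d_def a_def)
    have Q2: "(norm Q)\<^sup>2 \<le> \<nu> ^ 3 * energy a b d"
      using energy_ge[OF fd, of a b] ab da by (simp add: Q_def)
    have "energy a b c \<le> 1 / \<nu> ^ 3 * (norm Q)\<^sup>2 + 8/3 * \<nu>"
    proof -
      have "energy a b (\<lambda>t. (t - a) / (b - a)) * (norm Q)\<^sup>2 \<le> 1 / \<nu> ^ 3 * (norm Q)\<^sup>2"
        using energy_affine_fun(2)[OF ab(1)] unfolding ab(2) by (intro mult_right_mono) auto
      moreover have "energy a b (bump a b) \<le> 8/3 * \<nu>"
        using energy_bump(2)[OF ab(1)] unfolding ab(2) p13 .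
      ultimately show ?thesis using Ec by linarith
    qed
    also have "1 / \<nu> ^ 3 * (norm Q)\<^sup>2 \<le> energy a b d"
      using Q2 \<nu> by (simp add: divide_simps mult.commute)
    finally have Ecd: "energy a b c \<le> energy a b d + 8/3 * \<nu>" by simp
    have ca: "c a = 0" "c b = Q" using ab(1) by (simp_all add: c_def bump_def)
    have bump_le: "0 \<le> bump a b t" "bump a b t \<le> r / 8" if "a \<le> t" "t \<le> b" for t
    proof -
      show "0 \<le> bump a b t" by (simp add: bump_def)
      have "bump a b t \<le> (\<nu> ^ 3) powr (2/3)"
        unfolding bump_def using that ab by (intro powr_mono2) auto
      then show "bump a b t \<le> r / 8" unfolding p13 using \<nu>3 \<nu> \<nu>0 by linarith
    qed
    have Qr: "norm Q \<le> r / 8"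
    proof -
      have "Q = (x b $ i - x t0 $ i) - (x b $ j - x t0 $ j)" using col by (simp add: Q_def d_def)
      then show ?thesis
        using norm_triangle_ineq4[of "x b $ i - x t0 $ i" "x b $ j - x t0 $ j"] near[of b i] near[of b j] ab by simp
    qed
    have cr: "norm (c t) \<le> r / 4" if t: "a \<le> t" "t \<le> b" for t
    proof -
      have "norm (c t) \<le> (t - a) / (b - a) * norm Q + bump a b t"
        unfolding c_def using norm_triangle_ineq[of "((t - a) / (b - a)) *\<^sub>R Q" "bump a b t *\<^sub>R u"] t ab(1) u bump_le[OF t] by simp
      also have "(t - a) / (b - a) * norm Q \<le> norm Q" using t ab(1) by (intro mult_left_le_one_le) auto
      finally show ?thesis using bump_le[OF t] Qr by linarith
    qed
    have cb: "bump a b t \<le> norm (c t)" if t: "a \<le> t" "t \<le> b" for t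
    proof -
      have "(norm (c t))\<^sup>2 = (norm (((t - a) / (b - a)) *\<^sub>R Q))\<^sup>2 + (norm (bump a b t *\<^sub>R u))\<^sup>2"
        unfolding c_def using u by (intro norm_add_Pythagorean) (simp add: orthogonal_def)
      then have "(bump a b t)\<^sup>2 \<le> (norm (c t))\<^sup>2" using u by (simp add: power_mult_distrib)
      then show ?thesis by (rule power2_le_imp_le) simp
    qed
    define dn where "dn t = (if a \<le> t \<and> t \<le> b then c t else d t)" for t
    have Dc: "dn t = c t" if "a \<le> t" "t \<le> b" for t using that by (simp add: dn_def)
    have fD: "fin_energy a b dn" and ED: "energy a b dn = energy a b c"
      using energy_cong[of a b dn c] Dc fc by auto
    let ?y = "with_pair m i j x dn"
    have yx: "?y t = x t" if "\<not> (a < t \<and> t < b)" for t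
    proof (rule with_pair_same)
      have "t = a \<or> t = b \<or> \<not> (a \<le> t \<and> t \<le> b)" using that by auto
      then show "dn t = x t $ i - x t $ j"
        by (elim disjE) (use ca ab da in \<open>auto simp: dn_def Q_def d_def\<close>)
    qed
    note kp = kin_with_pair[OF m dist less_imp_le[OF ab(1)] fab fD, folded d_def]
    have "pot m a b ?y \<le> (\<integral>\<^sup>+t\<in>{a..b}. pair_potential m i j (dn t) \<partial>lborel) + ennreal (CR * (b - a))"
      unfolding CR_def
      by (rule pot_with_pair_le[OF m dist less_imp_le[OF ab(1)] r fab fD near col r_def[symmetric]])
         (use cr Dc in auto)
    also have "(\<integral>\<^sup>+t\<in>{a..b}. pair_potential m i j (dn t) \<partial>lborel) \<le> (\<integral>\<^sup>+t\<in>{a..b}. ennreal k2 / ennreal (bump a b t) \<partial>lborel)"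
    proof (intro nn_integral_mono)
      fix t
      show "pair_potential m i j (dn t) * indicator {a..b} t \<le> ennreal k2 / ennreal (bump a b t) * indicator {a..b} t"
        using cb[of t] Dc[of t] bump_le(1)[of t] \<mu>(2)
        by (auto simp: indicator_def pair_potential_def k2_def intro!: ennreal_divide_antimono)
    qed
    also have "\<dots> \<le> ennreal (6 * k2 * \<nu>)"
      using nn_integral_bump[OF ab(1), of k2] \<mu> unfolding ab(2) p13 by simp
    finally have py: "pot m a b ?y \<le> ennreal (6 * k2 * \<nu> + CR * \<nu> ^ 3)"
      unfolding ab(2) using \<mu> \<nu> CR by (simp add: ennreal_plus)
    have "kin m a b x + enn2real (pot m a b x) \<le> kin m a b ?y + (6 * k2 * \<nu> + CR * \<nu> ^ 3)"
      by (rule minimizer_local[OF m x ab(4) less_imp_le[OF ab(1)] ab(3) kp(1)])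
         (use yx ab x py \<mu> CR \<nu> in \<open>auto simp: minimizer_def\<close>)
    moreover have "kin m a b ?y = kin m a b x + \<mu> / 2 * (energy a b dn - energy a b d)"
      using kp(2) unfolding \<mu>_def by simp
    moreover have "\<mu> / 2 * (energy a b dn - energy a b d) \<le> \<mu> / 2 * (8/3 * \<nu>)"
      using Ecd \<mu> unfolding ED by (intro mult_left_mono) auto
    ultimately have P: "enn2real (pot m a b x) \<le> (4/3 * \<mu> + 6 * k2) * \<nu> + CR * \<nu> ^ 3" by (simp add: algebra_simps)
    have "\<nu> ^ 3 \<le> (1 - t0) / 3" using \<nu>3 \<nu> \<nu>0 by linarith
    then have "kin m a b x \<le> 2 * enn2real (pot m a b x) + 6 * \<nu> ^ 3 / (1 - t0) * K"
      using kin_le_pot[OF m x t0, of "\<nu> ^ 3"] \<nu> by (simp add: a_def b_def K_def)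
    moreover have "6 * \<nu> ^ 3 / (1 - t0) * K \<le> 6 * K / (1 - t0) * \<nu>"
    proof -
      have "6 * K / (1 - t0) * \<nu> ^ 3 \<le> 6 * K / (1 - t0) * \<nu>" using \<nu>3 K t0 by (intro mult_left_mono) auto
      then show ?thesis by (simp add: mult_ac)
    qed
    moreover have "CR * \<nu> ^ 3 \<le> CR * \<nu>" using \<nu>3 CR by (intro mult_left_mono) auto
    then have "2 * enn2real (pot m a b x) \<le> 2 * (4/3 * \<mu> + 6 * k2 + CR) * \<nu>" using P by (simp add: algebra_simps)
    ultimately have kx: "kin m a b x \<le> C0 * \<nu>" unfolding C0_def distrib_right by linarith
    \<comment> \<open>Collapsing the pair to its centre of mass leaves a nonnegative kinetic part,
      so the relative motion accounts for at most \<open>kin m a b x\<close>.\<close>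
    have "fin_energy a b (\<lambda>t. 0 :: complex)" "energy a b (\<lambda>t. 0 :: complex) \<le> 0"
      using energy_dom[of a b "\<lambda>t. 0 :: complex" "\<lambda>t. 0"] ab by auto
    note z = this
    have "0 \<le> kin m a b x + \<mu> / 2 * (energy a b (\<lambda>t. 0 :: complex) - energy a b d)"
      using kin_with_pair[OF m dist less_imp_le[OF ab(1)] fab z(1)] kin_nonneg[OF m] unfolding \<mu>_def d_def by metis
    moreover have "\<mu> / 2 * (energy a b (\<lambda>t. 0 :: complex) - energy a b d) \<le> \<mu> / 2 * (0 - energy a b d)"
      using z \<mu> by (intro mult_left_mono) auto
    ultimately have "\<mu> / 2 * energy a b d \<le> C0 * \<nu>" using kx by simp
    then have "energy a b d \<le> 2 * C0 / \<mu> * \<nu>" using \<mu> by (simp add: field_simps)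
    then show "energy t0 (t0 + \<nu> ^ 3) (\<lambda>t. x t $ i - x t $ j) \<le> 2 * C0 / \<mu> * \<nu>"
      unfolding a_def b_def d_def .
  qed
  have "2 * C0 / \<mu> > 0" using C0 \<mu> by simp
  then show ?thesis using main \<nu>0(1) by blast
qed

text \<open>The constants are matched to each other: \<open>eps = \<eta> * \<nu>^2\<close> makes the
  increase of energy \<open>\<eta>^2 * \<nu>\<close>; \<open>tau\<close> is the largest time with
  \<open>tau * (C * \<nu>) \<le> eps^2 / 4\<close>; and \<open>\<eta>\<close> makes
  \<open>tau / (2 * eps)\<close> equal to \<open>\<eta>^2 * \<nu>\<close> divided by the mass of the
  pair. The gain is then twice the kinetic cost, in which the energy is weighted with half the
  reduced mass.\<close>

lemma side_competitor:
  assumes m: "m > 0" and ij: "i \<noteq> j" and \<nu>: "\<nu> > 0" and b: "b = a + \<nu> ^ 3" and fd: "fin_energy a b d" and d0: "d a = 0"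
    and C: "C \<ge> 1" "C \<ge> mass m i + mass m j" and E: "energy a b d \<le> C * \<nu>"
    and \<eta>: "\<eta> = (mass m i + mass m j) / (8 * C)"
    and Q: "norm Q = 1" "norm (d b) *\<^sub>R Q = d b" and u: "norm u = 1" "inner Q u \<ge> 0"
  shows "\<exists>e. fin_energy a b e \<and> energy a b e \<le> energy a b d + \<eta>\<^sup>2 * \<nu> \<and> e a = (\<eta> * \<nu>\<^sup>2) *\<^sub>R u \<and> e b = d b \<and>
     (\<forall>t. a \<le> t \<longrightarrow> t \<le> b \<longrightarrow> norm (e t) \<le> norm (d t) + \<nu>\<^sup>2) \<and>
     (\<integral>\<^sup>+t\<in>{a..b}. pair_potential m i j (e t) \<partial>lborel)
        + ennreal (mass m i * mass m j / (mass m i + mass m j) * \<eta>\<^sup>2 * \<nu>)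
      \<le> (\<integral>\<^sup>+t\<in>{a..b}. pair_potential m i j (d t) \<partial>lborel)"
proof -
  define S where "S = mass m i + mass m j"
  have S: "S > 0" using mass_pos[OF m] by (simp add: S_def add_pos_pos)
  have \<eta>S: "\<eta> = S / (8 * C)" using \<eta> by (simp add: S_def)
  have \<eta>1: "\<eta> > 0" "\<eta> \<le> 1/8" using C S by (auto simp: \<eta>S S_def divide_simps)
  define eps tau where "eps = \<eta> * \<nu>\<^sup>2" and "tau = \<eta>\<^sup>2 * \<nu> ^ 3 / (4 * C)"
  have eps: "eps > 0" "eps \<le> \<nu>\<^sup>2" using \<eta>1 \<nu> by (auto simp: eps_def intro!: mult_left_le_one_le)
  have ab: "a < b" "b - a = \<nu> ^ 3" using \<nu> b by auto
  have tau: "tau > 0" "tau \<le> (b - a) / 2" "tau * (C * \<nu>) \<le> eps\<^sup>2 / 4"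
  proof -
    show "tau > 0" using \<eta>1 \<nu> C by (simp add: tau_def)
    have "\<eta>\<^sup>2 \<le> 1" using \<eta>1 by (simp add: power_le_one)
    then have "\<eta>\<^sup>2 / (4 * C) \<le> 1 / 2" using C by (simp add: divide_simps)
    then have "\<eta>\<^sup>2 / (4 * C) * \<nu> ^ 3 \<le> 1 / 2 * \<nu> ^ 3" using \<nu> by (intro mult_right_mono) auto
    then show "tau \<le> (b - a) / 2" unfolding ab by (simp add: tau_def)
    have "tau * (C * \<nu>) = eps\<^sup>2 / 4" using C by (simp add: tau_def eps_def power_mult_distrib power2_eq_square power3_eq_cube)
    then show "tau * (C * \<nu>) \<le> eps\<^sup>2 / 4" by simp
  qed
  define e where "e = tent a b d Q eps u"
  note T = tent[OF ab(1) fd d0 Q(1) u(1) u(2) less_imp_le[OF eps(1)]]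
  have fe: "fin_energy a b e" unfolding e_def by (rule T(1))
  have "eps\<^sup>2 / (b - a) = \<eta>\<^sup>2 * \<nu>" unfolding ab using \<nu> by (simp add: eps_def power_mult_distrib power2_eq_square power3_eq_cube)
  then have Ee: "energy a b e \<le> energy a b d + \<eta>\<^sup>2 * \<nu>" using T(2) by (simp add: e_def)
  have G: "(\<integral>\<^sup>+t\<in>{a..b}. pair_potential m i j (e t) \<partial>lborel) + ennreal (mass m i * mass m j * tau / (2 * eps))
      \<le> (\<integral>\<^sup>+t\<in>{a..b}. pair_potential m i j (d t) \<partial>lborel)"
    by (rule pair_potential_gain[OF m ab(1) fd fe d0 E eps(1) _ tau]) (unfold e_def, rule T(3))
  have "tau / (2 * eps) = \<eta>\<^sup>2 * \<nu> / S"
  proof -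
    have "tau / (2 * eps) = \<eta> * \<nu> / (8 * C)" using \<eta>1 \<nu> C by (simp add: tau_def eps_def power2_eq_square power3_eq_cube)
    also have "\<dots> = \<eta> * (S / (8 * C)) * \<nu> / S" using S by simp
    also have "\<dots> = \<eta>\<^sup>2 * \<nu> / S" unfolding \<eta>S[symmetric] by (simp add: power2_eq_square)
    finally show ?thesis .
  qed
  then have te: "mass m i * mass m j * tau / (2 * eps) = mass m i * mass m j / (mass m i + mass m j) * \<eta>\<^sup>2 * \<nu>"
    by (simp add: S_def) (metis mult.assoc times_divide_eq_right)
  have eb: "e b = d b" using Q by (simp add: e_def tent_def)
  have n: "norm (e t) \<le> norm (d t) + \<nu>\<^sup>2" if "a \<le> t" "t \<le> b" for t
    using T(4)[OF that] eps(2) unfolding e_def by linarith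
  have ea: "e a = (\<eta> * \<nu>\<^sup>2) *\<^sub>R u" using T(5) by (simp add: e_def eps_def)
  show ?thesis
    using fe Ee ea eb n G[unfolded te] by blast
qed

lemma nn_integral_pair_reflect:
  fixes f :: "real \<Rightarrow> complex"
  assumes "continuous_on {c - b..c - a} f"
  shows "(\<integral>\<^sup>+t\<in>{a..b}. pair_potential m i j (f (c - t)) \<partial>lborel) = (\<integral>\<^sup>+t\<in>{c - b..c - a}. pair_potential m i j (f t) \<partial>lborel)"
proof -
  have "(\<integral>\<^sup>+t\<in>{c - b..c - a}. pair_potential m i j (f t) \<partial>lborel)
      = ennreal \<bar>-1\<bar> * (\<integral>\<^sup>+t. pair_potential m i j (f (c + (-1) * t)) * indicator {c - b..c - a} (c + (-1) * t) \<partial>lborel)"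
    using measurable_pair_potential[OF assms, of m i j] by (intro nn_integral_real_affine) auto
  also have "(\<lambda>t. pair_potential m i j (f (c + (-1) * t)) * indicator {c - b..c - a} (c + (-1) * t)) =
      (\<lambda>t. pair_potential m i j (f (c - t)) * indicator {a..b} t)"
    by (auto simp: indicator_def fun_eq_iff)
  finally show ?thesis by simp
qed

text \<open>The mirror image, about \<open>b\<close>, of the construction to the right of a
  collision.\<close>

lemma side_competitor_left:
  assumes m: "m > 0" and ij: "i \<noteq> j" and \<nu>: "\<nu> > 0" and a: "a = b - \<nu> ^ 3" and fd: "fin_energy a b d" and d0: "d b = 0"
    and C: "C \<ge> 1" "C \<ge> mass m i + mass m j" and E: "energy a b d \<le> C * \<nu>"
    and \<eta>: "\<eta> = (mass m i + mass m j) / (8 * C)"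
    and Q: "norm Q = 1" "norm (d a) *\<^sub>R Q = d a" and u: "norm u = 1" "inner Q u \<ge> 0"
  shows "\<exists>e. fin_energy a b e \<and> energy a b e \<le> energy a b d + \<eta>\<^sup>2 * \<nu> \<and> e b = (\<eta> * \<nu>\<^sup>2) *\<^sub>R u \<and> e a = d a \<and>
     (\<forall>t. a \<le> t \<longrightarrow> t \<le> b \<longrightarrow> norm (e t) \<le> norm (d t) + \<nu>\<^sup>2) \<and>
     (\<integral>\<^sup>+t\<in>{a..b}. pair_potential m i j (e t) \<partial>lborel)
        + ennreal (mass m i * mass m j / (mass m i + mass m j) * \<eta>\<^sup>2 * \<nu>)
      \<le> (\<integral>\<^sup>+t\<in>{a..b}. pair_potential m i j (d t) \<partial>lborel)"
proof -
  define b' where "b' = b + \<nu> ^ 3"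
  have le: "b \<le> b'" "a \<le> b" using \<nu> a by (auto simp: b'_def)
  have r: "2 * b - b' = a" "2 * b - b = b" "2 * b - a = b'" by (auto simp: a b'_def)
  define d' where "d' t = d (2 * b - t)" for t
  have fd': "fin_energy b b' d'" and Ed': "energy b b' d' = energy a b d"
    using energy_reflect[of b b' "2 * b" d] fd le unfolding r d'_def by auto
  have d'0: "d' b = 0" "d' b' = d a" using d0 by (simp_all add: d'_def r)
  obtain e where e: "fin_energy b b' e" "energy b b' e \<le> energy b b' d' + \<eta>\<^sup>2 * \<nu>" "e b = (\<eta> * \<nu>\<^sup>2) *\<^sub>R u" "e b' = d' b'"
     "\<And>t. b \<le> t \<Longrightarrow> t \<le> b' \<Longrightarrow> norm (e t) \<le> norm (d' t) + \<nu>\<^sup>2"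
     "(\<integral>\<^sup>+t\<in>{b..b'}. pair_potential m i j (e t) \<partial>lborel)
        + ennreal (mass m i * mass m j / (mass m i + mass m j) * \<eta>\<^sup>2 * \<nu>)
      \<le> (\<integral>\<^sup>+t\<in>{b..b'}. pair_potential m i j (d' t) \<partial>lborel)"
    using side_competitor[OF m ij \<nu> b'_def fd' d'0(1) C E[folded Ed'] \<eta> Q(1) _ u] Q(2) unfolding d'0(2) by blast
  define f where "f t = e (2 * b - t)" for t
  have ff: "fin_energy a b f" and Ef: "energy a b f = energy b b' e"
    using energy_reflect[of a b "2 * b" e] e(1) le unfolding r f_def by auto
  have I1: "(\<integral>\<^sup>+t\<in>{a..b}. pair_potential m i j (f t) \<partial>lborel) = (\<integral>\<^sup>+t\<in>{b..b'}. pair_potential m i j (e t) \<partial>lborel)"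
    using nn_integral_pair_reflect[of "2 * b" b a e m i j] fin_energy_isCont[OF e(1)] unfolding r f_def by simp
  have I2: "(\<integral>\<^sup>+t\<in>{b..b'}. pair_potential m i j (d' t) \<partial>lborel) = (\<integral>\<^sup>+t\<in>{a..b}. pair_potential m i j (d t) \<partial>lborel)"
    using nn_integral_pair_reflect[of "2 * b" b' b d m i j] fin_energy_isCont[OF fd] unfolding r d'_def by simp
  have n: "norm (f t) \<le> norm (d t) + \<nu>\<^sup>2" if "a \<le> t" "t \<le> b" for t
    using e(5)[of "2 * b - t"] that r by (simp add: f_def d'_def)
  have fb: "f b = (\<eta> * \<nu>\<^sup>2) *\<^sub>R u" "f a = d a" using e(3,4) d'0(2) by (simp_all add: f_def r)
  show ?thesis
    using ff e(2)[folded Ef, unfolded Ed'] fb n e(6)[folded I1, unfolded I2] by blast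
qed

text \<open>The balance of actions for a competitor that changes one pair: the gain \<open>g\<close>
  against the increase \<open>\<delta>\<close> of energy, weighted with half the reduced mass, and
  the potential of the third body. At an end of \<open>[0, 1]\<close> the competitor has to obey the
  boundary map, at an inner end point it has to meet \<open>x\<close>.\<close>

lemma gap_contradiction:
  assumes m: "m > 0" and x: "minimizer m ha hb x" and dist: "distinct [i, j, k]"
    and ab: "0 \<le> a" "a < b" "b \<le> 1"
    and near: "\<And>t l. a \<le> t \<Longrightarrow> t \<le> b \<Longrightarrow> norm (x t $ l - z $ l) \<le> r / 16"
    and z: "z $ i = z $ j" "norm (z $ i - z $ k) = r" and r: "r > 0"
    and e: "fin_energy a b e" "\<And>t. a \<le> t \<Longrightarrow> t \<le> b \<Longrightarrow> norm (e t) \<le> r / 4"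
    and ea: "a > 0 \<Longrightarrow> e a = x a $ i - x a $ j" "a = 0 \<Longrightarrow> ha (with_pair m i j x e 0) = with_pair m i j x e 0"
    and eb: "b < 1 \<Longrightarrow> e b = x b $ i - x b $ j" "b = 1 \<Longrightarrow> hb (with_pair m i j x e 1) = with_pair m i j x e 1"
    and E: "energy a b e \<le> energy a b (\<lambda>t. x t $ i - x t $ j) + \<delta>"
    and I: "(\<integral>\<^sup>+t\<in>{a..b}. pair_potential m i j (e t) \<partial>lborel) + ennreal g
      \<le> (\<integral>\<^sup>+t\<in>{a..b}. pair_potential m i j (x t $ i - x t $ j) \<partial>lborel)"
    and g: "g \<ge> 0" "mass m i * mass m j / (mass m i + mass m j) / 2 * \<delta> + (mass m i + mass m j) * mass m k / (r / 4) * (b - a) < g"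
  shows False
proof -
  define \<mu> where "\<mu> = mass m i * mass m j / (mass m i + mass m j)"
  have \<mu>: "\<mu> > 0" using mass_pos[OF m] by (simp_all add: \<mu>_def add_pos_pos)
  define CR where "CR = (mass m i + mass m j) * mass m k / (r / 4)"
  have CR: "CR > 0" unfolding CR_def using r mass_pos[OF m] by (intro divide_pos_pos mult_pos_pos add_pos_pos) auto
  have fx: "fin_kin 0 1 x" and px: "pot m 0 1 x < \<infinity>" and bx: "ha (x 0) = x 0" "hb (x 1) = x 1"
    using x by (auto simp: minimizer_def)
  have fab: "fin_kin a b x" using ab by (intro fin_kin_subset[OF fx]) auto
  define d where "d t = x t $ i - x t $ j" for t
  define e' where "e' t = (if a \<le> t \<and> t \<le> b then e t else d t)" for t
  have e'e: "e' t = e t" if "a \<le> t" "t \<le> b" for t using that by (simp add: e'_def)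
  have fe': "fin_energy a b e'" and Ee': "energy a b e' = energy a b e"
    using energy_cong[of a b e' e] e'e e(1) by auto
  let ?y = "with_pair m i j x e'"
  note kp = kin_with_pair[OF m dist less_imp_le[OF ab(2)] fab fe', folded d_def]
  have yx: "?y t = x t" if "e' t = d t" for t using that by (intro with_pair_same) (simp add: d_def)
  have yl: "?y t = x t" if "0 \<le> t" "t \<le> a" "0 < a" for t
  proof (rule yx)
    show "e' t = d t" using ea(1) that ab by (cases "t = a") (auto simp: e'_def d_def)
  qed
  have yr: "?y t = x t" if "b \<le> t" "t \<le> 1" "b < 1" for t
  proof (rule yx)
    show "e' t = d t" using eb(1) that ab by (cases "t = b") (auto simp: e'_def d_def)
  qed
  have we: "with_pair m i j x e' t = with_pair m i j x e t" if "e' t = e t" for t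
    using that by (simp add: with_pair_def)
  have y0: "ha (?y 0) = ?y 0"
  proof (cases "a = 0")
    case True
    then show ?thesis using ea(2) we[OF e'e[of 0]] ab by simp
  next
    case False
    then show ?thesis using yl[of 0] ab bx by simp
  qed
  have y1: "hb (?y 1) = ?y 1"
  proof (cases "b = 1")
    case True
    then show ?thesis using eb(2) we[OF e'e[of 1]] ab by simp
  next
    case False
    then show ?thesis using yr[of 1] ab bx by simp
  qed
  have meas: "(\<lambda>t. pair_potential m i j (d t) * indicator {a..b} t) \<in> borel_measurable lborel"
    unfolding d_def by (intro measurable_pair_potential continuous_intros fin_kin_continuous fab)
  have "(\<integral>\<^sup>+t\<in>{a..b}. pair_potential m i j (d t) \<partial>lborel) \<le> pot m a b x"
    unfolding pot_def potential_distinct[OF dist] d_def by (intro nn_integral_mono) (auto simp: indicator_def add.assoc)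
  then have I': "(\<integral>\<^sup>+t\<in>{a..b}. pair_potential m i j (e t) \<partial>lborel) + ennreal g \<le> pot m a b x"
    using I unfolding d_def by (rule order_trans[rotated])
  have fs: "fin_kin 0 a x" "fin_kin b 1 x" "fin_kin 0 b x" using ab by (auto intro!: fin_kin_subset[OF fx])
  have "pot m 0 1 x = pot m 0 a x + pot m a b x + pot m b 1 x"
    using pot_split[OF fs(3,2), of m] pot_split[OF fs(1) fab, of m] ab by simp
  then have "pot m a b x < \<infinity>" using px by auto
  then obtain P where P: "pot m a b x = ennreal P" "P \<ge> 0"
    by (metis ennreal_cases infinity_ennreal_def less_irrefl)
  have "(\<integral>\<^sup>+t\<in>{a..b}. pair_potential m i j (e t) \<partial>lborel) < \<infinity>"
    using I' unfolding P by (auto simp: less_top[symmetric] top_unique)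
  then obtain p where p: "(\<integral>\<^sup>+t\<in>{a..b}. pair_potential m i j (e t) \<partial>lborel) = ennreal p" "p \<ge> 0"
    by (metis ennreal_cases infinity_ennreal_def less_irrefl)
  have pP: "p + g \<le> P" using I' P(2) p(2) g(1) unfolding P(1) p(1) by (simp flip: ennreal_plus)
  have "pot m a b ?y \<le> (\<integral>\<^sup>+t\<in>{a..b}. pair_potential m i j (e' t) \<partial>lborel) + ennreal (CR * (b - a))"
    unfolding CR_def
    by (rule pot_with_pair_le[OF m dist less_imp_le[OF ab(2)] r fab fe' near z]) (use e(2) e'e in auto)
  also have "(\<integral>\<^sup>+t\<in>{a..b}. pair_potential m i j (e' t) \<partial>lborel) = ennreal p"
    unfolding p(1)[symmetric] by (intro nn_integral_cong) (auto simp: indicator_def e'e)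
  also have "ennreal p + ennreal (CR * (b - a)) = ennreal (p + CR * (b - a))"
    using p(2) CR ab by (intro ennreal_plus[symmetric]) auto
  finally have py: "pot m a b ?y \<le> ennreal (p + CR * (b - a))" .
  have "kin m a b x + enn2real (pot m a b x) \<le> kin m a b ?y + (p + CR * (b - a))"
    using CR ab p(2) by (intro minimizer_local[OF m x ab(1) less_imp_le[OF ab(2)] ab(3) kp(1) _ _ y0 y1 py] yl yr) auto
  moreover have "kin m a b ?y = kin m a b x + \<mu> / 2 * (energy a b e' - energy a b d)"
    using kp(2) unfolding \<mu>_def by simp
  moreover have "\<mu> / 2 * (energy a b e' - energy a b d) \<le> \<mu> / 2 * \<delta>"
    using E \<mu> unfolding Ee' d_def by (intro mult_left_mono) auto
  moreover have "\<mu> / 2 * \<delta> + CR * (b - a) < g" using g(2) unfolding \<mu>_def CR_def .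
  ultimately show False using pP P by simp
qed

lemma small_cube_root:
  fixes A B C R :: real
  assumes "A > 0" "B > 0" "C > 0" "R > 0"
  shows "\<exists>\<nu>>0. \<nu> \<le> A \<and> \<nu> \<le> B \<and> \<nu> \<le> 1 \<and> \<nu>\<^sup>2 \<le> R \<and> C * \<nu> ^ 3 < R * \<nu>"
proof -
  define \<nu> where "\<nu> = Min {1, A, B, R, R / (2 * C)}"
  have pos: "\<nu> > 0" using assms by (simp add: \<nu>_def)
  have le: "\<nu> \<le> v" if "v \<in> {1, A, B, R, R / (2 * C)}" for v
    unfolding \<nu>_def using that by (intro Min_le) auto
  have l: "\<nu> \<le> 1" "\<nu> \<le> A" "\<nu> \<le> B" "\<nu> \<le> R" "\<nu> \<le> R / (2 * C)" by (rule le; simp)+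
  have sq: "\<nu>\<^sup>2 \<le> \<nu>" using pos l power_decreasing[of 1 2 \<nu>] by simp
  have "C * \<nu> \<le> R / 2" using l(5) assms by (simp add: field_simps)
  then have "C * \<nu>\<^sup>2 \<le> R / 2" using sq assms by (smt (verit) mult_left_mono)
  then have "C * \<nu>\<^sup>2 < R" using assms by simp
  then have "C * \<nu>\<^sup>2 * \<nu> < R * \<nu>" using pos by (intro mult_strict_right_mono)
  then have "C * \<nu> ^ 3 < R * \<nu>" by (simp add: power2_eq_square power3_eq_cube mult.assoc)
  moreover have "\<nu>\<^sup>2 \<le> R" using sq l by linarith
  ultimately show ?thesis using pos l by blast
qed

text \<open>At time 0 the bodies may only be separated within the fixed set of \<open>ha\<close>.
  The hypothesis supplies a whole line of such displacements, so the sign can be chosen to avoid an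
  obtuse angle with the outgoing branch.\<close>

lemma no_pair_collision_start:
  assumes m: "m > 0" and x: "minimizer m ha hb x" and dist: "distinct [i, j, k]"
    and col: "x 0 $ i = x 0 $ j" and free: "x 0 $ i \<noteq> x 0 $ k"
    and dir: "\<exists>u. norm u = 1 \<and> (\<forall>\<epsilon>. ha (x 0 + dirv m i j (\<epsilon> *\<^sub>R u)) = x 0 + dirv m i j (\<epsilon> *\<^sub>R u))"
  shows False
proof -
  define r where "r = norm (x 0 $ i - x 0 $ k)"
  have r: "r > 0" using free by (simp add: r_def)
  define d where "d t = x t $ i - x t $ j" for t
  have d0: "d 0 = 0" using col by (simp add: d_def)
  have ij: "i \<noteq> j" using dist by simp
  have fx: "fin_kin 0 1 x" using x by (auto simp: minimizer_def)
  obtain C1 \<nu>1 where c1: "C1 > 0" "\<nu>1 > 0"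
    and c2: "\<And>\<nu>. 0 < \<nu> \<Longrightarrow> \<nu> \<le> \<nu>1 \<Longrightarrow> 0 + \<nu> ^ 3 \<le> 1 \<and> energy 0 (0 + \<nu> ^ 3) d \<le> C1 * \<nu> \<and>
     (\<forall>t l. 0 \<le> t \<longrightarrow> t \<le> 0 + \<nu> ^ 3 \<longrightarrow> norm (x t $ l - x 0 $ l) \<le> r / 16)"
    using minimizer_pair_energy[OF m x order_refl _ dist col free] unfolding d_def r_def by auto
  define S where "S = mass m i + mass m j"
  define \<mu> where "\<mu> = mass m i * mass m j / S"
  have S: "S > 0" "\<mu> > 0" using mass_pos[OF m] by (simp_all add: S_def \<mu>_def add_pos_pos)
  define CR where "CR = S * mass m k / (r / 4)"
  have CR: "CR > 0" unfolding CR_def using r S mass_pos[OF m] by (intro divide_pos_pos mult_pos_pos) auto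
  define C where "C = max 1 (max S C1)"
  have C: "C \<ge> 1" "C \<ge> mass m i + mass m j" "C \<ge> C1" by (auto simp: C_def S_def)
  define \<eta> where "\<eta> = S / (8 * C)"
  have \<eta>: "\<eta> > 0" using S C by (simp add: \<eta>_def)
  \<comment> \<open>The two demands on \<open>\<nu>\<close>: the displacement must keep the pair
    within \<open>r / 4\<close>, and the potential of the third body must stay below the net gain
    \<open>\<mu> / 2 * \<eta>^2 * \<nu>\<close>.\<close>
  define R where "R = min (r / 8) (\<mu> / 2 * \<eta>\<^sup>2)"
  have "R > 0" using r S \<eta> by (simp add: R_def)
  then obtain \<nu> where \<nu>: "\<nu> > 0" "\<nu> \<le> \<nu>1" "\<nu> \<le> 1" "\<nu>\<^sup>2 \<le> R" "CR * \<nu> ^ 3 < R * \<nu>"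
    using small_cube_root[OF c1(2) c1(2) CR] by blast
  note c = c2[OF \<nu>(1,2)]
  define b where "b = 0 + \<nu> ^ 3"
  have b: "0 < b" "b \<le> 1" using \<nu>(1) c by (auto simp: b_def)
  have near: "norm (x t $ l - x 0 $ l) \<le> r / 16" if "0 \<le> t" "t \<le> b" for t l using c that by (auto simp: b_def)
  have fd: "fin_energy 0 b d" unfolding d_def using b
    by (intro fin_energy_diff fin_kinD fin_kin_subset[OF fx]) auto
  have Ed: "energy 0 b d \<le> C * \<nu>"
  proof -
    have "C1 * \<nu> \<le> C * \<nu>" using C(3) \<nu>(1) by (intro mult_right_mono) auto
    then show ?thesis using c by (simp add: b_def)
  qed
  obtain Q where Q: "norm Q = 1" "norm (d b) *\<^sub>R Q = d b" using complex_unit_direction by blast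
  obtain u0 where u0: "norm u0 = 1" "\<And>\<epsilon>. ha (x 0 + dirv m i j (\<epsilon> *\<^sub>R u0)) = x 0 + dirv m i j (\<epsilon> *\<^sub>R u0)"
    using dir by blast
  define u where "u = (if inner Q u0 \<ge> 0 then u0 else - u0)"
  have u: "norm u = 1" "inner Q u \<ge> 0" using u0(1) by (auto simp: u_def)
  have hu: "ha (x 0 + dirv m i j (\<epsilon> *\<^sub>R u)) = x 0 + dirv m i j (\<epsilon> *\<^sub>R u)" for \<epsilon>
    using u0(2)[of \<epsilon>] u0(2)[of "- \<epsilon>"] by (auto simp: u_def)
  obtain e where e: "fin_energy 0 b e" "energy 0 b e \<le> energy 0 b d + \<eta>\<^sup>2 * \<nu>" "e 0 = (\<eta> * \<nu>\<^sup>2) *\<^sub>R u" "e b = d b"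
     "\<And>t. 0 \<le> t \<Longrightarrow> t \<le> b \<Longrightarrow> norm (e t) \<le> norm (d t) + \<nu>\<^sup>2"
     "(\<integral>\<^sup>+t\<in>{0..b}. pair_potential m i j (e t) \<partial>lborel) + ennreal (\<mu> * \<eta>\<^sup>2 * \<nu>)
      \<le> (\<integral>\<^sup>+t\<in>{0..b}. pair_potential m i j (d t) \<partial>lborel)"
    using side_competitor[OF m ij \<nu>(1) b_def fd d0 C(1,2) Ed \<eta>_def[unfolded S_def] Q u] unfolding \<mu>_def S_def by blast
  have R: "R \<le> r / 8" "R \<le> \<mu> / 2 * \<eta>\<^sup>2" by (auto simp: R_def)
  have er: "norm (e t) \<le> r / 4" if t: "0 \<le> t" "t \<le> b" for t
  proof -
    have "d t = (x t $ i - x 0 $ i) - (x t $ j - x 0 $ j)" using col by (simp add: d_def)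
    then have "norm (d t) \<le> r / 8"
      using norm_triangle_ineq4[of "x t $ i - x 0 $ i" "x t $ j - x 0 $ j"] near[OF t, of i] near[OF t, of j] by simp
    then show ?thesis using e(5)[OF t] \<nu>(4) R(1) by linarith
  qed
  show False
  proof (rule gap_contradiction[OF m x dist order_refl b near col r_def[symmetric] r e(1) er])
    show "ha (with_pair m i j x e 0) = with_pair m i j x e 0"
      using hu[of "\<eta> * \<nu>\<^sup>2"] d0 by (simp add: with_pair_def e(3) d_def)
    show "e b = x b $ i - x b $ j" using e(4) by (simp add: d_def)
    show "hb (with_pair m i j x e 1) = with_pair m i j x e 1" if "b = 1"
    proof -
      have "with_pair m i j x e 1 = x 1" using e(4) that by (intro with_pair_same) (simp add: d_def)
      then show ?thesis using x by (simp add: minimizer_def)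
    qed
    show "energy 0 b e \<le> energy 0 b (\<lambda>t. x t $ i - x t $ j) + \<eta>\<^sup>2 * \<nu>" using e(2) unfolding d_def .
    show "(\<integral>\<^sup>+t\<in>{0..b}. pair_potential m i j (e t) \<partial>lborel) + ennreal (\<mu> * \<eta>\<^sup>2 * \<nu>)
      \<le> (\<integral>\<^sup>+t\<in>{0..b}. pair_potential m i j (x t $ i - x t $ j) \<partial>lborel)" using e(6) unfolding d_def .
    show "\<mu> * \<eta>\<^sup>2 * \<nu> \<ge> 0" using S \<nu> by simp
    have "CR * (b - 0) < \<mu> / 2 * \<eta>\<^sup>2 * \<nu>"
      using \<nu>(5) mult_right_mono[OF R(2) less_imp_le[OF \<nu>(1)]] by (simp add: b_def)
    then show "mass m i * mass m j / (mass m i + mass m j) / 2 * (\<eta>\<^sup>2 * \<nu>)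
        + (mass m i + mass m j) * mass m k / (r / 4) * (b - 0) < \<mu> * \<eta>\<^sup>2 * \<nu>"
      unfolding S_def[symmetric] \<mu>_def[symmetric] CR_def[symmetric] by (simp add: mult.assoc)
  qed auto
qed

text \<open>Both branches are shifted at the collision by the same multiple of \<open>u\<close>, so
  the two one-sided competitors fit together at \<open>t0\<close>. Kinetic cost and gain double
  alike.\<close>

lemma no_pair_collision_interior:
  assumes m: "m > 0" and x: "minimizer m ha hb x" and dist: "distinct [i, j, k]" and t0: "0 < t0" "t0 < 1"
    and col: "x t0 $ i = x t0 $ j" and free: "x t0 $ i \<noteq> x t0 $ k"
  shows False
proof -
  define r where "r = norm (x t0 $ i - x t0 $ k)"
  have r: "r > 0" using free by (simp add: r_def)
  define d where "d t = x t $ i - x t $ j" for t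
  have d0: "d t0 = 0" using col by (simp add: d_def)
  have ij: "i \<noteq> j" using dist by simp
  have fx: "fin_kin 0 1 x" using x by (auto simp: minimizer_def)
  obtain C1 \<nu>1 where c1: "C1 > 0" "\<nu>1 > 0"
    and c2: "\<And>\<nu>. 0 < \<nu> \<Longrightarrow> \<nu> \<le> \<nu>1 \<Longrightarrow> t0 + \<nu> ^ 3 \<le> 1 \<and> energy t0 (t0 + \<nu> ^ 3) d \<le> C1 * \<nu> \<and>
     (\<forall>t l. t0 \<le> t \<longrightarrow> t \<le> t0 + \<nu> ^ 3 \<longrightarrow> norm (x t $ l - x t0 $ l) \<le> r / 16)"
    using minimizer_pair_energy[OF m x less_imp_le[OF t0(1)] t0(2) dist col free] unfolding d_def r_def by auto
  have t0': "0 \<le> 1 - t0" "1 - t0 < 1" "1 - (1 - t0) = t0" using t0 by auto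
  obtain C2 \<nu>2 where c3: "C2 > 0" "\<nu>2 > 0"
    and c4: "\<And>\<nu>. 0 < \<nu> \<Longrightarrow> \<nu> \<le> \<nu>2 \<Longrightarrow> 1 - t0 + \<nu> ^ 3 \<le> 1 \<and> energy (1 - t0) (1 - t0 + \<nu> ^ 3) (\<lambda>t. d (1 - t)) \<le> C2 * \<nu> \<and>
     (\<forall>t l. 1 - t0 \<le> t \<longrightarrow> t \<le> 1 - t0 + \<nu> ^ 3 \<longrightarrow> norm (x (1 - t) $ l - x t0 $ l) \<le> r / 16)"
    using minimizer_pair_energy[OF m minimizer_reverse[OF x] t0'(1,2) dist] col free unfolding t0'(3) d_def r_def by auto
  define S where "S = mass m i + mass m j"
  define \<mu> where "\<mu> = mass m i * mass m j / S"
  have S: "S > 0" "\<mu> > 0" using mass_pos[OF m] by (simp_all add: S_def \<mu>_def add_pos_pos)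
  define CR where "CR = S * mass m k / (r / 4)"
  have CR: "CR > 0" unfolding CR_def using r S mass_pos[OF m] by (intro divide_pos_pos mult_pos_pos) auto
  define C where "C = max (max 1 C2) (max S C1)"
  have C: "C \<ge> 1" "C \<ge> mass m i + mass m j" "C \<ge> C1" "C \<ge> C2" by (auto simp: C_def S_def)
  define \<eta> where "\<eta> = S / (8 * C)"
  have \<eta>: "\<eta> > 0" using S C by (simp add: \<eta>_def)
  define R where "R = min (r / 8) (\<mu> / 2 * \<eta>\<^sup>2)"
  have "R > 0" using r S \<eta> by (simp add: R_def)
  then obtain \<nu> where \<nu>: "\<nu> > 0" "\<nu> \<le> \<nu>1" "\<nu> \<le> \<nu>2" "\<nu> \<le> 1" "\<nu>\<^sup>2 \<le> R" "CR * \<nu> ^ 3 < R * \<nu>"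
    using small_cube_root[OF c1(2) c3(2) CR] by blast
  note cr = c2[OF \<nu>(1,2)] and cl = c4[OF \<nu>(1,3)]
  define a b where "a = t0 - \<nu> ^ 3" and "b = t0 + \<nu> ^ 3"
  have ab: "a < t0" "t0 < b" "0 \<le> a" "b \<le> 1" "a < b" using \<nu>(1) cr cl by (auto simp: a_def b_def)
  have near: "norm (x t $ l - x t0 $ l) \<le> r / 16" if "a \<le> t" "t \<le> b" for t l
  proof (cases "t0 \<le> t")
    case True
    then show ?thesis using cr that by (auto simp: b_def)
  next
    case False
    have "1 - t0 \<le> 1 - t" "1 - t \<le> 1 - t0 + \<nu> ^ 3" using that False by (auto simp: a_def)
    then have "norm (x (1 - (1 - t)) $ l - x t0 $ l) \<le> r / 16" using cl by blast
    then show ?thesis by simp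
  qed
  have fdd: "fin_energy a b d" unfolding d_def using ab
    by (intro fin_energy_diff fin_kinD fin_kin_subset[OF fx]) auto
  have fd: "fin_energy a t0 d" "fin_energy t0 b d" using ab by (auto intro!: fin_energy_subset[OF fdd])
  have Cm: "C1 * \<nu> \<le> C * \<nu>" "C2 * \<nu> \<le> C * \<nu>" using C \<nu>(1) by (auto intro!: mult_right_mono)
  have Er: "energy t0 b d \<le> C * \<nu>" using cr Cm by (simp add: b_def)
  have El: "energy a t0 d \<le> C * \<nu>"
  proof -
    have r1: "1 - (1 - t0 + \<nu> ^ 3) = a" by (simp add: a_def)
    have "energy (1 - t0) (1 - t0 + \<nu> ^ 3) (\<lambda>t. d (1 - t)) = energy a t0 d"
      using energy_reflect(2)[of "1 - t0" "1 - t0 + \<nu> ^ 3" 1 d] fd(1) \<nu>(1) unfolding r1 t0'(3) by simp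
    then show ?thesis using cl Cm by simp
  qed
  obtain P where P: "norm P = 1" "norm (d a) *\<^sub>R P = d a" using complex_unit_direction by blast
  obtain Q where Q: "norm Q = 1" "norm (d b) *\<^sub>R Q = d b" using complex_unit_direction by blast
  obtain u where u: "norm u = 1" "inner P u \<ge> 0" "inner Q u \<ge> 0" using complex_common_halfplane[OF P(1) Q(1)] by blast
  obtain e where e: "fin_energy t0 b e" "energy t0 b e \<le> energy t0 b d + \<eta>\<^sup>2 * \<nu>" "e t0 = (\<eta> * \<nu>\<^sup>2) *\<^sub>R u" "e b = d b"
     "\<And>t. t0 \<le> t \<Longrightarrow> t \<le> b \<Longrightarrow> norm (e t) \<le> norm (d t) + \<nu>\<^sup>2"
     "(\<integral>\<^sup>+t\<in>{t0..b}. pair_potential m i j (e t) \<partial>lborel) + ennreal (\<mu> * \<eta>\<^sup>2 * \<nu>)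
      \<le> (\<integral>\<^sup>+t\<in>{t0..b}. pair_potential m i j (d t) \<partial>lborel)"
    using side_competitor[OF m ij \<nu>(1) b_def fd(2) d0 C(1,2) Er \<eta>_def[unfolded S_def] Q u(1,3)] unfolding \<mu>_def S_def by blast
  obtain f where f: "fin_energy a t0 f" "energy a t0 f \<le> energy a t0 d + \<eta>\<^sup>2 * \<nu>" "f t0 = (\<eta> * \<nu>\<^sup>2) *\<^sub>R u" "f a = d a"
     "\<And>t. a \<le> t \<Longrightarrow> t \<le> t0 \<Longrightarrow> norm (f t) \<le> norm (d t) + \<nu>\<^sup>2"
     "(\<integral>\<^sup>+t\<in>{a..t0}. pair_potential m i j (f t) \<partial>lborel) + ennreal (\<mu> * \<eta>\<^sup>2 * \<nu>)
      \<le> (\<integral>\<^sup>+t\<in>{a..t0}. pair_potential m i j (d t) \<partial>lborel)"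
    using side_competitor_left[OF m ij \<nu>(1) a_def fd(1) d0 C(1,2) El \<eta>_def[unfolded S_def] P u(1,2)] unfolding \<mu>_def S_def by blast
  define g where "g t = (if t \<le> t0 then f t else e t)" for t
  have gf: "g t = f t" if "a \<le> t" "t \<le> t0" for t using that by (simp add: g_def)
  have ge: "g t = e t" if "t0 \<le> t" "t \<le> b" for t using that e(3) f(3) by (cases "t = t0") (auto simp: g_def)
  have fg: "fin_energy a t0 g" "energy a t0 g = energy a t0 f" using energy_cong[of a t0 g f] gf f(1) by auto
  have fg': "fin_energy t0 b g" "energy t0 b g = energy t0 b e" using energy_cong[of t0 b g e] ge e(1) by auto
  have fgg: "fin_energy a b g" "energy a b g = energy a t0 f + energy t0 b e"
    using energy_add[OF less_imp_le[OF ab(1)] less_imp_le[OF ab(2)] fg(1) fg'(1)] fg(2) fg'(2) by auto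
  have Ed: "energy a b d = energy a t0 d + energy t0 b d" using ab by (intro energy_split[OF fdd]) auto
  have R: "R \<le> r / 8" "R \<le> \<mu> / 2 * \<eta>\<^sup>2" by (auto simp: R_def)
  have gr: "norm (g t) \<le> r / 4" if t: "a \<le> t" "t \<le> b" for t
  proof -
    have "d t = (x t $ i - x t0 $ i) - (x t $ j - x t0 $ j)" using col by (simp add: d_def)
    then have dr: "norm (d t) \<le> r / 8"
      using norm_triangle_ineq4[of "x t $ i - x t0 $ i" "x t $ j - x t0 $ j"] near[OF t, of i] near[OF t, of j] by simp
    have "norm (g t) \<le> norm (d t) + \<nu>\<^sup>2" using e(5)[of t] f(5)[of t] t by (auto simp: g_def)
    then show ?thesis using dr \<nu>(5) R(1) by linarith
  qed
  have split: "(\<integral>\<^sup>+t\<in>{a..b}. pair_potential m i j (w t) \<partial>lborel) =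
      (\<integral>\<^sup>+t\<in>{a..t0}. pair_potential m i j (w t) \<partial>lborel) + (\<integral>\<^sup>+t\<in>{t0..b}. pair_potential m i j (w t) \<partial>lborel)"
    if "fin_energy a t0 w" "fin_energy t0 b w" for w
    using that ab by (intro nn_integral_interval_split measurable_pair_potential fin_energy_isCont) auto
  have ig: "(\<integral>\<^sup>+t\<in>{a..t0}. pair_potential m i j (g t) \<partial>lborel) = (\<integral>\<^sup>+t\<in>{a..t0}. pair_potential m i j (f t) \<partial>lborel)"
    "(\<integral>\<^sup>+t\<in>{t0..b}. pair_potential m i j (g t) \<partial>lborel) = (\<integral>\<^sup>+t\<in>{t0..b}. pair_potential m i j (e t) \<partial>lborel)"
    by (intro nn_integral_cong; auto simp: indicator_def gf ge)+
  show False
  proof (rule gap_contradiction[OF m x dist ab(3,5,4) near col r_def[symmetric] r fgg(1) gr])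
    show "g a = x a $ i - x a $ j" using f(4) ab by (simp add: g_def d_def)
    show "g b = x b $ i - x b $ j" using e(4) ab by (simp add: g_def d_def)
    show "ha (with_pair m i j x g 0) = with_pair m i j x g 0" if "a = 0"
    proof -
      have "with_pair m i j x g 0 = x 0" using f(4) that ab by (intro with_pair_same) (simp add: g_def d_def)
      then show ?thesis using x by (simp add: minimizer_def)
    qed
    show "hb (with_pair m i j x g 1) = with_pair m i j x g 1" if "b = 1"
    proof -
      have "with_pair m i j x g 1 = x 1" using e(4) that ab by (intro with_pair_same) (simp add: g_def d_def)
      then show ?thesis using x by (simp add: minimizer_def)
    qed
    show "energy a b g \<le> energy a b (\<lambda>t. x t $ i - x t $ j) + 2 * (\<eta>\<^sup>2 * \<nu>)"
      using e(2) f(2) Ed fgg(2) unfolding d_def by linarith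
    have "ennreal (2 * (\<mu> * \<eta>\<^sup>2 * \<nu>)) = ennreal (\<mu> * \<eta>\<^sup>2 * \<nu>) + ennreal (\<mu> * \<eta>\<^sup>2 * \<nu>)"
      using S \<nu> by (subst ennreal_plus[symmetric]) auto
    then show "(\<integral>\<^sup>+t\<in>{a..b}. pair_potential m i j (g t) \<partial>lborel) + ennreal (2 * (\<mu> * \<eta>\<^sup>2 * \<nu>))
      \<le> (\<integral>\<^sup>+t\<in>{a..b}. pair_potential m i j (x t $ i - x t $ j) \<partial>lborel)"
      using add_mono[OF f(6) e(6)] split[OF fg(1) fg'(1)] split[OF fd] ig
      unfolding d_def by (simp add: ac_simps)
    show "2 * (\<mu> * \<eta>\<^sup>2 * \<nu>) \<ge> 0" using S \<nu> by simp
    have "CR * \<nu> ^ 3 < \<mu> / 2 * \<eta>\<^sup>2 * \<nu>"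
      using \<nu>(6) mult_right_mono[OF R(2) less_imp_le[OF \<nu>(1)]] by simp
    moreover have "b - a = 2 * \<nu> ^ 3" by (simp add: a_def b_def)
    ultimately show "mass m i * mass m j / (mass m i + mass m j) / 2 * (2 * (\<eta>\<^sup>2 * \<nu>))
        + (mass m i + mass m j) * mass m k / (r / 4) * (b - a) < 2 * (\<mu> * \<eta>\<^sup>2 * \<nu>)"
      unfolding S_def[symmetric] \<mu>_def[symmetric] CR_def[symmetric] by (simp add: mult_ac)
  qed
qed

section \<open>Existence of minimizers\<close>

definition center :: "real \<Rightarrow> config \<Rightarrow> complex" where
  "center m x = (x $ 1 + x $ 2 + of_real m * x $ 3) / of_real (2 + m)"

definition centered :: "real \<Rightarrow> config \<Rightarrow> config" where
  "centered m x = (\<chi> i. x $ i - center m x)"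

lemma sum_UNIV_3: "sum f (UNIV :: 3 set) = f 1 + f 2 + f 3"
  by (rule sum_3_distinct) simp

lemma centered_config_space: "m > 0 \<Longrightarrow> centered m x \<in> config_space m"
proof -
  assume "m > 0"
  then have "of_real (2 + m) \<noteq> (0 :: complex)" by (simp only: of_real_eq_0_iff)
  then have "of_real (2 + m) * center m x = x $ 1 + x $ 2 + of_real m * x $ 3" by (simp add: center_def)
  then show ?thesis by (simp add: config_space_def centered_def algebra_simps)
qed

lemma h1_fixed: "h1 x = x \<longleftrightarrow> (\<forall>i. cnj (x $ i) = x $ i)"
  by (auto simp: h1_def vec_eq_iff forall_3)

lemma h2_fixed: "h2 \<theta> x = x \<longleftrightarrow> refl \<theta> (x $ 2) = x $ 1 \<and> refl \<theta> (x $ 1) = x $ 2 \<and> refl \<theta> (x $ 3) = x $ 3"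
  by (auto simp: h2_def vec_eq_iff forall_3)

lemma refl_simps: "refl \<theta> (z + w) = refl \<theta> z + refl \<theta> w" "refl \<theta> (z - w) = refl \<theta> z - refl \<theta> w"
  "refl \<theta> (of_real c * z) = of_real c * refl \<theta> z" "refl \<theta> (c *\<^sub>R z) = c *\<^sub>R refl \<theta> z" "refl \<theta> (- z) = - refl \<theta> z" "refl \<theta> 0 = 0"
  "refl \<theta> (z / of_real c) = refl \<theta> z / of_real c"
  by (simp_all add: refl_def algebra_simps scaleR_conv_of_real)

lemma h1_centered: "h1 x = x \<Longrightarrow> h1 (centered m x) = centered m x"
  by (simp add: h1_fixed centered_def center_def)

lemma h2_centered: "h2 \<theta> x = x \<Longrightarrow> h2 \<theta> (centered m x) = centered m x"
proof -
  assume a: "h2 \<theta> x = x"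
  have "refl \<theta> (center m x) = (refl \<theta> (x $ 1) + refl \<theta> (x $ 2) + of_real m * refl \<theta> (x $ 3)) / of_real (2 + m)"
    unfolding center_def refl_simps ..
  also have "\<dots> = center m x" using a unfolding h2_fixed by (simp add: center_def add_ac)
  finally have c: "refl \<theta> (center m x) = center m x" .
  show ?thesis using a unfolding h2_fixed centered_def vec_lambda_beta refl_simps c by simp
qed

lemma potential_centered: "potential m (centered m x) = potential m x"
  by (simp add: potential_def centered_def)

text \<open>Koenig's theorem for three masses: the motion of the centre of mass carries its own
  nonnegative share of the kinetic part, which centering removes.\<close>

lemma kin_centered:
  assumes m: "m > 0" and ab: "a \<le> b" and y: "fin_kin a b y"
  shows "fin_kin a b (\<lambda>t. centered m (y t))" "kin m a b (\<lambda>t. centered m (y t)) \<le> kin m a b y"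
proof -
  define c where "c t = center m (y t)" for t
  have c_eq: "c t = inverse (of_real (2 + m)) * (y t $ 1 + y t $ 2 + of_real m * y t $ 3)" for t
    by (simp add: c_def center_def divide_inverse mult.commute)
  have fc: "fin_energy a b c" unfolding c_eq
    by (intro fin_energy_linear energy_add_functions fin_kinD[OF y] ab)
  show f: "fin_kin a b (\<lambda>t. centered m (y t))"
    unfolding fin_kin_def centered_def vec_lambda_beta c_def[symmetric]
    by (intro allI fin_energy_diff fin_kinD[OF y] fc ab)
  define f where "f l = (case l of None \<Rightarrow> c | Some l \<Rightarrow> (\<lambda>t. centered m (y t) $ l))" for l :: "3 option"
  define g where "g l = (\<lambda>t. y t $ l)" for l :: 3
  define w where "w l = (case l of None \<Rightarrow> 2 + m | Some l \<Rightarrow> mass m l)" for l :: "3 option"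
  have S: "sum F UNIV = F None + (F (Some 1) + F (Some 2) + F (Some 3))" for F :: "3 option \<Rightarrow> real"
    by (simp add: UNIV_option_conv sum.reindex sum_UNIV_3)
  have real_id: "(2 + m) * z\<^sup>2 + (1 * (p - z)\<^sup>2 + 1 * (q - z)\<^sup>2 + m * (r - z)\<^sup>2) = 1 * p\<^sup>2 + 1 * q\<^sup>2 + m * r\<^sup>2"
    if "(2 + m) * z = p + q + m * r" for p q r z :: real
  proof -
    have "(2 + m) * z\<^sup>2 + (1 * (p - z)\<^sup>2 + 1 * (q - z)\<^sup>2 + m * (r - z)\<^sup>2)
        = p\<^sup>2 + q\<^sup>2 + m * r\<^sup>2 + 2 * z * ((2 + m) * z - (p + q + m * r))"
      by (simp add: power2_eq_square algebra_simps)
    then show ?thesis using that by simp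
  qed
  have id: "(\<Sum>l\<in>UNIV. w l * (norm (f l t - f l s))\<^sup>2) = (\<Sum>l\<in>UNIV. mass m l * (norm (g l t - g l s))\<^sup>2)" for s t
  proof -
    define p q r z where "p = y t $ 1 - y s $ 1" and "q = y t $ 2 - y s $ 2" and "r = y t $ 3 - y s $ 3" and "z = c t - c s"
    have nz: "of_real (2 + m) \<noteq> (0 :: complex)" using m by (simp only: of_real_eq_0_iff)
    have "of_real (2 + m) * c u = y u $ 1 + y u $ 2 + of_real m * y u $ 3" for u
      using nz by (simp add: c_def center_def)
    from this[of t] this[of s] have z: "of_real (2 + m) * z = p + q + of_real m * r"
      by (simp add: z_def p_def q_def r_def algebra_simps)
    have z1: "(2 + m) * Re z = Re p + Re q + m * Re r" "(2 + m) * Im z = Im p + Im q + m * Im r"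
      using arg_cong[OF z, of Re] arg_cong[OF z, of Im] by simp_all
    have e: "centered m (y t) $ 1 - centered m (y s) $ 1 = p - z" "centered m (y t) $ 2 - centered m (y s) $ 2 = q - z"
      "centered m (y t) $ 3 - centered m (y s) $ 3 = r - z"
      by (simp_all add: centered_def c_def[symmetric] p_def q_def r_def z_def)
    have "(\<Sum>l\<in>UNIV. w l * (norm (f l t - f l s))\<^sup>2)
        = (2 + m) * (norm z)\<^sup>2 + (1 * (norm (p - z))\<^sup>2 + 1 * (norm (q - z))\<^sup>2 + m * (norm (r - z))\<^sup>2)"
      unfolding S by (simp add: w_def f_def e mass_def z_def)
    also have "\<dots> = 1 * (norm p)\<^sup>2 + 1 * (norm q)\<^sup>2 + m * (norm r)\<^sup>2"
      using real_id[OF z1(1)] real_id[OF z1(2)]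
      unfolding cmod_power2 minus_complex.sel distrib_left by linarith
    also have "\<dots> = (\<Sum>l\<in>UNIV. mass m l * (norm (g l t - g l s))\<^sup>2)"
      unfolding sum_UNIV_3 by (simp add: g_def mass_def p_def q_def r_def)
    finally show ?thesis .
  qed
  have "(\<Sum>l\<in>UNIV. w l * energy a b (f l)) = (\<Sum>l\<in>UNIV. mass m l * energy a b (g l))"
  proof (rule energy_combination)
    show "fin_energy a b (f l)" for l using fc fin_kinD[OF f] by (cases l) (auto simp: f_def)
    show "fin_energy a b (g l)" for l using fin_kinD[OF y] by (auto simp: g_def)
  qed (rule id)
  then have "(2 + m) * energy a b c + 2 * kin m a b (\<lambda>t. centered m (y t)) = 2 * kin m a b y"
    unfolding S kin_def sum_UNIV_3 by (simp add: w_def f_def g_def algebra_simps)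
  then show "kin m a b (\<lambda>t. centered m (y t)) \<le> kin m a b y"
    using m energy_nonneg[OF fc] by (smt (verit) mult_nonneg_nonneg)
qed

definition admissible :: "real \<Rightarrow> real \<Rightarrow> (real \<Rightarrow> config) set" where
  "admissible m \<theta> = {y. fin_kin 0 1 y \<and> h1 (y 0) = y 0 \<and> h2 \<theta> (y 1) = y 1 \<and> (\<forall>t\<in>{0..1}. y t \<in> config_space m)}"

text \<open>Centering respects both boundary maps, keeps the potential and does not raise the
  kinetic part. A minimum among centred paths is therefore one among all paths, which frees the
  variations from the constraint.\<close>

lemma minimizer_from_admissible:
  assumes m: "m > 0" and x: "x \<in> admissible m \<theta>" "pot m 0 1 x < \<infinity>"
    and min: "\<And>y. y \<in> admissible m \<theta> \<Longrightarrow> ennreal (kin m 0 1 x) + pot m 0 1 x \<le> ennreal (kin m 0 1 y) + pot m 0 1 y"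
  shows "minimizer m h1 (h2 \<theta>) x"
  unfolding minimizer_def
proof (intro conjI allI impI)
  show "fin_kin 0 1 x" "h1 (x 0) = x 0" "h2 \<theta> (x 1) = x 1" "pot m 0 1 x < \<infinity>" using x by (auto simp: admissible_def)
  fix y assume y: "fin_kin 0 1 y" "h1 (y 0) = y 0" "h2 \<theta> (y 1) = y 1"
  let ?z = "\<lambda>t. centered m (y t)"
  have "?z \<in> admissible m \<theta>"
    using kin_centered(1)[OF m _ y(1)] y h1_centered h2_centered centered_config_space[OF m] by (simp add: admissible_def)
  from min[OF this] have "ennreal (kin m 0 1 x) + pot m 0 1 x \<le> ennreal (kin m 0 1 ?z) + pot m 0 1 ?z" .
  also have "pot m 0 1 ?z = pot m 0 1 y" by (simp add: pot_def potential_centered)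
  also have "ennreal (kin m 0 1 ?z) + pot m 0 1 y \<le> ennreal (kin m 0 1 y) + pot m 0 1 y"
    using kin_centered(2)[OF m _ y(1)] by (intro add_right_mono ennreal_leI) simp
  finally show "ennreal (kin m 0 1 x) + pot m 0 1 x \<le> ennreal (kin m 0 1 y) + pot m 0 1 y" .
qed

section \<open>Coercivity and compactness\<close>

text \<open>\<open>inverse\<close> is continuous on all of \<open>ennreal\<close>, with the value
  infinity at 0, so limits with collisions are covered; Fatou's lemma is applied to such
  limits.\<close>

lemma tendsto_potential:
  fixes y :: "'a \<Rightarrow> config"
  assumes lim: "\<And>i. ((\<lambda>n. y n $ i) \<longlongrightarrow> z $ i) F"
  shows "((\<lambda>n. potential m (y n)) \<longlongrightarrow> potential m z) F"
proof -
  have inv: "((\<lambda>n. inverse (f n)) \<longlongrightarrow> inverse l) F" if "(f \<longlongrightarrow> l) F" for f :: "'a \<Rightarrow> ennreal" and l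
    by (rule continuous_on_tendsto_compose[where f=inverse and g=f and s=UNIV,
        OF continuous_on_inverse_ennreal[OF continuous_on_id] that]) auto
  have *: "((\<lambda>n. ennreal c / ennreal (norm (y n $ i - y n $ j))) \<longlongrightarrow> ennreal c / ennreal (norm (z $ i - z $ j))) F" for c i j
    unfolding divide_ennreal_def
    by (intro ennreal_tendsto_cmult inv tendsto_ennrealI tendsto_norm tendsto_diff lim) auto
  show ?thesis unfolding potential_def by (intro tendsto_add *)
qed

text \<open>The left-hand side is the distance of the real point \<open>p\<close> from the line
  through 0 orthogonal to \<open>cis \<alpha>\<close>, on which \<open>q\<close> lies.\<close>

lemma real_line_distance:
  fixes p q :: complex
  assumes "Im p = 0" "Re (q * cis (- \<alpha>)) = 0"
  shows "norm p * \<bar>cos \<alpha>\<bar> \<le> norm (q - p)"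
proof -
  have "Re ((q - p) * cis (- \<alpha>)) = - Re p * cos \<alpha>" using assms by (simp add: algebra_simps)
  then have "\<bar>Re p * cos \<alpha>\<bar> \<le> norm ((q - p) * cis (- \<alpha>))" using abs_Re_le_cmod[of "(q - p) * cis (- \<alpha>)"] by simp
  also have "\<dots> = norm (q - p)" by (simp add: norm_mult)
  finally show ?thesis using assms(1) by (simp add: cmod_eq_Re abs_mult)
qed

text \<open>The boundary conditions supply coercivity. At time 0 all bodies are on the real line; at
  time 1 the difference of bodies 1 and 2 is orthogonal to \<open>cis \<theta>\<close>, and body 3
  is on the line along \<open>cis \<theta>\<close>. For \<open>0 < \<theta> < pi / 2\<close> these
  lines are transversal to the real one, so bounded displacements bound the initial difference and
  the initial position of body 3; the centre-of-mass equation recovers the rest.\<close>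

lemma admissible_bound:
  assumes m: "m > 0" and \<theta>: "0 < \<theta>" "\<theta> < pi / 2"
  shows "\<exists>B. \<forall>y\<in>admissible m \<theta>. kin m 0 1 y \<le> K \<longrightarrow> (\<forall>t\<in>{0..1}. norm (y t) \<le> B)"
proof -
  have cs: "cos \<theta> > 0" "sin \<theta> > 0" using \<theta> by (auto intro!: cos_gt_zero sin_gt_zero)
  define H where "H = sqrt (max 0 (2 * K)) + sqrt (max 0 (2 * K / m))"
  have H0: "H \<ge> 0" using m by (simp add: H_def)
  have incr: "norm (y t $ i - y s $ i) \<le> H" if y: "fin_kin 0 1 y" "kin m 0 1 y \<le> K" and st: "s \<in> {0..1}" "t \<in> {0..1}" for y s t i
  proof -
    have "energy 0 1 (\<lambda>t. y t $ i) \<le> 2 * K / mass m i"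
    proof -
      have "mass m i / 2 * energy 0 1 (\<lambda>t. y t $ i) \<le> K" using kin_le_energy_bound[OF m y(1), of i] y(2) by simp
      then show ?thesis using mass_pos[OF m, of i] by (simp add: field_simps)
    qed
    moreover have "(norm (y t $ i - y s $ i))\<^sup>2 \<le> energy 0 1 (\<lambda>t. y t $ i)"
    proof -
      note f = fin_kinD[OF y(1), of i]
      have "(norm (y t $ i - y s $ i))\<^sup>2 \<le> \<bar>t - s\<bar> * energy 0 1 (\<lambda>t. y t $ i)"
        using energy_ge[OF f, of s t] energy_ge[OF f, of t s] st by (cases "s \<le> t") (auto simp: norm_minus_commute)
      also have "\<dots> \<le> 1 * energy 0 1 (\<lambda>t. y t $ i)"
        using st energy_nonneg[OF f] by (intro mult_right_mono) auto
      finally show ?thesis by simp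
    qed
    ultimately have "norm (y t $ i - y s $ i) \<le> sqrt (max 0 (2 * K / mass m i))"
      by (intro real_le_rsqrt) linarith
    also have "\<dots> \<le> H" using m by (auto simp: H_def mass_def)
    finally show ?thesis .
  qed
  define B0 where "B0 = 2 * H / cos \<theta> + (1 + m) * (H / sin \<theta>)"
  show ?thesis
  proof (intro exI[of _ "3 * (B0 + H)"] ballI impI)
    fix y t assume y: "y \<in> admissible m \<theta>" and K: "kin m 0 1 y \<le> K" and t: "t \<in> {0..1::real}"
    have fy: "fin_kin 0 1 y" and b0: "h1 (y 0) = y 0" and b1: "h2 \<theta> (y 1) = y 1" and cs0: "y 0 \<in> config_space m"
      using y by (auto simp: admissible_def)
    have im: "Im (y 0 $ i) = 0" for i using b0 unfolding h1_fixed by (metis complex_cnj_cancel_iff Reals_cnj_iff complex_is_Real_iff)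
    have imz: "Im z = 0" if "z = cnj z" for z using arg_cong[OF that, of Im] by simp
    have r: "y 1 $ 1 = cis (2 * \<theta>) * cnj (y 1 $ 2)" "y 1 $ 3 = cis (2 * \<theta>) * cnj (y 1 $ 3)"
      using b1 unfolding h2_fixed refl_def by auto
    have c2: "cis (2 * \<theta>) * cis (- \<theta>) = cnj (cis (- \<theta>))" by (simp add: cis_mult cis_cnj)
    have "y 1 $ 1 * cis (- \<theta>) = cnj (y 1 $ 2 * cis (- \<theta>))"
      unfolding r(1) complex_cnj_mult c2[symmetric] by (simp add: mult_ac)
    then have u1: "Re ((y 1 $ 1 - y 1 $ 2) * cis (- \<theta>)) = 0" by (simp add: left_diff_distrib)
    have "y 1 $ 3 * cis (- \<theta>) = cnj (y 1 $ 3 * cis (- \<theta>))"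
      unfolding complex_cnj_mult c2[symmetric] by (subst r(2)) (simp add: mult_ac)
    then have w0: "Im (y 1 $ 3 * cis (- \<theta>)) = 0" by (rule imz)
    \<comment> \<open>The line along \<open>cis \<theta>\<close> is orthogonal to
      \<open>cis (\<theta> + pi / 2)\<close>, and the cosine of that angle is
      \<open>- sin \<theta>\<close>: \<open>real_line_distance\<close> applies to body 3 as
      well.\<close>
    have "cis (- (\<theta> + pi / 2)) = cis (- \<theta>) * (- \<i>)"
      by (simp add: complex_eq_iff cos_add sin_add cos_diff sin_diff)
    then have "y 1 $ 3 * cis (- (\<theta> + pi / 2)) = y 1 $ 3 * cis (- \<theta>) * (- \<i>)" by (simp add: mult.assoc)
    then have w1: "Re (y 1 $ 3 * cis (- (\<theta> + pi / 2))) = 0" using w0 by simp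
    have u0: "Im (y 0 $ 1 - y 0 $ 2) = 0" using im by simp
    have U: "norm (y 0 $ 1 - y 0 $ 2) * cos \<theta> \<le> 2 * H"
    proof -
      have "norm (y 0 $ 1 - y 0 $ 2) * \<bar>cos \<theta>\<bar> \<le> norm ((y 1 $ 1 - y 1 $ 2) - (y 0 $ 1 - y 0 $ 2))"
        by (rule real_line_distance[OF u0 u1])
      also have "\<dots> = norm ((y 1 $ 1 - y 0 $ 1) - (y 1 $ 2 - y 0 $ 2))" by (simp add: algebra_simps)
      also have "\<dots> \<le> H + H"
        using norm_triangle_ineq4[of "y 1 $ 1 - y 0 $ 1" "y 1 $ 2 - y 0 $ 2"] incr[OF fy K, of 0 1 1] incr[OF fy K, of 0 1 2] by simp
      finally show ?thesis using cs by simp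
    qed
    have W: "norm (y 0 $ 3) * sin \<theta> \<le> H"
    proof -
      have "norm (y 0 $ 3) * \<bar>cos (\<theta> + pi / 2)\<bar> \<le> norm (y 1 $ 3 - y 0 $ 3)"
        by (rule real_line_distance[OF im w1])
      then show ?thesis using incr[OF fy K, of 0 1 3] cs by (simp add: cos_add)
    qed
    have u: "norm (y 0 $ 1 - y 0 $ 2) \<le> 2 * H / cos \<theta>" and w: "norm (y 0 $ 3) \<le> H / sin \<theta>"
      using U W cs by (simp_all add: pos_le_divide_eq)
    have e: "2 * y 0 $ 1 = (y 0 $ 1 - y 0 $ 2) - of_real m * y 0 $ 3" "2 * y 0 $ 2 = - (y 0 $ 1 - y 0 $ 2) - of_real m * y 0 $ 3"
    proof -
      have "y 0 $ 1 = - y 0 $ 2 - of_real m * y 0 $ 3" using cs0 unfolding config_space_def mem_Collect_eq by algebra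
      then show "2 * y 0 $ 1 = (y 0 $ 1 - y 0 $ 2) - of_real m * y 0 $ 3" "2 * y 0 $ 2 = - (y 0 $ 1 - y 0 $ 2) - of_real m * y 0 $ 3"
        by simp_all
    qed
    have mw: "norm (of_real m * y 0 $ 3) \<le> m * (H / sin \<theta>)" using mult_left_mono[OF w, of m] m by (simp add: norm_mult)
    have nn: "H / sin \<theta> \<ge> 0" "H / cos \<theta> \<ge> 0" using H0 cs by auto
    have "2 * norm (y 0 $ 1) \<le> 2 * H / cos \<theta> + m * (H / sin \<theta>)"
      using norm_triangle_ineq4[of "y 0 $ 1 - y 0 $ 2" "of_real m * y 0 $ 3"] u mw unfolding e(1)[symmetric] by (simp add: norm_mult)
    moreover have "2 * norm (y 0 $ 2) \<le> 2 * H / cos \<theta> + m * (H / sin \<theta>)"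
      using norm_triangle_ineq4[of "- (y 0 $ 1 - y 0 $ 2)" "of_real m * y 0 $ 3"] u mw unfolding e(2)[symmetric] norm_minus_cancel by (simp add: norm_mult)
    moreover have "m * (H / sin \<theta>) \<ge> 0" by (intro mult_nonneg_nonneg nn(1) less_imp_le[OF m])
    moreover have "2 * H / cos \<theta> \<ge> 0" using H0 cs by simp
    moreover have aux: "p \<le> X + (Y + Z)" if "2 * p \<le> X + Z" "0 \<le> X" "0 \<le> Z" "0 \<le> Y" for p X Y Z :: real
      using that by linarith
    moreover have "q \<le> X + (Y + Z)" if "q \<le> Y" "0 \<le> X" "0 \<le> Z" for q X Y Z :: real
      using that by linarith
    ultimately have "norm (y 0 $ 1) \<le> B0" "norm (y 0 $ 2) \<le> B0" "norm (y 0 $ 3) \<le> B0"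
      using w nn(1) unfolding B0_def distrib_right mult_1 by blast+
    then have "norm (y 0 $ i) \<le> B0" for i
      using exhaust_3[of i] by (elim disjE) (simp_all only:)
    then have "norm (y t $ i) \<le> B0 + H" for i
    proof -
      have "norm (y t $ i) \<le> norm (y 0 $ i) + norm (y t $ i - y 0 $ i)"
        using norm_triangle_ineq[of "y 0 $ i" "y t $ i - y 0 $ i"] by simp
      moreover have "norm (y t $ i - y 0 $ i) \<le> H" using t by (intro incr[OF fy K]) auto
      ultimately show ?thesis using \<open>\<And>i. norm (y 0 $ i) \<le> B0\<close>[of i] by linarith
    qed
    then have "(\<Sum>i\<in>UNIV. norm (y t $ i)) \<le> 3 * (B0 + H)" unfolding sum_UNIV_3
      using \<open>\<And>i. norm (y t $ i) \<le> B0 + H\<close>[of 1] \<open>\<And>i. norm (y t $ i) \<le> B0 + H\<close>[of 2] \<open>\<And>i. norm (y t $ i) \<le> B0 + H\<close>[of 3] unfolding distrib_left by linarith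
    then show "norm (y t) \<le> 3 * (B0 + H)"
      unfolding norm_vec_def using L2_set_le_sum[of UNIV "\<lambda>i. norm (y t $ i)"] by simp
  qed
qed

lemma psum_tendsto:
  assumes "\<And>t. t \<in> set ts \<Longrightarrow> ((\<lambda>n. f n t) \<longlongrightarrow> g t) F"
  shows "((\<lambda>n. psum (f n) ts) \<longlongrightarrow> psum g ts) F"
  using assms
proof (induction ts rule: induct_list012)
  case (3 s t ts)
  have "((\<lambda>n. psum (f n) (t # ts)) \<longlongrightarrow> psum g (t # ts)) F" using 3 by auto
  moreover have "((\<lambda>n. (norm (f n t - f n s))\<^sup>2 / (t - s)) \<longlongrightarrow> (norm (g t - g s))\<^sup>2 / (t - s)) F"
    unfolding divide_inverse
    by (intro tendsto_mult tendsto_const tendsto_power tendsto_norm tendsto_diff 3(3)) auto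
  ultimately show ?case by (auto intro: tendsto_add)
qed auto

lemma minimizer_exists:
  assumes m: "m > 0" and \<theta>: "0 < \<theta>" "\<theta> < pi / 2" and z: "z \<in> admissible m \<theta>" "pot m 0 1 z < \<infinity>"
  shows "\<exists>x. minimizer m h1 (h2 \<theta>) x \<and> x \<in> admissible m \<theta> \<and>
    kin m 0 1 x + enn2real (pot m 0 1 x) \<le> kin m 0 1 z + enn2real (pot m 0 1 z)"
proof -
  define A where "A y = kin m 0 1 y + enn2real (pot m 0 1 y)" for y
  define V where "V = A ` {y \<in> admissible m \<theta>. pot m 0 1 y < \<infinity>}"
  define I where "I = Inf V"
  have fk: "fin_kin 0 1 y" if "y \<in> admissible m \<theta>" for y using that by (simp add: admissible_def)
  have A0: "A y \<ge> 0" "kin m 0 1 y \<le> A y" if "y \<in> admissible m \<theta>" for y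
    using kin_nonneg[OF m fk[OF that]] by (simp_all add: A_def)
  have bdd: "bdd_below V" unfolding V_def using A0 by (intro bdd_belowI[of _ 0]) auto
  have ne: "V \<noteq> {}" using z by (auto simp: V_def)
  have "\<exists>y. y \<in> admissible m \<theta> \<and> pot m 0 1 y < \<infinity> \<and> A y < I + 1 / real (Suc n)" for n
  proof -
    have "Inf V < I + 1 / real (Suc n)" by (simp add: I_def)
    from cInf_lessD[OF ne this] show ?thesis unfolding V_def by blast
  qed
  then obtain y where y: "\<And>n. y n \<in> admissible m \<theta>" "\<And>n. pot m 0 1 (y n) < \<infinity>" "\<And>n. A (y n) < I + 1 / real (Suc n)"
    by metis
  have yK: "kin m 0 1 (y n) \<le> I + 1" for n
  proof -
    have "1 / real (Suc n) \<le> 1" by simp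
    then show ?thesis using A0(2)[OF y(1), of n] y(3)[of n] by linarith
  qed
  have eb: "energy 0 1 (\<lambda>t. y n t $ i) \<le> 2 * (I + 1) / mass m i" for n i
    using kin_le_energy_bound[OF m fk[OF y(1)], of i n] yK[of n] mass_pos[OF m, of i] by (simp add: field_simps)
  obtain B where B: "\<And>n t. t \<in> {0..1} \<Longrightarrow> norm (y n t) \<le> B"
    using admissible_bound[OF m \<theta>, of "I + 1"] y(1) yK by blast
  define H where "H = sqrt (\<Sum>i\<in>UNIV. max 0 (2 * (I + 1) / mass m i))"
  have H: "(norm (y n t - y n s)) \<le> 3 * (H * sqrt \<bar>t - s\<bar>)" if st: "s \<in> {0..1}" "t \<in> {0..1}" for n s t
  proof -
    have "norm (y n t $ i - y n s $ i) \<le> H * sqrt \<bar>t - s\<bar>" for i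
    proof -
      note f = fin_kinD[OF fk[OF y(1)[of n]], of i]
      have "(norm (y n t $ i - y n s $ i))\<^sup>2 \<le> \<bar>t - s\<bar> * energy 0 1 (\<lambda>t. y n t $ i)"
        using energy_ge[OF f, of s t] energy_ge[OF f, of t s] st by (cases "s \<le> t") (auto simp: norm_minus_commute)
      also have "\<dots> \<le> \<bar>t - s\<bar> * (\<Sum>i\<in>UNIV. max 0 (2 * (I + 1) / mass m i))"
      proof (rule mult_left_mono)
        have "max 0 (2 * (I + 1) / mass m i) \<le> (\<Sum>i\<in>UNIV. max 0 (2 * (I + 1) / mass m i))"
          by (rule member_le_sum) auto
        then show "energy 0 1 (\<lambda>t. y n t $ i) \<le> (\<Sum>i\<in>UNIV. max 0 (2 * (I + 1) / mass m i))"
          using eb[of n i] by linarith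
      qed simp
      finally show ?thesis unfolding H_def real_sqrt_mult[symmetric] by (subst mult.commute) (rule real_le_rsqrt)
    qed
    then have "(\<Sum>i\<in>UNIV. norm ((y n t - y n s) $ i)) \<le> 3 * (H * sqrt \<bar>t - s\<bar>)"
      unfolding sum_UNIV_3 vector_minus_component by (smt (verit))
    then show ?thesis
      unfolding norm_vec_def using L2_set_le_sum[of UNIV "\<lambda>i. norm ((y n t - y n s) $ i)"] by simp
  qed
  have H0: "H \<ge> 0" unfolding H_def by (intro real_sqrt_ge_zero sum_nonneg) auto
  have equi: "\<exists>\<delta>>0. \<forall>n t. t \<in> {0..1} \<and> norm (s - t) < \<delta> \<longrightarrow> norm (y n s - y n t) < e" if s: "s \<in> {0..1}" and e: "e > 0" for s e
  proof -
    define \<delta> where "\<delta> = (e / (3 * H + 1))\<^sup>2"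
    have d: "\<delta> > 0" using e H0 by (simp add: \<delta>_def)
    have "norm (y n s - y n t) < e" if t: "t \<in> {0..1}" "norm (s - t) < \<delta>" for n t
    proof -
      have "sqrt \<bar>s - t\<bar> < e / (3 * H + 1)"
        using t(2) e H0 by (intro real_less_lsqrt) (auto simp: \<delta>_def)
      then have "(3 * H + 1) * sqrt \<bar>s - t\<bar> < e" using H0 by (simp add: pos_less_divide_eq mult.commute)
      moreover have "3 * (H * sqrt \<bar>s - t\<bar>) \<le> (3 * H + 1) * sqrt \<bar>s - t\<bar>" by (simp add: algebra_simps)
      ultimately show ?thesis using H[OF t(1) s, of n] by linarith
    qed
    then show ?thesis using d by blast
  qed
  obtain g and k :: "nat \<Rightarrow> nat" where g: "strict_mono k"
    and lim: "\<And>e. 0 < e \<Longrightarrow> \<exists>N. \<forall>n t. n \<ge> N \<and> t \<in> {0..1} \<longrightarrow> norm (y (k n) t - g t) < e"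
    using Arzela_Ascoli[of "{0..1::real}" y B] B equi by (metis compact_Icc)
  have vlim: "(\<lambda>n. y (k n) t) \<longlonglongrightarrow> g t" if "t \<in> {0..1}" for t
    unfolding LIMSEQ_iff using lim that by blast
  then have plim: "(\<lambda>n. y (k n) t $ i) \<longlonglongrightarrow> g t $ i" if "t \<in> {0..1}" for t i
    using that by (intro tendsto_vec_nth)
  have pen: "(\<lambda>n. penergy (\<lambda>t. y (k n) t $ i) P) \<longlonglongrightarrow> penergy (\<lambda>t. g t $ i) P" if "finite P" "P \<subseteq> {0..1}" for P i
    unfolding penergy_def using that by (intro psum_tendsto plim) auto
  have fg: "fin_kin 0 1 g" unfolding fin_kin_def
  proof
    fix i
    show "fin_energy 0 1 (\<lambda>t. g t $ i)"
    proof (rule energy_leI(1))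
      fix P :: "real set" assume P: "finite P" "P \<subseteq> {0..1}"
      have "penergy (\<lambda>t. y (k n) t $ i) P \<le> 2 * (I + 1) / mass m i" for n
        using penergy_le_energy[OF fin_kinD[OF fk[OF y(1)]] P, of "k n" i] eb[of "k n" i] by linarith
      then show "penergy (\<lambda>t. g t $ i) P \<le> 2 * (I + 1) / mass m i"
        by (intro LIMSEQ_le_const2[OF pen[OF P, of i]] exI[of _ 0] allI impI)
    qed
  qed
  have g_adm: "g \<in> admissible m \<theta>"
    unfolding admissible_def
  proof (intro CollectI conjI ballI fg)
    have "(\<lambda>n. cnj (y (k n) 0 $ i)) \<longlonglongrightarrow> cnj (g 0 $ i)" for i by (intro tendsto_cnj plim) auto
    moreover have "cnj (y (k n) 0 $ i) = y (k n) 0 $ i" for n i using y(1)[of "k n"] by (simp add: admissible_def h1_fixed)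
    ultimately have "(\<lambda>n. y (k n) 0 $ i) \<longlonglongrightarrow> cnj (g 0 $ i)" for i by simp
    from LIMSEQ_unique[OF this plim] show "h1 (g 0) = g 0" unfolding h1_fixed by auto
    have R: "(\<lambda>n. refl \<theta> (y (k n) 1 $ i)) \<longlonglongrightarrow> refl \<theta> (g 1 $ i)" for i unfolding refl_def by (intro tendsto_intros plim) auto
    have Y: "refl \<theta> (y (k n) 1 $ 2) = y (k n) 1 $ 1" "refl \<theta> (y (k n) 1 $ 1) = y (k n) 1 $ 2" "refl \<theta> (y (k n) 1 $ 3) = y (k n) 1 $ 3" for n
      using y(1)[of "k n"] by (auto simp: admissible_def h2_fixed)
    show "h2 \<theta> (g 1) = g 1" unfolding h2_fixed
      using LIMSEQ_unique[OF R[of 2, unfolded Y] plim] LIMSEQ_unique[OF R[of 1, unfolded Y] plim]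
        LIMSEQ_unique[OF R[of 3, unfolded Y] plim] by auto
    fix t :: real assume t: "t \<in> {0..1}"
    have "(\<lambda>n. y (k n) t $ 1 + y (k n) t $ 2 + of_real m * y (k n) t $ 3) \<longlonglongrightarrow> g t $ 1 + g t $ 2 + of_real m * g t $ 3"
      by (intro tendsto_intros plim t)
    moreover have "y (k n) t $ 1 + y (k n) t $ 2 + of_real m * y (k n) t $ 3 = 0" for n
      using y(1)[of "k n"] t by (auto simp: admissible_def config_space_def)
    ultimately have "(\<lambda>n. 0) \<longlonglongrightarrow> g t $ 1 + g t $ 2 + of_real m * g t $ 3" by simp
    from LIMSEQ_unique[OF this tendsto_const] show "g t \<in> config_space m" by (simp add: config_space_def)
  qed
  \<comment> \<open>For a fixed partition \<open>P\<close> the kinetic part of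
    \<open>y (k n)\<close> is at least its sum over \<open>P\<close>, which tends to that of the
    limit. What is left of the nearly minimal action bounds the potential part.\<close>
  have ev: "\<forall>\<^sub>F n in sequentially. enn2real (pot m 0 1 (y (k n))) \<le> I + \<epsilon> - (\<Sum>i\<in>UNIV. mass m i / 2 * penergy (\<lambda>t. g t $ i) P)"
    if P: "finite P" "P \<subseteq> {0..1}" and e: "\<epsilon> > 0" for P \<epsilon>
  proof -
    define Kg where "Kg = (\<Sum>i\<in>UNIV. mass m i / 2 * penergy (\<lambda>t. g t $ i) P)"
    define Kn where "Kn n = (\<Sum>i\<in>UNIV. mass m i / 2 * penergy (\<lambda>t. y (k n) t $ i) P)" for n
    have "Kn \<longlonglongrightarrow> Kg" unfolding Kn_def Kg_def by (intro tendsto_intros pen P)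
    then have 1: "eventually (\<lambda>n. Kn n > Kg - \<epsilon> / 2) sequentially" using e by (intro order_tendstoD(1)) auto
    have "(\<lambda>n. 1 / real (Suc n)) \<longlonglongrightarrow> 0" using LIMSEQ_inverse_real_of_nat by (simp add: inverse_eq_divide)
    then have "(\<lambda>n. 1 / real (Suc (k n))) \<longlonglongrightarrow> 0" using LIMSEQ_subseq_LIMSEQ[OF _ g] by (fastforce simp: o_def)
    then have 2: "eventually (\<lambda>n. 1 / real (Suc (k n)) < \<epsilon> / 2) sequentially" using e by (intro order_tendstoD(2)) auto
    show ?thesis
      using 1 2
    proof eventually_elim
      case (elim n)
      have "Kn n \<le> kin m 0 1 (y (k n))"
        unfolding Kn_def kin_def
        by (intro sum_mono mult_left_mono penergy_le_energy fin_kinD fk y P) (use mass_pos[OF m] less_imp_le in auto)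
      then show ?case
        using elim y(3)[of "k n"] unfolding A_def Kg_def[symmetric] by linarith
    qed
  qed
  \<comment> \<open>\<open>ennreal\<close> sends negative numbers to 0, so the sign is required to
    carry the bound back to the reals.\<close>
  have bound_nonneg: "0 \<le> I + \<epsilon> - (\<Sum>i\<in>UNIV. mass m i / 2 * penergy (\<lambda>t. g t $ i) P)"
    if P: "finite P" "P \<subseteq> {0..1}" and e: "\<epsilon> > 0" for P \<epsilon>
  proof -
    from eventually_happens'[OF sequentially_bot ev[OF P e]] obtain n where
      n: "enn2real (pot m 0 1 (y (k n))) \<le> I + \<epsilon> - (\<Sum>i\<in>UNIV. mass m i / 2 * penergy (\<lambda>t. g t $ i) P)" ..
    show ?thesis by (rule order_trans[OF enn2real_nonneg n])
  qed
  have pot_le: "pot m 0 1 g \<le> ennreal (I + \<epsilon> - (\<Sum>i\<in>UNIV. mass m i / 2 * penergy (\<lambda>t. g t $ i) P))"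
    if P: "finite P" "P \<subseteq> {0..1}" and e: "\<epsilon> > 0" for P \<epsilon>
  proof -
    have "pot m 0 1 g = (\<integral>\<^sup>+t. liminf (\<lambda>n. potential m (y (k n) t) * indicator {0..1} t) \<partial>lborel)"
      unfolding pot_def
    proof (rule nn_integral_cong)
      fix t :: real
      show "potential m (g t) * indicator {0..1} t = liminf (\<lambda>n. potential m (y (k n) t) * indicator {0..1} t)"
      proof (cases "t \<in> {0..1}")
        case True
        then show ?thesis using lim_imp_Liminf[OF _ tendsto_potential[OF plim[OF True], of m]] by simp
      qed (simp add: Liminf_const)
    qed
    also have "\<dots> \<le> liminf (\<lambda>n. pot m 0 1 (y (k n)))"
      unfolding pot_def by (intro nn_integral_liminf measurable_potential fk y)
    also have "\<dots> \<le> ennreal (I + \<epsilon> - (\<Sum>i\<in>UNIV. mass m i / 2 * penergy (\<lambda>t. g t $ i) P))"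
    proof (rule Liminf_le)
      show "\<forall>\<^sub>F n in sequentially. pot m 0 1 (y (k n)) \<le> ennreal (I + \<epsilon> - (\<Sum>i\<in>UNIV. mass m i / 2 * penergy (\<lambda>t. g t $ i) P))"
        using ev[OF P e]
      proof eventually_elim
        case (elim n)
        have "pot m 0 1 (y (k n)) = ennreal (enn2real (pot m 0 1 (y (k n))))"
          using y(2)[of "k n"] by (intro ennreal_enn2real[symmetric]) (simp add: infinity_ennreal_def)
        also have "\<dots> \<le> ennreal (I + \<epsilon> - (\<Sum>i\<in>UNIV. mass m i / 2 * penergy (\<lambda>t. g t $ i) P))" by (rule ennreal_leI[OF elim])
        finally show ?case .
      qed
    qed simp
    finally show ?thesis .
  qed
  have pg: "pot m 0 1 g < \<infinity>"
    using pot_le[of "{}" 1] by (auto simp: less_top[symmetric] infinity_ennreal_def top_unique)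
  have "A g \<le> I + \<epsilon>" if e: "\<epsilon> > 0" for \<epsilon>
  proof -
    have ub: "(\<Sum>i\<in>UNIV. mass m i / 2 * penergy (\<lambda>t. g t $ i) P) \<le> I + \<epsilon> - enn2real (pot m 0 1 g)"
      if P: "finite P" "P \<subseteq> {0..1}" for P
    proof -
      define Kg where "Kg = (\<Sum>i\<in>UNIV. mass m i / 2 * penergy (\<lambda>t. g t $ i) P)"
      have "ennreal (enn2real (pot m 0 1 g)) \<le> ennreal (I + \<epsilon> - Kg)"
        using pot_le[OF P e, folded Kg_def] pg by (simp add: infinity_ennreal_def)
      then have "enn2real (pot m 0 1 g) \<le> I + \<epsilon> - Kg"
        using bound_nonneg[OF P e, folded Kg_def] by (simp add: ennreal_le_iff)
      then show ?thesis unfolding Kg_def by linarith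
    qed
    \<comment> \<open>Only now is \<open>P\<close> refined, which turns the partition sums into the
      full kinetic part of the limit.\<close>
    have lm: "((\<lambda>P. \<Sum>i\<in>UNIV. mass m i / 2 * penergy (\<lambda>t. g t $ i) P) \<longlongrightarrow> kin m 0 1 g) (finite_subsets_at_top {0..1})"
      unfolding kin_def by (intro tendsto_intros tendsto_penergy fin_kinD fg)
    have "kin m 0 1 g \<le> I + \<epsilon> - enn2real (pot m 0 1 g)"
      by (rule tendsto_upperbound[OF lm eventually_finite_subsets_at_top_weakI finite_subsets_at_top_neq_bot]) (rule ub)
    then show ?thesis by (simp add: A_def)
  qed
  then have AgI: "A g \<le> I" by (rule field_le_epsilon)
  have min: "A g \<le> A w" if "w \<in> admissible m \<theta>" "pot m 0 1 w < \<infinity>" for w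
  proof -
    have "I \<le> A w" unfolding I_def using that by (intro cInf_lower bdd) (auto simp: V_def)
    then show ?thesis using AgI by simp
  qed
  have "minimizer m h1 (h2 \<theta>) g"
  proof (rule minimizer_from_admissible[OF m g_adm pg])
    fix w assume w: "w \<in> admissible m \<theta>"
    show "ennreal (kin m 0 1 g) + pot m 0 1 g \<le> ennreal (kin m 0 1 w) + pot m 0 1 w"
    proof (cases "pot m 0 1 w = \<infinity>")
      case False
      then have fin: "pot m 0 1 w < \<infinity>" by (simp add: less_top[symmetric] infinity_ennreal_def)
      have e: "ennreal (kin m 0 1 v) + pot m 0 1 v = ennreal (A v)" if "v \<in> admissible m \<theta>" "pot m 0 1 v < \<infinity>" for v
      proof -
        have "ennreal (A v) = ennreal (kin m 0 1 v) + ennreal (enn2real (pot m 0 1 v))"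
          unfolding A_def using kin_nonneg[OF m fk[OF that(1)]] by (intro ennreal_plus) auto
        then show ?thesis using that(2) by (simp add: infinity_ennreal_def)
      qed
      show ?thesis unfolding e[OF w fin] e[OF g_adm pg] using min[OF w fin] by (rule ennreal_leI)
    qed (simp add: infinity_ennreal_def)
  qed
  then show ?thesis using g_adm min[OF z] unfolding A_def by blast
qed

section \<open>Absence of triple collisions\<close>

text \<open>The tangent at \<open>\<rho>^2\<close> to \<open>1 / r\<close>, regarded as a convex
  function of \<open>r^2\<close>.\<close>

lemma inverse_tangent_bound:
  fixes r \<rho> :: real
  assumes "r > 0" "\<rho> > 0"
  shows "3 / (2 * \<rho>) - r\<^sup>2 / (2 * \<rho> ^ 3) \<le> 1 / r"
proof -
  have "1 / r - (3 / (2 * \<rho>) - r\<^sup>2 / (2 * \<rho> ^ 3)) = (r - \<rho>)\<^sup>2 * (r + 2 * \<rho>) / (2 * \<rho> ^ 3 * r)"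
    using assms by (simp add: field_simps power2_eq_square power3_eq_cube)
  also have "\<dots> \<ge> 0" using assms by simp
  finally show ?thesis by simp
qed

text \<open>Jensen's inequality with the weights 1, \<open>m\<close>, \<open>m\<close>; the extremal
  configuration is the equilateral triangle with side \<open>\<rho>\<close>.\<close>

lemma potential_ge_mean:
  assumes m: "m > 0" and \<rho>: "\<rho> > 0"
    and le: "(norm (z $ 1 - z $ 2))\<^sup>2 + m * (norm (z $ 1 - z $ 3))\<^sup>2 + m * (norm (z $ 2 - z $ 3))\<^sup>2 \<le> (1 + 2 * m) * \<rho>\<^sup>2"
  shows "ennreal ((1 + 2 * m) / \<rho>) \<le> potential m z"
proof -
  define p q r where "p = norm (z $ 1 - z $ 2)" and "q = norm (z $ 1 - z $ 3)" and "r = norm (z $ 2 - z $ 3)"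
  have pot: "potential m z = ennreal 1 / ennreal p + ennreal m / ennreal q + ennreal m / ennreal r"
    by (simp add: potential_def mass_def p_def q_def r_def)
  show ?thesis
  proof (cases "p = 0 \<or> q = 0 \<or> r = 0")
    case True
    then have "potential m z = \<infinity>" unfolding pot using m by (auto simp: infinity_ennreal_def)
    then show ?thesis by (simp add: infinity_ennreal_def)
  next
    case False
    then have pos: "p > 0" "q > 0" "r > 0" by (auto simp: p_def q_def r_def)
    have "potential m z = ennreal (1 / p + m / q + m / r)"
    proof -
      have "ennreal 1 / ennreal p = ennreal (1 / p)" "ennreal m / ennreal q = ennreal (m / q)" "ennreal m / ennreal r = ennreal (m / r)"
        using pos m by (intro divide_ennreal; simp)+
      then show ?thesis unfolding pot using pos m by (simp only:) (simp flip: ennreal_plus)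
    qed
    moreover have "(1 + 2 * m) / \<rho> \<le> 1 / p + m / q + m / r"
    proof -
      have a: "3 / (2 * \<rho>) - p\<^sup>2 / (2 * \<rho> ^ 3) \<le> 1 / p" using inverse_tangent_bound[OF pos(1) \<rho>] .
      have b: "m * (3 / (2 * \<rho>) - q\<^sup>2 / (2 * \<rho> ^ 3)) \<le> m * (1 / q)"
        using inverse_tangent_bound[OF pos(2) \<rho>] m by (intro mult_left_mono) auto
      have c: "m * (3 / (2 * \<rho>) - r\<^sup>2 / (2 * \<rho> ^ 3)) \<le> m * (1 / r)"
        using inverse_tangent_bound[OF pos(3) \<rho>] m by (intro mult_left_mono) auto
      have "(3 / (2 * \<rho>) - p\<^sup>2 / (2 * \<rho> ^ 3)) + m * (3 / (2 * \<rho>) - q\<^sup>2 / (2 * \<rho> ^ 3)) + m * (3 / (2 * \<rho>) - r\<^sup>2 / (2 * \<rho> ^ 3))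
        = 3 * (1 + 2 * m) / (2 * \<rho>) - (p\<^sup>2 + m * q\<^sup>2 + m * r\<^sup>2) / (2 * \<rho> ^ 3)"
        by (simp add: algebra_simps add_divide_distrib diff_divide_distrib)
      also have "\<dots> \<ge> 3 * (1 + 2 * m) / (2 * \<rho>) - ((1 + 2 * m) * \<rho>\<^sup>2) / (2 * \<rho> ^ 3)"
        using le \<rho> unfolding p_def q_def r_def by (intro diff_left_mono divide_right_mono) auto
      also have "3 * (1 + 2 * m) / (2 * \<rho>) - ((1 + 2 * m) * \<rho>\<^sup>2) / (2 * \<rho> ^ 3) = (1 + 2 * m) / \<rho>"
        using \<rho> by (simp add: field_simps power2_eq_square power3_eq_cube)
      finally show ?thesis using a b c by simp
    qed
    ultimately show ?thesis by (simp add: ennreal_leI)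
  qed
qed

text \<open>Leibniz's identity for the moment of inertia about the centre of mass; the weights of
  the distances are the products of the masses.\<close>

lemma mutual_distances_inertia:
  assumes "z \<in> config_space m"
  shows "(norm (z $ 1 - z $ 2))\<^sup>2 + m * (norm (z $ 1 - z $ 3))\<^sup>2 + m * (norm (z $ 2 - z $ 3))\<^sup>2
    = (2 + m) * (\<Sum>i\<in>UNIV. mass m i * (norm (z $ i))\<^sup>2)"
proof -
  have z: "z $ 1 = - z $ 2 - of_real m * z $ 3" using assms unfolding config_space_def mem_Collect_eq by algebra
  show ?thesis unfolding sum_UNIV_3 mass_def cmod_power2 z
    by (simp add: power2_eq_square algebra_simps)
qed

text \<open>The moment of inertia at time \<open>t\<close> is at most
  \<open>2 * K * |t - t0|\<close>, so the potential is at least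
  \<open>c * |t - t0| powr (-1/2)\<close> and its integral at least \<open>2 * c\<close>. This makes
  \<open>K * P^2\<close> at least \<open>2 * (1 + 2 * m)^3 / (2 + m)\<close>, and
  \<open>27/4 * K * P^2 \<le> (K + P)^3\<close> by the inequality of the means.\<close>

lemma triple_collision_action:
  assumes m: "m > 0" and x: "fin_kin 0 1 x" "\<And>t. t \<in> {0..1} \<Longrightarrow> x t \<in> config_space m"
    and t0: "t0 \<in> {0..1}" and col: "x t0 $ 1 = x t0 $ 2" "x t0 $ 2 = x t0 $ 3" and pfin: "pot m 0 1 x < \<infinity>"
  shows "27/4 * (2 * (1 + 2 * m) ^ 3 / (2 + m)) \<le> (kin m 0 1 x + enn2real (pot m 0 1 x)) ^ 3"
proof -
  define K P where "K = kin m 0 1 x" and "P = enn2real (pot m 0 1 x)"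
  have K0: "K \<ge> 0" unfolding K_def by (rule kin_nonneg[OF m x(1)])
  have P0: "P \<ge> 0" by (simp add: P_def)
  have z0: "x t0 $ i = 0" for i
  proof -
    have "of_real (2 + m) * x t0 $ 3 = 0"
      using x(2)[OF t0] col by (simp add: config_space_def algebra_simps)
    moreover have "of_real (2 + m) \<noteq> (0::complex)" using m by (simp only: of_real_eq_0_iff)
    ultimately have "x t0 $ 3 = 0" by (metis mult_eq_0_iff)
    then show ?thesis using col exhaust_3[of i] by auto
  qed
  have inertia: "(\<Sum>i\<in>UNIV. mass m i * (norm (x t $ i))\<^sup>2) \<le> 2 * K * \<bar>t - t0\<bar>" if t: "t \<in> {0..1}" for t
  proof -
    have "(norm (x t $ i))\<^sup>2 \<le> \<bar>t - t0\<bar> * energy 0 1 (\<lambda>t. x t $ i)" for i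
      using energy_ge[OF fin_kinD[OF x(1), of i], of t t0] energy_ge[OF fin_kinD[OF x(1), of i], of t0 t] t t0 z0[of i]
      by (cases "t0 \<le> t") auto
    then have "(\<Sum>i\<in>UNIV. mass m i * (norm (x t $ i))\<^sup>2) \<le> (\<Sum>i\<in>UNIV. mass m i * (\<bar>t - t0\<bar> * energy 0 1 (\<lambda>t. x t $ i)))"
      using mass_pos[OF m] by (intro sum_mono mult_left_mono) (auto intro: less_imp_le)
    also have "\<dots> = 2 * K * \<bar>t - t0\<bar>"
      unfolding K_def kin_def by (simp add: sum_distrib_left sum_distrib_right mult_ac)
    finally show ?thesis .
  qed
  \<comment> \<open>A number \<open>k > K\<close> in place of \<open>K\<close> avoids dividing by 0
    in the definition of \<open>c\<close>; the limit \<open>k\<close> to \<open>K\<close> is taken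
    at the end.\<close>
  have key: "27/4 * (2 * (1 + 2 * m) ^ 3 / (2 + m)) \<le> (k + P) ^ 3" if k: "k > K" for k
  proof -
    have kp: "k > 0" using k K0 by simp
    define W where "W = 1 + 2 * m"
    have W: "W > 0" using m by (simp add: W_def)
    define c where "c = sqrt (W ^ 3 / (2 * (2 + m) * k))"
    have c: "c > 0" "c\<^sup>2 = W ^ 3 / (2 * (2 + m) * k)" using W m kp by (simp_all add: c_def)
    have pt: "ennreal (c * \<bar>t - t0\<bar> powr (-1/2)) \<le> potential m (x t)" if t: "t \<in> {0..1}" "t \<noteq> t0" for t
    proof -
      define \<rho> where "\<rho> = W / (c * \<bar>t - t0\<bar> powr (-1/2))"
      have pos: "\<bar>t - t0\<bar> > 0" using t by simp
      then have ww: "\<bar>t - t0\<bar> powr (-1/2) > 0" by simp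
      then have \<rho>: "\<rho> > 0" using W c by (simp add: \<rho>_def)
      have "(\<bar>t - t0\<bar> powr (-1/2))\<^sup>2 = 1 / \<bar>t - t0\<bar>"
        using pos by (simp add: power2_eq_square powr_minus_divide flip: powr_add)
      then have "W * \<rho>\<^sup>2 = W * W\<^sup>2 / (c\<^sup>2 * (1 / \<bar>t - t0\<bar>))" by (simp add: \<rho>_def power_divide power_mult_distrib)
      also have "\<dots> = (2 + m) * (2 * k * \<bar>t - t0\<bar>)"
        unfolding c(2) using W m kp pos by (simp add: field_simps power2_eq_square power3_eq_cube)
      finally have r: "W * \<rho>\<^sup>2 = (2 + m) * (2 * k * \<bar>t - t0\<bar>)" .
      have "(2 + m) * (\<Sum>i\<in>UNIV. mass m i * (norm (x t $ i))\<^sup>2) \<le> (2 + m) * (2 * K * \<bar>t - t0\<bar>)"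
        using inertia[OF t(1)] m by (intro mult_left_mono) auto
      also have "\<dots> \<le> (2 + m) * (2 * k * \<bar>t - t0\<bar>)" using k m pos by (intro mult_left_mono mult_right_mono) auto
      finally have "ennreal (W / \<rho>) \<le> potential m (x t)"
        using potential_ge_mean[OF m \<rho>, of "x t"] mutual_distances_inertia[OF x(2)[OF t(1)]] r unfolding W_def by simp
      moreover have "W / \<rho> = c * \<bar>t - t0\<bar> powr (-1/2)" using W c ww by (simp add: \<rho>_def)
      ultimately show ?thesis by simp
    qed
    define h1' h2' where "h1' = t0" and "h2' = 1 - t0"
    have hh: "h1' \<ge> 0" "h2' \<ge> 0" "h1' + h2' = 1" using t0 by (auto simp: h1'_def h2'_def)
    let ?f = "\<lambda>t. ennreal c * (ennreal ((t0 - t) powr (-1/2)) * indicator {t0 - h1'..t0} t) + ennreal c * (ennreal ((t - t0) powr (-1/2)) * indicator {t0..t0 + h2'} t)"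
    have "ennreal c * ennreal (h1' powr (1/2) / (1/2)) + ennreal c * ennreal (h2' powr (1/2) / (1/2)) = (\<integral>\<^sup>+t. ?f t \<partial>lborel)"
      using nn_integral_powr(2)[of "-1/2" h1' t0] nn_integral_powr(1)[of "-1/2" h2' t0] hh
      by (simp add: nn_integral_add nn_integral_cmult)
    also have "\<dots> \<le> pot m 0 1 x" unfolding pot_def
    proof (rule nn_integral_mono_AE)
      have "AE t in lborel. t \<noteq> t0" by (rule AE_lborel_singleton)
      then show "AE t in lborel. ?f t \<le> potential m (x t) * indicator {0..1} t"
      proof eventually_elim
        case (elim t)
        show ?case
        proof (cases "t \<in> {0..1}")
          case True
          have "?f t = ennreal (c * \<bar>t - t0\<bar> powr (-1/2))"
          proof (cases "t < t0")
            case lt: True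
            then show ?thesis using True c(1) by (simp add: indicator_def h1'_def ennreal_mult'')
          next
            case False
            then have "t > t0" using elim by simp
            then show ?thesis using True c(1) by (simp add: indicator_def h2'_def ennreal_mult'')
          qed
          then show ?thesis using pt[OF True elim] True by simp
        next
          case False
          then show ?thesis using t0 by (auto simp: indicator_def h1'_def h2'_def)
        qed
      qed
    qed
    also have "pot m 0 1 x = ennreal P" using pfin by (simp add: P_def infinity_ennreal_def)
    also have "ennreal c * ennreal (h1' powr (1/2) / (1/2)) + ennreal c * ennreal (h2' powr (1/2) / (1/2))
        = ennreal (2 * c * (h1' powr (1/2) + h2' powr (1/2)))"
    proof -
      have "ennreal (2 * c * (h1' powr (1/2) + h2' powr (1/2))) = ennreal (c * (h1' powr (1/2) / (1/2)) + c * (h2' powr (1/2) / (1/2)))"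
        by (rule arg_cong[where f=ennreal]) (simp add: algebra_simps)
      also have "\<dots> = ennreal (c * (h1' powr (1/2) / (1/2))) + ennreal (c * (h2' powr (1/2) / (1/2)))"
        using c(1) by (intro ennreal_plus) auto
      finally show ?thesis by (simp add: ennreal_mult'')
    qed
    finally have A: "2 * c * (h1' powr (1/2) + h2' powr (1/2)) \<le> P" using P0 by (simp add: ennreal_le_iff)
    \<comment> \<open>The least value of \<open>sqrt t0 + sqrt (1 - t0)\<close>, attained for a
      collision at an end of the interval.\<close>
    have one: "1 \<le> h1' powr (1/2) + h2' powr (1/2)"
    proof -
      have "h \<le> h powr (1/2)" if "0 \<le> h" "h \<le> 1" for h :: real
      proof -
        have "h * h \<le> h" using that by (simp add: mult_left_le)
        then have "h\<^sup>2 \<le> h" by (simp add: power2_eq_square)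
        then show ?thesis using that real_le_rsqrt by (simp add: powr_half_sqrt)
      qed
      from this[of h1'] this[of h2'] show ?thesis using hh by linarith
    qed
    have "2 * c * 1 \<le> 2 * c * (h1' powr (1/2) + h2' powr (1/2))" using one c(1) by (intro mult_left_mono) auto
    from order_trans[OF this A] have "2 * c \<le> P" by simp
    then have "(2 * c)\<^sup>2 \<le> P\<^sup>2" using c(1) by (intro power_mono) auto
    then have e1: "4 * c\<^sup>2 * k \<le> P\<^sup>2 * k" using kp by (simp add: power_mult_distrib)
    have e2: "4 * c\<^sup>2 * k = 2 * W ^ 3 / (2 + m)" 
    proof -
      have r: "4 * (A / (2 * n * k)) * k = 2 * A / n" if "n \<noteq> 0" for A n :: real using that kp by (simp add: field_simps)
      show ?thesis unfolding c(2) by (rule r) (use m in simp)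
    qed
    have "2 * W ^ 3 / (2 + m) \<le> k * P\<^sup>2" using e1 unfolding e2 by (simp only: mult.commute[of k])
    then have "27/4 * (2 * W ^ 3 / (2 + m)) \<le> 27/4 * (k * P\<^sup>2)" by (rule mult_left_mono) simp
    also have "\<dots> \<le> (k + P) ^ 3"
    proof -
      have "(k + P) ^ 3 - 27/4 * (k * P\<^sup>2) = (k - P / 2)\<^sup>2 * (k + 4 * P)"
        by (simp add: power2_eq_square power3_eq_cube algebra_simps)
      also have "\<dots> \<ge> 0" using kp P0 by simp
      finally show ?thesis by simp
    qed
    finally show ?thesis unfolding W_def .
  qed
  have "((\<lambda>k. (k + P) ^ 3) \<longlongrightarrow> (K + P) ^ 3) (at_right K)" by (intro tendsto_intros)
  then show ?thesis unfolding K_def[symmetric] P_def[symmetric]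
    by (rule tendsto_lowerbound) (rule eventually_mono[OF eventually_at_right_less key], simp_all)
qed

lemma minimizer_collision_free:
  assumes m: "m > 0" and \<theta>: "0 < \<theta>" "\<theta> < pi / 2" and x: "minimizer m h1 (h2 \<theta>) x" and adm: "x \<in> admissible m \<theta>"
    and small: "(kin m 0 1 x + enn2real (pot m 0 1 x)) ^ 3 < 27/4 * (1/2 + 2 * m)\<^sup>2 * (pi / 2 - \<theta>)\<^sup>2"
    and t: "t \<in> {0..1}" and ij: "i \<noteq> j"
  shows "x t $ i \<noteq> x t $ j"
proof
  assume col: "x t $ i = x t $ j"
  have fx: "fin_kin 0 1 x" and pf: "pot m 0 1 x < \<infinity>" using x by (auto simp: minimizer_def)
  obtain k where d: "distinct [i, j, k]"
  proof -
    have "card {i, j} < card (UNIV :: 3 set)" using ij by simp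
    then obtain k where "k \<notin> {i, j}" by (metis UNIV_I card_mono finite leD subsetI)
    then show ?thesis using that[of k] ij by auto
  qed
  have nt: "\<not> (x t $ 1 = x t $ 2 \<and> x t $ 2 = x t $ 3)"
  proof
    assume "x t $ 1 = x t $ 2 \<and> x t $ 2 = x t $ 3"
    then have "27/4 * (2 * (1 + 2 * m) ^ 3 / (2 + m)) \<le> (kin m 0 1 x + enn2real (pot m 0 1 x)) ^ 3"
      using adm by (intro triple_collision_action[OF m fx _ t _ _ pf]) (auto simp: admissible_def)
    also have "\<dots> < 27/4 * (1/2 + 2 * m)\<^sup>2 * (pi / 2 - \<theta>)\<^sup>2" by (rule small)
    \<comment> \<open>Since \<open>pi / 2 \<le> 1.58\<close>, the square of the angle is at most
      5/2. The comparison with the triple collision then comes down to the positivity of a cubic in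
      \<open>m\<close>.\<close>
    also have "\<dots> \<le> 27/4 * (1/2 + 2 * m)\<^sup>2 * (5/2)"
    proof (rule mult_left_mono)
      have "pi / 2 \<le> 1.58" using pi_approx(2) by simp
      then have "(pi / 2 - \<theta>)\<^sup>2 \<le> 1.58\<^sup>2" using \<theta> by (intro power_mono) auto
      then show "(pi / 2 - \<theta>)\<^sup>2 \<le> 5/2" by (simp add: power2_eq_square)
    qed simp
    finally have f: "27/4 * (2 * (1 + 2 * m) ^ 3 / (2 + m)) < 27/4 * (1/2 + 2 * m)\<^sup>2 * (5/2)" .
    have cancel: "X < Y * (5/2)" if "27/4 * X < 27/4 * Y * (5/2)" for X Y :: real using that by simp
    have "2 * (1 + 2 * m) ^ 3 / (2 + m) < (1/2 + 2 * m)\<^sup>2 * (5/2)" by (rule cancel[OF f])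
    then have "2 * (1 + 2 * m) ^ 3 < (1/2 + 2 * m)\<^sup>2 * (5/2) * (2 + m)" using m by (subst (asm) pos_divide_less_eq) auto
    moreover have eq: "2 * (1 + 2 * m) ^ 3 - (1/2 + 2 * m)\<^sup>2 * (5/2) * (2 + m) = 6 * m ^ 3 - m\<^sup>2 + 11/8 * m + 3/4"
      by (simp add: power2_eq_square power3_eq_cube algebra_simps add_divide_distrib)
    moreover have "m * (6 * m\<^sup>2 - m + 11/8) > 0"
    proof (rule mult_pos_pos[OF m])
      have "6 * m\<^sup>2 - m + 11/8 = 6 * (m - 1/12)\<^sup>2 + 4/3" by (simp add: power2_eq_square algebra_simps)
      also have "\<dots> > 0" by (intro add_nonneg_pos) auto
      finally show "6 * m\<^sup>2 - m + 11/8 > 0" .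
    qed
    then have "6 * m ^ 3 - m\<^sup>2 + 11/8 * m + 3/4 > 0"
      by (simp add: power2_eq_square power3_eq_cube algebra_simps)
    moreover have "\<not> X < Y" if "X - Y = Z" "Z > 0" for X Y Z :: real using that by simp
    ultimately show False by blast
  qed
  have free: "x t $ i \<noteq> x t $ k"
  proof
    assume a: "x t $ i = x t $ k"
    have "x t $ l = x t $ i" for l
      using a col UNIV_3_distinct[OF d] by (metis UNIV_I emptyE insertE)
    then show False using nt by metis
  qed
  consider "t = 0" | "t = 1" | "0 < t \<and> t < 1" using t by fastforce
  then show False
  proof cases
    case 1
    have "h1 (x 0) = x 0" using adm by (simp add: admissible_def)
    then have "h1 (x 0 + dirv m i j (\<epsilon> *\<^sub>R 1)) = x 0 + dirv m i j (\<epsilon> *\<^sub>R 1)" for \<epsilon>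
      unfolding h1_fixed by (simp add: dirv_def)
    then have "\<exists>u. norm u = 1 \<and> (\<forall>\<epsilon>. h1 (x 0 + dirv m i j (\<epsilon> *\<^sub>R u)) = x 0 + dirv m i j (\<epsilon> *\<^sub>R u))"
      by (intro exI[of _ 1]) auto
    then show False using no_pair_collision_start[OF m x d] col free 1 by auto
  next
    case 2
    have h: "h2 \<theta> (x 1) = x 1" using adm by (simp add: admissible_def)
    \<comment> \<open>The reflection at time 1 exchanges bodies 1 and 2, so a collision of one of
      them with body 3 would be a triple collision.\<close>
    have "i \<noteq> 3 \<and> j \<noteq> 3"
    proof (rule ccontr)
      assume "\<not> ?thesis"
      then have "x 1 $ 3 = x 1 $ 1 \<or> x 1 $ 3 = x 1 $ 2" using col 2 ij exhaust_3[of i] exhaust_3[of j] by auto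
      then have "x 1 $ 1 = x 1 $ 2 \<and> x 1 $ 2 = x 1 $ 3" using h unfolding h2_fixed by metis
      then show False using nt 2 by simp
    qed
    then have ij': "(i = 1 \<and> j = 2) \<or> (i = 2 \<and> j = 1)" using ij exhaust_3[of i] exhaust_3[of j] by auto
    \<comment> \<open>Normal to the axis of the reflection: moving body 1 along \<open>u\<close> and
      body 2 by the opposite vector is compatible with \<open>h2 \<theta>\<close>.\<close>
    define u where "u = \<i> * cis \<theta>"
    have u1: "norm u = 1" by (simp add: u_def norm_mult)
    have "refl \<theta> u = - u"
    proof -
      have "cis (2 * \<theta>) * cnj (cis \<theta>) = cis \<theta>" by (simp add: cis_cnj cis_mult)
      then have "cis (2 * \<theta>) * (- \<i> * cnj (cis \<theta>)) = - \<i> * cis \<theta>" by (simp add: mult.left_commute)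
      then show ?thesis by (simp add: refl_def u_def)
    qed
    then have ru: "refl \<theta> (z + c *\<^sub>R u) = refl \<theta> z - c *\<^sub>R u" "refl \<theta> (z - c *\<^sub>R u) = refl \<theta> z + c *\<^sub>R u" for c z
      by (simp_all add: refl_def distrib_left right_diff_distrib)
    have dv: "dirv m i j z $ 3 = 0" "dirv m i j z $ i = (1/2) *\<^sub>R z" "dirv m i j z $ j = - (1/2) *\<^sub>R z" for z
      using ij' by (auto simp: dirv_def mass_def scaleR_conv_of_real)
    have "h2 \<theta> (x 1 + dirv m i j (\<epsilon> *\<^sub>R u)) = x 1 + dirv m i j (\<epsilon> *\<^sub>R u)" for \<epsilon>
      using ij'
    proof
      assume "i = 1 \<and> j = 2"
      then show ?thesis using h dv[of "\<epsilon> *\<^sub>R u"] unfolding h2_fixed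
        by (simp add: ru)
    next
      assume "i = 2 \<and> j = 1"
      then show ?thesis using h dv[of "\<epsilon> *\<^sub>R u"] unfolding h2_fixed
        by (simp add: ru)
    qed
    then have dir: "\<exists>u. norm u = 1 \<and> (\<forall>\<epsilon>. h2 \<theta> (x (1 - 0) + dirv m i j (\<epsilon> *\<^sub>R u)) = x (1 - 0) + dirv m i j (\<epsilon> *\<^sub>R u))"
      using u1 by auto
    show False
      by (rule no_pair_collision_start[OF m minimizer_reverse[OF x] d _ _ dir]) (use col free 2 in auto)
  next
    case 3
    then show False using no_pair_collision_interior[OF m x d _ _ col free] by simp
  qed
qed

section \<open>Euler-Lagrange equations\<close>

text \<open>With \<open>N = |z + h| / |z|\<close> the claim becomes a bound of \<open>1 / N\<close>
  to second order in \<open>N^2 - 1\<close>, which is exactly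
  \<open>2 * \<alpha> + \<beta>^2\<close>. The remainder has the factor \<open>(N - 1)^2\<close>,
  with a nonnegative cofactor for \<open>N \<ge> 1/2\<close>. The coefficient comes out as
  \<open>2 * 25/4 - 1/2 = 12\<close>, rounded up to 13.\<close>

lemma inverse_norm_taylor:
  fixes z h :: "'a::real_inner"
  assumes z: "norm z \<ge> r" and r: "r > 0" and h: "norm h \<le> r / 2"
  shows "1 / norm (z + h) \<le> 1 / norm z - inner z h / norm z ^ 3 + 13 / r ^ 3 * (norm h)\<^sup>2"
proof -
  define R where "R = norm z"
  have R: "R > 0" "R \<ge> r" using z r by (auto simp: R_def)
  define N where "N = norm (z + h) / R"
  define \<beta> where "\<beta> = norm h / R"
  define \<alpha> where "\<alpha> = inner z h / R\<^sup>2"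
  have hR: "norm h \<le> R / 2" using h R by simp
  have "norm (z + h) \<ge> R - norm h" unfolding R_def using norm_triangle_ineq2[of z "- h"] by simp
  then have N: "N \<ge> 1/2" unfolding N_def using hR R by (simp add: le_divide_eq)
  have \<beta>: "0 \<le> \<beta>" "\<beta> \<le> 1/2" using hR R by (simp_all add: \<beta>_def divide_le_eq)
  have "\<bar>inner z h\<bar> \<le> R * norm h" unfolding R_def by (rule Cauchy_Schwarz_ineq2)
  then have \<alpha>: "\<bar>\<alpha>\<bar> \<le> \<beta>" unfolding \<alpha>_def \<beta>_def using R
    by (simp add: abs_divide power2_eq_square divide_simps mult.commute)
  have N2: "N\<^sup>2 - 1 = 2 * \<alpha> + \<beta>\<^sup>2"
  proof -
    have "(norm (z + h))\<^sup>2 = R\<^sup>2 + 2 * inner z h + (norm h)\<^sup>2"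
      unfolding R_def power2_norm_eq_inner by (simp add: inner_add_left inner_add_right inner_commute)
    then have "N\<^sup>2 = (R\<^sup>2 + 2 * inner z h + (norm h)\<^sup>2) / R\<^sup>2" by (simp add: N_def power_divide)
    then show ?thesis using R by (simp add: \<alpha>_def \<beta>_def power_divide add_divide_distrib)
  qed
  have "1 / N \<le> 1 - (N\<^sup>2 - 1) / 2 + 2 * (N\<^sup>2 - 1)\<^sup>2"
  proof -
    have "N * (1 - (N\<^sup>2 - 1) / 2 + 2 * (N\<^sup>2 - 1)\<^sup>2) - 1 = (N - 1)\<^sup>2 * (2 * N * (N + 1)\<^sup>2 - (N + 2) / 2)"
      by (simp add: power2_eq_square field_simps)
    also have "\<dots> \<ge> 0"
    proof (intro mult_nonneg_nonneg)
      have "(3/2)\<^sup>2 \<le> (N + 1)\<^sup>2" using N by (intro power_mono) auto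
      then have "2 * N * (9/4) \<le> 2 * N * (N + 1)\<^sup>2" using N by (intro mult_left_mono) (auto simp: power2_eq_square)
      moreover have "(N + 2) / 2 \<le> 2 * N * (9/4)" using N by simp
      ultimately show "0 \<le> 2 * N * (N + 1)\<^sup>2 - (N + 2) / 2" by linarith
    qed simp
    finally have "1 \<le> N * (1 - (N\<^sup>2 - 1) / 2 + 2 * (N\<^sup>2 - 1)\<^sup>2)" by simp
    then show ?thesis using N by (simp add: divide_le_eq mult.commute)
  qed
  also have "(N\<^sup>2 - 1)\<^sup>2 \<le> 25/4 * \<beta>\<^sup>2"
  proof -
    have "\<bar>2 * \<alpha> + \<beta>\<^sup>2\<bar> \<le> 2 * \<beta> + \<beta>\<^sup>2" using \<alpha> by (smt (verit) zero_le_power2)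
    also have "\<beta>\<^sup>2 \<le> 1/2 * \<beta>" unfolding power2_eq_square using \<beta> by (intro mult_right_mono) auto
    finally have "\<bar>N\<^sup>2 - 1\<bar> \<le> 5/2 * \<beta>" unfolding N2 by simp
    then have "\<bar>N\<^sup>2 - 1\<bar>\<^sup>2 \<le> (5/2 * \<beta>)\<^sup>2" by (intro power_mono) auto
    then show ?thesis by (simp add: power_mult_distrib power2_eq_square)
  qed
  finally have "1 / N \<le> 1 - (2 * \<alpha> + \<beta>\<^sup>2) / 2 + 2 * (25/4 * \<beta>\<^sup>2)" unfolding N2 by simp
  then have "1 / N \<le> 1 - \<alpha> + 13 * \<beta>\<^sup>2" using zero_le_power2[of \<beta>] by argo
  then have "1 / N / R \<le> (1 - \<alpha> + 13 * \<beta>\<^sup>2) / R" using R by (intro divide_right_mono) auto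
  also have "1 / N / R = 1 / norm (z + h)" using R by (simp add: N_def)
  also have "(1 - \<alpha> + 13 * \<beta>\<^sup>2) / R = 1 / R - inner z h / R ^ 3 + 13 / R ^ 3 * (norm h)\<^sup>2"
    using R by (simp add: \<alpha>_def \<beta>_def field_simps power2_eq_square power3_eq_cube)
  also have "\<dots> \<le> 1 / R - inner z h / R ^ 3 + 13 / r ^ 3 * (norm h)\<^sup>2"
    using R r by (intro add_left_mono mult_right_mono divide_left_mono power_mono) auto
  finally show ?thesis unfolding R_def .
qed

text \<open>The gradient of the potential with respect to body \<open>i\<close>, that is, mass times
  acceleration.\<close>

definition force :: "real \<Rightarrow> config \<Rightarrow> 3 \<Rightarrow> complex" where
  "force m x i = (\<Sum>j\<in>UNIV - {i}. (mass m i * mass m j / norm (x $ j - x $ i) ^ 3) *\<^sub>R (x $ j - x $ i))"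

definition rpot :: "real \<Rightarrow> config \<Rightarrow> real" where
  "rpot m x = 1 / norm (x $ 1 - x $ 2) + m / norm (x $ 1 - x $ 3) + m / norm (x $ 2 - x $ 3)"

lemma UNIV_minus_3: "UNIV - {1::3} = {2, 3}" "UNIV - {2::3} = {1, 3}" "UNIV - {3::3} = {1, 2}"
  using exhaust_3 by fastforce+

lemma sum_force_inner:
  "(\<Sum>i\<in>UNIV. inner (force m x i) (w $ i)) =
     - inner (x $ 1 - x $ 2) (w $ 1 - w $ 2) / norm (x $ 1 - x $ 2) ^ 3
     - m * inner (x $ 1 - x $ 3) (w $ 1 - w $ 3) / norm (x $ 1 - x $ 3) ^ 3
     - m * inner (x $ 2 - x $ 3) (w $ 2 - w $ 3) / norm (x $ 2 - x $ 3) ^ 3"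
proof -
  have n: "norm (x $ 2 - x $ 1) = norm (x $ 1 - x $ 2)" "norm (x $ 3 - x $ 1) = norm (x $ 1 - x $ 3)"
    "norm (x $ 3 - x $ 2) = norm (x $ 2 - x $ 3)" by (rule norm_minus_commute)+
  have f: "force m x 1 = (1 / norm (x $ 1 - x $ 2) ^ 3) *\<^sub>R (x $ 2 - x $ 1) + (m / norm (x $ 1 - x $ 3) ^ 3) *\<^sub>R (x $ 3 - x $ 1)"
    "force m x 2 = (1 / norm (x $ 1 - x $ 2) ^ 3) *\<^sub>R (x $ 1 - x $ 2) + (m / norm (x $ 2 - x $ 3) ^ 3) *\<^sub>R (x $ 3 - x $ 2)"
    "force m x 3 = (m / norm (x $ 1 - x $ 3) ^ 3) *\<^sub>R (x $ 1 - x $ 3) + (m / norm (x $ 2 - x $ 3) ^ 3) *\<^sub>R (x $ 2 - x $ 3)"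
    unfolding force_def UNIV_minus_3 by (simp_all add: n mass_def)
  show ?thesis
    unfolding sum_UNIV_3 f
    by (simp add: inner_add_left inner_diff_left inner_diff_right add_divide_distrib diff_divide_distrib algebra_simps)
qed

lemma potential_rpot:
  assumes "m > 0" "x $ 1 \<noteq> x $ 2" "x $ 1 \<noteq> x $ 3" "x $ 2 \<noteq> x $ 3"
  shows "potential m x = ennreal (rpot m x)"
proof -
  have "ennreal 1 / ennreal (norm (x $ 1 - x $ 2)) = ennreal (1 / norm (x $ 1 - x $ 2))"
    "ennreal m / ennreal (norm (x $ 1 - x $ 3)) = ennreal (m / norm (x $ 1 - x $ 3))"
    "ennreal m / ennreal (norm (x $ 2 - x $ 3)) = ennreal (m / norm (x $ 2 - x $ 3))"
    using assms by (intro divide_ennreal; simp)+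
  then have "potential m x = ennreal (1 / norm (x $ 1 - x $ 2)) + ennreal (m / norm (x $ 1 - x $ 3)) + ennreal (m / norm (x $ 2 - x $ 3))"
    unfolding potential_def mass_def by simp
  then show ?thesis using assms by (simp add: rpot_def flip: ennreal_plus)
qed

text \<open>The constant 52 is \<open>13 * 2^2\<close>, since differences of two displacements may
  reach \<open>2 * \<delta>\<close>. The second claim makes it possible to leave
  \<open>ennreal\<close> again.\<close>

lemma potential_taylor:
  assumes m: "m > 0" and r: "r > 0" and far: "norm (x $ 1 - x $ 2) \<ge> r" "norm (x $ 1 - x $ 3) \<ge> r" "norm (x $ 2 - x $ 3) \<ge> r"
    and w: "\<And>i. norm (w $ i) \<le> r / 4" "\<And>i. norm (w $ i) \<le> \<delta>"
  shows "potential m (x + w) \<le> ennreal (rpot m x + (\<Sum>i\<in>UNIV. inner (force m x i) (w $ i)) + (1 + 2 * m) * (52 / r ^ 3) * \<delta>\<^sup>2)"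
    and "0 \<le> rpot m x + (\<Sum>i\<in>UNIV. inner (force m x i) (w $ i)) + (1 + 2 * m) * (52 / r ^ 3) * \<delta>\<^sup>2"
proof -
  have T: "1 / norm ((x $ i - x $ j) + (w $ i - w $ j)) \<le> 1 / norm (x $ i - x $ j) - inner (x $ i - x $ j) (w $ i - w $ j) / norm (x $ i - x $ j) ^ 3 + 52 / r ^ 3 * \<delta>\<^sup>2"
    and nz: "x $ i + w $ i \<noteq> x $ j + w $ j"
    if "norm (x $ i - x $ j) \<ge> r" for i j
  proof -
    have h: "norm (w $ i - w $ j) \<le> r / 2" "norm (w $ i - w $ j) \<le> 2 * \<delta>"
      using norm_triangle_ineq4[of "w $ i" "w $ j"] w(1)[of i] w(1)[of j] w(2)[of i] w(2)[of j] by auto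
    have "(norm (w $ i - w $ j))\<^sup>2 \<le> (2 * \<delta>)\<^sup>2" using h by (intro power_mono) auto
    then have "13 / r ^ 3 * (norm (w $ i - w $ j))\<^sup>2 \<le> 13 / r ^ 3 * (2 * \<delta>)\<^sup>2" using r by (intro mult_left_mono) auto
    also have "\<dots> = 52 / r ^ 3 * \<delta>\<^sup>2" by (simp add: power_mult_distrib)
    finally show "1 / norm ((x $ i - x $ j) + (w $ i - w $ j)) \<le> 1 / norm (x $ i - x $ j) - inner (x $ i - x $ j) (w $ i - w $ j) / norm (x $ i - x $ j) ^ 3 + 52 / r ^ 3 * \<delta>\<^sup>2"
      using inverse_norm_taylor[OF that r h(1)] by linarith
    show "x $ i + w $ i \<noteq> x $ j + w $ j"
    proof
      assume "x $ i + w $ i = x $ j + w $ j"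
      then have "x $ i - x $ j = w $ j - w $ i" by (simp add: algebra_simps)
      then have "norm (x $ i - x $ j) = norm (w $ i - w $ j)" by (simp add: norm_minus_commute)
      then show False using h(1) that r by simp
    qed
  qed
  define d12 d13 d23 where "d12 = 1 / norm ((x $ 1 - x $ 2) + (w $ 1 - w $ 2))" and "d13 = 1 / norm ((x $ 1 - x $ 3) + (w $ 1 - w $ 3))"
    and "d23 = 1 / norm ((x $ 2 - x $ 3) + (w $ 2 - w $ 3))"
  have rp: "rpot m (x + w) = d12 + m * d13 + m * d23"
    by (simp add: rpot_def d12_def d13_def d23_def algebra_simps)
  have *: "D1 + m * D2 + m * D3 \<le> n1 + m / n2 + m / n3 + (- I1 / N1 - m * I2 / N2 - m * I3 / N3) + (1 + 2 * m) * E"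
      if "m * D2 \<le> m * (1 / n2 - I2 / N2 + E)" "m * D3 \<le> m * (1 / n3 - I3 / N3 + E)" "D1 \<le> n1 - I1 / N1 + E"
      for D1 D2 D3 n1 n2 n3 I1 I2 I3 N1 N2 N3 E :: real
      using that unfolding distrib_left right_diff_distrib distrib_right by simp
  have taylor_sum: "d12 + m * d13 + m * d23 \<le> rpot m x + (\<Sum>i\<in>UNIV. inner (force m x i) (w $ i)) + (1 + 2 * m) * (52 / r ^ 3) * \<delta>\<^sup>2" if
      "m * d13 \<le> m * (1 / norm (x $ 1 - x $ 3) - inner (x $ 1 - x $ 3) (w $ 1 - w $ 3) / norm (x $ 1 - x $ 3) ^ 3 + 52 / r ^ 3 * \<delta>\<^sup>2)"
      "m * d23 \<le> m * (1 / norm (x $ 2 - x $ 3) - inner (x $ 2 - x $ 3) (w $ 2 - w $ 3) / norm (x $ 2 - x $ 3) ^ 3 + 52 / r ^ 3 * \<delta>\<^sup>2)"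
      "d12 \<le> 1 / norm (x $ 1 - x $ 2) - inner (x $ 1 - x $ 2) (w $ 1 - w $ 2) / norm (x $ 1 - x $ 2) ^ 3 + 52 / r ^ 3 * \<delta>\<^sup>2"
      using *[OF that] unfolding sum_force_inner rpot_def by (simp only: mult.assoc)
  have "m * d13 \<le> m * (1 / norm (x $ 1 - x $ 3) - inner (x $ 1 - x $ 3) (w $ 1 - w $ 3) / norm (x $ 1 - x $ 3) ^ 3 + 52 / r ^ 3 * \<delta>\<^sup>2)"
    "m * d23 \<le> m * (1 / norm (x $ 2 - x $ 3) - inner (x $ 2 - x $ 3) (w $ 2 - w $ 3) / norm (x $ 2 - x $ 3) ^ 3 + 52 / r ^ 3 * \<delta>\<^sup>2)"
    unfolding d13_def d23_def by (intro mult_left_mono T(1)[OF far(2)] T(1)[OF far(3)], use m in simp)+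
  moreover have "d12 \<le> 1 / norm (x $ 1 - x $ 2) - inner (x $ 1 - x $ 2) (w $ 1 - w $ 2) / norm (x $ 1 - x $ 2) ^ 3 + 52 / r ^ 3 * \<delta>\<^sup>2"
    unfolding d12_def by (rule T(1)[OF far(1)])
  ultimately have le: "rpot m (x + w) \<le> rpot m x + (\<Sum>i\<in>UNIV. inner (force m x i) (w $ i)) + (1 + 2 * m) * (52 / r ^ 3) * \<delta>\<^sup>2"
    unfolding rp by (rule taylor_sum)
  have "potential m (x + w) = ennreal (rpot m (x + w))"
    using nz[OF far(1)] nz[OF far(2)] nz[OF far(3)] by (intro potential_rpot[OF m]) auto
  then show "potential m (x + w) \<le> ennreal (rpot m x + (\<Sum>i\<in>UNIV. inner (force m x i) (w $ i)) + (1 + 2 * m) * (52 / r ^ 3) * \<delta>\<^sup>2)"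
    using le by (simp add: ennreal_leI)
  have "rpot m (x + w) \<ge> 0" using m by (simp add: rpot_def)
  then show "0 \<le> rpot m x + (\<Sum>i\<in>UNIV. inner (force m x i) (w $ i)) + (1 + 2 * m) * (52 / r ^ 3) * \<delta>\<^sup>2"
    using le by linarith
qed

section \<open>First variation along piecewise linear test functions\<close>

lemma energy_affine_perturbation:
  fixes g :: "real \<Rightarrow> complex"
  assumes ab: "a \<le> b" and g: "fin_energy a b g"
  shows "fin_energy a b (\<lambda>t. g t + (p * t + q) *\<^sub>R v)"
    "energy a b (\<lambda>t. g t + (p * t + q) *\<^sub>R v) \<le> energy a b g + 2 * p * inner (g b - g a) v + p\<^sup>2 * (norm v)\<^sup>2 * (b - a)"
proof -
  define G where "G t = energy a t g + 2 * p * inner (g t) v + p\<^sup>2 * (norm v)\<^sup>2 * t" for t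
  have "(norm ((g t + (p * t + q) *\<^sub>R v) - (g s + (p * s + q) *\<^sub>R v)))\<^sup>2 \<le> (t - s) * (G t - G s)"
    if st: "a \<le> s" "s \<le> t" "t \<le> b" for s t
  proof -
    have "(g t + (p * t + q) *\<^sub>R v) - (g s + (p * s + q) *\<^sub>R v) = (g t - g s) + (p * (t - s)) *\<^sub>R v"
      by (simp add: algebra_simps)
    moreover have "(norm ((g t - g s) + (p * (t - s)) *\<^sub>R v))\<^sup>2 = (norm (g t - g s))\<^sup>2 + 2 * (p * (t - s)) * inner (g t - g s) v + (p * (t - s))\<^sup>2 * (norm v)\<^sup>2"
      unfolding power2_norm_eq_inner by (simp add: inner_add_left inner_add_right inner_commute power2_eq_square algebra_simps)
    moreover have "(norm (g t - g s))\<^sup>2 \<le> (t - s) * (energy a t g - energy a s g)" by (rule energy_incr[OF g st])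
    ultimately show ?thesis by (simp add: G_def inner_diff_left power2_eq_square algebra_simps)
  qed
  from energy_dom[OF ab this] show "fin_energy a b (\<lambda>t. g t + (p * t + q) *\<^sub>R v)"
    "energy a b (\<lambda>t. g t + (p * t + q) *\<^sub>R v) \<le> energy a b g + 2 * p * inner (g b - g a) v + p\<^sup>2 * (norm v)\<^sup>2 * (b - a)"
    by (auto simp: G_def energy_degenerate inner_diff_left algebra_simps)
qed

lemma linear_coefficient_zero:
  fixes A C :: real
  assumes "\<epsilon>0 > 0" "\<And>\<epsilon>. \<bar>\<epsilon>\<bar> \<le> \<epsilon>0 \<Longrightarrow> 0 \<le> \<epsilon> * A + C * \<epsilon>\<^sup>2"
  shows "A = 0"
proof -
  have *: "B \<ge> 0" if B: "\<And>\<epsilon>. 0 < \<epsilon> \<Longrightarrow> \<epsilon> \<le> \<epsilon>0 \<Longrightarrow> 0 \<le> \<epsilon> * B + C * \<epsilon>\<^sup>2" for B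
  proof -
    have "((\<lambda>\<epsilon>. B + C * \<epsilon>) \<longlongrightarrow> B + C * 0) (at_right 0)" by (intro tendsto_intros)
    moreover have "eventually (\<lambda>\<epsilon>. 0 \<le> B + C * \<epsilon>) (at_right 0)"
      unfolding eventually_at_right_field
    proof (intro exI[of _ \<epsilon>0] conjI allI impI)
      fix \<epsilon> assume e: "0 < \<epsilon>" "\<epsilon> < \<epsilon>0"
      have "0 \<le> \<epsilon> * (B + C * \<epsilon>)" using B[of \<epsilon>] e by (simp add: power2_eq_square algebra_simps)
      then show "0 \<le> B + C * \<epsilon>" using e by (simp add: zero_le_mult_iff)
    qed (use assms in auto)
    ultimately have "0 \<le> B + C * 0" by (intro tendsto_lowerbound) auto
    then show ?thesis by simp
  qed
  have "A \<ge> 0" by (rule *) (use assms in auto)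
  moreover have "- A \<ge> 0"
  proof (rule *)
    fix \<epsilon> assume "0 < \<epsilon>" "\<epsilon> \<le> \<epsilon>0"
    then show "0 \<le> \<epsilon> * - A + C * \<epsilon>\<^sup>2" using assms(2)[of "- \<epsilon>"] by simp
  qed
  ultimately show ?thesis by simp
qed

text \<open>With \<open>\<alpha> = \<gamma> = 0\<close> this is a hat function, which tests the
  equation of motion; with \<open>\<alpha> = 1\<close> and \<open>a = 0\<close> it moves the initial
  point, which tests the boundary condition.\<close>

definition ramp :: "real \<Rightarrow> real \<Rightarrow> real \<Rightarrow> real \<Rightarrow> real \<Rightarrow> real \<Rightarrow> real \<Rightarrow> real" where
  "ramp a b c \<alpha> \<beta> \<gamma> t = (if t \<le> b then \<alpha> + (\<beta> - \<alpha>) / (b - a) * (t - a) else \<beta> + (\<gamma> - \<beta>) / (c - b) * (t - b))"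

lemma ramp_props:
  assumes "a < b" "b < c"
  shows "ramp a b c \<alpha> \<beta> \<gamma> a = \<alpha>" "ramp a b c \<alpha> \<beta> \<gamma> b = \<beta>" "ramp a b c \<alpha> \<beta> \<gamma> c = \<gamma>"
    "\<And>t. t \<ge> b \<Longrightarrow> ramp a b c \<alpha> \<beta> \<gamma> t = \<beta> + (\<gamma> - \<beta>) / (c - b) * (t - b)"
    "continuous_on S (ramp a b c \<alpha> \<beta> \<gamma>)"
proof -
  show r: "\<And>t. t \<ge> b \<Longrightarrow> ramp a b c \<alpha> \<beta> \<gamma> t = \<beta> + (\<gamma> - \<beta>) / (c - b) * (t - b)"
    using assms by (auto simp: ramp_def dest: antisym)
  show "ramp a b c \<alpha> \<beta> \<gamma> a = \<alpha>" "ramp a b c \<alpha> \<beta> \<gamma> b = \<beta>" "ramp a b c \<alpha> \<beta> \<gamma> c = \<gamma>"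
    using assms r[of c] by (auto simp: ramp_def)
  have "continuous_on ({..b} \<union> {b..}) (ramp a b c \<alpha> \<beta> \<gamma>)"
  proof (rule continuous_on_closed_Un)
    have "continuous_on {..b} (\<lambda>t. \<alpha> + (\<beta> - \<alpha>) / (b - a) * (t - a))" by (intro continuous_intros)
    then show "continuous_on {..b} (ramp a b c \<alpha> \<beta> \<gamma>)"
      by (rule continuous_on_eq) (simp add: ramp_def)
    have "continuous_on {b..} (\<lambda>t. \<beta> + (\<gamma> - \<beta>) / (c - b) * (t - b))" by (intro continuous_intros)
    then show "continuous_on {b..} (ramp a b c \<alpha> \<beta> \<gamma>)"
      by (rule continuous_on_eq) (simp add: r)
  qed auto
  moreover have "{..b} \<union> {b..} = (UNIV :: real set)" by auto
  ultimately show "continuous_on S (ramp a b c \<alpha> \<beta> \<gamma>)" using continuous_on_subset by fastforce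
qed


lemma continuous_force:
  assumes c: "\<And>i. continuous_on {a..b} (\<lambda>t. x t $ i)" and f: "\<And>t i j. t \<in> {a..b} \<Longrightarrow> i \<noteq> j \<Longrightarrow> x t $ i \<noteq> x t $ j"
  shows "continuous_on {a..b} (\<lambda>t. force m (x t) i)" "continuous_on {a..b} (\<lambda>t. rpot m (x t))"
  unfolding force_def rpot_def using f by (auto intro!: continuous_intros c)

lemma pot_rpot:
  assumes m: "m > 0" and ab: "a \<le> b" and c: "\<And>i. continuous_on {a..b} (\<lambda>t. x t $ i)"
    and f: "\<And>t i j. t \<in> {a..b} \<Longrightarrow> i \<noteq> j \<Longrightarrow> x t $ i \<noteq> x t $ j"
  shows "pot m a b x = ennreal (integral {a..b} (\<lambda>t. rpot m (x t)))" "0 \<le> integral {a..b} (\<lambda>t. rpot m (x t))"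
proof -
  have "pot m a b x = (\<integral>\<^sup>+t\<in>{a..b}. ennreal (rpot m (x t)) \<partial>lborel)"
    unfolding pot_def by (intro nn_integral_cong) (auto simp: indicator_def f potential_rpot[OF m])
  also have "\<dots> = ennreal (integral {a..b} (\<lambda>t. rpot m (x t)))"
    by (rule nn_integral_has_integral_lebesgue')
       (auto simp: rpot_def m less_imp_le intro!: integrable_integral integrable_continuous_real continuous_force(2)[OF c f, unfolded rpot_def])
  finally show "pot m a b x = ennreal (integral {a..b} (\<lambda>t. rpot m (x t)))" .
  show "0 \<le> integral {a..b} (\<lambda>t. rpot m (x t))"
    by (intro integral_nonneg integrable_continuous_real continuous_force(2)[OF c f]) (auto simp: rpot_def m less_imp_le)
qed

lemma energy_ramp_perturbation:
  fixes g :: "real \<Rightarrow> complex"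
  assumes abc: "a < b" "b < c" and g: "fin_energy a c g"
  shows "fin_energy a c (\<lambda>t. g t + (\<epsilon> * ramp a b c \<alpha> \<beta> \<gamma> t) *\<^sub>R v)"
    "energy a c (\<lambda>t. g t + (\<epsilon> * ramp a b c \<alpha> \<beta> \<gamma> t) *\<^sub>R v) \<le> energy a c g
       + 2 * \<epsilon> * ((\<beta> - \<alpha>) / (b - a) * inner (g b - g a) v + (\<gamma> - \<beta>) / (c - b) * inner (g c - g b) v)
       + \<epsilon>\<^sup>2 * ((norm v)\<^sup>2 * ((\<beta> - \<alpha>)\<^sup>2 / (b - a) + (\<gamma> - \<beta>)\<^sup>2 / (c - b)))"
proof -
  define p q where "p = (\<beta> - \<alpha>) / (b - a)" and "q = (\<gamma> - \<beta>) / (c - b)"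
  let ?y = "\<lambda>t. g t + (\<epsilon> * ramp a b c \<alpha> \<beta> \<gamma> t) *\<^sub>R v"
  have g1: "fin_energy a b g" and g2: "fin_energy b c g" using fin_energy_subset[OF g] abc by auto
  have y1: "?y t = g t + (\<epsilon> * p * t + \<epsilon> * (\<alpha> - p * a)) *\<^sub>R v" if "t \<le> b" for t
    using that by (simp add: ramp_def p_def[symmetric] algebra_simps)
  have y2: "?y t = g t + (\<epsilon> * q * t + \<epsilon> * (\<beta> - q * b)) *\<^sub>R v" if "b \<le> t" for t
  proof -
    have "ramp a b c \<alpha> \<beta> \<gamma> t = \<beta> + q * (t - b)" unfolding q_def by (rule ramp_props(4)[OF abc that])
    then show ?thesis by (simp only:) (simp add: algebra_simps)
  qed
  have E1: "fin_energy a b ?y" "energy a b ?y \<le> energy a b g + 2 * (\<epsilon> * p) * inner (g b - g a) v + (\<epsilon> * p)\<^sup>2 * (norm v)\<^sup>2 * (b - a)"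
    using energy_affine_perturbation[OF _ g1, of "\<epsilon> * p" "\<epsilon> * (\<alpha> - p * a)" v] abc
      energy_cong[of a b ?y "\<lambda>t. g t + (\<epsilon> * p * t + \<epsilon> * (\<alpha> - p * a)) *\<^sub>R v"] y1 by auto
  have E2: "fin_energy b c ?y" "energy b c ?y \<le> energy b c g + 2 * (\<epsilon> * q) * inner (g c - g b) v + (\<epsilon> * q)\<^sup>2 * (norm v)\<^sup>2 * (c - b)"
    using energy_affine_perturbation[OF _ g2, of "\<epsilon> * q" "\<epsilon> * (\<beta> - q * b)" v] abc
      energy_cong[of b c ?y "\<lambda>t. g t + (\<epsilon> * q * t + \<epsilon> * (\<beta> - q * b)) *\<^sub>R v"] y2 by auto
  show "fin_energy a c ?y" using energy_add(1)[OF _ _ E1(1) E2(1)] abc by simp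
  have comb: "A \<le> B + L + X"
    if "A = A1 + A2" "B = B1 + B2" "X1 + X2 = X" "L1 + L2 = L" "A1 \<le> B1 + L1 + X1" "A2 \<le> B2 + L2 + X2"
    for A A1 A2 B B1 B2 X X1 X2 L L1 L2 :: real using that by simp
  have pq: "(\<beta> - \<alpha>)\<^sup>2 / (b - a) = p\<^sup>2 * (b - a)" "(\<gamma> - \<beta>)\<^sup>2 / (c - b) = q\<^sup>2 * (c - b)"
    using abc by (simp_all add: p_def q_def power_divide power2_eq_square)
  show "energy a c ?y \<le> energy a c g
       + 2 * \<epsilon> * ((\<beta> - \<alpha>) / (b - a) * inner (g b - g a) v + (\<gamma> - \<beta>) / (c - b) * inner (g c - g b) v)
       + \<epsilon>\<^sup>2 * ((norm v)\<^sup>2 * ((\<beta> - \<alpha>)\<^sup>2 / (b - a) + (\<gamma> - \<beta>)\<^sup>2 / (c - b)))"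
    unfolding pq p_def[symmetric] q_def[symmetric]
    by (rule comb[OF energy_add(2)[OF _ _ E1(1) E2(1)] energy_split[OF g] _ _ E1(2) E2(2)])
       (use abc in \<open>simp_all add: power_mult_distrib distrib_left distrib_right mult_ac\<close>)
qed

text \<open>For a piecewise linear variation the linear term of the kinetic part involves only the
  values of \<open>x\<close> at \<open>a\<close>, \<open>b\<close>, \<open>c\<close>, so that no
  differentiability of \<open>x\<close> is presupposed. Small \<open>\<epsilon>\<close> of either
  sign force the linear coefficient to vanish.\<close>

lemma first_variation:
  assumes m: "m > 0" and x: "minimizer m ha hb x" and abc: "0 \<le> a" "a < b" "b < c" "c \<le> 1"
    and r: "r > 0" and far: "\<And>t i j. t \<in> {0..1} \<Longrightarrow> i \<noteq> j \<Longrightarrow> norm (x t $ i - x t $ j) \<ge> r"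
    and w: "\<alpha> = 0 \<or> a = 0 \<and> (\<forall>s. ha (x 0 + s *\<^sub>R w) = x 0 + s *\<^sub>R w)"
  shows "(\<Sum>i\<in>UNIV. mass m i * ((\<beta> - \<alpha>) / (b - a) * inner (x b $ i - x a $ i) (w $ i) + (0 - \<beta>) / (c - b) * inner (x c $ i - x b $ i) (w $ i)))
    + integral {a..c} (\<lambda>t. ramp a b c \<alpha> \<beta> 0 t * (\<Sum>i\<in>UNIV. inner (force m (x t) i) (w $ i))) = 0"
    (is "?L + ?I = 0")
proof -
  define \<rho> where "\<rho> = ramp a b c \<alpha> \<beta> 0"
  define S where "S t = (\<Sum>i\<in>UNIV. inner (force m (x t) i) (w $ i))" for t
  have fx: "fin_kin 0 1 x" using x by (simp add: minimizer_def)
  have fx': "fin_kin a c x" using fx by (rule fin_kin_subset) (use abc in auto)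
  have xc: "continuous_on {a..c} (\<lambda>t. x t $ i)" for i by (rule fin_kin_continuous[OF fx'])
  have free: "x t $ i \<noteq> x t $ j" if "t \<in> {a..c}" "i \<noteq> j" for t i j using far[OF _ that(2), of t] that r abc by auto
  have \<rho>c: "continuous_on {a..c} \<rho>" unfolding \<rho>_def by (rule ramp_props(5)) (use abc in auto)
  have Sc: "continuous_on {a..c} S" unfolding S_def by (intro continuous_intros continuous_force(1)[OF xc free])
  have Rc: "continuous_on {a..c} (\<lambda>t. rpot m (x t))" by (rule continuous_force(2)[OF xc free])
  obtain M where M: "M > 0" "\<And>t. t \<in> {a..c} \<Longrightarrow> \<bar>\<rho> t\<bar> \<le> M"
  proof -
    have "bounded (\<rho> ` {a..c})" using compact_continuous_image[OF \<rho>c compact_Icc] by (rule compact_imp_bounded)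
    then obtain B where "\<forall>y\<in>\<rho> ` {a..c}. norm y \<le> B" unfolding bounded_iff by blast
    then show ?thesis using that[of "max B 1"] by (auto simp: le_max_iff_disj)
  qed
  define N where "N = norm w + 1"
  have N: "N > 0" by (simp add: N_def add_nonneg_pos)
  have wN: "norm (w $ i) \<le> N" for i using Finite_Cartesian_Product.norm_nth_le[of w i] by (simp add: N_def)
  define C2 where "C2 = (1 + 2 * m) * (52 / r ^ 3) * (M * N)\<^sup>2"
  define K where "K = (\<Sum>i\<in>UNIV. mass m i / 2 * ((norm (w $ i))\<^sup>2 * ((\<beta> - \<alpha>)\<^sup>2 / (b - a) + (0 - \<beta>)\<^sup>2 / (c - b))))"
  have "0 \<le> \<epsilon> * (?L + ?I) + (C2 * (c - a) + K) * \<epsilon>\<^sup>2" if e: "\<bar>\<epsilon>\<bar> \<le> r / (4 * M * N)" for \<epsilon>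
  proof -
    define y where "y t = (if a \<le> t \<and> t \<le> c then x t + (\<epsilon> * \<rho> t) *\<^sub>R w else x t)" for t
    define g where "g t = rpot m (x t) + \<epsilon> * (\<rho> t * S t) + C2 * \<epsilon>\<^sup>2" for t
    have small: "norm (((\<epsilon> * \<rho> t) *\<^sub>R w) $ i) \<le> \<bar>\<epsilon>\<bar> * (M * N)" if "t \<in> {a..c}" for t i
    proof -
      have "norm (((\<epsilon> * \<rho> t) *\<^sub>R w) $ i) = \<bar>\<epsilon>\<bar> * (\<bar>\<rho> t\<bar> * norm (w $ i))" by (simp add: abs_mult)
      also have "\<dots> \<le> \<bar>\<epsilon>\<bar> * (M * N)" using M(1) M(2)[OF that] wN[of i] by (intro mult_left_mono mult_mono) auto
      finally show ?thesis .
    qed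
    have e4: "\<bar>\<epsilon>\<bar> * (M * N) \<le> r / 4" using e M(1) N by (simp add: field_simps)
    have T: "potential m (y t) \<le> ennreal (g t)" "0 \<le> g t" if t: "t \<in> {a..c}" for t
    proof -
      have t1: "t \<in> {0..1}" using t abc by auto
      have eq: "rpot m (x t) + (\<Sum>i\<in>UNIV. inner (force m (x t) i) (((\<epsilon> * \<rho> t) *\<^sub>R w) $ i)) + (1 + 2 * m) * (52 / r ^ 3) * (\<bar>\<epsilon>\<bar> * (M * N))\<^sup>2 = g t"
        by (simp add: g_def S_def C2_def sum_distrib_left power_mult_distrib mult_ac)
      have "y t = x t + (\<epsilon> * \<rho> t) *\<^sub>R w" using t by (simp add: y_def)
      then show "potential m (y t) \<le> ennreal (g t)" "0 \<le> g t"
        using potential_taylor[OF m r far[OF t1] far[OF t1] far[OF t1] order_trans[OF small[OF t] e4] small[OF t], unfolded eq] by auto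
    qed
    have gc: "continuous_on {a..c} g" unfolding g_def by (intro continuous_intros Rc \<rho>c Sc)
    have B: "pot m a c y \<le> ennreal (integral {a..c} g)" "0 \<le> integral {a..c} g"
    proof -
      have "pot m a c y \<le> (\<integral>\<^sup>+t\<in>{a..c}. ennreal (g t) \<partial>lborel)"
        unfolding pot_def by (intro nn_integral_mono) (auto simp: indicator_def T)
      also have "\<dots> = ennreal (integral {a..c} g)"
        by (rule nn_integral_has_integral_lebesgue') (auto intro!: T(2) integrable_integral integrable_continuous_real gc)
      finally show "pot m a c y \<le> ennreal (integral {a..c} g)" .
      show "0 \<le> integral {a..c} g" by (intro integral_nonneg integrable_continuous_real gc) (auto intro: T(2))
    qed
    have Ig: "integral {a..c} g = integral {a..c} (\<lambda>t. rpot m (x t)) + \<epsilon> * ?I + C2 * \<epsilon>\<^sup>2 * (c - a)"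
    proof -
      have i1: "(\<lambda>t. rpot m (x t)) integrable_on {a..c}" "(\<lambda>t. \<epsilon> * (\<rho> t * S t)) integrable_on {a..c}"
        by (intro integrable_continuous_real continuous_intros Rc \<rho>c Sc)+
      have "(g has_integral integral {a..c} (\<lambda>t. rpot m (x t)) + integral {a..c} (\<lambda>t. \<epsilon> * (\<rho> t * S t)) + C2 * \<epsilon>\<^sup>2 * (c - a)) {a..c}"
        unfolding g_def using has_integral_add[OF has_integral_add[OF i1[THEN integrable_integral]] has_integral_const_real[of "C2 * \<epsilon>\<^sup>2" a c]] abc
        by (simp add: mult.commute)
      then show ?thesis unfolding \<rho>_def S_def by (simp add: integral_unique)
    qed
    have yi: "y t $ i = x t $ i + (\<epsilon> * \<rho> t) *\<^sub>R w $ i" if "a \<le> t" "t \<le> c" for t i using that by (simp add: y_def)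
    have Ey: "fin_energy a c (\<lambda>t. y t $ i)" "energy a c (\<lambda>t. y t $ i) \<le> energy a c (\<lambda>t. x t $ i)
       + 2 * \<epsilon> * ((\<beta> - \<alpha>) / (b - a) * inner (x b $ i - x a $ i) (w $ i) + (0 - \<beta>) / (c - b) * inner (x c $ i - x b $ i) (w $ i))
       + \<epsilon>\<^sup>2 * ((norm (w $ i))\<^sup>2 * ((\<beta> - \<alpha>)\<^sup>2 / (b - a) + (0 - \<beta>)\<^sup>2 / (c - b)))" for i
      unfolding energy_cong[of a c "\<lambda>t. y t $ i" "\<lambda>t. x t $ i + (\<epsilon> * \<rho> t) *\<^sub>R w $ i", OF yi, simplified]
      unfolding \<rho>_def by (intro energy_ramp_perturbation abc(2,3) fin_kinD[OF fx'])+
    have kin: "kin m a c y \<le> kin m a c x + \<epsilon> * ?L + \<epsilon>\<^sup>2 * K"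
    proof -
      have term_eq: "M / 2 * (E + 2 * \<epsilon> * L + \<epsilon>\<^sup>2 * Q) = M / 2 * E + \<epsilon> * (M * L) + \<epsilon>\<^sup>2 * (M / 2 * Q)" for M E L Q :: real
        by (simp add: algebra_simps)
      have split: "(\<Sum>i\<in>UNIV. mass m i / 2 * (E i + 2 * \<epsilon> * L i + \<epsilon>\<^sup>2 * Q i))
        = (\<Sum>i\<in>UNIV. mass m i / 2 * E i) + \<epsilon> * (\<Sum>i\<in>UNIV. mass m i * L i) + \<epsilon>\<^sup>2 * (\<Sum>i\<in>UNIV. mass m i / 2 * Q i)" for E L Q :: "3 \<Rightarrow> real"
        unfolding term_eq sum.distrib sum_distrib_left ..
      have "kin m a c y \<le> (\<Sum>i\<in>UNIV. mass m i / 2 * (energy a c (\<lambda>t. x t $ i)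
       + 2 * \<epsilon> * ((\<beta> - \<alpha>) / (b - a) * inner (x b $ i - x a $ i) (w $ i) + (0 - \<beta>) / (c - b) * inner (x c $ i - x b $ i) (w $ i))
       + \<epsilon>\<^sup>2 * ((norm (w $ i))\<^sup>2 * ((\<beta> - \<alpha>)\<^sup>2 / (b - a) + (0 - \<beta>)\<^sup>2 / (c - b)))))"
        unfolding kin_def by (intro sum_mono mult_left_mono Ey(2)) (use mass_pos[OF m] in \<open>simp add: less_imp_le\<close>)
      also have "\<dots> = kin m a c x + \<epsilon> * ?L + \<epsilon>\<^sup>2 * K"
        unfolding kin_def K_def by (rule split)
      finally show ?thesis .
    qed
    have "kin m a c x + enn2real (pot m a c x) \<le> kin m a c y + integral {a..c} g"
    proof (rule minimizer_local[OF m x abc(1) _ abc(4) _ _ _ _ _ B])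
      show "a \<le> c" using abc by simp
      show "fin_kin a c y" unfolding fin_kin_def using Ey(1) by blast
      have \<rho>ac: "\<rho> a = \<alpha>" "\<rho> c = 0" using ramp_props[OF abc(2,3)] by (auto simp: \<rho>_def)
      show "y t = x t" if "0 \<le> t" "t \<le> a" "0 < a" for t
        using that \<rho>ac w abc by (cases "t = a") (auto simp: y_def)
      show "y t = x t" if "c \<le> t" "t \<le> 1" "c < 1" for t
        using that \<rho>ac by (cases "t = c") (auto simp: y_def)
      have "ha (x 0) = x 0" "hb (x 1) = x 1" using x by (auto simp: minimizer_def)
      then show "ha (y 0) = y 0" "hb (y 1) = y 1" using w \<rho>ac abc by (cases "c = 1"; auto simp: y_def; fail)+
    qed
    moreover have "enn2real (pot m a c x) = integral {a..c} (\<lambda>t. rpot m (x t))"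
      using pot_rpot[OF m _ xc free] abc by simp
    ultimately show ?thesis using kin Ig by (simp add: algebra_simps)
  qed
  moreover have pos: "r / (4 * M * N) > 0" by (intro divide_pos_pos mult_pos_pos r M(1) N) simp
  ultimately show ?thesis using linear_coefficient_zero[OF pos] by blast
qed

text \<open>Two integrations by parts: on each linear piece
  \<open>(p * t + q) * \<psi> t - p * \<Psi> t\<close> is a primitive of
  \<open>(p * t + q) * f t\<close>, and the terms \<open>\<beta> * \<psi> b\<close> at the kink
  cancel.\<close>

lemma ramp_integral:
  fixes \<Psi> \<psi> f :: "real \<Rightarrow> real"
  assumes abc: "a < b" "b < c"
    and \<Psi>: "\<And>t. t \<in> {a..c} \<Longrightarrow> (\<Psi> has_vector_derivative \<psi> t) (at t within {a..c})"
    and \<psi>: "\<And>t. t \<in> {a..c} \<Longrightarrow> (\<psi> has_vector_derivative f t) (at t within {a..c})"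
  shows "integral {a..c} (\<lambda>t. ramp a b c \<alpha> \<beta> 0 t * f t)
    = - \<alpha> * \<psi> a - (\<beta> - \<alpha>) / (b - a) * (\<Psi> b - \<Psi> a) - (0 - \<beta>) / (c - b) * (\<Psi> c - \<Psi> b)"
proof -
  have piece: "((\<lambda>t. (p * t + q) * f t) has_integral ((p * v + q) * \<psi> v - p * \<Psi> v) - ((p * u + q) * \<psi> u - p * \<Psi> u)) {u..v}"
    if "a \<le> u" "u \<le> v" "v \<le> c" for p q u v
  proof (rule fundamental_theorem_of_calculus[OF that(2)])
    fix t assume t: "t \<in> {u..v}"
    have "(\<Psi> has_real_derivative \<psi> t) (at t within {u..v})" "(\<psi> has_real_derivative f t) (at t within {u..v})"
      using \<Psi>[of t] \<psi>[of t] t that by (auto simp: has_real_derivative_iff_has_vector_derivative intro: has_vector_derivative_within_subset)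
    then have "((\<lambda>t. (p * t + q) * \<psi> t - p * \<Psi> t) has_real_derivative (p * t + q) * f t) (at t within {u..v})"
      by (auto intro!: derivative_eq_intros)
    then show "((\<lambda>t. (p * t + q) * \<psi> t - p * \<Psi> t) has_vector_derivative (p * t + q) * f t) (at t within {u..v})"
      by (simp add: has_real_derivative_iff_has_vector_derivative)
  qed
  define p p' where "p = (\<beta> - \<alpha>) / (b - a)" and "p' = (0 - \<beta>) / (c - b)"
  have pab: "p * (b - a) = \<beta> - \<alpha>" "p' * (c - b) = - \<beta>" using abc by (auto simp: p_def p'_def)
  have i1: "((\<lambda>t. ramp a b c \<alpha> \<beta> 0 t * f t) has_integral ((p * b + (\<alpha> - p * a)) * \<psi> b - p * \<Psi> b) - ((p * a + (\<alpha> - p * a)) * \<psi> a - p * \<Psi> a)) {a..b}"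
    by (rule has_integral_eq[OF _ piece]) (use abc in \<open>auto simp: ramp_def p_def[symmetric] algebra_simps\<close>)
  have i2: "((\<lambda>t. ramp a b c \<alpha> \<beta> 0 t * f t) has_integral ((p' * c + (\<beta> - p' * b)) * \<psi> c - p' * \<Psi> c) - ((p' * b + (\<beta> - p' * b)) * \<psi> b - p' * \<Psi> b)) {b..c}"
  proof (rule has_integral_eq[OF _ piece])
    fix t assume "t \<in> {b..c}"
    then have "ramp a b c \<alpha> \<beta> 0 t = \<beta> + p' * (t - b)" unfolding p'_def by (intro ramp_props(4)[OF abc]) auto
    then show "(p' * t + (\<beta> - p' * b)) * f t = ramp a b c \<alpha> \<beta> 0 t * f t" by (simp only:) (simp add: algebra_simps)
  qed (use abc in auto)
  have e: "p * b + (\<alpha> - p * a) = \<beta>" "p * a + (\<alpha> - p * a) = \<alpha>" "p' * c + (\<beta> - p' * b) = 0" "p' * b + (\<beta> - p' * b) = \<beta>"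
    using pab by (auto simp: algebra_simps)
  have "((\<lambda>t. ramp a b c \<alpha> \<beta> 0 t * f t) has_integral (\<beta> * \<psi> b - p * \<Psi> b - (\<alpha> * \<psi> a - p * \<Psi> a)) + (0 * \<psi> c - p' * \<Psi> c - (\<beta> * \<psi> b - p' * \<Psi> b))) {a..c}"
    using has_integral_combine[OF _ _ i1 i2] abc unfolding e by simp
  then have "integral {a..c} (\<lambda>t. ramp a b c \<alpha> \<beta> 0 t * f t) = (\<beta> * \<psi> b - p * \<Psi> b - (\<alpha> * \<psi> a - p * \<Psi> a)) + (0 * \<psi> c - p' * \<Psi> c - (\<beta> * \<psi> b - p' * \<Psi> b))"
    by (rule integral_unique)
  then show ?thesis unfolding p_def[symmetric] p'_def[symmetric] by (simp add: algebra_simps)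
qed

text \<open>The argument of du Bois-Reymond. \<open>g i\<close> is mass times position minus the
  second primitive \<open>\<Psi> i\<close> of the force. Hat functions show that its chords over
  \<open>[0, t]\<close> and \<open>[t, 1]\<close> have the same slope, so \<open>g i\<close> is
  affine and \<open>x\<close> inherits two derivatives from \<open>\<Psi>\<close>.\<close>

lemma euler_lagrange:
  assumes m: "m > 0" and x: "minimizer m ha hb x"
    and free: "\<And>t i j. t \<in> {0..1} \<Longrightarrow> i \<noteq> j \<Longrightarrow> x t $ i \<noteq> x t $ j"
  obtains v :: "real \<Rightarrow> config" where
    "\<And>t i. t \<in> {0..1} \<Longrightarrow> ((\<lambda>s. x s $ i) has_vector_derivative v t $ i) (at t within {0..1})"
    "\<And>t i. t \<in> {0..1} \<Longrightarrow> ((\<lambda>s. v s $ i) has_vector_derivative force m (x t) i /\<^sub>R mass m i) (at t within {0..1})"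
    "\<And>w. (\<forall>s. ha (x 0 + s *\<^sub>R w) = x 0 + s *\<^sub>R w) \<Longrightarrow> (\<Sum>i\<in>UNIV. mass m i * inner (v 0 $ i) (w $ i)) = 0"
proof -
  have fx: "fin_kin 0 1 x" using x by (simp add: minimizer_def)
  have xc: "continuous_on {0..1} (\<lambda>t. x t $ i)" for i by (rule fin_kin_continuous[OF fx])
  have "\<exists>r>0. \<forall>t\<in>{0..1}. r \<le> norm (x t $ i - x t $ j)" if "i \<noteq> j" for i j
  proof -
    have "continuous_on {0..1} (\<lambda>t. norm (x t $ i - x t $ j))" by (intro continuous_intros xc)
    then obtain s where "s \<in> {0..1}" "\<forall>t\<in>{0..1}. norm (x s $ i - x s $ j) \<le> norm (x t $ i - x t $ j)"
      using continuous_attains_inf[of "{0..1::real}" "\<lambda>t. norm (x t $ i - x t $ j)"] by auto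
    then show ?thesis using free[of s i j] that by (intro exI[of _ "norm (x s $ i - x s $ j)"]) auto
  qed
  then obtain R where R: "\<And>i j. i \<noteq> j \<Longrightarrow> R i j > 0" "\<And>i j t. i \<noteq> j \<Longrightarrow> t \<in> {0..1} \<Longrightarrow> R i j \<le> norm (x t $ i - x t $ j)"
    by metis
  define r where "r = Min ((\<lambda>(i, j). R i j) ` {(i, j). i \<noteq> j})"
  have ne: "(1, 2) \<in> {(i, j). i \<noteq> (j :: 3)}" by simp
  have r: "r > 0" unfolding r_def using ne by (subst Min_gr_iff) (simp, blast, use R(1) in auto)
  have far: "r \<le> norm (x t $ i - x t $ j)" if "t \<in> {0..1}" "i \<noteq> j" for t i j
  proof -
    have "r \<le> R i j" unfolding r_def using that(2) by (intro Min_le) auto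
    then show ?thesis using R(2)[OF that(2,1)] by linarith
  qed
  define \<psi> where "\<psi> i t = integral {0..t} (\<lambda>s. force m (x s) i)" for i t
  define \<Psi> where "\<Psi> i t = integral {0..t} (\<psi> i)" for i t
  have d1: "(\<psi> i has_vector_derivative force m (x t) i) (at t within {0..1})" if "t \<in> {0..1}" for i t
    unfolding \<psi>_def using that by (intro integral_has_vector_derivative continuous_force(1)[OF xc free]) auto
  have d2: "(\<Psi> i has_vector_derivative \<psi> i t) (at t within {0..1})" if "t \<in> {0..1}" for i t
  proof -
    have "continuous_on {0..1} (\<psi> i)" using d1 by (meson continuous_on_eq_continuous_within has_vector_derivative_continuous)
    then show ?thesis unfolding \<Psi>_def using that by (intro integral_has_vector_derivative) auto
  qed
  define g where "g i t = mass m i *\<^sub>R x t $ i - \<Psi> i t" for i t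
  have var: "(\<Sum>i\<in>UNIV. inner (((\<beta> - \<alpha>) / (b - a)) *\<^sub>R (g i b - g i a) + ((0 - \<beta>) / (c - b)) *\<^sub>R (g i c - g i b) - \<alpha> *\<^sub>R \<psi> i a) (w $ i)) = 0"
    if abc: "0 \<le> a" "a < b" "b < c" "c \<le> 1" and w: "\<alpha> = 0 \<or> a = 0 \<and> (\<forall>s. ha (x 0 + s *\<^sub>R w) = x 0 + s *\<^sub>R w)" for a b c \<alpha> \<beta> w
  proof -
    have sub: "{a..c} \<subseteq> {0..1}" using abc by auto
    have D2: "((\<lambda>t. \<Sum>i\<in>UNIV. inner (\<Psi> i t) (w $ i)) has_vector_derivative (\<Sum>i\<in>UNIV. inner (\<psi> i t) (w $ i))) (at t within {a..c})"
      and D1: "((\<lambda>t. \<Sum>i\<in>UNIV. inner (\<psi> i t) (w $ i)) has_vector_derivative (\<Sum>i\<in>UNIV. inner (force m (x t) i) (w $ i))) (at t within {a..c})"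
      if "t \<in> {a..c}" for t
      by (intro has_vector_derivative_sum bounded_linear.has_vector_derivative[OF bounded_linear_inner_left]
          has_vector_derivative_within_subset[OF d2 sub] has_vector_derivative_within_subset[OF d1 sub]; use that sub in auto)+
    have "(\<Sum>i\<in>UNIV. inner (((\<beta> - \<alpha>) / (b - a)) *\<^sub>R (g i b - g i a) + ((0 - \<beta>) / (c - b)) *\<^sub>R (g i c - g i b) - \<alpha> *\<^sub>R \<psi> i a) (w $ i))
      = (\<Sum>i\<in>UNIV. mass m i * ((\<beta> - \<alpha>) / (b - a) * inner (x b $ i - x a $ i) (w $ i) + (0 - \<beta>) / (c - b) * inner (x c $ i - x b $ i) (w $ i)))
      + (- \<alpha> * (\<Sum>i\<in>UNIV. inner (\<psi> i a) (w $ i)) - (\<beta> - \<alpha>) / (b - a) * ((\<Sum>i\<in>UNIV. inner (\<Psi> i b) (w $ i)) - (\<Sum>i\<in>UNIV. inner (\<Psi> i a) (w $ i)))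
        - (0 - \<beta>) / (c - b) * ((\<Sum>i\<in>UNIV. inner (\<Psi> i c) (w $ i)) - (\<Sum>i\<in>UNIV. inner (\<Psi> i b) (w $ i))))"
    proof -
      define p q where "p = (\<beta> - \<alpha>) / (b - a)" and "q = (0 - \<beta>) / (c - b)"
      show ?thesis
        unfolding p_def[symmetric] q_def[symmetric] sum_UNIV_3 g_def
        by (simp add: inner_add_left inner_diff_left algebra_simps)
    qed
    then show ?thesis
      using first_variation[OF m x abc r far w, of \<beta>] ramp_integral[OF abc(2,3) D2 D1, of \<alpha> \<beta>] by simp
  qed
  have aff: "g i t = g i 0 + t *\<^sub>R (g i 1 - g i 0)" if t: "t \<in> {0..1}" for i t
  proof (cases "0 < t \<and> t < 1")
    case True
    have "inner ((1 / t) *\<^sub>R (g i t - g i 0) - (1 / (1 - t)) *\<^sub>R (g i 1 - g i t)) e = 0" for e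
    proof -
      have "(\<Sum>j\<in>UNIV. inner (((1 - 0) / (t - 0)) *\<^sub>R (g j t - g j 0) + ((0 - 1) / (1 - t)) *\<^sub>R (g j 1 - g j t) - 0 *\<^sub>R \<psi> j 0) (axis i e $ j)) = 0"
        by (rule var) (use True in auto)
      moreover have "(\<Sum>j\<in>UNIV. inner (Q j) (axis i e $ j)) = inner (Q i) e" for Q :: "3 \<Rightarrow> complex"
      proof -
        have "(\<Sum>j\<in>UNIV. inner (Q j) (axis i e $ j)) = (\<Sum>j\<in>UNIV. if j = i then inner (Q i) e else 0)"
          by (intro sum.cong) (auto simp: axis_def)
        then show ?thesis by simp
      qed
      ultimately show ?thesis by simp
    qed
    then have "(1 / t) *\<^sub>R (g i t - g i 0) - (1 / (1 - t)) *\<^sub>R (g i 1 - g i t) = 0" using inner_eq_zero_iff by blast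
    then have "(t * (1 - t)) *\<^sub>R ((1 / t) *\<^sub>R (g i t - g i 0) - (1 / (1 - t)) *\<^sub>R (g i 1 - g i t)) = 0" by simp
    then have "(1 - t) *\<^sub>R (g i t - g i 0) - t *\<^sub>R (g i 1 - g i t) = 0" using True unfolding scaleR_diff_right scaleR_scaleR by simp
    then show ?thesis by (simp add: algebra_simps)
  next
    case False
    then have "t = 0 \<or> t = 1" using t by auto
    then show ?thesis by auto
  qed
  define v where "v t = (\<chi> i. (\<psi> i t + (g i 1 - g i 0)) /\<^sub>R mass m i)" for t
  have mp: "mass m i \<noteq> 0" for i using mass_pos[OF m, of i] by simp
  show ?thesis
  proof (rule that)
    fix t :: real and i :: 3 assume t: "t \<in> {0..1}"
    have "((\<lambda>s. (\<Psi> i s + (g i 0 + s *\<^sub>R (g i 1 - g i 0))) /\<^sub>R mass m i) has_vector_derivative v t $ i) (at t within {0..1})"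
      unfolding v_def by (auto intro!: derivative_eq_intros d2 t)
    then show "((\<lambda>s. x s $ i) has_vector_derivative v t $ i) (at t within {0..1})"
    proof (rule has_vector_derivative_transform[OF t, rotated])
      show "x s $ i = (\<Psi> i s + (g i 0 + s *\<^sub>R (g i 1 - g i 0))) /\<^sub>R mass m i" if "s \<in> {0..1}" for s
        unfolding aff[OF that, symmetric] unfolding g_def using mp[of i] by simp
    qed
    show "((\<lambda>s. v s $ i) has_vector_derivative force m (x t) i /\<^sub>R mass m i) (at t within {0..1})"
      unfolding v_def by (auto intro!: derivative_eq_intros d1 t)
  next
    fix w assume w: "\<forall>s. ha (x 0 + s *\<^sub>R w) = x 0 + s *\<^sub>R w"
    \<comment> \<open>The test function falls from 1 to 0 on \<open>[0, 1/2]\<close> and vanishes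
      afterwards; its initial displacement is the admissible vector \<open>w\<close>.\<close>
    have "(\<Sum>i\<in>UNIV. inner (((0 - 1) / (1/2 - 0)) *\<^sub>R (g i (1/2) - g i 0) + ((0 - 0) / (1 - 1/2)) *\<^sub>R (g i 1 - g i (1/2)) - 1 *\<^sub>R \<psi> i 0) (w $ i)) = 0"
      by (rule var) (use w in auto)
    moreover have "g i (1/2) - g i 0 = (1/2) *\<^sub>R (g i 1 - g i 0)" for i using aff[of "1/2" i] by simp
    ultimately have "(\<Sum>i\<in>UNIV. inner (- (\<psi> i 0 + (g i 1 - g i 0))) (w $ i)) = 0" by simp
    moreover have "inner (- (\<psi> i 0 + (g i 1 - g i 0))) (w $ i) = - (mass m i * inner (v 0 $ i) (w $ i))" for i
    proof -
      have "mass m i * inner (v 0 $ i) (w $ i) = inner (\<psi> i 0 + (g i 1 - g i 0)) (w $ i)" using mp[of i] by (simp add: v_def)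
      then show ?thesis by (simp only: inner_minus_left)
    qed
    ultimately show "(\<Sum>i\<in>UNIV. mass m i * inner (v 0 $ i) (w $ i)) = 0" by (simp add: sum_negf)
  qed
qed

section \<open>The action of smooth paths\<close>

lemma has_vector_derivative_componentwise:
  fixes f :: "real \<Rightarrow> 'a::real_normed_vector ^ 'n"
  assumes "\<And>i. ((\<lambda>t. f t $ i) has_vector_derivative f' $ i) (at x within S)"
  shows "(f has_vector_derivative f') (at x within S)"
proof -
  have "((\<lambda>y. (1 / norm (y - x)) *\<^sub>R (f y - (f x + (y - x) *\<^sub>R f'))) \<longlongrightarrow> 0) (at x within S)"
    using assms unfolding has_vector_derivative_def has_derivative_within by (intro vec_tendstoI) simp
  then show ?thesis unfolding has_vector_derivative_def has_derivative_within by (simp add: bounded_linear_scaleR_left)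
qed

lemma has_vector_derivative_nth:
  fixes f :: "real \<Rightarrow> 'a::real_normed_vector ^ 'n"
  assumes "(f has_vector_derivative f') F"
  shows "((\<lambda>t. f t $ i) has_vector_derivative f' $ i) F"
  by (rule bounded_linear.has_vector_derivative[OF bounded_linear_vec_nth assms])

lemma continuous_on_componentwise:
  fixes f :: "real \<Rightarrow> 'a::real_normed_vector ^ 'n"
  assumes "\<And>i. continuous_on S (\<lambda>t. f t $ i)"
  shows "continuous_on S f"
  using assms unfolding continuous_on_def by (auto intro: vec_tendstoI)

definition C1_path :: "(real \<Rightarrow> config) \<Rightarrow> (real \<Rightarrow> config) \<Rightarrow> bool" where
  "C1_path x v \<longleftrightarrow> continuous_on {0..1} v \<and> (\<forall>t\<in>{0..1}. (x has_vector_derivative v t) (at t within {0..1}))"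

lemma C1_pathD:
  assumes "C1_path x v"
  shows "continuous_on {0..1} (\<lambda>t. v t $ i)" "t \<in> {0..1} \<Longrightarrow> ((\<lambda>s. x s $ i) has_vector_derivative v t $ i) (at t within {0..1})"
  using assms by (auto simp: C1_path_def intro!: continuous_intros has_vector_derivative_nth)

lemma C1_path_L2_derivative:
  assumes "C1_path x v"
  shows "has_L2_derivative 0 1 x v"
proof -
  have c: "continuous_on {0..1} v" and d: "\<And>t. t \<in> {0..1} \<Longrightarrow> (x has_vector_derivative v t) (at t within {0..1})"
    using assms by (auto simp: C1_path_def)
  show ?thesis
    unfolding has_L2_derivative_def
  proof (intro conjI ballI)
    show "set_borel_measurable lborel {0..1} v"
      unfolding set_borel_measurable_def using borel_measurable_continuous_on_indicator[OF _ c] by simp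
    show "set_integrable lborel {0..1} (\<lambda>t. (norm (v t))\<^sup>2)" by (intro borel_integrable_atLeastAtMost' continuous_intros c)
    fix t :: real assume t: "t \<in> {0..1}"
    have "(LBINT s:{0..t}. v s) = x t - x 0"
      unfolding set_lebesgue_integral_def
      by (rule integral_FTC_atLeastAtMost) (use t in \<open>auto intro!: has_vector_derivative_within_subset[OF d] continuous_on_subset[OF c]\<close>)
    then show "x t = x 0 + (LBINT s:{0..t}. v s)" by simp
  qed
qed

text \<open>The positive and the negative part of \<open>u\<close> are densities of finite measures
  that agree on all half-lines and hence are equal. The two parts then coincide almost everywhere
  and, never being positive together, vanish there.\<close>

lemma AE_zero_if_integrals_zero:
  fixes u :: "real \<Rightarrow> real"
  assumes u: "integrable lborel u" and z: "\<And>t. (\<integral>x. indicator {t<..} x * u x \<partial>lborel) = 0"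
  shows "AE x in lborel. u x = 0"
proof -
  define p n where "p x = max (u x) 0" and "n x = max (- u x) 0" for x
  have um: "u \<in> borel_measurable lborel" using u by simp
  have pi: "integrable lborel p" and ni: "integrable lborel n" using u unfolding p_def[abs_def] n_def[abs_def] by (intro integrable_max; simp)+
  have pm: "p \<in> borel_measurable lborel" and nm: "n \<in> borel_measurable lborel" using pi ni by auto
  have iset: "integrable lborel (\<lambda>x. indicator {t<..} x * h x)" if "integrable lborel h" for h :: "real \<Rightarrow> real" and t
    using integrable_mult_indicator[OF _ that, of "{t<..}"] by simp
  have em: "emeasure (density lborel (\<lambda>x. ennreal (h x))) {t<..} = ennreal (\<integral>x. indicator {t<..} x * h x \<partial>lborel)"
    if h: "integrable lborel h" "\<And>x. h x \<ge> 0" for h :: "real \<Rightarrow> real" and t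
  proof -
    have hm: "h \<in> borel_measurable lborel" using h by auto
    have "emeasure (density lborel (\<lambda>x. ennreal (h x))) {t<..} = (\<integral>\<^sup>+x. ennreal (h x) * indicator {t<..} x \<partial>lborel)"
      using hm by (intro emeasure_density) auto
    also have "\<dots> = (\<integral>\<^sup>+x. ennreal (indicator {t<..} x * h x) \<partial>lborel)"
      by (intro nn_integral_cong) (auto simp: indicator_def)
    also have "\<dots> = ennreal (\<integral>x. indicator {t<..} x * h x \<partial>lborel)"
      by (intro nn_integral_eq_integral iset h) (auto simp: h indicator_def)
    finally show ?thesis .
  qed
  have eq: "(\<integral>x. indicator {t<..} x * p x \<partial>lborel) = (\<integral>x. indicator {t<..} x * n x \<partial>lborel)" for t
  proof -
    have "(\<integral>x. indicator {t<..} x * p x \<partial>lborel) - (\<integral>x. indicator {t<..} x * n x \<partial>lborel)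
      = (\<integral>x. indicator {t<..} x * p x - indicator {t<..} x * n x \<partial>lborel)"
      by (intro Bochner_Integration.integral_diff[symmetric] iset pi ni)
    also have "\<dots> = (\<integral>x. indicator {t<..} x * u x \<partial>lborel)"
      by (intro Bochner_Integration.integral_cong) (auto simp: p_def n_def indicator_def)
    finally show ?thesis using z by simp
  qed
  have "density lborel (\<lambda>x. ennreal (p x)) = density lborel (\<lambda>x. ennreal (n x))"
  proof (rule measure_eqI_lessThan)
    have p0: "p x \<ge> 0" and n0: "n x \<ge> 0" for x by (simp_all add: p_def n_def)
    show "emeasure (density lborel (\<lambda>x. ennreal (p x))) {t<..} < \<infinity>" for t
      unfolding em[OF pi p0] by (simp add: ennreal_less_top)
    show "emeasure (density lborel (\<lambda>x. ennreal (p x))) {t<..} = emeasure (density lborel (\<lambda>x. ennreal (n x))) {t<..}" for t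
      unfolding em[OF pi p0] em[OF ni n0] eq ..
  qed simp_all
  moreover have "(\<lambda>x. ennreal (p x)) \<in> borel_measurable lborel" "(\<lambda>x. ennreal (n x)) \<in> borel_measurable lborel"
    using measurable_compose[OF pm measurable_ennreal] measurable_compose[OF nm measurable_ennreal] by auto
  ultimately have "AE x in lborel. ennreal (p x) = ennreal (n x)"
    using sigma_finite_measure.density_unique_iff[OF lborel.sigma_finite_measure_axioms] by blast
  then show ?thesis by eventually_elim (auto simp: p_def n_def max_def split: if_splits)
qed

text \<open>\<open>weak_deriv\<close> is chosen by \<open>SOME\<close>; this uniqueness identifies
  it, up to a null set, with the classical derivative of a smooth path.\<close>

lemma L2_derivative_unique:
  assumes v: "has_L2_derivative 0 1 x v" and w: "has_L2_derivative 0 1 x w"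
  shows "AE t in lborel. t \<in> {0..1} \<longrightarrow> v t = w t"
proof -
  have L1: "set_integrable lborel {0..1} f" if "has_L2_derivative 0 1 x f" for f :: "real \<Rightarrow> config"
  proof -
    have m: "set_borel_measurable lborel {0..1} f" and i: "set_integrable lborel {0..1} (\<lambda>t. (norm (f t))\<^sup>2)"
      using that unfolding has_L2_derivative_def by blast+
    have "set_integrable lborel {0..1::real} (\<lambda>t. 1 + (norm (f t))\<^sup>2)"
      by (intro set_integral_add i) (auto intro!: borel_integrable_atLeastAtMost' continuous_intros)
    then show ?thesis
      unfolding set_integrable_def
    proof (rule Bochner_Integration.integrable_bound)
      have b: "r \<le> 1 + r\<^sup>2" for r :: real using zero_le_power2[of "r - 1/2"] by (simp add: power2_eq_square algebra_simps)
      show "AE t in lborel. norm (indicat_real {0..1} t *\<^sub>R f t) \<le> norm (indicat_real {0..1} t *\<^sub>R (1 + (norm (f t))\<^sup>2))"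
        using b by (auto simp: indicator_def)
    qed (use m in \<open>simp add: set_borel_measurable_def\<close>)
  qed
  define u where "u t = indicator {0..1} t *\<^sub>R (v t - w t)" for t :: real
  have ui: "integrable lborel u"
  proof -
    have "set_integrable lborel {0..1} (\<lambda>t. v t - w t)" by (intro set_integral_diff L1 v w)
    then show ?thesis by (simp add: set_integrable_def u_def[abs_def])
  qed
  have uz: "(\<integral>s. indicator {..t} s *\<^sub>R u s \<partial>lborel) = 0" for t
  proof (cases "t < 0")
    case True
    then have z: "indicator {..t} s *\<^sub>R u s = 0" for s by (auto simp: u_def indicator_def)
    show ?thesis unfolding z by simp
  next
    case False
    define t' where "t' = min t 1"
    have t': "t' \<in> {0..1}" using False by (auto simp: t'_def)
    have e: "indicator {..t} s *\<^sub>R u s = indicator {0..t'} s *\<^sub>R (v s - w s)" for s by (auto simp: u_def indicator_def t'_def)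
    have sub: "set_integrable lborel {0..t'} v" "set_integrable lborel {0..t'} w"
      by (rule set_integrable_subset[OF L1[OF v]]; use t' in auto; fail) (rule set_integrable_subset[OF L1[OF w]]; use t' in auto; fail)
    have "(LBINT s:{0..t'}. v s - w s) = (LBINT s:{0..t'}. v s) - (LBINT s:{0..t'}. w s)" by (rule set_integral_diff(2)[OF sub])
    also have "\<dots> = 0"
    proof -
      have "x t' = x 0 + (LBINT s:{0..t'}. v s)" "x t' = x 0 + (LBINT s:{0..t'}. w s)" using v w t' unfolding has_L2_derivative_def by blast+
      then show ?thesis by simp
    qed
    finally show ?thesis by (simp add: e set_lebesgue_integral_def)
  qed
  have tot: "(\<integral>s. u s \<partial>lborel) = 0"
  proof -
    have "indicator {..1} s *\<^sub>R u s = u s" for s by (auto simp: u_def indicator_def)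
    then show ?thesis using uz[of 1] by simp
  qed
  have comp: "AE t in lborel. inner (u t) b = 0" for b
  proof (rule AE_zero_if_integrals_zero)
    show "integrable lborel (\<lambda>t. inner (u t) b)" using ui by simp
    fix t :: real
    have i1: "integrable lborel (\<lambda>s. indicator {..t} s *\<^sub>R u s)" by (rule integrable_mult_indicator[OF _ ui]) auto
    have e: "indicator {t<..} s * inner (u s) b = inner (u s - indicator {..t} s *\<^sub>R u s) b" for s
      by (auto simp: indicator_def)
    have "(\<integral>s. u s - indicator {..t} s *\<^sub>R u s \<partial>lborel) = 0"
      using Bochner_Integration.integral_diff[OF ui i1] tot uz by simp
    then show "(\<integral>s. indicator {t<..} s * inner (u s) b \<partial>lborel) = 0"
      unfolding e using integral_inner_left[of b lborel "\<lambda>s. u s - indicator {..t} s *\<^sub>R u s"] Bochner_Integration.integrable_diff[OF ui i1] by simp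
  qed
  have "AE t in lborel. \<forall>b\<in>Basis. inner (u t) b = 0" by (intro AE_finite_allI comp) simp
  then show ?thesis
  proof eventually_elim
    case (elim t)
    then have "u t = 0" by (simp add: euclidean_all_zero_iff)
    then show ?case by (auto simp: u_def)
  qed
qed

lemma integral_square_deriv:
  fixes f f' :: "real \<Rightarrow> complex"
  assumes st: "s \<le> t" and d: "\<And>r. r \<in> {s..t} \<Longrightarrow> (f has_vector_derivative f' r) (at r within {s..t})" and c: "continuous_on {s..t} f'"
  shows "integral {s..t} (\<lambda>r. (norm (f' r - e))\<^sup>2) = integral {s..t} (\<lambda>r. (norm (f' r))\<^sup>2) - 2 * inner (f t - f s) e + (norm e)\<^sup>2 * (t - s)"
proof -
  have i: "(f' has_integral f t - f s) {s..t}" by (rule fundamental_theorem_of_calculus[OF st d])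
  have j: "((\<lambda>r. (norm (f' r))\<^sup>2) has_integral integral {s..t} (\<lambda>r. (norm (f' r))\<^sup>2)) {s..t}"
    by (intro integrable_integral integrable_continuous_real continuous_intros c)
  have k: "((\<lambda>r. 2 * inner (f' r) e) has_integral 2 * inner (f t - f s) e) {s..t}"
    by (intro has_integral_mult_right has_integral_linear[OF i bounded_linear_inner_left, unfolded o_def])
  have "((\<lambda>r. (norm (f' r))\<^sup>2 - 2 * inner (f' r) e + (norm e)\<^sup>2) has_integral integral {s..t} (\<lambda>r. (norm (f' r))\<^sup>2) - 2 * inner (f t - f s) e + (norm e)\<^sup>2 * (t - s)) {s..t}"
    using has_integral_add[OF has_integral_diff[OF j k] has_integral_const_real[of "(norm e)\<^sup>2" s t]] st by (simp add: mult.commute)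
  moreover have "(\<lambda>r. (norm (f' r - e))\<^sup>2) = (\<lambda>r. (norm (f' r))\<^sup>2 - 2 * inner (f' r) e + (norm e)\<^sup>2)"
    by (simp add: power2_norm_eq_inner inner_diff_left inner_diff_right inner_commute algebra_simps fun_eq_iff)
  ultimately show ?thesis by (simp add: integral_unique)
qed

text \<open>The integral of \<open>|f' - e|^2\<close> is nonnegative for the mean slope
  \<open>e\<close>; this is the increment inequality required by \<open>energy_dom\<close>.\<close>

lemma energy_C1_le:
  fixes f f' :: "real \<Rightarrow> complex"
  assumes d: "\<And>r. r \<in> {0..1} \<Longrightarrow> (f has_vector_derivative f' r) (at r within {0..1})" and c: "continuous_on {0..1} f'"
  shows "fin_energy 0 1 f" "energy 0 1 f \<le> integral {0..1} (\<lambda>r. (norm (f' r))\<^sup>2)"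
proof -
  define G where "G t = integral {0..t} (\<lambda>r. (norm (f' r))\<^sup>2)" for t
  have "(norm (f t - f s))\<^sup>2 \<le> (t - s) * (G t - G s)" if st: "0 \<le> s" "s \<le> t" "t \<le> 1" for s t
  proof (cases "s = t")
    case False
    have sub: "{s..t} \<subseteq> {0..1}" using st by auto
    have int: "(\<lambda>r. (norm (f' r))\<^sup>2) integrable_on {0..t}"
      by (intro integrable_continuous_real continuous_intros continuous_on_subset[OF c]) (use st in auto)
    have GG: "G t - G s = integral {s..t} (\<lambda>r. (norm (f' r))\<^sup>2)"
      unfolding G_def using Henstock_Kurzweil_Integration.integral_combine[OF st(1,2) int] by simp
    define e where "e = (1 / (t - s)) *\<^sub>R (f t - f s)"
    have "0 \<le> integral {s..t} (\<lambda>r. (norm (f' r - e))\<^sup>2)"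
      by (intro integral_nonneg integrable_continuous_real continuous_intros continuous_on_subset[OF c sub]) auto
    also have "\<dots> = G t - G s - 2 * inner (f t - f s) e + (norm e)\<^sup>2 * (t - s)"
      unfolding GG by (rule integral_square_deriv[OF st(2) _ continuous_on_subset[OF c sub]])
        (use sub in \<open>auto intro: has_vector_derivative_within_subset[OF d]\<close>)
    also have "inner (f t - f s) e = (norm (f t - f s))\<^sup>2 / (t - s)" by (simp add: e_def power2_norm_eq_inner)
    also have "(norm e)\<^sup>2 * (t - s) = (norm (f t - f s))\<^sup>2 / (t - s)"
      using False st by (simp add: e_def power_divide power2_eq_square)
    finally have "(norm (f t - f s))\<^sup>2 / (t - s) \<le> G t - G s" by simp
    then show ?thesis using False st by (simp add: pos_divide_le_eq mult.commute)
  qed simp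
  from energy_dom[of 0 1 f G, OF _ this] show "fin_energy 0 1 f" "energy 0 1 f \<le> integral {0..1} (\<lambda>r. (norm (f' r))\<^sup>2)"
    by (auto simp: G_def)
qed

text \<open>On a short interval \<open>f'\<close> is within \<open>sqrt \<epsilon>\<close> of its
  initial value \<open>e\<close>, and \<open>2 * inner (f t - f s) e\<close> is at most
  \<open>|f t - f s|^2 / (t - s) + |e|^2 * (t - s)\<close>. Over \<open>Suc n\<close> equal
  intervals the errors add up to \<open>\<epsilon>\<close>.\<close>

lemma energy_C1_ge:
  fixes f f' :: "real \<Rightarrow> complex"
  assumes d: "\<And>r. r \<in> {0..1} \<Longrightarrow> (f has_vector_derivative f' r) (at r within {0..1})" and c: "continuous_on {0..1} f'"
  shows "integral {0..1} (\<lambda>r. (norm (f' r))\<^sup>2) \<le> energy 0 1 f"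
proof (rule field_le_epsilon)
  fix \<epsilon> :: real assume \<epsilon>: "\<epsilon> > 0"
  have fin: "fin_energy 0 1 f" by (rule energy_C1_le(1)[OF d c])
  have "uniformly_continuous_on {0..1} f'" by (rule compact_uniformly_continuous[OF c compact_Icc])
  then obtain \<delta> where \<delta>: "\<delta> > 0" "\<And>r s. r \<in> {0..1} \<Longrightarrow> s \<in> {0..1} \<Longrightarrow> dist r s < \<delta> \<Longrightarrow> dist (f' r) (f' s) < sqrt \<epsilon>"
    unfolding uniformly_continuous_on_def using \<epsilon> real_sqrt_gt_zero by metis
  obtain n :: nat where n: "inverse (real (Suc n)) < \<delta>" using reals_Archimedean[OF \<delta>(1)] by auto
  define N where "N = real (Suc n)"
  have N: "N > 0" "1 / N < \<delta>" using n by (auto simp: N_def inverse_eq_divide)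
  have step: "integral {0..real k / N} (\<lambda>r. (norm (f' r))\<^sup>2) \<le> energy 0 (real k / N) f + \<epsilon> * (real k / N)" if "k \<le> Suc n" for k
    using that
  proof (induction k)
    case 0
    show ?case by (simp add: energy_degenerate)
  next
    case (Suc k)
    define s t where "s = real k / N" and "t = real (Suc k) / N"
    have "real (Suc k) \<le> N" using Suc.prems unfolding N_def by (subst of_nat_le_iff)
    then have st: "0 \<le> s" "s < t" "t \<le> 1" using N by (auto simp: s_def t_def divide_strict_right_mono)
    have ts: "t - s = 1 / N" by (simp add: s_def t_def add_divide_distrib)
    have sub: "{s..t} \<subseteq> {0..1}" using st by auto
    have c': "continuous_on {s..t} f'" by (rule continuous_on_subset[OF c sub])
    define e where "e = f' s"
    have "integral {s..t} (\<lambda>r. (norm (f' r - e))\<^sup>2) \<le> integral {s..t} (\<lambda>r. \<epsilon>)"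
    proof (rule integral_le)
      show "(\<lambda>r. (norm (f' r - e))\<^sup>2) integrable_on {s..t}" by (intro integrable_continuous_real continuous_intros c')
      show "(norm (f' r - e))\<^sup>2 \<le> \<epsilon>" if r: "r \<in> {s..t}" for r
      proof -
        have "dist r s < \<delta>" using r ts N by (auto simp: dist_real_def)
        then have "norm (f' r - e) \<le> sqrt \<epsilon>" using \<delta>(2)[of r s] r st by (auto simp: e_def dist_norm)
        then have "(norm (f' r - e))\<^sup>2 \<le> (sqrt \<epsilon>)\<^sup>2" by (intro power_mono) auto
        then show ?thesis using \<epsilon> by simp
      qed
    qed auto
    then have 1: "integral {s..t} (\<lambda>r. (norm (f' r))\<^sup>2) - 2 * inner (f t - f s) e + (norm e)\<^sup>2 * (t - s) \<le> \<epsilon> * (t - s)"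
      using integral_square_deriv[OF less_imp_le[OF st(2)] _ c', of f e] has_vector_derivative_within_subset[OF d sub] sub st by (auto simp: mult.commute)
    have "(norm (f t - f s))\<^sup>2 \<le> (t - s) * energy s t f"
      using energy_ge[of s t f s t] fin_energy_subset[OF fin] st by auto
    then have 2: "(norm (f t - f s))\<^sup>2 / (t - s) \<le> energy s t f" using st by (simp add: pos_divide_le_eq mult.commute)
    have 3: "2 * inner (f t - f s) e \<le> (norm (f t - f s))\<^sup>2 / (t - s) + (norm e)\<^sup>2 * (t - s)"
    proof -
      have "(norm (a - h *\<^sub>R e))\<^sup>2 = (norm a)\<^sup>2 - h * (2 * inner a e) + h * (h * (norm e)\<^sup>2)" for a h
        unfolding power2_norm_eq_inner by (simp add: inner_diff_left inner_diff_right inner_commute algebra_simps)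
      then have "0 \<le> (norm (f t - f s))\<^sup>2 - (t - s) * (2 * inner (f t - f s) e) + (t - s) * ((t - s) * (norm e)\<^sup>2)"
        by (metis zero_le_power2)
      then have "(t - s) * (2 * inner (f t - f s) e) \<le> (t - s) * ((norm (f t - f s))\<^sup>2 / (t - s) + (norm e)\<^sup>2 * (t - s))"
        using st by (simp add: distrib_left mult_ac)
      then show ?thesis using st by (simp only: mult_le_cancel_left_pos)
    qed
    have int: "(\<lambda>r. (norm (f' r))\<^sup>2) integrable_on {0..t}"
      by (intro integrable_continuous_real continuous_intros continuous_on_subset[OF c]) (use st in auto)
    have "integral {0..t} (\<lambda>r. (norm (f' r))\<^sup>2) = integral {0..s} (\<lambda>r. (norm (f' r))\<^sup>2) + integral {s..t} (\<lambda>r. (norm (f' r))\<^sup>2)"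
      using Henstock_Kurzweil_Integration.integral_combine[OF st(1) less_imp_le[OF st(2)] int] by simp
    moreover have "energy 0 t f = energy 0 s f + energy s t f"
      using energy_split[of 0 t f s] fin_energy_subset[OF fin] st by auto
    moreover have "integral {0..s} (\<lambda>r. (norm (f' r))\<^sup>2) \<le> energy 0 s f + \<epsilon> * s" using Suc by (simp add: s_def)
    moreover have "\<epsilon> * t = \<epsilon> * s + \<epsilon> * (t - s)" by (simp add: algebra_simps)
    ultimately show ?case using 1 2 3 unfolding t_def[symmetric] by linarith
  qed
  from step[of "Suc n"] show "integral {0..1} (\<lambda>r. (norm (f' r))\<^sup>2) \<le> energy 0 1 f + \<epsilon>"
    by (simp add: N_def[symmetric] N(1)[THEN less_imp_neq, symmetric] del: of_nat_Suc)
qed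

lemma C1_path_action:
  assumes m: "m > 0" and x: "C1_path x v"
  shows "fin_kin 0 1 x" "kin m 0 1 x \<le> integral {0..1} (\<lambda>t. kinetic m (v t))"
    "action m 0 1 x = (\<integral>\<^sup>+t\<in>{0..1}. ennreal (kinetic m (v t)) + potential m (x t) \<partial>lborel)"
    "action m 0 1 x = ennreal (integral {0..1} (\<lambda>t. kinetic m (v t))) + pot m 0 1 x"
proof -
  note vc = C1_pathD(1)[OF x] and xd = C1_pathD(2)[OF x]
  show fk: "fin_kin 0 1 x" unfolding fin_kin_def by (intro allI energy_C1_le(1)[OF xd vc])
  have mp: "mass m i \<ge> 0" for i using mass_pos[OF m] by (simp add: less_imp_le)
  have int: "(\<lambda>t. (norm (v t $ i))\<^sup>2) integrable_on {0..1}" for i by (intro integrable_continuous_real continuous_intros vc)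
  have "integral {0..1} (\<lambda>t. kinetic m (v t)) = (\<Sum>i\<in>UNIV. integral {0..1} (\<lambda>t. mass m i / 2 * (norm (v t $ i))\<^sup>2))"
    unfolding kinetic_def by (subst integral_sum[symmetric]) (auto intro!: integrable_on_mult_right int)
  also have "\<dots> = (\<Sum>i\<in>UNIV. mass m i / 2 * integral {0..1} (\<lambda>t. (norm (v t $ i))\<^sup>2))" by simp
  finally show "kin m 0 1 x \<le> integral {0..1} (\<lambda>t. kinetic m (v t))"
    unfolding kin_def by (simp only:) (intro sum_mono mult_left_mono energy_C1_le(2)[OF xd vc], use mp in auto)
  have L2: "has_L2_derivative 0 1 x v" by (rule C1_path_L2_derivative[OF x])
  then have "has_L2_derivative 0 1 x (weak_deriv 0 1 x)" unfolding weak_deriv_def by (rule someI[where P = "has_L2_derivative 0 1 x"])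
  from L2_derivative_unique[OF this L2]
  show a: "action m 0 1 x = (\<integral>\<^sup>+t\<in>{0..1}. ennreal (kinetic m (v t)) + potential m (x t) \<partial>lborel)"
    unfolding action_def by (intro nn_integral_cong_AE) (auto simp: indicator_def elim!: eventually_mono)
  have kc: "continuous_on {0..1} (\<lambda>t. kinetic m (v t))" unfolding kinetic_def by (intro continuous_intros vc) auto
  have k0: "kinetic m (v t) \<ge> 0" for t unfolding kinetic_def using mp by (intro sum_nonneg) auto
  have km: "(\<lambda>t. ennreal (kinetic m (v t)) * indicator {0..1} t) \<in> borel_measurable lborel"
  proof -
    have "(\<lambda>t. ennreal (indicator {0..1} t *\<^sub>R kinetic m (v t))) \<in> borel_measurable borel"
      using borel_measurable_continuous_on_indicator[OF _ kc] by simp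
    moreover have "(\<lambda>t. ennreal (indicator {0..1} t *\<^sub>R kinetic m (v t))) = (\<lambda>t. ennreal (kinetic m (v t)) * indicator {0..1} t)"
      by (auto simp: indicator_def fun_eq_iff)
    ultimately show ?thesis by simp
  qed
  have "action m 0 1 x = (\<integral>\<^sup>+t\<in>{0..1}. ennreal (kinetic m (v t)) \<partial>lborel) + pot m 0 1 x"
    unfolding a pot_def distrib_right by (rule nn_integral_add[OF km measurable_potential[OF fk]])
  also have "(\<integral>\<^sup>+t\<in>{0..1}. ennreal (kinetic m (v t)) \<partial>lborel) = ennreal (integral {0..1} (\<lambda>t. kinetic m (v t)))"
    by (intro nn_integral_has_integral_lebesgue' k0 integrable_integral integrable_continuous_real kc)
  finally show "action m 0 1 x = ennreal (integral {0..1} (\<lambda>t. kinetic m (v t))) + pot m 0 1 x" .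
qed

lemma C1_path_kin_pot_le:
  assumes m: "m > 0" and x: "C1_path x v" and B: "action m 0 1 x \<le> ennreal B" "B \<ge> 0"
  shows "pot m 0 1 x < \<infinity>" "kin m 0 1 x + enn2real (pot m 0 1 x) \<le> B"
proof -
  have k0: "integral {0..1} (\<lambda>t. kinetic m (v t)) \<ge> 0"
    using C1_path_action(2)[OF m x] kin_nonneg[OF m C1_path_action(1)[OF m x]] by linarith
  have le: "ennreal (integral {0..1} (\<lambda>t. kinetic m (v t))) + pot m 0 1 x \<le> ennreal B" using B C1_path_action(4)[OF m x] by simp
  have "pot m 0 1 x \<le> ennreal (integral {0..1} (\<lambda>t. kinetic m (v t))) + pot m 0 1 x" by (rule add_increasing) simp_all
  also note le
  finally have "pot m 0 1 x \<le> ennreal B" .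
  then show p: "pot m 0 1 x < \<infinity>" by (simp add: le_less_trans ennreal_less_top)
  then have pe: "pot m 0 1 x = ennreal (enn2real (pot m 0 1 x))" by simp
  have "ennreal (integral {0..1} (\<lambda>t. kinetic m (v t)) + enn2real (pot m 0 1 x)) \<le> ennreal B"
    using le k0 by (subst ennreal_plus) (auto simp: pe[symmetric])
  then have "integral {0..1} (\<lambda>t. kinetic m (v t)) + enn2real (pot m 0 1 x) \<le> B" using B by (simp add: ennreal_le_iff)
  then show "kin m 0 1 x + enn2real (pot m 0 1 x) \<le> B" using C1_path_action(2)[OF m x] by linarith
qed

section \<open>The action of the Euler orbit\<close>

definition euler_value :: "real \<Rightarrow> real \<Rightarrow> real" where
  "euler_value m \<theta> = 3/2 * root 3 (2 * (1/2 + 2 * m)\<^sup>2 * (pi/2 - \<theta>)\<^sup>2)"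

lemma euler_value_cube: "euler_value m \<theta> ^ 3 = 27/4 * (1/2 + 2 * m)\<^sup>2 * (pi / 2 - \<theta>)\<^sup>2" "euler_value m \<theta> \<ge> 0"
  unfolding euler_value_def power_mult_distrib by (subst real_root_pow_pos2) (auto simp: power3_eq_cube)

lemma has_vector_derivative_cis:
  "((\<lambda>t. z * cis (a * t)) has_vector_derivative z * (\<i> * of_real a) * cis (a * t)) (at t within S)"
proof -
  have "((\<lambda>w. z * exp (\<i> * of_real a * w)) has_field_derivative z * (\<i> * of_real a) * exp (\<i> * of_real a * of_real t)) (at (of_real t))"
    by (auto intro!: derivative_eq_intros)
  from has_vector_derivative_real_field[OF this] show ?thesis
    by (simp add: cis_conv_exp mult.assoc has_vector_derivative_at_within)
qed

lemma euler_action: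
  assumes m: "m > 0" and \<theta>: "\<theta> < pi / 2"
  shows "action m 0 1 (euler_path m \<theta>) = ennreal (euler_value m \<theta>)"
proof -
  define a R where "a = \<theta> - pi / 2" and "R = euler_radius m \<theta>"
  have a: "a \<noteq> 0" using \<theta> by (simp add: a_def)
  have aa: "(pi / 2 - \<theta>)\<^sup>2 = a\<^sup>2" by (simp add: a_def power2_commute)
  have pos: "(1/4 + m) / a\<^sup>2 > 0" using a m by simp
  have Rr: "R = root 3 ((1/4 + m) / a\<^sup>2)" unfolding R_def euler_radius_def aa ..
  then have R: "R > 0" using pos by (simp add: real_root_gt_zero)
  have R3: "R ^ 3 * a\<^sup>2 = 1/4 + m" unfolding Rr using pos a by (simp add: real_root_pow_pos2)
  define v :: "real \<Rightarrow> config" where "v t = vector [of_real R * (\<i> * of_real a) * cis (a * t), - of_real R * (\<i> * of_real a) * cis (a * t), 0]" for t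
  have x: "euler_path m \<theta> t = vector [of_real R * cis (a * t), - of_real R * cis (a * t), 0]" for t
    by (simp add: euler_path_def R_def a_def)
  have C: "C1_path (euler_path m \<theta>) v"
    unfolding C1_path_def
  proof (intro conjI ballI)
    show "continuous_on {0..1} v"
    proof (rule continuous_on_componentwise)
      show "continuous_on {0..1} (\<lambda>t. v t $ i)" for i :: 3
        using exhaust_3[of i] by (elim disjE; hypsubst; simp add: v_def cis_conv_exp; auto intro!: continuous_intros)
    qed
    show "(euler_path m \<theta> has_vector_derivative v t) (at t within {0..1})" for t
    proof (rule has_vector_derivative_componentwise)
      show "((\<lambda>t. euler_path m \<theta> t $ i) has_vector_derivative v t $ i) (at t within {0..1})" for i :: 3
        using exhaust_3[of i] has_vector_derivative_cis[of "of_real R" a t "{0..1}"] has_vector_derivative_cis[of "- of_real R" a t "{0..1}"]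
        by (auto simp: v_def x)
    qed
  qed
  define E where "E = R\<^sup>2 * a\<^sup>2 + (1/2 + 2 * m) / R"
  have kin: "kinetic m (v t) = R\<^sup>2 * a\<^sup>2" for t
    using R by (simp add: kinetic_def sum_UNIV_3 v_def mass_def norm_mult power_mult_distrib)
  have pot: "potential m (euler_path m \<theta> t) = ennreal ((1/2 + 2 * m) / R)" for t
  proof -
    have "euler_path m \<theta> t $ 1 - euler_path m \<theta> t $ 2 = of_real (2 * R) * cis (a * t)" by (simp add: x)
    then have n: "norm (euler_path m \<theta> t $ 1 - euler_path m \<theta> t $ 2) = 2 * R" "norm (euler_path m \<theta> t $ 1 - euler_path m \<theta> t $ 3) = R"
      "norm (euler_path m \<theta> t $ 2 - euler_path m \<theta> t $ 3) = R" using R by (auto simp: x norm_mult)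
    have far: "u \<noteq> w" if "norm (u - w) = d" "d > 0" for u w :: complex and d using that by auto
    have nz: "euler_path m \<theta> t $ 1 \<noteq> euler_path m \<theta> t $ 2" "euler_path m \<theta> t $ 1 \<noteq> euler_path m \<theta> t $ 3" "euler_path m \<theta> t $ 2 \<noteq> euler_path m \<theta> t $ 3"
      using far[OF n(1)] far[OF n(2) R] far[OF n(3) R] R by simp_all
    show ?thesis unfolding potential_rpot[OF m nz] rpot_def n by (rule arg_cong[where f = ennreal]) (use R in \<open>simp add: field_simps\<close>)
  qed
  have E0: "E \<ge> 0" using R m by (simp add: E_def)
  have "action m 0 1 (euler_path m \<theta>) = (\<integral>\<^sup>+t\<in>{0..1::real}. ennreal E \<partial>lborel)"
    unfolding C1_path_action(3)[OF m C] kin pot using R m by (simp add: E_def flip: ennreal_plus)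
  also have "\<dots> = ennreal E" by (simp add: nn_integral_cmult_indicator)
  also have "E = euler_value m \<theta>"
  proof -
    \<comment> \<open>Newton's equation in the form \<open>R3\<close> makes the potential twice the
      kinetic energy.\<close>
    have "(1/2 + 2 * m) / R = 2 * (R ^ 3 * a\<^sup>2) / R" unfolding R3 by simp
    also have "\<dots> = 2 * (R\<^sup>2 * a\<^sup>2)" using R by (simp add: power2_eq_square power3_eq_cube)
    finally have "E = 3 * (R\<^sup>2 * a\<^sup>2)" by (simp add: E_def)
    then have "E ^ 3 = 27 * (R ^ 3 * a\<^sup>2)\<^sup>2 * a\<^sup>2" by (simp add: power2_eq_square power3_eq_cube)
    also have "\<dots> = 27/4 * (1/2 + 2 * m)\<^sup>2 * a\<^sup>2" unfolding R3 by (simp add: power2_eq_square algebra_simps)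
    finally have "E ^ 3 = euler_value m \<theta> ^ 3" unfolding euler_value_cube aa .
    then show ?thesis using E0 euler_value_cube(2) by (simp add: power_eq_iff_eq_base)
  qed
  finally show ?thesis .
qed

section \<open>The exact potential of the test path\<close>

text \<open>The sum \<open>1 / sqrt (1 + y) + 1 / sqrt (1 - y)\<close> as a function of
  \<open>S = sqrt (1 - y^2)\<close>.\<close>

definition chord :: "real \<Rightarrow> real" where "chord S = sqrt (2 * (1 + S)) / S"

lemma sum_inverse_sqrt:
  assumes "\<bar>y\<bar> < 1"
  shows "1 / sqrt (1 + y) + 1 / sqrt (1 - y) = chord (sqrt (1 - y\<^sup>2))"
proof -
  define a b where "a = sqrt (1 + y)" and "b = sqrt (1 - y)"
  have ab: "a > 0" "b > 0" "a\<^sup>2 = 1 + y" "b\<^sup>2 = 1 - y" using assms by (auto simp: a_def b_def)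
  have S: "sqrt (1 - y\<^sup>2) = a * b" by (simp add: a_def b_def real_sqrt_mult[symmetric] power2_eq_square algebra_simps)
  have "(a + b)\<^sup>2 = 2 * (1 + a * b)" using ab(3,4) by (simp add: power2_eq_square algebra_simps)
  then have "sqrt (2 * (1 + a * b)) = a + b" using ab by (metis add_pos_pos less_imp_le real_sqrt_unique)
  then show ?thesis unfolding S chord_def a_def[symmetric] b_def[symmetric] using ab(1,2) by (simp add: field_simps)
qed

text \<open>A multiplied-out form, valid also for \<open>S = 1\<close>, of the fact that
  \<open>(chord S - 2) / (1 - S^2)\<close> decreases. As \<open>1 - S^2 = y^2\<close>, this quotient
  is the slope of the chord from \<open>y = 0\<close> in the variable \<open>y^2\<close>. It equals
  \<open>h S\<close>, a product of positive decreasing factors.\<close>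

lemma chord_mono:
  assumes "0 < S1" "S1 \<le> S" "S \<le> 1"
  shows "(chord S - 2) * (1 - S1\<^sup>2) \<le> (chord S1 - 2) * (1 - S\<^sup>2)"
proof -
  define h where "h S = 2 * (1 / S + 1 / (1 + S)) * (1 / (sqrt (2 * (1 + S)) + 2 * S))" for S :: real
  have ch: "chord T - 2 = (1 - T\<^sup>2) * h T" if T: "0 < T" for T
  proof -
    define q where "q = sqrt (2 * (1 + T))"
    have q: "q\<^sup>2 = 2 * (1 + T)" "q > 0" using T by (auto simp: q_def)
    have "(q - 2 * T) * (q + 2 * T) = 2 * (1 - T) * (1 + 2 * T)" using q(1) by (simp add: power2_eq_square algebra_simps)
    then have "q - 2 * T = 2 * (1 - T) * (1 + 2 * T) / (q + 2 * T)" using q T by (simp add: eq_divide_eq)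
    then have "(q - 2 * T) / T = 2 * (1 - T) * (1 + 2 * T) / (q + 2 * T) / T" by simp
    moreover have "chord T - 2 = (q - 2 * T) / T" using T by (simp add: chord_def q_def diff_divide_distrib)
    moreover have "(1 - T\<^sup>2) * h T = 2 * (1 - T) * (1 + 2 * T) / (q + 2 * T) / T"
    proof -
      have "1 / T + 1 / (1 + T) = (1 + 2 * T) / (T * (1 + T))" using T by (simp add: field_simps)
      moreover have "1 - T\<^sup>2 = (1 - T) * (1 + T)" by (simp add: power2_eq_square algebra_simps)
      ultimately have "(1 - T\<^sup>2) * h T = (1 - T) * (1 + T) * (2 * ((1 + 2 * T) / (T * (1 + T))) * (1 / (q + 2 * T)))"
        by (simp only: h_def q_def)
      moreover have "q + 2 * T > 0" using T q by simp
      moreover have "X * u * (2 * (w / (T * u)) * (1 / v)) = 2 * X * w / v / T" if "u > 0" "v > 0" for u v w X :: real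
        using that T by (simp add: mult_ac)
      ultimately show ?thesis using T by (simp only:)
    qed
    ultimately show ?thesis by simp
  qed
  have "h S \<le> h S1"
    unfolding h_def using assms by (intro mult_mono add_mono divide_left_mono mult_left_mono mult_pos_pos add_pos_pos) auto
  moreover have "S\<^sup>2 \<le> 1" "S1\<^sup>2 \<le> 1" using assms by (auto simp: power_le_one)
  ultimately have "(1 - S\<^sup>2) * (1 - S1\<^sup>2) * h S \<le> (1 - S\<^sup>2) * (1 - S1\<^sup>2) * h S1" by (intro mult_left_mono) auto
  then show ?thesis using ch[of S] ch[of S1] assms by (simp add: mult_ac)
qed

text \<open>As a function of \<open>\<xi>\<^sup>2\<close> the left-hand side is convex; the bound is its chord over \<open>0 \<le> \<xi>\<^sup>2 \<le> 1\<close>.\<close>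

lemma chord_bound:
  assumes r: "0 < r" "r < A" and \<xi>: "\<bar>\<xi>\<bar> \<le> 1"
  shows "1 / sqrt (A\<^sup>2 + r\<^sup>2 + 2 * A * r * \<xi>) + 1 / sqrt (A\<^sup>2 + r\<^sup>2 - 2 * A * r * \<xi>)
    \<le> (1 - \<xi>\<^sup>2) * (2 / sqrt (A\<^sup>2 + r\<^sup>2)) + \<xi>\<^sup>2 * (2 * A / (A\<^sup>2 - r\<^sup>2))"
proof -
  define P q where "P = A\<^sup>2 + r\<^sup>2" and "q = 2 * A * r / P"
  have P: "P > 0" using r by (simp add: P_def add_pos_pos)
  have qP: "q * P = 2 * A * r" using P by (simp add: q_def)
  have q0: "q > 0" using r P by (simp add: q_def)
  have q1: "q < 1"
  proof -
    have "(A - r)\<^sup>2 > 0" using r by simp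
    then have "2 * A * r < P" by (simp add: P_def power2_eq_square algebra_simps)
    then show ?thesis using P by (simp add: q_def)
  qed
  have qx: "\<bar>q * \<xi>\<bar> < 1" using q0 q1 \<xi> by (simp add: abs_mult) (metis abs_ge_zero less_eq_real_def mult_left_le order_le_less_trans)
  have sum: "1 / sqrt (P + P * y) + 1 / sqrt (P - P * y) = chord (sqrt (1 - y\<^sup>2)) / sqrt P" if "\<bar>y\<bar> < 1" for y
  proof -
    have "P + P * y = P * (1 + y)" "P - P * y = P * (1 - y)" by (simp_all add: algebra_simps)
    then show ?thesis using P by (simp add: real_sqrt_mult sum_inverse_sqrt[OF that, symmetric] add_divide_distrib mult.commute)
  qed
  define S S1 where "S = sqrt (1 - (q * \<xi>)\<^sup>2)" and "S1 = sqrt (1 - q\<^sup>2)"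
  have q2: "q\<^sup>2 < 1" using q0 q1 by (simp add: power_less_one_iff)
  have xi2: "\<xi>\<^sup>2 \<le> 1" using \<xi> by (simp add: abs_square_le_1)
  have qx2: "(q * \<xi>)\<^sup>2 \<le> q\<^sup>2" using xi2 by (simp add: power_mult_distrib mult_left_le)
  have SS: "0 < S1" "S1 \<le> S" "S \<le> 1" using q2 qx2 by (auto simp: S_def S1_def)
  have sq: "1 - S1\<^sup>2 = q\<^sup>2" "1 - S\<^sup>2 = \<xi>\<^sup>2 * q\<^sup>2" using q2 qx2 by (auto simp: S_def S1_def power_mult_distrib)
  have "(chord S - 2) * q\<^sup>2 \<le> (chord S1 - 2) * \<xi>\<^sup>2 * q\<^sup>2" using chord_mono[OF SS] unfolding sq by (simp add: mult.assoc)
  then have "chord S - 2 \<le> (chord S1 - 2) * \<xi>\<^sup>2" using q0 by (simp add: mult_le_cancel_right)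
  then have "chord S \<le> (1 - \<xi>\<^sup>2) * 2 + \<xi>\<^sup>2 * chord S1" by (simp add: algebra_simps)
  then have le: "chord S / sqrt P \<le> ((1 - \<xi>\<^sup>2) * 2 + \<xi>\<^sup>2 * chord S1) / sqrt P" by (rule divide_right_mono) (use P in simp)
  have "chord S1 / sqrt P = 2 * A / (A\<^sup>2 - r\<^sup>2)"
  proof -
    have "chord S1 / sqrt P = 1 / sqrt (P + P * q) + 1 / sqrt (P - P * q)" using sum[of q] q0 q1 by (simp add: S1_def)
    moreover have "P + P * q = (A + r)\<^sup>2" "P - P * q = (A - r)\<^sup>2" using qP by (simp_all add: P_def power2_eq_square algebra_simps)
    moreover have "1 / sqrt ((A + r)\<^sup>2) + 1 / sqrt ((A - r)\<^sup>2) = 2 * A / (A\<^sup>2 - r\<^sup>2)"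
    proof -
      have "A\<^sup>2 - r\<^sup>2 = (A + r) * (A - r)" by (simp add: power2_eq_square algebra_simps)
      then show ?thesis using r by (simp add: field_simps)
    qed
    ultimately show ?thesis by simp
  qed
  moreover have "((1 - \<xi>\<^sup>2) * 2 + \<xi>\<^sup>2 * chord S1) / sqrt P = (1 - \<xi>\<^sup>2) * (2 / sqrt P) + \<xi>\<^sup>2 * (chord S1 / sqrt P)"
    by (simp add: add_divide_distrib)
  moreover have "1 / sqrt (P + 2 * A * r * \<xi>) + 1 / sqrt (P - 2 * A * r * \<xi>) = chord S / sqrt P"
  proof -
    have "P * (q * \<xi>) = 2 * A * r * \<xi>" unfolding qP[symmetric] by (simp only: mult_ac)
    then show ?thesis using sum[OF qx] unfolding S_def by (simp only:)
  qed
  ultimately show ?thesis using le unfolding P_def by simp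
qed

lemma norm_cis_combination: "(norm (of_real A * cis a + of_real r * cis b))\<^sup>2 = A\<^sup>2 + r\<^sup>2 + 2 * A * r * cos (a - b)"
proof -
  have "(norm (of_real A * cis a + of_real r * cis b))\<^sup>2 = A\<^sup>2 * (cos a)\<^sup>2 + A\<^sup>2 * (sin a)\<^sup>2 + (r\<^sup>2 * (cos b)\<^sup>2 + r\<^sup>2 * (sin b)\<^sup>2) + 2 * A * r * (cos a * cos b + sin a * sin b)"
    unfolding cmod_power2 by (simp add: power2_eq_square algebra_simps)
  moreover have "u * (cos y)\<^sup>2 + u * (sin y)\<^sup>2 = u" for u y :: real unfolding distrib_left[symmetric] by simp
  ultimately show ?thesis by (simp only: cos_diff)
qed

text \<open>\<open>l\<close> is such that \<open>l + 2 * l / m = A\<close>: the vectors from body 3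
  to bodies 1 and 2 are the sum and the difference of two arms of lengths \<open>A\<close> and
  \<open>r t\<close> enclosing the angle \<open>pi / 2 * t\<close>. So \<open>chord_bound\<close>
  applies with the cosine of that angle, whose square has mean 1/2. Elsewhere the radius is replaced
  by its extreme values, a loss that vanishes as \<open>c\<close> tends to 0.\<close>

lemma test_path_action:
  assumes m: "m > 0" and \<theta>: "0 < \<theta>" "\<theta> < pi / 2" and \<rho>: "0 < \<rho>" "\<rho> + c < A" and c: "0 < c"
  defines "l \<equiv> A * m / (m + 2)"
  defines "B \<equiv> \<theta>\<^sup>2 * m / (m + 2) * A\<^sup>2 + c\<^sup>2 + (pi / 2 - \<theta>)\<^sup>2 * (\<rho> + c)\<^sup>2 + 1 / (2 * \<rho>) + m * (1 / sqrt (A\<^sup>2 + \<rho>\<^sup>2) + A / (A\<^sup>2 - (\<rho> + c)\<^sup>2))"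
  shows "test_path m \<theta> l \<rho> c \<in> admissible m \<theta>" "\<exists>v. C1_path (test_path m \<theta> l \<rho> c) v" "action m 0 1 (test_path m \<theta> l \<rho> c) \<le> ennreal B" "B \<ge> 0"
proof -
  define \<phi> where "\<phi> = pi / 2 - \<theta>"
  define r where "r t = \<rho> + c * t" for t
  let ?x = "test_path m \<theta> l \<rho> c"
  define w1 w2 where "w1 t = of_real l * (\<i> * of_real \<theta>) * cis (\<theta> * t)" and "w2 t = (of_real c - \<i> * of_real (\<phi> * r t)) * cis (- \<phi> * t)" for t
  define v :: "real \<Rightarrow> config" where "v t = vector [w1 t + w2 t, w1 t - w2 t, - of_real (2 * l / m) * (\<i> * of_real \<theta>) * cis (\<theta> * t)]" for t
  have x: "?x t = vector [of_real l * cis (\<theta> * t) + of_real (r t) * cis (- \<phi> * t), of_real l * cis (\<theta> * t) - of_real (r t) * cis (- \<phi> * t), - of_real (2 * l / m) * cis (\<theta> * t)]" for t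
    by (simp add: test_path_def r_def \<phi>_def)
  have d1: "((\<lambda>t. of_real l * cis (\<theta> * t)) has_vector_derivative w1 t) (at t within S)" for t S
    unfolding w1_def by (rule has_vector_derivative_cis)
  have d2: "((\<lambda>t. of_real (r t) * cis (- \<phi> * t)) has_vector_derivative w2 t) (at t within S)" for t S
  proof -
    have "((\<lambda>t. r t *\<^sub>R cis (- \<phi> * t)) has_vector_derivative r t *\<^sub>R (1 * (\<i> * of_real (- \<phi>)) * cis (- \<phi> * t)) + c *\<^sub>R cis (- \<phi> * t)) (at t within S)"
    proof (rule has_vector_derivative_scaleR)
      show "(r has_field_derivative c) (at t within S)" unfolding r_def by (auto intro!: derivative_eq_intros)
      show "((\<lambda>t. cis (- \<phi> * t)) has_vector_derivative 1 * (\<i> * of_real (- \<phi>)) * cis (- \<phi> * t)) (at t within S)"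
        using has_vector_derivative_cis[of 1 "- \<phi>" t S] by simp
    qed
    then show ?thesis by (simp add: w2_def scaleR_conv_of_real algebra_simps)
  qed
  have C: "C1_path ?x v"
    unfolding C1_path_def
  proof (intro conjI ballI)
    show "continuous_on {0..1} v"
    proof (rule continuous_on_componentwise)
      show "continuous_on {0..1} (\<lambda>t. v t $ i)" for i :: 3
        using exhaust_3[of i] m by (elim disjE; hypsubst; simp add: v_def w1_def w2_def r_def cis_conv_exp; auto intro!: continuous_intros)
    qed
    show "(?x has_vector_derivative v t) (at t within {0..1})" for t
    proof (rule has_vector_derivative_componentwise)
      show "((\<lambda>t. ?x t $ i) has_vector_derivative v t $ i) (at t within {0..1})" for i :: 3
        using exhaust_3[of i] has_vector_derivative_add[OF d1[of t "{0..1}"] d2[of t "{0..1}"]] has_vector_derivative_diff[OF d1[of t "{0..1}"] d2[of t "{0..1}"]]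
          has_vector_derivative_cis[of "- of_real (2 * l / m)" \<theta> t "{0..1}"]
        by (auto simp: v_def x)
    qed
  qed
  then show "\<exists>v. C1_path ?x v" by blast
  show "?x \<in> admissible m \<theta>"
    using C1_path_action(1)[OF m C] m by (auto simp: admissible_def test_path_boundary)
  have Ap: "A > 0" using \<rho> c by simp
  have lA: "l * (1 + 2 / m) = A"
  proof -
    have "1 + 2 / m = (m + 2) / m" using m by (simp add: add_divide_distrib)
    moreover have "A * m / n * (n / m) = A" if "n \<noteq> 0" for n using that m by simp
    from this[of "m + 2"] have "A * m / (m + 2) * ((m + 2) / m) = A" using m by simp
    ultimately show ?thesis unfolding l_def by (simp only:)
  qed
  have beta: "l\<^sup>2 * \<theta>\<^sup>2 * (1 + 2 / m) = \<theta>\<^sup>2 * m / (m + 2) * A\<^sup>2"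
  proof -
    have "l\<^sup>2 * \<theta>\<^sup>2 * (1 + 2 / m) = l * \<theta>\<^sup>2 * (l * (1 + 2 / m))" by (simp add: power2_eq_square mult_ac)
    then show ?thesis unfolding lA by (simp add: l_def power2_eq_square)
  qed
  have kin: "kinetic m (v t) = l\<^sup>2 * \<theta>\<^sup>2 * (1 + 2 / m) + c\<^sup>2 + \<phi>\<^sup>2 * (r t)\<^sup>2" for t
  proof -
    have p: "(norm (w1 t + w2 t))\<^sup>2 + (norm (w1 t - w2 t))\<^sup>2 = 2 * (norm (w1 t))\<^sup>2 + 2 * (norm (w2 t))\<^sup>2"
      unfolding power2_norm_eq_inner by (simp add: inner_add_left inner_add_right inner_diff_left inner_diff_right)
    have n1: "(norm (w1 t))\<^sup>2 = l\<^sup>2 * \<theta>\<^sup>2" by (simp add: w1_def norm_mult power_mult_distrib)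
    have n2: "(norm (w2 t))\<^sup>2 = c\<^sup>2 + \<phi>\<^sup>2 * (r t)\<^sup>2" by (simp add: w2_def norm_mult power_mult_distrib cmod_power2)
    have n3: "(norm (v t $ 3))\<^sup>2 = 4 * l\<^sup>2 * \<theta>\<^sup>2 / m\<^sup>2" by (simp add: v_def norm_mult norm_divide power_mult_distrib power_divide)
    have "kinetic m (v t) = ((norm (w1 t + w2 t))\<^sup>2 + (norm (w1 t - w2 t))\<^sup>2) / 2 + m * (norm (v t $ 3))\<^sup>2 / 2"
      by (simp add: kinetic_def sum_UNIV_3 mass_def v_def add_divide_distrib)
    then show ?thesis unfolding p n1 n2 n3 using m by (simp add: field_simps power2_eq_square)
  qed
  define K1 K2 where "K1 = 2 / sqrt (A\<^sup>2 + \<rho>\<^sup>2)" and "K2 = 2 * A / (A\<^sup>2 - (\<rho> + c)\<^sup>2)"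
  define K0 where "K0 = \<theta>\<^sup>2 * m / (m + 2) * A\<^sup>2 + c\<^sup>2 + \<phi>\<^sup>2 * (\<rho> + c)\<^sup>2 + 1 / (2 * \<rho>)"
  have Arc: "A\<^sup>2 - (\<rho> + c)\<^sup>2 > 0" using \<rho> c power_strict_mono[of "\<rho> + c" A 2] by simp
  have K: "K0 \<ge> 0" "K1 \<ge> 0" "K2 \<ge> 0" using m \<rho> Ap Arc by (auto simp: K0_def K1_def K2_def)
  define g where "g t = K0 + m * ((1 - (cos (pi / 2 * t))\<^sup>2) * K1 + (cos (pi / 2 * t))\<^sup>2 * K2)" for t
  have cos1: "(cos y)\<^sup>2 \<le> 1" for y :: real by (simp add: abs_square_le_1)
  have g0: "g t \<ge> 0" for t unfolding g_def using K m cos1 by (intro add_nonneg_nonneg mult_nonneg_nonneg) auto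
  have pw: "ennreal (kinetic m (v t)) + potential m (?x t) \<le> ennreal (g t)" if t: "t \<in> {0..1}" for t
  proof -
    have "0 \<le> c * t" "c * t \<le> c" using t c by (auto simp: mult_left_le)
    then have rt: "\<rho> \<le> r t" "r t \<le> \<rho> + c" "0 < r t" "r t < A" using \<rho> unfolding r_def by linarith+
    have e12: "?x t $ 1 - ?x t $ 2 = of_real (2 * r t) * cis (- \<phi> * t)" by (simp add: x)
    have lA': "of_real l + of_real (2 * l / m) = (of_real A :: complex)"
      unfolding of_real_add[symmetric] lA[symmetric] by (simp add: distrib_left)
    have e13: "?x t $ 1 - ?x t $ 3 = of_real A * cis (\<theta> * t) + of_real (r t) * cis (- \<phi> * t)"
      unfolding lA'[symmetric] by (simp add: x algebra_simps)
    have e23: "?x t $ 2 - ?x t $ 3 = of_real A * cis (\<theta> * t) + of_real (- r t) * cis (- \<phi> * t)"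
      unfolding lA'[symmetric] by (simp add: x algebra_simps)
    have ang: "\<theta> * t - - \<phi> * t = pi / 2 * t" by (simp add: \<phi>_def algebra_simps)
    have n12: "norm (?x t $ 1 - ?x t $ 2) = 2 * r t" unfolding e12 using rt by (simp add: norm_mult)
    have n13: "norm (?x t $ 1 - ?x t $ 3) = sqrt (A\<^sup>2 + (r t)\<^sup>2 + 2 * A * r t * cos (pi / 2 * t))"
      using norm_cis_combination[of A "\<theta> * t" "r t" "- \<phi> * t"] unfolding e13 ang by (metis norm_ge_zero real_sqrt_unique)
    have n23: "norm (?x t $ 2 - ?x t $ 3) = sqrt (A\<^sup>2 + (r t)\<^sup>2 - 2 * A * r t * cos (pi / 2 * t))"
    proof -
      have "A\<^sup>2 + (- r t)\<^sup>2 + 2 * A * (- r t) * cos (pi / 2 * t) = A\<^sup>2 + (r t)\<^sup>2 - 2 * A * r t * cos (pi / 2 * t)" by simp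
      then show ?thesis using norm_cis_combination[of A "\<theta> * t" "- r t" "- \<phi> * t"] unfolding e23 ang by (metis norm_ge_zero real_sqrt_unique)
    qed
    have big: "norm (of_real A * cis a + of_real s * cis b) > 0" if "\<bar>s\<bar> < A" for s a b
    proof -
      have "A \<le> norm (of_real A * cis a + of_real s * cis b) + \<bar>s\<bar>"
        using norm_triangle_ineq4[of "of_real A * cis a + of_real s * cis b" "of_real s * cis b"] Ap by (simp add: norm_mult)
      then show ?thesis using that by linarith
    qed
    have nz: "?x t $ 1 \<noteq> ?x t $ 2" "?x t $ 1 \<noteq> ?x t $ 3" "?x t $ 2 \<noteq> ?x t $ 3"
      using n12 rt big[of "r t" "\<theta> * t" "- \<phi> * t", folded e13] big[of "- r t" "\<theta> * t" "- \<phi> * t", folded e23] by auto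
    have "rpot m (?x t) = 1 / (2 * r t) + m * (1 / sqrt (A\<^sup>2 + (r t)\<^sup>2 + 2 * A * r t * cos (pi / 2 * t)) + 1 / sqrt (A\<^sup>2 + (r t)\<^sup>2 - 2 * A * r t * cos (pi / 2 * t)))"
      unfolding rpot_def n12 n13 n23 by (simp add: distrib_left)
    also have "\<dots> \<le> 1 / (2 * \<rho>) + m * ((1 - (cos (pi / 2 * t))\<^sup>2) * K1 + (cos (pi / 2 * t))\<^sup>2 * K2)"
    proof (rule add_mono[OF _ mult_left_mono])
      have "1 / sqrt (A\<^sup>2 + (r t)\<^sup>2 + 2 * A * r t * cos (pi / 2 * t)) + 1 / sqrt (A\<^sup>2 + (r t)\<^sup>2 - 2 * A * r t * cos (pi / 2 * t))
        \<le> (1 - (cos (pi / 2 * t))\<^sup>2) * (2 / sqrt (A\<^sup>2 + (r t)\<^sup>2)) + (cos (pi / 2 * t))\<^sup>2 * (2 * A / (A\<^sup>2 - (r t)\<^sup>2))"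
        by (rule chord_bound[OF rt(3,4)]) simp
      also have "\<dots> \<le> (1 - (cos (pi / 2 * t))\<^sup>2) * K1 + (cos (pi / 2 * t))\<^sup>2 * K2"
      proof (intro add_mono mult_left_mono)
        have "\<rho>\<^sup>2 \<le> (r t)\<^sup>2" "(r t)\<^sup>2 \<le> (\<rho> + c)\<^sup>2" using rt \<rho> by (auto intro!: power_mono)
        moreover from this have "(r t)\<^sup>2 < A\<^sup>2" using Arc by linarith
        ultimately show "2 / sqrt (A\<^sup>2 + (r t)\<^sup>2) \<le> K1" "2 * A / (A\<^sup>2 - (r t)\<^sup>2) \<le> K2"
          unfolding K1_def K2_def using \<rho> Ap Arc rt by (auto intro!: divide_left_mono mult_pos_pos add_pos_pos)
      qed (use cos1 in auto)
      finally show "1 / sqrt (A\<^sup>2 + (r t)\<^sup>2 + 2 * A * r t * cos (pi / 2 * t)) + 1 / sqrt (A\<^sup>2 + (r t)\<^sup>2 - 2 * A * r t * cos (pi / 2 * t))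
        \<le> (1 - (cos (pi / 2 * t))\<^sup>2) * K1 + (cos (pi / 2 * t))\<^sup>2 * K2" .
      show "1 / (2 * r t) \<le> 1 / (2 * \<rho>)" using rt \<rho> by (intro divide_left_mono mult_pos_pos) auto
    qed (use m in auto)
    moreover have "kinetic m (v t) \<le> \<theta>\<^sup>2 * m / (m + 2) * A\<^sup>2 + c\<^sup>2 + \<phi>\<^sup>2 * (\<rho> + c)\<^sup>2"
      unfolding kin beta using rt by (intro add_left_mono mult_left_mono power_mono) auto
    ultimately have "kinetic m (v t) + rpot m (?x t) \<le> g t" by (simp add: g_def K0_def)
    moreover have "kinetic m (v t) \<ge> 0" "rpot m (?x t) \<ge> 0" unfolding kinetic_def rpot_def using m by (auto intro!: sum_nonneg simp: mass_def)
    ultimately show ?thesis unfolding potential_rpot[OF m nz] by (simp add: ennreal_leI flip: ennreal_plus)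
  qed
  have cosint: "((\<lambda>t. (cos (pi / 2 * t))\<^sup>2) has_integral 1/2) {0..1}"
  proof -
    have "((\<lambda>t. (cos (pi / 2 * t))\<^sup>2) has_integral ((1::real) / 2 + sin (pi * 1) / (2 * pi)) - (0 / 2 + sin (pi * 0) / (2 * pi))) {0..1}"
    proof (rule fundamental_theorem_of_calculus)
      fix t :: real
      have "((\<lambda>t. t / 2 + sin (pi * t) / (2 * pi)) has_real_derivative 1 / 2 + cos (pi * t) * pi / (2 * pi)) (at t within {0..1})"
        by (auto intro!: derivative_eq_intros)
      moreover have "1 / 2 + cos (pi * t) * pi / (2 * pi) = (cos (pi / 2 * t))\<^sup>2"
        using cos_double_cos[of "pi / 2 * t"] by (simp add: diff_divide_distrib)
      ultimately show "((\<lambda>t. t / 2 + sin (pi * t) / (2 * pi)) has_vector_derivative (cos (pi / 2 * t))\<^sup>2) (at t within {0..1})"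
        by (simp add: has_real_derivative_iff_has_vector_derivative)
    qed simp
    then show ?thesis by simp
  qed
  have ge: "g = (\<lambda>t. (K0 + m * K1) + (m * (K2 - K1)) * (cos (pi / 2 * t))\<^sup>2)" by (simp add: g_def fun_eq_iff algebra_simps)
  have gint: "(g has_integral B) {0..1}"
  proof -
    have "((\<lambda>t. (K0 + m * K1) + (m * (K2 - K1)) * (cos (pi / 2 * t))\<^sup>2) has_integral (K0 + m * K1) + m * (K2 - K1) * (1/2)) {0..1}"
      using has_integral_add[OF has_integral_const_real[of "K0 + m * K1" 0 1] has_integral_mult_right[OF cosint, of "m * (K2 - K1)"]] by simp
    moreover have "(K0 + m * K1) + m * (K2 - K1) * (1/2) = B"
    proof -
      have half: "2 / Y / 2 = 1 / Y" "2 * X / Y / 2 = X / Y" for X Y :: real by simp_all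
      have "K1 / 2 = 1 / sqrt (A\<^sup>2 + \<rho>\<^sup>2)" "K2 / 2 = A / (A\<^sup>2 - (\<rho> + c)\<^sup>2)" unfolding K1_def K2_def by (rule half)+
      then have "B = K0 + m * (K1 / 2 + K2 / 2)" by (simp only: B_def K0_def \<phi>_def)
      then show ?thesis by (simp add: algebra_simps)
    qed
    ultimately show ?thesis unfolding ge by simp
  qed
  show "B \<ge> 0" by (rule has_integral_nonneg[OF gint g0])
  have "action m 0 1 ?x \<le> (\<integral>\<^sup>+t\<in>{0..1}. ennreal (g t) \<partial>lborel)"
    unfolding C1_path_action(3)[OF m C] by (intro nn_integral_mono) (auto simp: indicator_def pw)
  also have "\<dots> = ennreal B" by (rule nn_integral_has_integral_lebesgue'[OF g0 gint])
  finally show "action m 0 1 ?x \<le> ennreal B" .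
qed

section \<open>The inequality between the test path and the Euler orbit\<close>

text \<open>The inequality of the means for \<open>a * s^2\<close>, \<open>b / s\<close>,
  \<open>b / s\<close>, with a lower bound \<open>K^3\<close> for their product in place of a cube
  root.\<close>

lemma amgm_square_inverse:
  fixes a b s K :: real
  assumes "b > 0" "s > 0" "K > 0" "a * b\<^sup>2 \<ge> K ^ 3"
  shows "a * s\<^sup>2 + 2 * b / s \<ge> 3 * K"
proof -
  have "(K * s - b)\<^sup>2 * (K * s + 2 * b) \<ge> 0" using assms by (intro mult_nonneg_nonneg add_nonneg_nonneg) auto
  then have "3 * K * s * b\<^sup>2 \<le> K ^ 3 * s ^ 3 + 2 * b ^ 3" by (simp add: power2_eq_square power3_eq_cube algebra_simps)
  also have "\<dots> \<le> a * b\<^sup>2 * s ^ 3 + 2 * b ^ 3" using assms by (intro add_right_mono mult_right_mono) auto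
  also have "\<dots> = (a * s\<^sup>2 + 2 * b / s) * (s * b\<^sup>2)" using assms by (simp add: field_simps power2_eq_square power3_eq_cube)
  finally have "3 * K * (s * b\<^sup>2) \<le> (a * s\<^sup>2 + 2 * b / s) * (s * b\<^sup>2)" by (simp add: mult.assoc)
  then show ?thesis using assms by (simp add: mult_le_cancel_right)
qed

text \<open>Consecutive partial sums of the alternating binomial series in
  \<open>y^2\<close>.\<close>

lemma inverse_sqrt_bounds:
  fixes y :: real
  shows "1 / sqrt (1 + y\<^sup>2) \<ge> 1 - y\<^sup>2 / 2" "1 / sqrt (1 + y\<^sup>2) \<le> 1 - y\<^sup>2 / 2 + 3/8 * (y\<^sup>2)\<^sup>2"
proof -
  define u where "u = y\<^sup>2"
  have u: "u \<ge> 0" by (simp add: u_def)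
  have s: "sqrt (1 + u) > 0" using u by simp
  have e1: "1 + u / 2 \<ge> sqrt (1 + u)" by (rule real_le_lsqrt) (use u in \<open>auto simp: power2_eq_square algebra_simps\<close>)
  have "1 - u / 2 \<le> 1 / (1 + u / 2)"
  proof -
    have "(1 - u / 2) * (1 + u / 2) \<le> 1" by (simp add: algebra_simps)
    then show ?thesis using u by (simp add: pos_le_divide_eq)
  qed
  also have "\<dots> \<le> 1 / sqrt (1 + u)" using e1 s u by (intro divide_left_mono mult_pos_pos) auto
  finally show "1 / sqrt (1 + y\<^sup>2) \<ge> 1 - y\<^sup>2 / 2" by (simp add: u_def)
  define P where "P = 1 - u / 2 + 3/8 * u\<^sup>2"
  have P: "P > 0"
  proof -
    have "P = 3/8 * (u - 2/3)\<^sup>2 + 5/6" by (simp add: P_def power2_eq_square algebra_simps)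
    also have "\<dots> > 0" by (intro add_nonneg_pos) auto
    finally show ?thesis .
  qed
  have "P\<^sup>2 * (1 + u) - 1 = u ^ 3 * (5/8 - 15/64 * u + 9/64 * u\<^sup>2)"
    by (simp add: P_def power2_eq_square power3_eq_cube algebra_simps add_divide_distrib diff_divide_distrib)
  also have "\<dots> \<ge> 0"
  proof (intro mult_nonneg_nonneg)
    have "5/8 - 15/64 * u + 9/64 * u\<^sup>2 = 9/64 * (u - 5/6)\<^sup>2 + 135/256" by (simp add: power2_eq_square algebra_simps)
    then show "0 \<le> 5/8 - 15/64 * u + 9/64 * u\<^sup>2" by simp
  qed (use u in auto)
  finally have "1 \<le> P\<^sup>2 * (1 + u)" by simp
  then have "1 \<le> sqrt (P\<^sup>2 * (1 + u))" by simp
  also have "\<dots> = P * sqrt (1 + u)" using P by (simp add: real_sqrt_mult)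
  finally have "1 / sqrt (1 + u) \<le> P" using s by (simp add: pos_divide_le_eq)
  then show "1 / sqrt (1 + y\<^sup>2) \<le> 1 - y\<^sup>2 / 2 + 3/8 * (y\<^sup>2)\<^sup>2" by (simp add: P_def u_def)
qed

text \<open>The difference vanishes at 0 and has the derivative
  \<open>x^2 / ((1 + x) * (2 + x)^2)\<close>.\<close>

lemma ln_add_one_ge:
  fixes u :: real
  assumes "u \<ge> 0"
  shows "2 * u / (2 + u) \<le> ln (1 + u)"
proof -
  define f where "f u = ln (1 + u) - 2 * u / (2 + u)" for u :: real
  have "f 0 \<le> f u"
  proof (rule DERIV_nonneg_imp_nondecreasing[OF assms])
    fix x :: real assume x: "0 \<le> x"
    have "(f has_real_derivative 1 / (1 + x) - (2 * (2 + x) - 2 * x) / ((2 + x) * (2 + x))) (at x)"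
      unfolding f_def using x by (auto intro!: derivative_eq_intros simp: field_simps)
    moreover have "1 / (1 + x) - (2 * (2 + x) - 2 * x) / ((2 + x) * (2 + x)) = x\<^sup>2 / ((1 + x) * (2 + x)\<^sup>2)"
      using x by (simp add: divide_simps power2_eq_square) (simp add: algebra_simps)
    moreover have "x\<^sup>2 / ((1 + x) * (2 + x)\<^sup>2) \<ge> 0" using x by simp
    ultimately show "\<exists>y. (f has_real_derivative y) (at x) \<and> 0 \<le> y" by auto
  qed
  then show ?thesis by (simp add: f_def)
qed

text \<open>Jensen's inequality for the linear radius \<open>r0 + c * t\<close>: the means of its
  square and of its inverse are at least the values at the mean radius \<open>r0 + c / 2\<close>,
  the only radius that matters from here on.\<close>

lemma two_body_bound:
  fixes r0 c \<phi> :: real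
  assumes "r0 > 0" "c > 0"
  shows "\<phi>\<^sup>2 * (r0 + c / 2)\<^sup>2 + 1 / (2 * (r0 + c / 2)) \<le> 1/12 * (3 * r0\<^sup>2 + c\<^sup>2 + 3 * c * r0) * (2 * \<phi>)\<^sup>2 + 1 / (2 * c) * ln (1 + c / r0)"
proof -
  have "1/12 * (3 * r0\<^sup>2 + c\<^sup>2 + 3 * c * r0) * (2 * \<phi>)\<^sup>2 = \<phi>\<^sup>2 * (r0 + c / 2)\<^sup>2 + \<phi>\<^sup>2 * c\<^sup>2 / 12"
    by (simp add: power2_eq_square algebra_simps)
  moreover have "1 / (2 * (r0 + c / 2)) \<le> 1 / (2 * c) * ln (1 + c / r0)"
  proof -
    have "1 / (2 * (r0 + c / 2)) = 1 / (2 * c) * (2 * (c / r0) / (2 + c / r0))" using assms by (simp add: field_simps)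
    also have "\<dots> \<le> 1 / (2 * c) * ln (1 + c / r0)" using assms by (intro mult_left_mono ln_add_one_ge) auto
    finally show ?thesis .
  qed
  moreover have "\<phi>\<^sup>2 * c\<^sup>2 / 12 \<ge> 0" by simp
  ultimately show ?thesis by linarith
qed

text \<open>\<open>\<rho>\<close> is the critical point of the right-hand side as a function of
  \<open>y\<close>; the excess over the minimum has the factor
  \<open>(y - \<rho>)^2\<close>.\<close>

lemma two_body_minimum:
  fixes \<rho> y \<phi> :: real
  assumes "\<rho> > 0" "y > 0" "\<rho> ^ 3 * (4 * \<phi>\<^sup>2) = 1"
  shows "\<phi>\<^sup>2 * \<rho>\<^sup>2 + 1 / (2 * \<rho>) \<le> \<phi>\<^sup>2 * y\<^sup>2 + 1 / (2 * y)" "\<phi>\<^sup>2 * \<rho>\<^sup>2 + 1 / (2 * \<rho>) = 3 / (4 * \<rho>)"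
proof -
  have f: "\<phi>\<^sup>2 = 1 / (4 * \<rho> ^ 3)" using assms by (simp add: field_simps)
  show e: "\<phi>\<^sup>2 * \<rho>\<^sup>2 + 1 / (2 * \<rho>) = 3 / (4 * \<rho>)" unfolding f using assms(1) by (simp add: field_simps power2_eq_square power3_eq_cube)
  have "\<phi>\<^sup>2 * y\<^sup>2 + 1 / (2 * y) - 3 / (4 * \<rho>) = (y - \<rho>)\<^sup>2 * (y + 2 * \<rho>) / (4 * \<rho> ^ 3 * y)"
    unfolding f using assms(1,2) by (simp add: field_simps power2_eq_square power3_eq_cube)
  also have "\<dots> \<ge> 0" using assms by simp
  finally show "\<phi>\<^sup>2 * \<rho>\<^sup>2 + 1 / (2 * \<rho>) \<le> \<phi>\<^sup>2 * y\<^sup>2 + 1 / (2 * y)" unfolding e by simp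
qed

text \<open>A lower bound, of second order, for half of \<open>1 / (1 - x) + 1 / sqrt (1 + (x + z)\<^sup>2)\<close>: with \<open>x = r0 / A\<close>, \<open>z = c / A\<close> and
  \<open>A = l (1 + 2 / m)\<close> this is the sum of the estimated potentials of the pairs \<open>{1, 3}\<close> and \<open>{2, 3}\<close>, up to the factor \<open>m / A\<close>.\<close>

definition half_bracket :: "real \<Rightarrow> real \<Rightarrow> real" where "half_bracket x z = 1 + x * (1 - z) / 2 + (x\<^sup>2 - z\<^sup>2) / 4"

text \<open>From \<open>1 / (1 - x) \<ge> 1 + x + x^2\<close>, and
  \<open>1 / sqrt (1 + y^2) \<ge> 1 - y^2 / 2\<close> for \<open>y = x + z\<close>.\<close>

lemma bracket_le:
  assumes "0 < x" "x < 1"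
  shows "2 * half_bracket x z \<le> 1 / (1 - x) + 1 / sqrt (1 + (x + z)\<^sup>2)"
proof -
  have "1 + x + x\<^sup>2 \<le> 1 / (1 - x)"
  proof -
    have "(1 + x + x\<^sup>2) * (1 - x) \<le> 1" using assms by (simp add: algebra_simps power2_eq_square)
    then show ?thesis using assms by (simp add: pos_le_divide_eq)
  qed
  moreover have "2 * half_bracket x z = 1 + x + x\<^sup>2 + (1 - (x + z)\<^sup>2 / 2)" by (simp add: half_bracket_def power2_eq_square algebra_simps add_divide_distrib diff_divide_distrib)
  ultimately show ?thesis using inverse_sqrt_bounds(1)[of "x + z"] by linarith
qed

lemma bracket_ge:
  assumes "0 \<le> x" "0 \<le> z" "z \<le> 1"
  shows "1 - z\<^sup>2 / 4 \<le> half_bracket x z" "3/4 \<le> half_bracket x z" "1/4 \<le> x \<Longrightarrow> half_bracket (1/4) z \<le> half_bracket x z"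
proof -
  have "0 \<le> x * (1 - z)" using assms by simp
  then show 1: "1 - z\<^sup>2 / 4 \<le> half_bracket x z" by (simp add: half_bracket_def diff_divide_distrib)
  have "z\<^sup>2 \<le> 1" using assms by (simp add: power_le_one)
  then show "3/4 \<le> half_bracket x z" using 1 by linarith
  show "half_bracket (1/4) z \<le> half_bracket x z" if "1/4 \<le> x"
  proof -
    have "half_bracket x z - half_bracket (1/4) z = (x - 1/4) * ((1 - z) / 2 + (x + 1/4) / 4)" by (simp add: half_bracket_def power2_eq_square algebra_simps add_divide_distrib diff_divide_distrib)
    also have "\<dots> \<ge> 0" using assms that by (intro mult_nonneg_nonneg add_nonneg_nonneg) auto
    finally show ?thesis by simp
  qed
qed

text \<open>With \<open>e = 2 * (half_bracket x z - 1)\<close> the product is at least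
  \<open>(1 + d) * (1 + e)\<close>, so \<open>e + d * (1 + e) \<ge> 0\<close> suffices. As
  \<open>1 + e\<close> lies between 0.82 and 1.29, only one of these ends has to be checked,
  depending on the sign of \<open>d\<close>; there the expression is \<open>x\<close> plus a
  quadratic form.\<close>

lemma bracket_unclipped:
  assumes x: "0 < x" "x \<le> 1/4" and z: "0 < z" "z \<le> 3/5"
  shows "1 \<le> (1 + 81/50 * z\<^sup>2 - 93/100 * (x + z / 2)\<^sup>2) * (half_bracket x z)\<^sup>2"
proof -
  define d e where "d = 81/50 * z\<^sup>2 - 93/100 * (x + z / 2)\<^sup>2" and "e = x * (1 - z) + (x\<^sup>2 - z\<^sup>2) / 2"
  have x2: "x\<^sup>2 \<le> 1/4 * x" unfolding power2_eq_square using x by (intro mult_right_mono) auto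
  have z2: "z\<^sup>2 \<le> 9/25" using power_mono[of z "3/5" 2] z by (simp add: power2_eq_square)
  have xz: "0 \<le> x * (1 - z)" "x * (1 - z) \<le> x" using x z by (auto simp: mult_left_le)
  have elo: "e \<ge> - (9/50)" using xz z2 zero_le_power2[of x] unfolding e_def by argo
  have ehi: "e \<le> 29/100" using xz x2 x zero_le_power2[of z] unfolding e_def by argo
  have lam: "e + k * d \<ge> 0" if "k = 82/100 \<or> k = 129/100" for k
    using that
  proof
    assume l: "k = 82/100"
    have ex: "e + k * d = x + 63775/100000 * (z * z) - 17626/10000 * (x * z) - 2626/10000 * (x * x)"
      unfolding l d_def e_def by (simp add: power2_eq_square algebra_simps add_divide_distrib diff_divide_distrib)
    \<comment> \<open>The square is chosen so that its mixed term absorbs the one in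
      \<open>x * z\<close>; what remains is at most a multiple of \<open>x * x\<close>, controlled
      by \<open>x \<le> 1/4\<close>.\<close>
    have "(z - 691/500 * x)\<^sup>2 = z * z - 2764/1000 * (x * z) + 1909924/1000000 * (x * x)"
      by (simp add: power2_eq_square algebra_simps add_divide_distrib diff_divide_distrib)
    then have "0 \<le> z * z - 2764/1000 * (x * z) + 1909924/1000000 * (x * x)" using zero_le_power2[of "z - 691/500 * x"] by simp
    moreover have "x * x \<le> 1/4 * x" using x2 by (simp only: power2_eq_square)
    moreover have "0 \<le> x * z" using x z by simp
    ultimately show ?thesis unfolding ex using x by linarith
  next
    assume l: "k = 129/100"
    have ex: "e + k * d = x + 1289875/1000000 * (z * z) - 21997/10000 * (x * z) - 6997/10000 * (x * x)"
      unfolding l d_def e_def by (simp add: power2_eq_square algebra_simps add_divide_distrib diff_divide_distrib)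
    have "(z - 86/100 * x)\<^sup>2 = z * z - 172/100 * (x * z) + 7396/10000 * (x * x)"
      by (simp add: power2_eq_square algebra_simps add_divide_distrib diff_divide_distrib)
    then have "0 \<le> z * z - 172/100 * (x * z) + 7396/10000 * (x * x)" using zero_le_power2[of "z - 86/100 * x"] by simp
    moreover have "x * x \<le> 1/4 * x" using x2 by (simp only: power2_eq_square)
    moreover have "0 \<le> x * z" using x z by simp
    ultimately show ?thesis unfolding ex using x by linarith
  qed
  have "0 \<le> e + d * (1 + e)"
  proof (cases "d \<ge> 0")
    case True
    have "82/100 * d \<le> d * (1 + e)" using True elo mult_left_mono[of "82/100" "1 + e" d] by (simp add: mult.commute)
    then show ?thesis using lam[of "82/100"] by simp
  next
    case False
    have "129/100 * d \<le> d * (1 + e)" using False ehi mult_left_mono_neg[of "1 + e" "129/100" d] by (simp add: mult.commute)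
    then show ?thesis using lam[of "129/100"] by simp
  qed
  then have 1: "1 \<le> (1 + d) * (1 + e)" by (simp add: algebra_simps)
  have "1 + e \<le> (half_bracket x z)\<^sup>2"
  proof -
    have "half_bracket x z = 1 + e / 2" by (simp add: half_bracket_def e_def add_divide_distrib)
    then show ?thesis by (simp add: power2_eq_square algebra_simps)
  qed
  moreover have "1 + d \<ge> 0"
  proof -
    have "(x + z / 2)\<^sup>2 \<le> (55/100)\<^sup>2" using x z by (intro power_mono) auto
    then have "93/100 * (x + z / 2)\<^sup>2 \<le> 93/100 * (55/100)\<^sup>2" by (intro mult_left_mono) auto
    also have "\<dots> \<le> 1" by (simp add: power2_eq_square)
    finally have "93/100 * (x + z / 2)\<^sup>2 \<le> 1" .
    moreover have "0 \<le> 81/50 * z\<^sup>2" by simp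
    ultimately show ?thesis unfolding d_def by linarith
  qed
  ultimately have "(1 + d) * (1 + e) \<le> (1 + d) * (half_bracket x z)\<^sup>2" by (intro mult_left_mono)
  then have "1 \<le> (1 + d) * (half_bracket x z)\<^sup>2" using 1 by linarith
  then show ?thesis unfolding d_def by (simp only: add_diff_eq)
qed

text \<open>The number 431/400 is a third of \<open>3 + 93/100 * (1/4)\<close>, the bound that
  \<open>three_body_bound\<close> needs when only \<open>\<xi>^2 \<le> 1/4\<close> is
  available.\<close>

lemma bracket_clipped:
  assumes x: "0 < x" "x < 1" and z: "0 < z" "z < 1" and far: "1/4 \<le> x \<or> 3/5 \<le> z"
  shows "(431/400) ^ 3 \<le> (1 + 81/50 * z\<^sup>2) * (half_bracket x z)\<^sup>2"
proof -
  have z21: "z\<^sup>2 \<le> 1" using z by (simp add: power_le_one)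
  have "12515/10000 \<le> (1 + 81/50 * z\<^sup>2) * (half_bracket x z)\<^sup>2"
  proof (cases "3/5 \<le> z")
    case True
    define y where "y = z\<^sup>2"
    have y: "9/25 \<le> y" "y \<le> 1" using power_mono[OF True, of 2] z21 by (auto simp: y_def power2_eq_square)
    \<comment> \<open>Without its positive cubic term, the product with \<open>1 - y / 4\<close> is
      a concave parabola in \<open>y\<close>, so that its values at the two ends decide.\<close>
    have "(y - 9/25) * (1 - y) \<ge> 0" using y by simp
    then have "12515/10000 \<le> 1 + 1.12 * y - 0.7475 * (y * y)" using y by (simp add: algebra_simps add_divide_distrib diff_divide_distrib)
    also have "\<dots> \<le> (1 + 81/50 * y) * (1 - y / 4)\<^sup>2"
    proof -
      have "(1 + 81/50 * y) * (1 - y / 4)\<^sup>2 - (1 + 1.12 * y - 0.7475 * (y * y)) = 81/800 * (y * y * y)"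
        by (simp add: power2_eq_square algebra_simps add_divide_distrib diff_divide_distrib)
      moreover have "81/800 * (y * y * y) \<ge> 0" using y by simp
      ultimately show ?thesis by linarith
    qed
    also have "\<dots> \<le> (1 + 81/50 * y) * (half_bracket x z)\<^sup>2"
      using bracket_ge(1)[of x z] x z y by (intro mult_left_mono power_mono) (auto simp: y_def)
    finally show ?thesis by (simp add: y_def)
  next
    case False
    then have z6: "z \<le> 3/5" and x4: "1/4 \<le> x" using far by auto
    \<comment> \<open>The tangent to the square at 1.12, close to
      \<open>half_bracket (1/4) z\<close> for \<open>z\<close> near 0.15, where the estimate is
      tight. It leaves a polynomial of degree 4 in \<open>z\<close>.\<close>
    have "2.24 * half_bracket (1/4) z - 1.2544 \<le> (half_bracket (1/4) z)\<^sup>2"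
      using zero_le_power2[of "half_bracket (1/4) z - 1.12"] by (simp add: power2_eq_square algebra_simps)
    then have "(1 + 81/50 * z\<^sup>2) * (2.24 * half_bracket (1/4) z - 1.2544) \<le> (1 + 81/50 * z\<^sup>2) * (half_bracket (1/4) z)\<^sup>2"
      by (intro mult_left_mono) auto
    also have "\<dots> \<le> (1 + 81/50 * z\<^sup>2) * (half_bracket x z)\<^sup>2"
      using bracket_ge(3)[of x z] bracket_ge(2)[of "1/4" z] x4 z by (intro mult_left_mono power_mono) auto
    finally have 1: "(1 + 81/50 * z\<^sup>2) * (2.24 * half_bracket (1/4) z - 1.2544) \<le> (1 + 81/50 * z\<^sup>2) * (half_bracket x z)\<^sup>2" .
    have z3: "z * z * z \<le> 3/5 * (z * z)" using z z6 mult_left_mono[of z "3/5" "z * z"] by (simp add: mult.commute)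
    have z4: "z * z * z * z \<le> 9/25 * (z * z)"
    proof -
      have "z * z \<le> 3/5 * (3/5)" using z z6 by (intro mult_mono) auto
      from mult_left_mono[OF this, of "z * z"] show ?thesis by (simp add: mult_ac)
    qed
    have "(z - 0.15)\<^sup>2 \<ge> 0" by simp
    then have sq: "0 \<le> z * z - 3/10 * z + 225/10000" by (simp add: power2_eq_square algebra_simps)
    have "(1 + 81/50 * z\<^sup>2) * (2.24 * half_bracket (1/4) z - 1.2544) = 13006/10000 - 28/100 * z + 1546972/1000000 * (z * z) - 4536/10000 * (z * z * z) - 9072/10000 * (z * z * z * z)"
      by (simp add: half_bracket_def power2_eq_square algebra_simps add_divide_distrib diff_divide_distrib)
    then have "12515/10000 \<le> (1 + 81/50 * z\<^sup>2) * (2.24 * half_bracket (1/4) z - 1.2544)"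
      using z3 z4 sq z by linarith
    then show ?thesis using 1 by linarith
  qed
  then show ?thesis by (simp add: power3_eq_cube)
qed

text \<open>Here \<open>s\<close> is the size \<open>A / As\<close>, and the left-hand side is the
  value for \<open>s = 1\<close>, \<open>c = 0\<close> and scaled radius \<open>\<xi>\<close>; it is
  at most \<open>3 + 93/100 * \<xi>^2\<close>. For small \<open>x\<close> and \<open>z\<close> this
  excess over 3 is absorbed by means of \<open>\<xi> \<le> s * (x + z / 2)\<close>; otherwise
  \<open>\<xi> \<le> 1/2\<close> is enough.\<close>

lemma three_body_bound:
  fixes s x z q \<xi> :: real
  assumes s: "s > 0" and x: "0 < x" "x < 1" and z: "0 < z" "z < 1" and q: "q \<ge> 81/50"
    and \<xi>: "0 \<le> \<xi>" "\<xi> \<le> 1/2" "\<xi> \<le> s * (x + z / 2)"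
  shows "1 + (1 / sqrt (1 + \<xi>\<^sup>2) + 1 / (1 - \<xi>\<^sup>2)) \<le> s\<^sup>2 + (1 / (1 - x) + 1 / sqrt (1 + (x + z)\<^sup>2)) / s + q * z\<^sup>2 * s\<^sup>2"
proof -
  define u where "u = \<xi>\<^sup>2"
  have u: "0 \<le> u" "u \<le> 1/4" using power_mono[of \<xi> "1/2" 2] \<xi> by (auto simp: u_def power2_eq_square)
  have uu: "u * u \<le> 1/4 * u" using u by (intro mult_right_mono) auto
  have "1 / (1 - u) \<le> 1 + u + 4/3 * (u * u)"
  proof -
    have "(1 + u + 4/3 * (u * u)) * (1 - u) - 1 = u * u * (1/3 - 4/3 * u)" by (simp add: algebra_simps add_divide_distrib diff_divide_distrib)
    also have "\<dots> \<ge> 0" using u by simp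
    finally have "1 \<le> (1 + u + 4/3 * (u * u)) * (1 - u)" by simp
    then show ?thesis using u by (simp add: pos_divide_le_eq)
  qed
  then have lhs: "1 / sqrt (1 + \<xi>\<^sup>2) + 1 / (1 - \<xi>\<^sup>2) \<le> 2 + 93/100 * u"
    using inverse_sqrt_bounds(2)[of \<xi>] uu u unfolding u_def[symmetric] power2_eq_square[of u] by argo
  have qz: "81/50 * z\<^sup>2 * s\<^sup>2 \<le> q * z\<^sup>2 * s\<^sup>2" using q by (intro mult_right_mono) auto
  have bs: "2 * half_bracket x z / s \<le> (1 / (1 - x) + 1 / sqrt (1 + (x + z)\<^sup>2)) / s"
    using bracket_le[OF x] s by (intro divide_right_mono) auto
  have b0: "half_bracket x z > 0" using bracket_ge(2)[of x z] x z by simp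
  show ?thesis
  proof (cases "x \<le> 1/4 \<and> z \<le> 3/5")
    case True
    have "u \<le> (s * (x + z / 2))\<^sup>2" unfolding u_def using \<xi> by (intro power_mono) auto
    then have us: "u \<le> s\<^sup>2 * (x + z / 2)\<^sup>2" by (simp add: power_mult_distrib)
    have "3 * 1 \<le> (1 + 81/50 * z\<^sup>2 - 93/100 * (x + z / 2)\<^sup>2) * s\<^sup>2 + 2 * half_bracket x z / s"
      by (rule amgm_square_inverse) (use b0 s bracket_unclipped[of x z] True x z in auto)
    also have "(1 + 81/50 * z\<^sup>2 - 93/100 * (x + z / 2)\<^sup>2) * s\<^sup>2 = s\<^sup>2 + 81/50 * z\<^sup>2 * s\<^sup>2 - 93/100 * (s\<^sup>2 * (x + z / 2)\<^sup>2)"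
      by (simp add: algebra_simps)
    finally show ?thesis using us lhs qz bs by linarith
  next
    case False
    have "3 * (431/400) \<le> (1 + 81/50 * z\<^sup>2) * s\<^sup>2 + 2 * half_bracket x z / s"
      by (rule amgm_square_inverse) (use b0 s bracket_clipped[OF x z] False in auto)
    also have "(1 + 81/50 * z\<^sup>2) * s\<^sup>2 = s\<^sup>2 + 81/50 * z\<^sup>2 * s\<^sup>2" by (simp add: algebra_simps)
    finally show ?thesis using u lhs qz bs by linarith
  qed
qed

text \<open>The weaker bound of \<open>half_bracket\<close> suffices because
  \<open>(1 + y) * (1 - y / 4)^2 \<ge> 1\<close> on the unit interval.\<close>

lemma three_body_crude:
  fixes s x z q :: real
  assumes s: "s > 0" and x: "0 < x" "x < 1" and z: "0 < z" "z < 1" and q: "q \<ge> 1"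
  shows "3 \<le> s\<^sup>2 + (1 / (1 - x) + 1 / sqrt (1 + (x + z)\<^sup>2)) / s + q * z\<^sup>2 * s\<^sup>2"
proof -
  have qz: "1 * z\<^sup>2 * s\<^sup>2 \<le> q * z\<^sup>2 * s\<^sup>2" using q by (intro mult_right_mono) auto
  have bs: "2 * (1 - z\<^sup>2 / 4) / s \<le> (1 / (1 - x) + 1 / sqrt (1 + (x + z)\<^sup>2)) / s"
    using bracket_le[OF x, of z] bracket_ge(1)[of x z] s x z by (intro divide_right_mono) auto
  define y where "y = z\<^sup>2"
  have y: "0 < y" "y \<le> 1" using z by (auto simp: y_def power_le_one)
  have "3 * 1 \<le> (1 + y) * s\<^sup>2 + 2 * (1 - y / 4) / s"
  proof (rule amgm_square_inverse)
    have "(1 + y) * (1 - y / 4)\<^sup>2 - 1 = y * (1 - y) / 2 + y * y / 16 * (1 + y)" by (simp add: power2_eq_square field_simps)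
    also have "\<dots> \<ge> 0" using y by (intro add_nonneg_nonneg) auto
    finally show "1 ^ 3 \<le> (1 + y) * (1 - y / 4)\<^sup>2" by simp
  qed (use y s in auto)
  then show ?thesis using qz bs unfolding y_def[symmetric] by (simp add: algebra_simps)
qed


section \<open>From the definition of \<open>D\<close> to the limiting test path\<close>

text \<open>Expanding with \<open>p^3 = m + 2\<close> leaves a cubic in \<open>m\<close> whose
  coefficients grow with \<open>p\<close>. For \<open>p\<close>, the lower bounds
  \<open>1.2599 + 0.18 * m\<close> up to \<open>m = 1\<close> and 1.44 beyond are close to the cube
  roots of 2 and 3 at \<open>m = 0\<close> and \<open>m = 1\<close>. The factors 23/25 and 329/1000
  stem from the range of angles in \<open>D_bound\<close>.\<close>

lemma cube_root_polynomial:
  fixes m p :: real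
  assumes m: "m > 0" and p: "p > 0" "p ^ 3 = m + 2"
  shows "(m + 1/4)\<^sup>2 / 2 * (m + 2) \<le> (23/25 * m + 329/1000 * p) ^ 3"
proof -
  have ge: "k \<le> p" if "k ^ 3 \<le> m + 2" for k using p that by (intro power_le_imp_le_base[of k 2]) (auto simp: numeral_3_eq_3)
  have "(23/25 * m + 329/1000 * p) ^ 3 = (23/25) ^ 3 * m ^ 3 + 3 * (23/25)\<^sup>2 * (329/1000) * (m\<^sup>2 * p) + 3 * (23/25) * (329/1000)\<^sup>2 * (m * p\<^sup>2) + (329/1000) ^ 3 * p ^ 3"
    by (simp add: power2_eq_square power3_eq_cube algebra_simps add_divide_distrib diff_divide_distrib)
  then have e: "(23/25 * m + 329/1000 * p) ^ 3 - (m + 1/4)\<^sup>2 / 2 * (m + 2)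
    = 8709/31250 * m ^ 3 + (522123/625000 * p - 5/4) * m\<^sup>2 + (7468629/25000000 * p\<^sup>2 - 495638711/1000000000) * m + 4361289/500000000"
    unfolding p(2) by (simp add: power2_eq_square power3_eq_cube algebra_simps add_divide_distrib diff_divide_distrib)
  have pos: "0 \<le> 8709/31250 * m ^ 3 + a * m\<^sup>2 + b * m + 4361289/500000000"
    if "m \<le> 1 \<and> - 1976/10000 + 15/100 * m \<le> a \<and> - 216/10000 + 135/1000 * m \<le> b \<or> 1 \<le> m \<and> - 472/10000 \<le> a \<and> 0 \<le> b" for a b
    using that
  proof
    assume h: "m \<le> 1 \<and> - 1976/10000 + 15/100 * m \<le> a \<and> - 216/10000 + 135/1000 * m \<le> b"
    have "0 \<le> (a - (- 1976/10000 + 15/100 * m)) * m\<^sup>2" "0 \<le> (b - (- 216/10000 + 135/1000 * m)) * m" using h m by auto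
    moreover have "(a - (- 1976/10000 + 15/100 * m)) * m\<^sup>2 = a * m\<^sup>2 + 1976/10000 * m\<^sup>2 - 15/100 * m ^ 3" "(b - (- 216/10000 + 135/1000 * m)) * m = b * m + 216/10000 * m - 135/1000 * m\<^sup>2"
      by (simp_all add: power2_eq_square power3_eq_cube algebra_simps add_divide_distrib diff_divide_distrib)
    moreover have "m * (m - 17/100)\<^sup>2 = m ^ 3 - 34/100 * m\<^sup>2 + 289/10000 * m" "(m - 1/5)\<^sup>2 = m\<^sup>2 - 2/5 * m + 1/25"
      by (simp_all add: power2_eq_square power3_eq_cube algebra_simps add_divide_distrib diff_divide_distrib)
    moreover have "0 \<le> m * (m - 17/100)\<^sup>2" "0 \<le> (m - 1/5)\<^sup>2" "0 \<le> m ^ 3" using m by auto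
    ultimately show ?thesis using m h by linarith
  next
    assume h: "1 \<le> m \<and> - 472/10000 \<le> a \<and> 0 \<le> b"
    have "- 472/10000 * m\<^sup>2 \<le> a * m\<^sup>2" by (rule mult_right_mono) (use h in auto)
    moreover have "0 \<le> b * m" using h m by simp
    moreover have "1 * m\<^sup>2 \<le> m * m\<^sup>2" using h by (intro mult_right_mono) auto
    moreover have "0 \<le> m\<^sup>2" by simp
    ultimately show ?thesis unfolding power3_eq_cube power2_eq_square by argo
  qed
  have "0 \<le> 8709/31250 * m ^ 3 + (522123/625000 * p - 5/4) * m\<^sup>2 + (7468629/25000000 * p\<^sup>2 - 495638711/1000000000) * m + 4361289/500000000"
  proof (rule pos, cases "m \<le> 1")
    case True
    have "0 \<le> m * (1 - m)" "0 \<le> m * (1 - m) * (1 + m)" using True m by (auto intro!: mult_nonneg_nonneg)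
    moreover have "m * (1 - m) = m - m * m" "m * (1 - m) * (1 + m) = m - m * m * m" by (simp_all add: algebra_simps)
    ultimately have mm: "m * m \<le> m" "m * m * m \<le> m" by simp_all
    have "(1.2599 + 0.18 * m) ^ 3 = 1999899757799/1000000000000 + 8571679254/10000000000 * m + 12246228/100000000 * (m * m) + 5832/1000000 * (m * m * m)"
      by (simp add: power3_eq_cube algebra_simps add_divide_distrib diff_divide_distrib)
    moreover have "Q \<le> m + 2" if "Q = 1999899757799/1000000000000 + 8571679254/10000000000 * m + 12246228/100000000 * u + 5832/1000000 * w" "u \<le> m" "w \<le> m" for Q u w
      using that m True by simp
    ultimately have "(1.2599 + 0.18 * m) ^ 3 \<le> m + 2" using mm by blast
    from ge[OF this] have p1: "1.2599 + 0.18 * m \<le> p" .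
    have "(1.2599 + 0.18 * m)\<^sup>2 \<le> p\<^sup>2" using p1 m by (intro power_mono) auto
    moreover have "(1.2599 + 0.18 * m)\<^sup>2 = 1.58734801 + 0.453564 * m + 0.0324 * (m * m)" by (simp add: power2_eq_square algebra_simps)
    moreover have "1.58734801 + 0.453564 * m \<le> 1.58734801 + 0.453564 * m + 0.0324 * (m * m)" by simp
    ultimately have "1.58734801 + 0.453564 * m \<le> p\<^sup>2" by (simp only:)
    then show "m \<le> 1 \<and> - 1976/10000 + 15/100 * m \<le> 522123/625000 * p - 5/4 \<and> - 216/10000 + 135/1000 * m \<le> 7468629/25000000 * p\<^sup>2 - 495638711/1000000000 \<or> 1 \<le> m \<and> - 472/10000 \<le> 522123/625000 * p - 5/4 \<and> 0 \<le> 7468629/25000000 * p\<^sup>2 - 495638711/1000000000"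
      using p1 True m by (intro disjI1 conjI) simp_all
  next
    case False
    have p1: "1.44 \<le> p" by (rule ge) (use False in \<open>simp add: power3_eq_cube\<close>)
    have "1.44\<^sup>2 \<le> p\<^sup>2" using p1 by (intro power_mono) auto
    then show "m \<le> 1 \<and> - 1976/10000 + 15/100 * m \<le> 522123/625000 * p - 5/4 \<and> - 216/10000 + 135/1000 * m \<le> 7468629/25000000 * p\<^sup>2 - 495638711/1000000000 \<or> 1 \<le> m \<and> - 472/10000 \<le> 522123/625000 * p - 5/4 \<and> 0 \<le> 7468629/25000000 * p\<^sup>2 - 495638711/1000000000"
      using p1 False by (intro disjI2 conjI) (simp_all add: power2_eq_square)
  qed
  then show ?thesis using e by linarith
qed

text \<open>\<open>A\<close> is the distance of body 3 from the midpoint of bodies 1 and 2, and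
  \<open>As\<close> is the minimizer of \<open>\<theta>^2 * m / (m + 2) * A^2 + 2 * m / A\<close>.
  Scaling by them leaves dimensionless variables and a two-body remainder.\<close>

lemma A_D_split:
  fixes m \<theta> l r0 c As :: real
  assumes m: "m > 0" and \<theta>: "\<theta> > 0" and l: "l > 0" and r0: "0 < r0" "r0 < l" and c: "0 < c" and As: "As > 0" "As ^ 3 * \<theta>\<^sup>2 = m + 2"
  defines "A \<equiv> l * (1 + 2 / m)"
  shows "A_D m \<theta> l r0 c = m / As * ((A / As)\<^sup>2 + (1 / (1 - r0 / A) + 1 / sqrt (1 + (r0 / A + c / A)\<^sup>2)) / (A / As) + (m + 2) / (m * \<theta>\<^sup>2) * (c / A)\<^sup>2 * (A / As)\<^sup>2)
    + (1/12 * (3 * r0\<^sup>2 + c\<^sup>2 + 3 * c * r0) * (2 * (pi / 2 - \<theta>))\<^sup>2 + 1 / (2 * c) * ln (1 + c / r0))"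
proof -
  have A: "A > 0" using m l by (simp add: A_def add_pos_pos)
  have lA: "l * (m + 2) = A * m" using m by (simp add: A_def field_simps)
  have "l < A" using m l by (simp add: A_def)
  then have rA: "r0 < A" using r0 by simp
  have t: "\<theta>\<^sup>2 = (m + 2) / As ^ 3" using As by (simp add: field_simps)
  have 1: "l\<^sup>2 * \<theta>\<^sup>2 * (1 + 2 / m) = m / As * (A / As)\<^sup>2"
  proof -
    have "l\<^sup>2 * \<theta>\<^sup>2 * (1 + 2 / m) = (l * (m + 2))\<^sup>2 / (m * As ^ 3)"
      unfolding t using m As by (simp add: field_simps power2_eq_square)
    then show ?thesis unfolding lA using m As by (simp add: field_simps power2_eq_square power3_eq_cube)
  qed
  have 2: "c\<^sup>2 = m / As * ((m + 2) / (m * \<theta>\<^sup>2) * (c / A)\<^sup>2 * (A / As)\<^sup>2)"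
  proof -
    have "(m + 2) / (m * \<theta>\<^sup>2) = As ^ 3 / m" unfolding t using m As by simp
    then show ?thesis using m As A by (simp add: power2_eq_square power3_eq_cube)
  qed
  have 3: "m\<^sup>2 / (m * (l - r0) + 2 * l) = m / As * (1 / (1 - r0 / A) / (A / As))"
  proof -
    have "m * (l - r0) + 2 * l = m * (A - r0)" using lA by (simp add: algebra_simps)
    then have "m\<^sup>2 / (m * (l - r0) + 2 * l) = m / (A - r0)" using m rA by (simp add: power2_eq_square)
    also have "\<dots> = m / As * (1 / (1 - r0 / A) / (A / As))" using A As rA by (simp add: field_simps)
    finally show ?thesis .
  qed
  have 4: "m / sqrt ((r0 + c)\<^sup>2 + l\<^sup>2 * (1 + 2 / m)\<^sup>2) = m / As * (1 / sqrt (1 + (r0 / A + c / A)\<^sup>2) / (A / As))"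
  proof -
    have "(r0 + c)\<^sup>2 + l\<^sup>2 * (1 + 2 / m)\<^sup>2 = A\<^sup>2 * (1 + (r0 / A + c / A)\<^sup>2)"
    proof -
      have "l\<^sup>2 * (1 + 2 / m)\<^sup>2 = A\<^sup>2" by (simp only: A_def power_mult_distrib)
      moreover have "r0 / A + c / A = (r0 + c) / A" by (simp add: add_divide_distrib)
      ultimately show ?thesis using A by (simp add: power_divide distrib_left)
    qed
    then have "sqrt ((r0 + c)\<^sup>2 + l\<^sup>2 * (1 + 2 / m)\<^sup>2) = A * sqrt (1 + (r0 / A + c / A)\<^sup>2)" using A by (simp add: real_sqrt_mult)
    then show ?thesis using A As by simp
  qed
  have 5: "pi - 2 * \<theta> = 2 * (pi / 2 - \<theta>)" by simp
  have comb: "X1 + X2 + Y + X3 + X4 + Z = M * (a + (b + d) / s + e) + (Y + Z)"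
    if "X1 = M * a" "X2 = M * e" "X3 = M * (b / s)" "X4 = M * (d / s)" for X1 X2 X3 X4 Y Z M a b d e s :: real
    unfolding that by (simp add: distrib_left add_divide_distrib)
  show ?thesis unfolding A_D_def 5 by (rule comb[OF 1 2 3 4])
qed

lemma A_E_cube: "\<theta> < pi / 2 \<Longrightarrow> A_E m \<theta> ^ 3 = 27/2 * (m + 1/4)\<^sup>2 * (pi / 2 - \<theta>)" "\<theta> < pi / 2 \<Longrightarrow> A_E m \<theta> \<ge> 0"
proof -
  assume t: "\<theta> < pi / 2"
  have "A_E m \<theta> ^ 3 = 27/8 * ((1/2 + 2 * m)\<^sup>2 * (pi / 2 - \<theta>))"
    unfolding A_E_def power_mult_distrib using t by (subst real_root_pow_pos2) (auto simp: power3_eq_cube)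
  also have "(1/2 + 2 * m)\<^sup>2 = 4 * (m + 1/4)\<^sup>2" by (simp add: power2_eq_square algebra_simps)
  finally show "A_E m \<theta> ^ 3 = 27/2 * (m + 1/4)\<^sup>2 * (pi / 2 - \<theta>)" by simp
  show "A_E m \<theta> \<ge> 0" using t by (simp add: A_E_def)
qed

text \<open>For \<open>\<theta> > 1\<close> the hypothesis \<open>q \<ge> 1\<close> of
  \<open>three_body_crude\<close> may fail. Instead all is estimated by \<open>l\<close> alone: the
  pairs with body 3 contribute at least \<open>3/2 * m / A\<close>, and the pair of bodies 1 and 2
  at least \<open>1 / (3 * l)\<close>, because its mean radius is below \<open>3/2 * l\<close>. The
  optimum in \<open>l\<close> is compared with \<open>A_E\<close>, using that
  \<open>pi / 2 - \<theta>\<close> is at most 0.5708.\<close>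

lemma A_E_le_large_angle:
  assumes m: "m > 0" and \<theta>: "1 \<le> \<theta>" "\<theta> < pi / 2" and r0: "0 < r0" "r0 < l" and c: "0 < c" "c < l"
  shows "A_E m \<theta> \<le> A_D m \<theta> l r0 c"
proof -
  define K where "K = A_E m \<theta> / 3"
  define A where "A = l * (1 + 2 / m)"
  define As where "As = root 3 ((m + 2) / \<theta>\<^sup>2)"
  have l: "l > 0" using r0 by simp
  have As: "As > 0" "As ^ 3 * \<theta>\<^sup>2 = m + 2" using m \<theta> by (auto simp: As_def real_root_gt_zero)
  have lA: "l < A" "A > 0" using m l by (simp_all add: A_def add_pos_pos)
  have x: "0 < r0 / A" "r0 / A < 1" and z: "0 < c / A" "c / A < 1" using r0 c lA by auto
  have K3: "K ^ 3 = (m + 1/4)\<^sup>2 * (pi / 2 - \<theta>) / 2" using A_E_cube(1)[OF \<theta>(2), of m] by (simp add: K_def power_divide)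
  have Kp: "K > 0"
  proof -
    have "K ^ 3 > 0" unfolding K3 using m \<theta> by (intro divide_pos_pos mult_pos_pos) auto
    moreover have "K \<ge> 0" using A_E_cube(2)[OF \<theta>(2)] by (simp add: K_def)
    ultimately show ?thesis by (cases "K = 0") auto
  qed
  define a b where "a = \<theta>\<^sup>2 * (1 + 2 / m)" and "b = (1/3 + 3/2 * (m\<^sup>2 / (m + 2))) / 2"
  have b0: "b > 0" using m by (simp add: b_def add_pos_pos)
  have "3 * K \<le> a * l\<^sup>2 + 2 * b / l"
  proof (rule amgm_square_inverse[OF b0 l Kp])
    have "m * m * ((m - 8364/10000)\<^sup>2 + 1/10) = m * m * m * m - 16728/10000 * (m * m * m) + 79956496/100000000 * (m * m)"
      by (simp add: power2_eq_square algebra_simps add_divide_distrib diff_divide_distrib)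
    moreover have "0 \<le> m * m * ((m - 8364/10000)\<^sup>2 + 1/10)" "0 \<le> m * m * m * m" "0 \<le> m * m" using m by simp_all
    moreover have "((m + 2) / 3 + 3/2 * m\<^sup>2)\<^sup>2 - 11416/10000 * (m * (m + 2) * (m + 1/4)\<^sup>2)
      = 11084/10000 * (m * m * m * m) - 1854/1000 * (m * m * m) + 19/9 * (m * m) - 121295/100000 * (m * m) + 4/9 * m - 1427/10000 * m + 4/9"
      by (simp add: power2_eq_square algebra_simps add_divide_distrib diff_divide_distrib)
    ultimately have poly: "11416/10000 * (m * (m + 2) * (m + 1/4)\<^sup>2) \<le> ((m + 2) / 3 + 3/2 * m\<^sup>2)\<^sup>2"
      using m by linarith
    have "pi / 2 - \<theta> \<le> 5708/10000" using \<theta> pi_approx(2) by simp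
    then have "(m + 1/4)\<^sup>2 * (pi / 2 - \<theta>) / 2 \<le> (m + 1/4)\<^sup>2 * (5708/10000) / 2" by (intro divide_right_mono mult_left_mono) auto
    also have "\<dots> = 11416/10000 * (m * (m + 2) * (m + 1/4)\<^sup>2) / (4 * (m * (m + 2)))"
    proof -
      have "Y * (5708/10000) / 2 = 11416/10000 * (X * Y) / (4 * X)" if "X \<noteq> 0" for X Y :: real using that by simp
      then show ?thesis using m by (metis add_pos_pos mult_pos_pos less_numeral_extra(3) zero_less_numeral)
    qed
    also have "\<dots> \<le> ((m + 2) / 3 + 3/2 * m\<^sup>2)\<^sup>2 / (4 * (m * (m + 2)))" using poly m by (intro divide_right_mono) auto
    also have "\<dots> = (1 + 2 / m) * b\<^sup>2"
    proof -
      have "2 * ((1/3 + 3/2 * (M / n)) / 2) * n = n / 3 + 3/2 * M" if "n \<noteq> 0" for M n :: real using that by (simp add: distrib_right)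
      from this[of "m + 2" "m\<^sup>2"] have "2 * b * (m + 2) = (m + 2) / 3 + 3/2 * m\<^sup>2" unfolding b_def using m by (simp only:)
      then have "((m + 2) / 3 + 3/2 * m\<^sup>2)\<^sup>2 = 4 * b\<^sup>2 * (m + 2)\<^sup>2" by (metis power_mult_distrib four_x_squared mult.assoc)
      moreover have "(1 + 2 / m) = (m + 2) / m" using m by (simp add: field_simps)
      ultimately show ?thesis using m by (simp add: power2_eq_square)
    qed
    also have "\<dots> \<le> a * b\<^sup>2"
    proof -
      have "1 * (1 + 2 / m) \<le> \<theta>\<^sup>2 * (1 + 2 / m)" using \<theta> m by (intro mult_right_mono) (auto simp: add_nonneg_nonneg)
      then show ?thesis unfolding a_def by (intro mult_right_mono) auto
    qed
    finally show "K ^ 3 \<le> a * b\<^sup>2" unfolding K3 .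
  qed
  also have "\<dots> \<le> A_D m \<theta> l r0 c"
  proof -
    have two: "1 / (3 * l) \<le> 1/12 * (3 * r0\<^sup>2 + c\<^sup>2 + 3 * c * r0) * (2 * (pi / 2 - \<theta>))\<^sup>2 + 1 / (2 * c) * ln (1 + c / r0)"
    proof -
      have "1 / (3 * l) \<le> 1 / (2 * (r0 + c / 2))" using r0 c l by (intro divide_left_mono mult_pos_pos) auto
      also have "\<dots> \<le> (pi / 2 - \<theta>)\<^sup>2 * (r0 + c / 2)\<^sup>2 + 1 / (2 * (r0 + c / 2))" by simp
      finally show ?thesis using two_body_bound[OF r0(1) c(1), of "pi / 2 - \<theta>"] by linarith
    qed
    have "3/2 \<le> 1 / (1 - r0 / A) + 1 / sqrt (1 + (r0 / A + c / A)\<^sup>2)"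
      using bracket_le[OF x, of "c / A"] bracket_ge(2)[of "r0 / A" "c / A"] x z by linarith
    then have "(3/2) / (A / As) \<le> (1 / (1 - r0 / A) + 1 / sqrt (1 + (r0 / A + c / A)\<^sup>2)) / (A / As)"
      by (rule divide_right_mono) (use As lA in simp)
    moreover have "0 \<le> (m + 2) / (m * \<theta>\<^sup>2) * (c / A)\<^sup>2 * (A / As)\<^sup>2" using m by simp
    ultimately have "(A / As)\<^sup>2 + (3/2) / (A / As) \<le> (A / As)\<^sup>2 + (1 / (1 - r0 / A) + 1 / sqrt (1 + (r0 / A + c / A)\<^sup>2)) / (A / As) + (m + 2) / (m * \<theta>\<^sup>2) * (c / A)\<^sup>2 * (A / As)\<^sup>2"
      by linarith
    then have "m / As * ((A / As)\<^sup>2 + (3/2) / (A / As)) \<le> m / As * ((A / As)\<^sup>2 + (1 / (1 - r0 / A) + 1 / sqrt (1 + (r0 / A + c / A)\<^sup>2)) / (A / As) + (m + 2) / (m * \<theta>\<^sup>2) * (c / A)\<^sup>2 * (A / As)\<^sup>2)"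
      by (rule mult_left_mono) (use m As in simp)
    moreover have "m / As * ((A / As)\<^sup>2 + (3/2) / (A / As)) = a * l\<^sup>2 + 3/2 * (m\<^sup>2 / (m + 2)) / l"
    proof -
      have Al: "A = l * (m + 2) / m" using m by (simp add: A_def field_simps)
      have t: "\<theta>\<^sup>2 = (m + 2) / As ^ 3" using As by (simp add: field_simps)
      have "m / As * (A / As)\<^sup>2 = a * l\<^sup>2" unfolding a_def t Al using m As by (simp add: field_simps power2_eq_square power3_eq_cube)
      moreover have "m / As * ((3/2) / (A / As)) = 3/2 * (m / A)" using As lA by simp
      moreover have "m / A = m\<^sup>2 / (m + 2) / l" unfolding Al using m l by (simp add: field_simps power2_eq_square)
      ultimately show ?thesis unfolding distrib_left by simp
    qed
    moreover have "2 * b / l = 1 / (3 * l) + 3/2 * (m\<^sup>2 / (m + 2)) / l"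
    proof -
      have "2 * ((1/3 + X) / 2) / l = 1 / (3 * l) + X / l" for X by (simp add: add_divide_distrib)
      then show ?thesis unfolding b_def by blast
    qed
    ultimately show ?thesis
      using two A_D_split[OF m _ l r0 c(1) As, folded A_def] \<theta> by simp
  qed
  finally show ?thesis by (simp add: K_def)
qed

text \<open>The result is the limit \<open>c = 0\<close> of the bound in
  \<open>test_path_action\<close>, for \<open>A = As\<close> and a suitable radius; the parameters
  behind \<open>D\<close> only serve to show that its value lies below \<open>A_E\<close>.\<close>

lemma D_bound:
  assumes m: "m > 0" and \<theta>: "0 < \<theta>" "\<theta> < pi / 2" and inD: "(m, \<theta>) \<in> D"
  obtains A \<rho> where "1/2 \<le> pi / 2 - \<theta>" "0 < \<rho>" "\<rho> < A"
    "\<theta>\<^sup>2 * m / (m + 2) * A\<^sup>2 + (pi / 2 - \<theta>)\<^sup>2 * \<rho>\<^sup>2 + 1 / (2 * \<rho>) + m * (1 / sqrt (A\<^sup>2 + \<rho>\<^sup>2) + A / (A\<^sup>2 - \<rho>\<^sup>2)) < A_E m \<theta>"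
proof -
  define S where "S = {A_D m \<theta> l r0 c - A_E m \<theta> | l r0 c. l > r0 \<and> r0 > 0 \<and> l > c \<and> c > 0}"
  \<comment> \<open>Any sample parameters do: the set has to be nonempty before a negative
    \<open>Inf\<close> yields a negative element.\<close>
  have "A_D m \<theta> 2 1 1 - A_E m \<theta> \<in> S" unfolding S_def by (rule CollectI, rule exI[of _ 2], rule exI[of _ 1], rule exI[of _ 1]) simp
  then have "S \<noteq> {}" by blast
  moreover have "Inf S < 0" using inD by (simp add: D_def S_def)
  ultimately obtain v where "v \<in> S" "v < 0" using cInf_lessD by blast
  then obtain l r0 c where lrc: "r0 < l" "0 < r0" "c < l" "0 < c" and lt: "A_D m \<theta> l r0 c < A_E m \<theta>" by (auto simp: S_def)
  define \<phi> where "\<phi> = pi / 2 - \<theta>"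
  have \<phi>: "\<phi> > 0" using \<theta> by (simp add: \<phi>_def)
  define A where "A = l * (1 + 2 / m)"
  define As where "As = root 3 ((m + 2) / \<theta>\<^sup>2)"
  define \<rho>s where "\<rho>s = root 3 (1 / (4 * \<phi>\<^sup>2))"
  have l: "l > 0" using lrc by simp
  have As: "As > 0" "As ^ 3 * \<theta>\<^sup>2 = m + 2" using m \<theta> by (auto simp: As_def real_root_gt_zero)
  have \<rho>s: "\<rho>s > 0" "\<rho>s ^ 3 * (4 * \<phi>\<^sup>2) = 1" using \<phi> by (auto simp: \<rho>s_def real_root_gt_zero)
  have lA: "l < A" "A > 0" using m l by (simp_all add: A_def add_pos_pos)
  define x z s where "x = r0 / A" and "z = c / A" and "s = A / As"
  have x: "0 < x" "x < 1" and z: "0 < z" "z < 1" and s: "s > 0" using lrc lA As by (auto simp: x_def z_def s_def)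
  define q where "q = (m + 2) / (m * \<theta>\<^sup>2)"
  define T where "T = 1/12 * (3 * r0\<^sup>2 + c\<^sup>2 + 3 * c * r0) * (2 * \<phi>)\<^sup>2 + 1 / (2 * c) * ln (1 + c / r0)"
  have AD: "A_D m \<theta> l r0 c = m / As * (s\<^sup>2 + (1 / (1 - x) + 1 / sqrt (1 + (x + z)\<^sup>2)) / s + q * z\<^sup>2 * s\<^sup>2) + T"
    using A_D_split[OF m \<theta>(1) l lrc(2,1,4) As] by (simp only: A_def x_def z_def s_def q_def T_def \<phi>_def)
  have T: "\<phi>\<^sup>2 * (r0 + c / 2)\<^sup>2 + 1 / (2 * (r0 + c / 2)) \<le> T" unfolding T_def by (rule two_body_bound[OF lrc(2,4)])
  have q1: "1 / \<theta>\<^sup>2 \<le> q"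
  proof -
    have "1 * (1 / \<theta>\<^sup>2) \<le> (m + 2) / m * (1 / \<theta>\<^sup>2)" using m by (intro mult_right_mono) auto
    then show ?thesis by (simp add: q_def)
  qed
  \<comment> \<open>Beyond \<open>pi / 4\<close> the two parts of \<open>A_D\<close> are at least
    their separate minima \<open>3 * m / As\<close> and \<open>3 / (4 * \<rho>s)\<close>, whose sum
    already reaches \<open>A_E\<close>. Angles from 1 on are dealt with by
    \<open>A_E_le_large_angle\<close>.\<close>
  have \<theta>4: "\<theta> \<le> pi / 4"
  proof (rule ccontr)
    assume "\<not> ?thesis"
    then have t4: "pi / 4 < \<theta>" by simp
    have t1: "\<theta> < 1" using A_E_le_large_angle[OF m _ \<theta>(2) lrc(2,1,4,3)] lt by force
    then have "1 \<le> 1 / \<theta>\<^sup>2" using \<theta> by (simp add: power_le_one)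
    then have "1 \<le> q" using q1 by linarith
    from three_body_crude[OF s x z this] have "m / As * 3 \<le> m / As * (s\<^sup>2 + (1 / (1 - x) + 1 / sqrt (1 + (x + z)\<^sup>2)) / s + q * z\<^sup>2 * s\<^sup>2)"
      using m As by (intro mult_left_mono) auto
    moreover have "3 / (4 * \<rho>s) \<le> T"
      using two_body_minimum[OF \<rho>s(1) _ \<rho>s(2), of "r0 + c / 2"] T lrc by simp
    ultimately have "m / As * 3 + 3 / (4 * \<rho>s) \<le> A_D m \<theta> l r0 c" unfolding AD by (rule add_mono)
    then have 1: "3 * (m / As) + 3 * (1 / (4 * \<rho>s)) \<le> A_D m \<theta> l r0 c" by simp
    define g p where "g = root 3 \<phi>" and "p = root 3 (m + 2)"
    have g: "g > 0" "g ^ 3 = \<phi>" and p: "p > 0" "p ^ 3 = m + 2" using \<phi> m by (auto simp: g_def p_def)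
    have le3: "u \<le> v" if "u ^ 3 \<le> v ^ 3" "0 \<le> v" for u v :: real
      using that by (intro power_le_imp_le_base[of u 2]) (auto simp: numeral_3_eq_3)
    \<comment> \<open>\<open>(23/25)^3\<close> is below \<open>pi / 4\<close>, while
      \<open>\<phi> < pi / 4 < \<theta>\<close>.\<close>
    have X: "23/25 * g * m / p \<le> m / As"
    proof -
      have "(23/25 * g) ^ 3 \<le> (p / As) ^ 3"
      proof -
        have "(23/25 * g) ^ 3 = 12167/15625 * \<phi>" using g by (simp add: power_mult_distrib power3_eq_cube)
        also have "\<dots> \<le> 0.785 * (pi / 4)" using t4 \<phi> unfolding \<phi>_def by (intro mult_mono) auto
        also have "\<dots> \<le> pi / 4 * (pi / 4)" using pi_approx(1) by (intro mult_right_mono) auto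
        also have "\<dots> \<le> \<theta>\<^sup>2" unfolding power2_eq_square using t4 \<theta> by (intro mult_mono) auto
        also have "\<theta>\<^sup>2 = (p / As) ^ 3" unfolding power_divide p(2) using As by (simp add: field_simps)
        finally show ?thesis .
      qed
      from le3[OF this] have "23/25 * g \<le> p / As" using p As by simp
      then have "(23/25 * g) * (m / p) \<le> p / As * (m / p)" using m p by (intro mult_right_mono) auto
      then show ?thesis using p by simp
    qed
    \<comment> \<open>\<open>0.329^3\<close> is at most \<open>\<phi> / 16\<close>, since
      \<open>\<theta> < 1\<close> keeps \<open>\<phi>\<close> above
      \<open>pi / 2 - 1\<close>.\<close>
    have Y: "329/1000 * g \<le> 1 / (4 * \<rho>s)"
    proof (rule le3)
      have "(329/1000 * g) ^ 3 = 35611289/1000000000 * \<phi>" using g by (simp add: power_mult_distrib power3_eq_cube)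
      also have "\<dots> \<le> \<phi> / 16 * \<phi>" using t1 pi_approx(1) \<phi> unfolding \<phi>_def by (intro mult_right_mono) auto
      also have "\<dots> = (1 / (4 * \<rho>s)) ^ 3"
      proof -
        have f: "\<phi>\<^sup>2 = 1 / (4 * \<rho>s ^ 3)" using \<rho>s by (simp add: field_simps)
        have "\<phi> / 16 * \<phi> = \<phi>\<^sup>2 / 16" by (simp add: power2_eq_square)
        then show ?thesis unfolding f by (simp add: power_divide power_mult_distrib)
      qed
      finally show "(329/1000 * g) ^ 3 \<le> (1 / (4 * \<rho>s)) ^ 3" .
    qed (use \<rho>s in simp)
    have "A_E m \<theta> / 3 \<le> g / p * (23/25 * m + 329/1000 * p)"
    proof (rule le3)
      have "(A_E m \<theta> / 3) ^ 3 = (m + 1/4)\<^sup>2 / 2 * \<phi>" using A_E_cube(1)[OF \<theta>(2), of m] by (simp add: power_divide \<phi>_def)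
      also have "\<dots> = \<phi> / (m + 2) * ((m + 1/4)\<^sup>2 / 2 * (m + 2))" using m by simp
      also have "\<dots> \<le> \<phi> / (m + 2) * (23/25 * m + 329/1000 * p) ^ 3"
        using \<phi> m by (intro mult_left_mono cube_root_polynomial p) auto
      also have "\<dots> = (g / p * (23/25 * m + 329/1000 * p)) ^ 3" by (simp only: power_mult_distrib power_divide g p)
      finally show "(A_E m \<theta> / 3) ^ 3 \<le> (g / p * (23/25 * m + 329/1000 * p)) ^ 3" .
    qed (use g p m in simp)
    also have "g / p * (23/25 * m + 329/1000 * p) = 23/25 * g * m / p + 329/1000 * g" using p by (simp add: field_simps)
    finally show False using X Y 1 lt by linarith
  qed
  \<comment> \<open>81/50 is slightly below \<open>16 / pi^2\<close>, which bounds
    \<open>1 / \<theta>^2\<close> from below.\<close>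
  have q2: "81/50 \<le> q"
  proof -
    have "\<theta>\<^sup>2 \<le> (50/63.66)\<^sup>2" using \<theta> \<theta>4 pi_approx(2) by (intro power_mono) auto
    then have "\<theta>\<^sup>2 * (81/50) \<le> 1" by (simp add: power2_eq_square)
    then have "81/50 \<le> 1 / \<theta>\<^sup>2" using \<theta> by (simp add: pos_le_divide_eq mult.commute)
    then show ?thesis using q1 by linarith
  qed
  \<comment> \<open>Not exceeding \<open>\<rho>s\<close>, the radius satisfies
    \<open>\<xi> \<le> 1/2\<close>; not exceeding the mean radius, it satisfies
    \<open>\<xi> \<le> s * (x + z / 2)\<close>. Whichever is smaller, the two-body part stays below
    \<open>T\<close>.\<close>
  define \<rho> where "\<rho> = min \<rho>s (r0 + c / 2)"
  have \<rho>: "\<rho> > 0" "\<rho> \<le> \<rho>s" "\<rho> \<le> r0 + c / 2" using \<rho>s lrc by (auto simp: \<rho>_def)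
  have half: "\<rho>s \<le> As / 2"
  proof -
    have tp: "\<theta> \<le> \<phi>" using \<theta>4 by (simp add: \<phi>_def)
    have "\<rho>s ^ 3 = 1 / (4 * \<phi>\<^sup>2)" using \<rho>s \<phi> by (simp add: field_simps)
    also have "\<dots> \<le> 1 / (4 * \<theta>\<^sup>2)" using tp \<theta> by (intro divide_left_mono mult_left_mono power_mono mult_pos_pos) auto
    also have "\<dots> \<le> (m + 2) / (8 * \<theta>\<^sup>2)" using m \<theta> by (simp add: field_simps)
    also have "\<dots> = (As / 2) ^ 3" using As(2)[symmetric] \<theta> by (simp add: power_divide field_simps)
    finally have "\<rho>s ^ 3 \<le> (As / 2) ^ 3" .
    then show ?thesis using As by (intro power_le_imp_le_base[of \<rho>s 2]) (auto simp: numeral_3_eq_3)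
  qed
  define \<xi> where "\<xi> = \<rho> / As"
  have "\<xi> \<le> s * (x + z / 2)"
  proof -
    have "x + z / 2 = (r0 + c / 2) / A" by (simp add: x_def z_def add_divide_distrib)
    then have "s * (x + z / 2) = (r0 + c / 2) / As" using lA by (simp add: s_def)
    then show ?thesis using \<rho> As by (simp add: \<xi>_def divide_right_mono)
  qed
  moreover have \<xi>2: "0 \<le> \<xi>" "\<xi> \<le> 1/2" using \<rho> half As by (auto simp: \<xi>_def pos_divide_le_eq)
  ultimately have "1 + (1 / sqrt (1 + \<xi>\<^sup>2) + 1 / (1 - \<xi>\<^sup>2)) \<le> s\<^sup>2 + (1 / (1 - x) + 1 / sqrt (1 + (x + z)\<^sup>2)) / s + q * z\<^sup>2 * s\<^sup>2"
    by (intro three_body_bound[OF s x z q2])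
  then have B1: "m / As * (1 + (1 / sqrt (1 + \<xi>\<^sup>2) + 1 / (1 - \<xi>\<^sup>2))) \<le> m / As * (s\<^sup>2 + (1 / (1 - x) + 1 / sqrt (1 + (x + z)\<^sup>2)) / s + q * z\<^sup>2 * s\<^sup>2)"
    using m As by (intro mult_left_mono) auto
  have B2: "\<phi>\<^sup>2 * \<rho>\<^sup>2 + 1 / (2 * \<rho>) \<le> T"
  proof (cases "\<rho>s \<le> r0 + c / 2")
    case True
    then have "\<rho> = \<rho>s" by (simp add: \<rho>_def)
    then show ?thesis using two_body_minimum(1)[OF \<rho>s(1) _ \<rho>s(2), of "r0 + c / 2"] T lrc by simp
  next
    case False
    then have "\<rho> = r0 + c / 2" by (simp add: \<rho>_def)
    then show ?thesis using T by simp
  qed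
  have B3: "\<theta>\<^sup>2 * m / (m + 2) * As\<^sup>2 + m * (1 / sqrt (As\<^sup>2 + \<rho>\<^sup>2) + As / (As\<^sup>2 - \<rho>\<^sup>2)) = m / As * (1 + (1 / sqrt (1 + \<xi>\<^sup>2) + 1 / (1 - \<xi>\<^sup>2)))"
  proof -
    have 1: "\<theta>\<^sup>2 * m / (m + 2) * As\<^sup>2 = m / As" unfolding As(2)[symmetric] using As(1) \<theta> by (simp add: power2_eq_square power3_eq_cube)
    have "As\<^sup>2 + \<rho>\<^sup>2 = As\<^sup>2 * (1 + \<xi>\<^sup>2)" using As by (simp add: \<xi>_def power_divide distrib_left)
    then have 2: "sqrt (As\<^sup>2 + \<rho>\<^sup>2) = As * sqrt (1 + \<xi>\<^sup>2)" using As by (simp add: real_sqrt_mult)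
    have 3: "As\<^sup>2 - \<rho>\<^sup>2 = As\<^sup>2 * (1 - \<xi>\<^sup>2)" using As by (simp add: \<xi>_def power_divide right_diff_distrib)
    show ?thesis unfolding 1 2 3 using As(1) by (simp add: distrib_left power2_eq_square)
  qed
  show ?thesis
  proof (rule that)
    show "1/2 \<le> pi / 2 - \<theta>" using \<theta>4 pi_approx(1) by simp
    show "0 < \<rho>" by (rule \<rho>)
    show "\<rho> < As" using \<rho> half As by simp
    show "\<theta>\<^sup>2 * m / (m + 2) * As\<^sup>2 + (pi / 2 - \<theta>)\<^sup>2 * \<rho>\<^sup>2 + 1 / (2 * \<rho>) + m * (1 / sqrt (As\<^sup>2 + \<rho>\<^sup>2) + As / (As\<^sup>2 - \<rho>\<^sup>2)) < A_E m \<theta>"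
      using B1 B2 B3 lt AD unfolding \<phi>_def by linarith
  qed
qed

section \<open>Extension by symmetry\<close>

definition accel :: "real \<Rightarrow> config \<Rightarrow> 3 \<Rightarrow> complex" where
  "accel m x i = (\<Sum>j\<in>UNIV - {i}. (mass m j / norm (x $ j - x $ i) ^ 3) *\<^sub>R (x $ j - x $ i))"

lemma force_accel:
  assumes "m > 0"
  shows "force m x i /\<^sub>R mass m i = accel m x i"
proof -
  have "mass m i \<noteq> 0" using mass_pos[OF assms, of i] by simp
  then show ?thesis unfolding force_def accel_def scaleR_sum_right by (intro sum.cong refl) simp
qed

text \<open>Derivatives within \<open>S\<close> are one-sided at the ends of an interval, so arcs
  can be treated separately and joined afterwards.\<close>

definition newton_on :: "real \<Rightarrow> (real \<Rightarrow> config) \<Rightarrow> (real \<Rightarrow> config) \<Rightarrow> real set \<Rightarrow> bool" where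
  "newton_on m x v S \<longleftrightarrow> (\<forall>t\<in>S. \<forall>i. ((\<lambda>s. x s $ i) has_vector_derivative v t $ i) (at t within S) \<and>
     ((\<lambda>s. v s $ i) has_vector_derivative accel m (x t) i) (at t within S))"

lemma newton_on_cong:
  assumes "newton_on m x v S" "\<And>t. t \<in> S \<Longrightarrow> x t = y t" "\<And>t. t \<in> S \<Longrightarrow> v t = w t"
  shows "newton_on m y w S"
  unfolding newton_on_def
proof (intro ballI allI conjI)
  fix t i assume t: "t \<in> S"
  have "((\<lambda>s. x s $ i) has_vector_derivative v t $ i) (at t within S)" "((\<lambda>s. v s $ i) has_vector_derivative accel m (x t) i) (at t within S)"
    using assms(1) t by (auto simp: newton_on_def)
  then show "((\<lambda>s. y s $ i) has_vector_derivative w t $ i) (at t within S)" "((\<lambda>s. w s $ i) has_vector_derivative accel m (y t) i) (at t within S)"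
    unfolding assms(2)[OF t, symmetric] assms(3)[OF t, symmetric]
    by (auto elim!: has_vector_derivative_transform[rotated 2] simp: t assms(2,3))
qed

text \<open>The acceleration depends only on masses and mutual differences, so it commutes with
  \<open>L\<close> and \<open>\<sigma>\<close>. Reversing time changes the sign of the velocity but,
  as \<open>\<epsilon> * \<epsilon> = 1\<close>, not that of the acceleration.\<close>

lemma newton_on_transform:
  assumes N: "newton_on m x v S" and L: "bounded_linear L" "\<And>z. norm (L z) = norm z"
    and \<sigma>: "bij \<sigma>" "\<And>i. mass m (\<sigma> i) = mass m i" and \<epsilon>: "\<epsilon> * \<epsilon> = 1" and T: "\<And>t. t \<in> T \<Longrightarrow> \<epsilon> * t + \<tau> \<in> S"
  shows "newton_on m (\<lambda>t. \<chi> i. L (x (\<epsilon> * t + \<tau>) $ \<sigma> i)) (\<lambda>t. \<chi> i. \<epsilon> *\<^sub>R L (v (\<epsilon> * t + \<tau>) $ \<sigma> i)) T"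
  unfolding newton_on_def
proof (intro ballI allI conjI)
  fix t i assume t: "t \<in> T"
  interpret L: bounded_linear L by (rule L(1))
  have d: "((\<lambda>t. \<epsilon> * t + \<tau>) has_vector_derivative \<epsilon>) (at t within T)"
    by (auto intro!: derivative_eq_intros simp flip: has_real_derivative_iff_has_vector_derivative)
  have chain: "((\<lambda>t. f (\<epsilon> * t + \<tau>)) has_vector_derivative \<epsilon> *\<^sub>R f') (at t within T)"
    if "(f has_vector_derivative f') (at (\<epsilon> * t + \<tau>) within S)" for f :: "real \<Rightarrow> complex" and f'
    using vector_diff_chain_within[OF d has_vector_derivative_within_subset[OF that]] T by (auto simp: o_def)
  have "((\<lambda>t. x (\<epsilon> * t + \<tau>) $ \<sigma> i) has_vector_derivative \<epsilon> *\<^sub>R (v (\<epsilon> * t + \<tau>) $ \<sigma> i)) (at t within T)"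
    "((\<lambda>t. v (\<epsilon> * t + \<tau>) $ \<sigma> i) has_vector_derivative \<epsilon> *\<^sub>R accel m (x (\<epsilon> * t + \<tau>)) (\<sigma> i)) (at t within T)"
    using N T[OF t] by (auto intro!: chain simp: newton_on_def)
  note this[THEN L.has_vector_derivative]
  then have D: "((\<lambda>t. L (x (\<epsilon> * t + \<tau>) $ \<sigma> i)) has_vector_derivative \<epsilon> *\<^sub>R L (v (\<epsilon> * t + \<tau>) $ \<sigma> i)) (at t within T)"
    "((\<lambda>t. L (v (\<epsilon> * t + \<tau>) $ \<sigma> i)) has_vector_derivative \<epsilon> *\<^sub>R L (accel m (x (\<epsilon> * t + \<tau>)) (\<sigma> i))) (at t within T)"
    by (simp_all add: L.scaleR)
  from D(1) show "((\<lambda>s. (\<chi> i. L (x (\<epsilon> * s + \<tau>) $ \<sigma> i)) $ i) has_vector_derivative (\<chi> i. \<epsilon> *\<^sub>R L (v (\<epsilon> * t + \<tau>) $ \<sigma> i)) $ i) (at t within T)"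
    by simp
  have "accel m (\<chi> i. L (x (\<epsilon> * t + \<tau>) $ \<sigma> i)) i = (\<Sum>j\<in>UNIV - {i}. (mass m (\<sigma> j) / norm (x (\<epsilon> * t + \<tau>) $ \<sigma> j - x (\<epsilon> * t + \<tau>) $ \<sigma> i) ^ 3) *\<^sub>R L (x (\<epsilon> * t + \<tau>) $ \<sigma> j - x (\<epsilon> * t + \<tau>) $ \<sigma> i))"
    unfolding accel_def by (simp add: \<sigma>(2) L.diff[symmetric] L(2))
  also have "\<dots> = (\<Sum>j\<in>\<sigma> ` (UNIV - {i}). (mass m j / norm (x (\<epsilon> * t + \<tau>) $ j - x (\<epsilon> * t + \<tau>) $ \<sigma> i) ^ 3) *\<^sub>R L (x (\<epsilon> * t + \<tau>) $ j - x (\<epsilon> * t + \<tau>) $ \<sigma> i))"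
    by (subst sum.reindex) (auto intro: inj_on_subset[OF bij_is_inj[OF \<sigma>(1)]])
  also have "\<sigma> ` (UNIV - {i}) = UNIV - {\<sigma> i}"
    using \<sigma>(1) by (metis Compl_eq_Diff_UNIV bij_image_Compl_eq image_empty image_insert)
  finally have A: "accel m (\<chi> i. L (x (\<epsilon> * t + \<tau>) $ \<sigma> i)) i = L (accel m (x (\<epsilon> * t + \<tau>)) (\<sigma> i))"
    unfolding accel_def[of m "x (\<epsilon> * t + \<tau>)"] L.sum L.scaleR .
  have "((\<lambda>s. \<epsilon> *\<^sub>R L (v (\<epsilon> * s + \<tau>) $ \<sigma> i)) has_vector_derivative \<epsilon> *\<^sub>R \<epsilon> *\<^sub>R L (accel m (x (\<epsilon> * t + \<tau>)) (\<sigma> i))) (at t within T)"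
    by (rule bounded_linear.has_vector_derivative[OF bounded_linear_scaleR_right D(2)])
  then show "((\<lambda>s. (\<chi> i. \<epsilon> *\<^sub>R L (v (\<epsilon> * s + \<tau>) $ \<sigma> i)) $ i) has_vector_derivative accel m (\<chi> i. L (x (\<epsilon> * t + \<tau>) $ \<sigma> i)) i) (at t within T)"
    unfolding A using \<epsilon> by simp
qed

lemma has_vector_derivative_union:
  assumes "(f has_vector_derivative f') (at x within S)" "(f has_vector_derivative f') (at x within T)"
  shows "(f has_vector_derivative f') (at x within S \<union> T)"
  using assms unfolding has_vector_derivative_def has_derivative_within by (auto simp: at_within_union intro: filterlim_sup)

lemma newton_on_glue:
  assumes "newton_on m x v {a..b}" "newton_on m x v {b..c}" "a \<le> b" "b \<le> c"
  shows "newton_on m x v {a..c}"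
proof -
  have ac: "{a..c} = {a..b} \<union> {b..c}" using assms by auto
  \<comment> \<open>Away from a closed interval the filter \<open>at t within\<close> is trivial and
    every derivative statement holds. This supplies the other half at points that belong to one of
    the two intervals only.\<close>
  have triv: "(f has_vector_derivative f') (at t within {u..w})" if "t \<notin> {u..w}" for f :: "real \<Rightarrow> complex" and f' t u w
  proof -
    have "\<not> t islimpt {u..w}" using that closed_atLeastAtMost[of u w] unfolding closed_limpt by blast
    then have bot: "at t within {u..w} = bot" by (simp only: trivial_limit_within[symmetric])
    show ?thesis unfolding has_vector_derivative_def has_derivative_def bot by (intro conjI bounded_linear_scaleR_left tendsto_bot)
  qed
  show ?thesis
    unfolding newton_on_def ac
  proof (intro ballI allI conjI has_vector_derivative_union)
    fix t i assume t: "t \<in> {a..b} \<union> {b..c}"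
    show "((\<lambda>s. x s $ i) has_vector_derivative v t $ i) (at t within {a..b})" "((\<lambda>s. v s $ i) has_vector_derivative accel m (x t) i) (at t within {a..b})"
      using assms(1) by (cases "t \<in> {a..b}"; auto simp: newton_on_def intro!: triv; fail)+
    show "((\<lambda>s. x s $ i) has_vector_derivative v t $ i) (at t within {b..c})" "((\<lambda>s. v s $ i) has_vector_derivative accel m (x t) i) (at t within {b..c})"
      using assms(2) by (cases "t \<in> {b..c}"; auto simp: newton_on_def intro!: triv; fail)+
  qed
qed

text \<open>The index permutation in the \<open>k\<close>-th power of
  \<open>h2 \<theta> \<circ> h1\<close>; integer exponents include the inverses.\<close>

definition swap12 :: "int \<Rightarrow> 3 \<Rightarrow> 3" where
  "swap12 k i = (if even k then i else if i = 1 then 2 else if i = 2 then 1 else i)"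

lemma swap12_simps [simp]: "swap12 k (swap12 l i) = swap12 (k + l) i" "mass m (swap12 k i) = mass m i" "swap12 0 i = i" "swap12 (- k) i = swap12 k i"
  by (auto simp: swap12_def mass_def)

lemma swap12_bij: "bij (swap12 k)"
proof (rule o_bij[of "swap12 (- k)"])
  show "swap12 (- k) \<circ> swap12 k = id" "swap12 k \<circ> swap12 (- k) = id"
    unfolding comp_def swap12_simps(1) fun_eq_iff by (simp_all only: add.left_inverse add.right_inverse swap12_simps(3) id_apply simp_thms)
qed

text \<open>The powers of \<open>h2 \<theta> \<circ> h1\<close>.\<close>

definition rot :: "real \<Rightarrow> int \<Rightarrow> config \<Rightarrow> config" where
  "rot \<theta> k x = (\<chi> i. cis (2 * \<theta> * of_int k) * x $ swap12 k i)"

lemma h1_nth: "h1 x $ i = cnj (x $ i)"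
  using exhaust_3[of i] by (auto simp: h1_def)

lemma h2_nth: "h2 \<theta> x $ i = refl \<theta> (x $ swap12 1 i)"
  using exhaust_3[of i] by (auto simp: h2_def swap12_def)

lemma rot_nth: "rot \<theta> k x $ i = cis (2 * \<theta> * of_int k) * x $ swap12 k i"
  by (simp add: rot_def)

lemma rot_simps: "rot \<theta> k (rot \<theta> l x) = rot \<theta> (k + l) x" "rot \<theta> 0 x = x" "h1 (rot \<theta> k x) = rot \<theta> (- k) (h1 x)" "rot \<theta> 1 (h1 x) = h2 \<theta> x" "h1 (h1 x) = x"
  "rot \<theta> k (- x) = - rot \<theta> k x" "h1 (- x) = - h1 x" "h2 \<theta> (- x) = - h2 \<theta> x"
proof -
  have "cis (2 * \<theta> * of_int k) * (cis (2 * \<theta> * of_int l) * z) = cis (2 * \<theta> * of_int (k + l)) * z" for z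
    unfolding mult.assoc[symmetric] cis_mult by (simp add: distrib_left)
  then show "rot \<theta> k (rot \<theta> l x) = rot \<theta> (k + l) x" by (simp only: vec_eq_iff rot_nth swap12_simps(1)) (simp add: add.commute)
qed (simp_all add: vec_eq_iff h1_nth h2_nth rot_nth refl_def cis_cnj)

lemma rot_distinct: "(\<And>i j. i \<noteq> j \<Longrightarrow> x $ i \<noteq> x $ j) \<Longrightarrow> i \<noteq> j \<Longrightarrow> rot \<theta> k x $ i \<noteq> rot \<theta> k x $ j"
proof -
  assume x: "\<And>i j. i \<noteq> j \<Longrightarrow> x $ i \<noteq> x $ j" and ij: "i \<noteq> j"
  have "swap12 k i \<noteq> swap12 k j" using bij_is_inj[OF swap12_bij[of k]] ij by (meson injD)
  then show ?thesis using x by (simp add: rot_nth)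
qed

text \<open>\<open>h1\<close> and \<open>h2 \<theta>\<close> act on time as the reflections about 0
  and 1, so \<open>h2 \<theta> \<circ> h1\<close>, which is \<open>rot \<theta> 1\<close>,
  translates by 2. Reflection at 0 gives an arc on \<open>[-1, 1]\<close>, whose images under
  \<open>rot \<theta> k\<close> tile the line. Positions and velocities match at the joints by the
  boundary conditions, and the second derivatives then match by Newton's equations.\<close>

lemma dihedral_extension:
  assumes m: "m > 0" and N: "newton_on m x v {0..1}" and cs: "\<And>t. t \<in> {0..1} \<Longrightarrow> x t \<in> config_space m"
    and free: "\<And>t i j. t \<in> {0..1} \<Longrightarrow> i \<noteq> j \<Longrightarrow> x t $ i \<noteq> x t $ j"
    and x0: "h1 (x 0) = x 0" "h1 (v 0) = - v 0" and x1: "h2 \<theta> (x 1) = x 1" "h2 \<theta> (v 1) = - v 1"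
  shows "\<exists>y. dihedral_orbit m \<theta> y \<and> (\<forall>t\<in>{0..1}. y t = x t)"
proof -
  define X where "X s = (if s \<ge> 0 then x s else h1 (x (- s)))" for s
  define V where "V s = (if s \<ge> 0 then v s else - h1 (v (- s)))" for s
  have XV: "X (- s) = h1 (X s)" "V (- s) = - h1 (V s)" for s
    using x0 by (cases "s = 0"; auto simp: X_def V_def rot_simps)+
  have NX: "newton_on m X V {-1..1}"
  proof (rule newton_on_glue)
    show "newton_on m X V {0..1}" by (rule newton_on_cong[OF N]) (auto simp: X_def V_def)
    have "newton_on m (\<lambda>t. \<chi> i. cnj (x (- 1 * t + 0) $ swap12 0 i)) (\<lambda>t. \<chi> i. - 1 *\<^sub>R cnj (v (- 1 * t + 0) $ swap12 0 i)) {-1..0}"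
      by (rule newton_on_transform[OF N bounded_linear_cnj _ swap12_bij]) auto
    then show "newton_on m X V {-1..0}"
    proof (rule newton_on_cong)
      fix t :: real assume t: "t \<in> {-1..0}"
      have "X t = h1 (x (- t))" "V t = - h1 (v (- t))" using t x0 by (cases "t = 0"; auto simp: X_def V_def)+
      then show "(\<chi> i. cnj (x (- 1 * t + 0) $ swap12 0 i)) = X t" "(\<chi> i. - 1 *\<^sub>R cnj (v (- 1 * t + 0) $ swap12 0 i)) = V t"
        by (simp_all add: vec_eq_iff h1_nth)
    qed
  qed auto
  \<comment> \<open>The index of the half-open arc \<open>[2 * k - 1, 2 * k + 1)\<close> containing
    \<open>t\<close>.\<close>
  define K where "K t = \<lfloor>(t + 1) / 2\<rfloor>" for t :: real
  define y where "y t = rot \<theta> (K t) (X (t - 2 * of_int (K t)))" for t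
  define w where "w t = rot \<theta> (K t) (V (t - 2 * of_int (K t)))" for t
  have Kb: "2 * of_int (K t) - 1 \<le> t" "t < 2 * of_int (K t) + 1" for t
    using floor_correct[of "(t + 1) / 2"] unfolding K_def by (auto simp: field_simps)
  have yw: "y t = rot \<theta> k (X (t - 2 * of_int k))" "w t = rot \<theta> k (V (t - 2 * of_int k))"
    if k: "2 * of_int k - 1 \<le> t" "t \<le> 2 * of_int k + 1" for t k
  proof -
    have "y t = rot \<theta> k (X (t - 2 * of_int k)) \<and> w t = rot \<theta> k (V (t - 2 * of_int k))"
    proof (cases "t = 2 * of_int k + 1")
      case False
      then have "K t = k" using k unfolding K_def by (intro floor_unique) auto
      then show ?thesis by (simp add: y_def w_def)
    next
      case True
      \<comment> \<open>At its right end an arc is described by the next index; the boundary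
        conditions at time 1 show that both descriptions agree.\<close>
      have Kt: "K t = k + 1" unfolding K_def True by (intro floor_unique) auto
      have 1: "t - 2 * of_int (K t) = - 1" "t - 2 * of_int k = 1" unfolding Kt by (simp_all add: True)
      have "rot \<theta> 1 (h1 (x 1)) = x 1" "rot \<theta> 1 (- h1 (v 1)) = v 1" by (simp_all add: rot_simps x1)
      then have "rot \<theta> (k + 1) (h1 (x 1)) = rot \<theta> k (x 1)" "rot \<theta> (k + 1) (- h1 (v 1)) = rot \<theta> k (v 1)"
        by (simp_all only: rot_simps(1)[symmetric])
      then show ?thesis unfolding y_def w_def unfolding 1 unfolding Kt by (simp add: X_def V_def)
    qed
    then show "y t = rot \<theta> k (X (t - 2 * of_int k))" "w t = rot \<theta> k (V (t - 2 * of_int k))" by auto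
  qed
  have Nk: "newton_on m y w {2 * of_int k - 1..2 * of_int k + 1}" for k
  proof -
    have L: "bounded_linear ((*) (cis (2 * \<theta> * of_int k)))" by (rule bounded_linear_mult_right)
    have "newton_on m (\<lambda>t. \<chi> i. cis (2 * \<theta> * of_int k) * X (1 * t + (- 2 * of_int k)) $ swap12 k i) (\<lambda>t. \<chi> i. 1 *\<^sub>R (cis (2 * \<theta> * of_int k) * V (1 * t + (- 2 * of_int k)) $ swap12 k i)) {2 * of_int k - 1..2 * of_int k + 1}"
      by (rule newton_on_transform[OF NX L _ swap12_bij]) (auto simp: norm_mult)
    then show ?thesis
      by (rule newton_on_cong) (auto simp: yw vec_eq_iff rot_nth)
  qed
  have glob: "((\<lambda>s. y s $ i) has_vector_derivative w t $ i) (at t) \<and> ((\<lambda>s. w s $ i) has_vector_derivative accel m (y t) i) (at t)" for t i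
  proof -
    define k where "k = K t"
    have k: "2 * of_int k - 1 \<le> t" "t < 2 * of_int k + 1" using Kb[of t] by (auto simp: k_def)
    \<comment> \<open>Two consecutive arcs, because \<open>t\<close> may be the left end of its own
      arc and has to be an interior point.\<close>
    have "newton_on m y w {2 * of_int (k - 1) - 1..2 * of_int k + 1}"
      by (rule newton_on_glue[OF _ Nk[of k]]) (use Nk[of "k - 1"] in \<open>auto simp: algebra_simps\<close>)
    moreover have "t \<in> interior {2 * of_int (k - 1) - 1..2 * of_int k + 1}" using k by (auto simp: interior_atLeastAtMost_real)
    ultimately show ?thesis unfolding newton_on_def using at_within_interior[of t] interior_subset by (metis (no_types, lifting) subsetD)
  qed
  have Xfree: "X s $ i \<noteq> X s $ j" if "s \<in> {-1..1}" "i \<noteq> j" for s i j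
    using that free[of s i j] free[of "- s" i j] by (auto simp: X_def h1_nth)
  have cf: "collision_free y"
    unfolding collision_free_def
  proof (intro allI impI)
    fix t and i j :: 3 assume ij: "i \<noteq> j"
    have k: "2 * of_int (K t) - 1 \<le> t" "t < 2 * of_int (K t) + 1" by (rule Kb)+
    show "y t $ i \<noteq> y t $ j" unfolding y_def by (rule rot_distinct[OF Xfree ij]) (use k in auto)
  qed
  have sol: "newton_solution m y"
    unfolding newton_solution_def using cf glob unfolding accel_def by blast
  have k01: "y t = x t" "w t = v t" if "t \<in> {0..1}" for t
    using yw[of 0 t] that by (auto simp: rot_simps X_def V_def)
  have refl0: "y (- t) = h1 (y t)" for t
  proof -
    define k where "k = K t"
    have k: "2 * of_int k - 1 \<le> t" "t \<le> 2 * of_int k + 1" using Kb[of t] by (auto simp: k_def)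
    have "y (- t) = rot \<theta> (- k) (X (- t - 2 * of_int (- k)))" by (rule yw) (use k in auto)
    also have "- t - 2 * of_int (- k) = - (t - 2 * of_int k)" by simp
    finally show ?thesis unfolding XV yw(1)[OF k] by (simp add: rot_simps)
  qed
  have per: "y (t + 2) = rot \<theta> 1 (y t)" for t
  proof -
    define k where "k = K t"
    have k: "2 * of_int k - 1 \<le> t" "t \<le> 2 * of_int k + 1" using Kb[of t] by (auto simp: k_def)
    have "y (t + 2) = rot \<theta> (1 + k) (X (t + 2 - 2 * of_int (1 + k)))" by (rule yw) (use k in auto)
    also have "t + 2 - 2 * of_int (1 + k) = t - 2 * of_int k" by simp
    finally show ?thesis unfolding yw(1)[OF k] by (simp add: rot_simps)
  qed
  have refl1: "y (2 - t) = h2 \<theta> (y t)" for t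
    using per[of "- t"] refl0[of t] by (simp add: rot_simps)
  have Nv: "newton_on m y w {0..1}" by (rule newton_on_cong[OF N]) (simp_all add: k01)
  have "C1_path y w"
    unfolding C1_path_def
  proof (intro conjI ballI)
    show "continuous_on {0..1} w"
    proof (rule continuous_on_componentwise)
      fix i :: 3
      have "\<forall>t\<in>{0..1}. ((\<lambda>s. w s $ i) has_vector_derivative accel m (y t) i) (at t within {0..1})" using Nv by (auto simp: newton_on_def)
      then show "continuous_on {0..1} (\<lambda>t. w t $ i)"
        by (meson continuous_on_eq_continuous_within has_vector_derivative_continuous)
    qed
    show "(y has_vector_derivative w t) (at t within {0..1})" if "t \<in> {0..1}" for t
      using Nv that by (intro has_vector_derivative_componentwise) (auto simp: newton_on_def)
  qed
  then have "H1_on 0 1 y" unfolding H1_on_def using C1_path_L2_derivative by blast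
  then have "y \<in> path_space m \<theta>" using cs x0 x1 k01 by (auto simp: path_space_def)
  then have "dihedral_orbit m \<theta> y"
    unfolding dihedral_orbit_def using sol refl0 refl1 by (intro conjI exI[of _ 0] exI[of _ 1]) auto
  then show ?thesis using k01 by blast
qed

section \<open>Natural boundary conditions of a minimizer\<close>

lemma euler_lagrange_newton:
  assumes m: "m > 0" and x: "minimizer m ha hb x"
    and free: "\<And>t i j. t \<in> {0..1} \<Longrightarrow> i \<noteq> j \<Longrightarrow> x t $ i \<noteq> x t $ j"
  shows "\<exists>v. newton_on m x v {0..1} \<and> (\<forall>w. (\<forall>s. ha (x 0 + s *\<^sub>R w) = x 0 + s *\<^sub>R w) \<longrightarrow> (\<Sum>i\<in>UNIV. mass m i * inner (v 0 $ i) (w $ i)) = 0)"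
proof (rule euler_lagrange[OF m x free])
  fix v :: "real \<Rightarrow> config"
  assume 1: "\<And>t i. t \<in> {0..1} \<Longrightarrow> ((\<lambda>s. x s $ i) has_vector_derivative v t $ i) (at t within {0..1})"
    and 2: "\<And>t i. t \<in> {0..1} \<Longrightarrow> ((\<lambda>s. v s $ i) has_vector_derivative force m (x t) i /\<^sub>R mass m i) (at t within {0..1})"
    and 3: "\<And>w. (\<forall>s. ha (x 0 + s *\<^sub>R w) = x 0 + s *\<^sub>R w) \<Longrightarrow> (\<Sum>i\<in>UNIV. mass m i * inner (v 0 $ i) (w $ i)) = 0"
  have "newton_on m x v {0..1}" unfolding newton_on_def by (intro conjI ballI allI 1 2[unfolded force_accel[OF m]])
  moreover have "(\<Sum>i\<in>UNIV. mass m i * inner (v 0 $ i) (w $ i)) = 0" if "\<forall>s. ha (x 0 + s *\<^sub>R w) = x 0 + s *\<^sub>R w" for w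
    using that by (rule 3)
  ultimately show ?thesis by blast
qed

lemma inner_refl: "inner (refl \<theta> a) b = inner a (refl \<theta> b)"
  by (simp add: refl_def inner_complex_def algebra_simps)

lemma refl_refl: "refl \<theta> (refl \<theta> z) = z"
  by (simp add: refl_def cis_cnj mult.assoc[symmetric] cis_mult)

text \<open>At an end the momentum is orthogonal to the fixed space of the reflection. As the
  reflection is orthogonal and only exchanges equal masses, the velocity lies in its eigenspace for
  \<open>-1\<close>, which is the sign required by the extension.\<close>

lemma minimizer_solution:
  assumes m: "m > 0" and x: "minimizer m h1 (h2 \<theta>) x" and adm: "x \<in> admissible m \<theta>"
    and free: "\<And>t i j. t \<in> {0..1} \<Longrightarrow> i \<noteq> j \<Longrightarrow> x t $ i \<noteq> x t $ j"
  obtains v where "newton_on m x v {0..1}" "h1 (v 0) = - v 0" "h2 \<theta> (v 1) = - v 1"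
proof -
  have hx0: "h1 (x 0) = x 0" and hx1: "h2 \<theta> (x 1) = x 1" using adm by (auto simp: admissible_def)
  obtain v where v: "newton_on m x v {0..1}"
    and v0: "\<And>w. (\<forall>s. h1 (x 0 + s *\<^sub>R w) = x 0 + s *\<^sub>R w) \<Longrightarrow> (\<Sum>i\<in>UNIV. mass m i * inner (v 0 $ i) (w $ i)) = 0"
    using euler_lagrange_newton[OF m x free] by blast
  have axis_sum: "(\<Sum>j\<in>UNIV. mass m j * inner (u $ j) (axis i e $ j)) = mass m i * inner (u $ i) e" for u :: config and i e
  proof -
    have "(\<Sum>j\<in>UNIV. mass m j * inner (u $ j) (axis i e $ j)) = (\<Sum>j\<in>UNIV. if j = i then mass m i * inner (u $ i) e else 0)"
      by (intro sum.cong) (auto simp: axis_def)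
    then show ?thesis by simp
  qed
  have mp: "mass m i \<noteq> 0" for i using mass_pos[OF m, of i] by simp
  have "Re (v 0 $ i) = 0" for i
  proof -
    have "\<forall>s. h1 (x 0 + s *\<^sub>R axis i 1) = x 0 + s *\<^sub>R axis i 1"
      using hx0 unfolding h1_fixed by (auto simp: axis_def)
    from v0[OF this] show ?thesis unfolding axis_sum using mp[of i] by (simp add: inner_complex_def)
  qed
  then have bc0: "h1 (v 0) = - v 0" by (simp add: vec_eq_iff h1_nth complex_eq_iff)
  have free': "x (1 - t) $ i \<noteq> x (1 - t) $ j" if "t \<in> {0..1}" "i \<noteq> j" for t i j using free[of "1 - t"] that by auto
  obtain u where u: "newton_on m (\<lambda>t. x (1 - t)) u {0..1}"
    and u0: "\<And>w. (\<forall>s. h2 \<theta> (x (1 - 0) + s *\<^sub>R w) = x (1 - 0) + s *\<^sub>R w) \<Longrightarrow> (\<Sum>i\<in>UNIV. mass m i * inner (u 0 $ i) (w $ i)) = 0"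
    using euler_lagrange_newton[OF m minimizer_reverse[OF x] free'] by blast
  \<comment> \<open>The condition at time 1 is the one at time 0 for the reversed path, whose
    initial velocity is \<open>- v 1\<close>.\<close>
  have uv: "u 0 = - v 1"
  proof -
    have "u 0 $ i = - v 1 $ i" for i
    proof (rule vector_derivative_unique_within)
      show "((\<lambda>s. x (1 - s) $ i) has_vector_derivative u 0 $ i) (at 0 within {0..1})" using u by (auto simp: newton_on_def)
      have d: "((\<lambda>s. 1 - s) has_vector_derivative - 1) (at 0 within {0..1::real})"
        by (auto intro!: derivative_eq_intros simp flip: has_real_derivative_iff_has_vector_derivative)
      have "((\<lambda>s. x s $ i) has_vector_derivative v 1 $ i) (at (1 - 0) within (\<lambda>s. 1 - s) ` {0..1})"
        using v by (auto simp: newton_on_def intro: has_vector_derivative_within_subset)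
      from vector_diff_chain_within[OF d this]
      show "((\<lambda>s. x (1 - s) $ i) has_vector_derivative - v 1 $ i) (at 0 within {0..1})" by (simp add: o_def)
      show "at (0::real) within {0..1} \<noteq> bot" by (simp add: trivial_limit_within islimpt_Icc)
    qed
    then show ?thesis by (simp add: vec_eq_iff)
  qed
  have nat1: "(\<Sum>i\<in>UNIV. mass m i * inner (v 1 $ i) (w $ i)) = 0"
    if "refl \<theta> (w $ 2) = w $ 1" "refl \<theta> (w $ 1) = w $ 2" "refl \<theta> (w $ 3) = w $ 3" for w
  proof -
    have "\<forall>s. h2 \<theta> (x (1 - 0) + s *\<^sub>R w) = x (1 - 0) + s *\<^sub>R w"
      using hx1 that unfolding h2_fixed by (simp add: refl_simps)
    from u0[OF this] show ?thesis unfolding uv by (simp add: sum_negf)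
  qed
  have r0: "refl \<theta> 0 = 0" by (simp add: refl_def)
  have "v 1 $ 1 + refl \<theta> (v 1 $ 2) = 0"
  proof -
    have "inner (v 1 $ 1 + refl \<theta> (v 1 $ 2)) z = 0" for z
      using nat1[of "vector [z, refl \<theta> z, 0]"] by (simp add: sum_UNIV_3 mass_def refl_refl r0 inner_add_left inner_refl)
    then show ?thesis using inner_eq_zero_iff by blast
  qed
  then have e12: "refl \<theta> (v 1 $ 2) = - v 1 $ 1" by (simp add: eq_neg_iff_add_eq_0 add.commute)
  then have "refl \<theta> (refl \<theta> (v 1 $ 2)) = - refl \<theta> (v 1 $ 1)" by (simp only: refl_simps(5))
  then have e21: "refl \<theta> (v 1 $ 1) = - v 1 $ 2" unfolding refl_refl by simp
  have "v 1 $ 3 + refl \<theta> (v 1 $ 3) = 0"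
  proof -
    define z where "z = v 1 $ 3 + refl \<theta> (v 1 $ 3)"
    have z: "refl \<theta> z = z" by (simp add: z_def refl_simps(1) refl_refl add.commute)
    have "inner (v 1 $ 3) z = 0"
      using nat1[of "vector [0, 0, z]"] z r0 m by (simp add: sum_UNIV_3 mass_def)
    moreover have "inner (refl \<theta> (v 1 $ 3)) z = inner (v 1 $ 3) z" unfolding inner_refl z ..
    ultimately have "inner z z = 0" by (subst (1) z_def) (simp add: inner_add_left)
    then show ?thesis unfolding z_def[symmetric] by simp
  qed
  then have e33: "refl \<theta> (v 1 $ 3) = - v 1 $ 3" by (simp add: eq_neg_iff_add_eq_0 add.commute)
  have bc1: "h2 \<theta> (v 1) = - v 1" by (simp add: h2_def vec_eq_iff forall_3 e12 e21 e33)
  show ?thesis using that v bc0 bc1 by blast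
qed

text \<open>Writing \<open>z = cis (- \<phi> t) (a + i b)\<close>, the boundary conditions say \<open>b = 0\<close> at both ends, and
  \<open>|z'|\<^sup>2 - \<phi>\<^sup>2 |z|\<^sup>2 + (2 \<phi> a b + p b\<^sup>2)' = (a' + 2 \<phi> b)\<^sup>2 + (b' + p b)\<^sup>2\<close> for \<open>p = 2 \<phi> tan (2 \<phi> (t - 1/2))\<close>.\<close>

lemma rotating_wirtinger:
  fixes z z' :: "real \<Rightarrow> complex"
  assumes \<phi>: "0 < \<phi>" "\<phi> < pi / 2" and d: "\<And>t. t \<in> {0..1} \<Longrightarrow> (z has_vector_derivative z' t) (at t within {0..1})"
    and c: "continuous_on {0..1} z'" and b0: "Im (z 0) = 0" and b1: "Im (cis \<phi> * z 1) = 0"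
  shows "\<phi>\<^sup>2 * integral {0..1} (\<lambda>t. (norm (z t))\<^sup>2) \<le> integral {0..1} (\<lambda>t. (norm (z' t))\<^sup>2)"
proof -
  define zr zi where "zr t = Re (z t)" and "zi t = Im (z t)" for t
  define a b where "a t = cos (\<phi> * t) * zr t - sin (\<phi> * t) * zi t" and "b t = sin (\<phi> * t) * zr t + cos (\<phi> * t) * zi t" for t
  \<comment> \<open>Components of \<open>z'\<close> in the rotating frame, not the derivatives of
    \<open>a\<close> and \<open>b\<close>: these are \<open>a' - \<phi> * b\<close> and
    \<open>b' + \<phi> * a\<close>.\<close>
  define a' b' where "a' t = cos (\<phi> * t) * Re (z' t) - sin (\<phi> * t) * Im (z' t)" and "b' t = sin (\<phi> * t) * Re (z' t) + cos (\<phi> * t) * Im (z' t)" for t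
  define p where "p t = 2 * \<phi> * tan (2 * \<phi> * (t - 1/2))" for t
  have cz: "continuous_on {0..1} z" using d by (meson continuous_on_eq_continuous_within has_vector_derivative_continuous)
  have dRe: "(zr has_real_derivative Re (z' t)) (at t within {0..1})"
    and dIm: "(zi has_real_derivative Im (z' t)) (at t within {0..1})" if "t \<in> {0..1}" for t
    using bounded_linear.has_vector_derivative[OF bounded_linear_Re d[OF that]] bounded_linear.has_vector_derivative[OF bounded_linear_Im d[OF that]]
    by (simp_all add: has_real_derivative_iff_has_vector_derivative zr_def[abs_def] zi_def[abs_def])
  have da: "(a has_real_derivative a' t - \<phi> * b t) (at t within {0..1})" and db: "(b has_real_derivative b' t + \<phi> * a t) (at t within {0..1})"
    if "t \<in> {0..1}" for t
    unfolding a_def[abs_def] b_def[abs_def] a'_def b'_def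
    by (auto intro!: derivative_eq_intros dRe[OF that] dIm[OF that] simp: algebra_simps)
  \<comment> \<open>The argument stays within \<open>[- \<phi>, \<phi>]\<close>, so
    \<open>\<phi> < pi / 2\<close> keeps the tangent in \<open>p\<close> finite.\<close>
  have cospos: "cos (2 * \<phi> * (t - 1/2)) > 0" if "t \<in> {0..1}" for t
  proof (rule cos_gt_zero_pi)
    have "\<phi> * (2 * t - 1) \<le> \<phi> * 1" by (rule mult_left_mono) (use that \<phi> in auto)
    moreover have "\<phi> * (- 1) \<le> \<phi> * (2 * t - 1)" by (rule mult_left_mono) (use that \<phi> in auto)
    moreover have "2 * \<phi> * (t - 1/2) = \<phi> * (2 * t - 1)" by (simp add: algebra_simps)
    ultimately show "- (pi / 2) < 2 * \<phi> * (t - 1/2)" "2 * \<phi> * (t - 1/2) < pi / 2" using \<phi> by linarith+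
  qed
  have dp: "(p has_real_derivative 4 * \<phi>\<^sup>2 + (p t)\<^sup>2) (at t within {0..1})" if t: "t \<in> {0..1}" for t
  proof -
    have "(p has_real_derivative 2 * \<phi> * (inverse ((cos (2 * \<phi> * (t - 1/2)))\<^sup>2) * (2 * \<phi>))) (at t within {0..1})"
      unfolding p_def[abs_def] using cospos[OF t] by (auto intro!: derivative_eq_intros)
    moreover have "inverse ((cos y)\<^sup>2) = 1 + (tan y)\<^sup>2" if "cos y > 0" for y :: real using that tan_sec[of y] by (simp add: power_inverse)
    ultimately show ?thesis using cospos[OF t] by (simp add: p_def power2_eq_square algebra_simps)
  qed
  define Q Q' where "Q t = 2 * \<phi> * (a t * b t) + p t * (b t)\<^sup>2"
    and "Q' t = 2 * \<phi> * ((a' t - \<phi> * b t) * b t + a t * (b' t + \<phi> * a t)) + ((4 * \<phi>\<^sup>2 + (p t)\<^sup>2) * (b t)\<^sup>2 + p t * (2 * b t * (b' t + \<phi> * a t)))" for t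
  have dQ: "(Q has_vector_derivative Q' t) (at t within {0..1})" if t: "t \<in> {0..1}" for t
  proof -
    have "(Q has_real_derivative Q' t) (at t within {0..1})"
      unfolding Q_def[abs_def] Q'_def by (auto intro!: derivative_eq_intros da[OF t] db[OF t] dp[OF t] simp: algebra_simps)
    then show ?thesis by (simp add: has_real_derivative_iff_has_vector_derivative)
  qed
  have "(Q' has_integral Q 1 - Q 0) {0..1}" by (rule fundamental_theorem_of_calculus) (use dQ in auto)
  moreover have "b 0 = 0" "b 1 = 0" using b0 b1 by (auto simp: b_def zr_def zi_def algebra_simps)
  ultimately have IQ: "(Q' has_integral 0) {0..1}" by (simp add: Q_def)
  have I1: "((\<lambda>t. (norm (z' t))\<^sup>2) has_integral integral {0..1} (\<lambda>t. (norm (z' t))\<^sup>2)) {0..1}"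
    and I2: "((\<lambda>t. (norm (z t))\<^sup>2) has_integral integral {0..1} (\<lambda>t. (norm (z t))\<^sup>2)) {0..1}"
    by (intro integrable_integral integrable_continuous_real continuous_intros c cz)+
  have I: "((\<lambda>t. (norm (z' t))\<^sup>2 - \<phi>\<^sup>2 * (norm (z t))\<^sup>2 + Q' t) has_integral integral {0..1} (\<lambda>t. (norm (z' t))\<^sup>2) - \<phi>\<^sup>2 * integral {0..1} (\<lambda>t. (norm (z t))\<^sup>2) + 0) {0..1}"
    by (intro has_integral_add has_integral_diff has_integral_mult_right I1 I2 IQ)
  have rotn: "(cos y * r - sin y * i)\<^sup>2 + (sin y * r + cos y * i)\<^sup>2 = r\<^sup>2 + i\<^sup>2" for y r i :: real
  proof -
    have "(cos y * r - sin y * i)\<^sup>2 + (sin y * r + cos y * i)\<^sup>2 = (r\<^sup>2 + i\<^sup>2) * ((cos y)\<^sup>2 + (sin y)\<^sup>2)"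
      unfolding power2_eq_square by algebra
    then show ?thesis by simp
  qed
  have "0 \<le> (norm (z' t))\<^sup>2 - \<phi>\<^sup>2 * (norm (z t))\<^sup>2 + Q' t" for t
  proof -
    have n: "(norm (z t))\<^sup>2 = (a t)\<^sup>2 + (b t)\<^sup>2" "(norm (z' t))\<^sup>2 = (a' t)\<^sup>2 + (b' t)\<^sup>2"
      unfolding a_def b_def a'_def b'_def rotn by (simp_all add: cmod_power2 zr_def zi_def)
    have "(norm (z' t))\<^sup>2 - \<phi>\<^sup>2 * (norm (z t))\<^sup>2 + Q' t = (a' t + \<phi> * b t)\<^sup>2 + (b' t + \<phi> * a t + p t * b t)\<^sup>2"
      unfolding n Q'_def by (simp add: power2_eq_square algebra_simps)
    then show ?thesis by simp
  qed
  from has_integral_nonneg[OF I this] show ?thesis by simp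
qed

text \<open>Similarity to a configuration on the real line, combined with the reflection at time 1,
  puts body 3 at 0 and bodies 1 and 2 at opposite positions. For the single function
  \<open>z\<close> that remains, \<open>rotating_wirtinger\<close> replaces the kinetic part by
  \<open>\<phi>^2 * |z|^2\<close>, and the minimum of \<open>\<phi>^2 * s^2 + k / s\<close> over
  \<open>s > 0\<close> is \<open>euler_value\<close>.\<close>

lemma homographic_action:
  assumes m: "m > 0" and \<theta>: "0 < \<theta>" "\<theta> < pi / 2" and N: "newton_on m x v {0..1}" and adm: "x \<in> admissible m \<theta>"
    and free: "\<And>t i j. t \<in> {0..1} \<Longrightarrow> i \<noteq> j \<Longrightarrow> x t $ i \<noteq> x t $ j"
    and hom: "\<And>t. t \<in> {0..1} \<Longrightarrow> \<exists>c d. c \<noteq> 0 \<and> (\<forall>i. x t $ i = c * x 0 $ i + d)"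
  shows "euler_value m \<theta> \<le> kin m 0 1 x + enn2real (pot m 0 1 x)"
proof -
  define \<phi> where "\<phi> = pi / 2 - \<theta>"
  have \<phi>: "0 < \<phi>" "\<phi> < pi / 2" using \<theta> by (auto simp: \<phi>_def)
  have fk: "fin_kin 0 1 x" and cs: "\<And>t. t \<in> {0..1} \<Longrightarrow> x t \<in> config_space m" and hx0: "h1 (x 0) = x 0" and hx1: "h2 \<theta> (x 1) = x 1"
    using adm by (auto simp: admissible_def)
  \<comment> \<open>The centre of mass is at 0 at both times, so the translation part of the
    similarity vanishes.\<close>
  have lin: "\<exists>c. c \<noteq> 0 \<and> (\<forall>i. x t $ i = c * x 0 $ i)" if t: "t \<in> {0..1}" for t
  proof -
    obtain c d where cd: "c \<noteq> 0" "\<And>i. x t $ i = c * x 0 $ i + d" using hom[OF t] by blast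
    have S: "x t $ 1 + x t $ 2 + of_real m * x t $ 3 = 0" "x 0 $ 1 + x 0 $ 2 + of_real m * x 0 $ 3 = 0"
      using cs[OF t] cs[of 0] by (auto simp: config_space_def)
    have "c * (x 0 $ 1 + x 0 $ 2 + of_real m * x 0 $ 3) + of_real (2 + m) * d = 0" using S(1) unfolding cd(2) by (simp add: algebra_simps)
    then have "of_real (2 + m) * d = 0" unfolding S(2) by (simp only: mult_zero_right add_0)
    moreover have "(of_real (2 + m) :: complex) \<noteq> 0" using m unfolding of_real_eq_0_iff by linarith
    ultimately have "d = 0" by simp
    then show ?thesis using cd by auto
  qed
  have real0: "cnj (x 0 $ i) = x 0 $ i" for i using hx0 unfolding h1_fixed by blast
  obtain c where c: "c \<noteq> 0" "\<And>i. x 1 $ i = c * x 0 $ i" using lin[of 1] by auto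
  \<comment> \<open>On real multiples of \<open>c\<close> the reflection is multiplication by
    \<open>\<mu>\<close>. For \<open>\<mu> = 1\<close> bodies 1 and 2 would coincide at time 0;
    hence body 3 is at 0, and the exchange of the other two forces
    \<open>\<mu> = - 1\<close>.\<close>
  define \<mu> where "\<mu> = cis (2 * \<theta>) * cnj c / c"
  have rc: "refl \<theta> (c * x 0 $ i) = \<mu> * (c * x 0 $ i)" for i
    using c(1) real0[of i] by (simp add: refl_def \<mu>_def)
  have "refl \<theta> (x 1 $ 2) = x 1 $ 1" "refl \<theta> (x 1 $ 1) = x 1 $ 2" "refl \<theta> (x 1 $ 3) = x 1 $ 3" using hx1 unfolding h2_fixed by blast+
  then have mu: "\<mu> * x 0 $ 2 = x 0 $ 1" "\<mu> * x 0 $ 1 = x 0 $ 2" "\<mu> * x 0 $ 3 = x 0 $ 3"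
    using c(1) unfolding c(2) rc by (simp_all add: mult.left_commute[of \<mu> c])
  have ne12: "x 0 $ 1 \<noteq> x 0 $ 2" using free[of 0 1 2] by simp
  have x03: "x 0 $ 3 = 0"
  proof (rule ccontr)
    assume "x 0 $ 3 \<noteq> 0"
    then have "\<mu> = 1" using mu(3) by simp
    then show False using mu(1) ne12 by simp
  qed
  have x02: "x 0 $ 2 = - x 0 $ 1"
    using cs[of 0] x03 by (auto simp: config_space_def eq_neg_iff_add_eq_0 add.commute)
  have x01: "x 0 $ 1 \<noteq> 0" using ne12 x02 by auto
  have "\<mu> = - 1"
  proof -
    have "\<mu> * x 0 $ 1 = (- 1) * x 0 $ 1" using mu(2) x02 by simp
    then show ?thesis using x01 by (simp only: mult_cancel_right) simp
  qed
  have xt: "x t $ 2 = - x t $ 1" "x t $ 3 = 0" if "t \<in> {0..1}" for t using lin[OF that] x02 x03 by auto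
  define z z' where "z t = x t $ 1" and "z' t = v t $ 1" for t
  have zd: "(z has_vector_derivative z' t) (at t within {0..1})" if "t \<in> {0..1}" for t
    using N that by (auto simp: newton_on_def z_def[abs_def] z'_def)
  have vc: "continuous_on {0..1} (\<lambda>t. v t $ i)" for i
  proof -
    have "\<forall>t\<in>{0..1}. ((\<lambda>s. v s $ i) has_vector_derivative accel m (x t) i) (at t within {0..1})" using N by (auto simp: newton_on_def)
    then show ?thesis by (meson continuous_on_eq_continuous_within has_vector_derivative_continuous)
  qed
  have zc: "continuous_on {0..1} z'" using vc[of 1] by (simp add: z'_def[abs_def])
  have cz: "continuous_on {0..1} z" using zd by (meson continuous_on_eq_continuous_within has_vector_derivative_continuous)
  have znz: "z t \<noteq> 0" if "t \<in> {0..1}" for t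
    using free[OF that, of 1 3] xt[OF that] by (auto simp: z_def)
  have b0: "Im (z 0) = 0" using real0[of 1] by (metis z_def Reals_cnj_iff complex_is_Real_iff)
  have b1: "Im (cis \<phi> * z 1) = 0"
  proof -
    have "refl \<theta> (z 1) = - z 1" using rc[of 1] c(2)[of 1] \<open>\<mu> = - 1\<close> by (simp add: z_def)
    then have r: "cis (2 * \<theta>) * cnj (z 1) = - z 1" by (simp add: refl_def)
    have "cnj (cis \<phi> * z 1) = cis (- \<phi>) * cnj (z 1)" by (simp add: cis_cnj)
    also have "cis (- \<phi>) = - (cis \<phi> * cis (2 * \<theta>))"
    proof -
      have "\<phi> + 2 * \<theta> = - \<phi> + pi" by (simp add: \<phi>_def)
      then have "cis \<phi> * cis (2 * \<theta>) = cis (- \<phi>) * cis pi" by (simp only: cis_mult)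
      then show ?thesis by simp
    qed
    also have "- (cis \<phi> * cis (2 * \<theta>)) * cnj (z 1) = - (cis \<phi> * (cis (2 * \<theta>) * cnj (z 1)))" by simp
    also have "\<dots> = cis \<phi> * z 1" unfolding r by simp
    finally show ?thesis by (metis Reals_cnj_iff complex_is_Real_iff)
  qed
  define E where "E = euler_value m \<theta>"
  define k where "k = 1/2 + 2 * m"
  have k: "k > 0" using m by (simp add: k_def)
  have W: "\<phi>\<^sup>2 * integral {0..1} (\<lambda>t. (norm (z t))\<^sup>2) \<le> integral {0..1} (\<lambda>t. (norm (z' t))\<^sup>2)"
    by (rule rotating_wirtinger[OF \<phi> zd zc b0 b1])
  have zd2: "((\<lambda>t. x t $ 2) has_vector_derivative - z' t) (at t within {0..1})" if t: "t \<in> {0..1}" for t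
    by (rule has_vector_derivative_transform[OF t _ has_vector_derivative_minus[OF zd[OF t]]]) (simp add: xt z_def)
  have "integral {0..1} (\<lambda>t. (norm (z' t))\<^sup>2) \<le> energy 0 1 (\<lambda>t. x t $ 1)"
    using energy_C1_ge[OF zd zc] by (simp add: z_def[abs_def])
  moreover have "integral {0..1} (\<lambda>t. (norm (z' t))\<^sup>2) \<le> energy 0 1 (\<lambda>t. x t $ 2)"
    using energy_C1_ge[OF zd2 continuous_on_minus[OF zc]] by simp
  moreover have "0 \<le> m / 2 * energy 0 1 (\<lambda>t. x t $ 3)" using m energy_nonneg[OF fin_kinD[OF fk]] by simp
  ultimately have K: "integral {0..1} (\<lambda>t. (norm (z' t))\<^sup>2) \<le> kin m 0 1 x"
    unfolding kin_def sum_UNIV_3 by (simp add: mass_def)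
  have xc: "continuous_on {0..1} (\<lambda>t. x t $ i)" for i by (rule fin_kin_continuous[OF fk])
  have "enn2real (pot m 0 1 x) = integral {0..1} (\<lambda>t. rpot m (x t))" using pot_rpot[OF m _ xc free] by simp
  also have "\<dots> = integral {0..1} (\<lambda>t. k / norm (z t))"
  proof (rule integral_cong)
    fix t :: real assume t: "t \<in> {0..1}"
    have "norm (z t - - z t) = 2 * norm (z t)" using norm_mult[of 2 "z t"] by simp
    then have "rpot m (x t) = 1 / (2 * norm (z t)) + m / norm (z t) + m / norm (z t)"
      unfolding rpot_def using xt[OF t] by (simp add: z_def)
    then show "rpot m (x t) = k / norm (z t)" using znz[OF t] by (simp add: k_def field_simps)
  qed
  finally have P: "enn2real (pot m 0 1 x) = integral {0..1} (\<lambda>t. k / norm (z t))" .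
  have i1: "(\<lambda>t. \<phi>\<^sup>2 * (norm (z t))\<^sup>2) integrable_on {0..1}" and i2: "(\<lambda>t. k / norm (z t)) integrable_on {0..1}"
    using znz by (auto intro!: integrable_continuous_real continuous_intros cz)
  have "E \<le> integral {0..1} (\<lambda>t. \<phi>\<^sup>2 * (norm (z t))\<^sup>2 + k / norm (z t))"
  proof -
    have "integral {0..1} (\<lambda>t::real. E) \<le> integral {0..1} (\<lambda>t. \<phi>\<^sup>2 * (norm (z t))\<^sup>2 + k / norm (z t))"
    proof (rule integral_le)
      show "(\<lambda>t. \<phi>\<^sup>2 * (norm (z t))\<^sup>2 + k / norm (z t)) integrable_on {0..1}" by (rule integrable_add[OF i1 i2])
      fix t :: real assume t: "t \<in> {0..1}"
      have E3: "E ^ 3 = 27/4 * k\<^sup>2 * \<phi>\<^sup>2" unfolding E_def k_def \<phi>_def by (rule euler_value_cube)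
      have "E > 0"
      proof -
        have "E ^ 3 > 0" unfolding E3 using k \<phi> by (intro mult_pos_pos) auto
        then show ?thesis using euler_value_cube(2)[of m \<theta>] by (cases "E = 0") (auto simp: E_def)
      qed
      then have "3 * (E / 3) \<le> \<phi>\<^sup>2 * (norm (z t))\<^sup>2 + 2 * (k / 2) / norm (z t)"
        by (intro amgm_square_inverse) (use k znz[OF t] E3 in \<open>auto simp: power_divide\<close>)
      then show "E \<le> \<phi>\<^sup>2 * (norm (z t))\<^sup>2 + k / norm (z t)" by simp
    qed (intro integrable_continuous_real continuous_intros)
    then show ?thesis by simp
  qed
  also have "\<dots> = \<phi>\<^sup>2 * integral {0..1} (\<lambda>t. (norm (z t))\<^sup>2) + integral {0..1} (\<lambda>t. k / norm (z t))"
    using integral_add[OF i1 i2] by simp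
  finally show ?thesis using W K P unfolding E_def by linarith
qed

theorem proposition7p5:
  fixes m \<theta> :: real
  assumes "m > 0"
    and "0 < \<theta>" and "\<theta> < pi / 2"
    and "collision_assumption m"
    and "(m, \<theta>) \<in> D"
  shows "(\<exists>l r0 c. l > 0 \<and> r0 > 0 \<and> c > 0 \<and>
            action m 0 1 (test_path m \<theta> l r0 c) < action m 0 1 (euler_path m \<theta>) \<and>
            action m 0 1 (test_path m \<theta> l r0 c) < ennreal (A_E m \<theta>)) \<and>
         (\<exists>y. dihedral_orbit m \<theta> y \<and> \<not> homographic y)"
proof -
  note m = assms(1) and \<theta> = assms(2,3)
  obtain A \<rho> where \<phi>: "1/2 \<le> pi / 2 - \<theta>" and \<rho>: "0 < \<rho>" "\<rho> < A"
    and lt: "\<theta>\<^sup>2 * m / (m + 2) * A\<^sup>2 + (pi / 2 - \<theta>)\<^sup>2 * \<rho>\<^sup>2 + 1 / (2 * \<rho>) + m * (1 / sqrt (A\<^sup>2 + \<rho>\<^sup>2) + A / (A\<^sup>2 - \<rho>\<^sup>2)) < A_E m \<theta>"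
    by (rule D_bound[OF m \<theta> assms(5)])
  \<comment> \<open>\<open>D_bound\<close> gives a strict inequality at \<open>c = 0\<close>,
    whereas the test path must have \<open>c > 0\<close>; continuity of the bound at 0 leaves room
    for a small \<open>c\<close>.\<close>
  define B where "B c = \<theta>\<^sup>2 * m / (m + 2) * A\<^sup>2 + c\<^sup>2 + (pi / 2 - \<theta>)\<^sup>2 * (\<rho> + c)\<^sup>2 + 1 / (2 * \<rho>) + m * (1 / sqrt (A\<^sup>2 + \<rho>\<^sup>2) + A / (A\<^sup>2 - (\<rho> + c)\<^sup>2))" for c
  have nz: "A\<^sup>2 - (\<rho> + 0)\<^sup>2 \<noteq> 0" using power_strict_mono[OF \<rho>(2), of 2] \<rho>(1) by simp
  have "(B \<longlongrightarrow> B 0) (at_right 0)"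
    unfolding B_def by (intro tendsto_intros nz)
  moreover have "B 0 < A_E m \<theta>" using lt by (simp add: B_def)
  ultimately have "eventually (\<lambda>c. B c < A_E m \<theta>) (at_right 0)" by (rule order_tendstoD)
  moreover have "eventually (\<lambda>c. c < A - \<rho>) (at_right 0)" using \<rho> by (intro eventually_at_rightI[of 0 "A - \<rho>"]) auto
  moreover have "eventually (\<lambda>c::real. 0 < c) (at_right 0)" by (rule eventually_at_right_less)
  ultimately have "eventually (\<lambda>c. B c < A_E m \<theta> \<and> c < A - \<rho> \<and> 0 < c) (at_right 0)" by eventually_elim auto
  then obtain c where c: "B c < A_E m \<theta>" "c < A - \<rho>" "0 < c" using eventually_happens'[OF trivial_limit_at_right_real] by blast
  define l where "l = A * m / (m + 2)"
  have l: "l > 0" using \<rho> m by (simp add: l_def)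
  have \<rho>c: "\<rho> + c < A" using c by simp
  note test = test_path_action[OF m \<theta> \<rho>(1) \<rho>c c(3), folded l_def, folded B_def]
  \<comment> \<open>Up to common factors the radicands are \<open>u\<close> and
    \<open>2 * u^2\<close> for \<open>u = pi / 2 - \<theta>\<close>, so this is where
    \<open>u \<ge> 1/2\<close> is needed.\<close>
  have AE: "A_E m \<theta> \<le> euler_value m \<theta>"
  proof -
    have "u \<le> 2 * u\<^sup>2" if "1/2 \<le> u" for u :: real using that mult_left_mono[of 1 "2 * u" u] by (simp add: power2_eq_square)
    from mult_left_mono[OF this[OF \<phi>], of "(1/2 + 2 * m)\<^sup>2"]
    have "(1/2 + 2 * m)\<^sup>2 * (pi / 2 - \<theta>) \<le> (1/2 + 2 * m)\<^sup>2 * (2 * (pi / 2 - \<theta>)\<^sup>2)" by simp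
    then have "(1/2 + 2 * m)\<^sup>2 * (pi / 2 - \<theta>) \<le> 2 * (1/2 + 2 * m)\<^sup>2 * (pi / 2 - \<theta>)\<^sup>2" by (simp only: mult_ac)
    then show ?thesis unfolding A_E_def euler_value_def by (intro mult_left_mono) auto
  qed
  have a1: "action m 0 1 (test_path m \<theta> l \<rho> c) < ennreal (A_E m \<theta>)"
    using test(3) test(4) c(1) by (meson ennreal_lessI le_less_trans)
  also have "\<dots> \<le> action m 0 1 (euler_path m \<theta>)" unfolding euler_action[OF m \<theta>(2)] by (rule ennreal_leI[OF AE])
  finally have a2: "action m 0 1 (test_path m \<theta> l \<rho> c) < action m 0 1 (euler_path m \<theta>)" .
  obtain u where u: "C1_path (test_path m \<theta> l \<rho> c) u" using test(2) by blast
  note kp = C1_path_kin_pot_le[OF m u test(3,4)]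
  obtain x where x: "minimizer m h1 (h2 \<theta>) x" "x \<in> admissible m \<theta>"
    and xle: "kin m 0 1 x + enn2real (pot m 0 1 x) \<le> kin m 0 1 (test_path m \<theta> l \<rho> c) + enn2real (pot m 0 1 (test_path m \<theta> l \<rho> c))"
    using minimizer_exists[OF m \<theta> test(1) kp(1)] by blast
  have xE: "kin m 0 1 x + enn2real (pot m 0 1 x) < euler_value m \<theta>" using xle kp(2) c(1) AE by linarith
  have k0: "0 \<le> kin m 0 1 x + enn2real (pot m 0 1 x)" using x(2) kin_nonneg[OF m] by (auto simp: admissible_def)
  have "(kin m 0 1 x + enn2real (pot m 0 1 x)) ^ 3 < euler_value m \<theta> ^ 3" by (rule power_strict_mono[OF xE k0]) simp
  then have small: "(kin m 0 1 x + enn2real (pot m 0 1 x)) ^ 3 < 27/4 * (1/2 + 2 * m)\<^sup>2 * (pi / 2 - \<theta>)\<^sup>2" unfolding euler_value_cube .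
  note free = minimizer_collision_free[OF m \<theta> x small]
  obtain v where v: "newton_on m x v {0..1}" "h1 (v 0) = - v 0" "h2 \<theta> (v 1) = - v 1"
    by (rule minimizer_solution[OF m x free])
  have hx: "h1 (x 0) = x 0" "h2 \<theta> (x 1) = x 1" and cs: "\<And>t. t \<in> {0..1} \<Longrightarrow> x t \<in> config_space m" using x(2) by (auto simp: admissible_def)
  obtain y where y: "dihedral_orbit m \<theta> y" "\<And>t. t \<in> {0..1} \<Longrightarrow> y t = x t"
    using dihedral_extension[OF m v(1) cs free hx(1) v(2) hx(2) v(3)] by blast
  have "\<not> homographic y"
  proof
    assume "homographic y"
    then have "\<exists>c d. c \<noteq> 0 \<and> (\<forall>i. x t $ i = c * x 0 $ i + d)" if "t \<in> {0..1}" for t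
      unfolding homographic_def using y(2)[OF that] y(2)[of 0] by (metis atLeastAtMost_iff order_refl zero_le_one)
    from homographic_action[OF m \<theta> v(1) x(2) free this] show False using xE by linarith
  qed
  then show ?thesis using l \<rho>(1) c(3) a1 a2 y(1) by blast
qed

end
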